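(* Let $R$ be a commutative ring, let $X$ be a simplicial set with $X_0=*$, and let $\Sigma^2X=\Sigma(\Sigma X)$ be its double simplicial suspension. Let $C_*(\Sigma^2X)$ denote the normalized chains with coefficients in $R$. Then: (1) the homotopy G-coalgebra structure on $C_*(\Sigma^2 X)$ corresponding to Baues' coproduct $\nabla_0:\Omega C_*(\Sigma^2X)\to\Omega C_*(\Sigma^2X)\otimes\Omega C_*(\Sigma^2X)$ has trivial higher operations, i.e. $E^{k,1}=0$ for all $k\ge1$; (2) the double cobar construction $\Omega^2C_*(\Sigma^2X)$ (the cobar construction of the DG-Hopf algebra $(\Omega C_*(\Sigma^2X),\nabla_0)$) is a homotopy BV-algebra whose BV-operator is the Connes-Moscovici operator.
   Context: Conventions. The Koszul sign rule is used, $s^{-1}$ lowers degree by $1$ and $s$ raises it by $1$. $\overline C$ is the kernel of the counit of a coaugmented coalgebra, with reduced coproduct $\overline\nabla(c)=\nabla(c)-c\otimes1-1\otimes c$; $\overline A$ is the augmentation ideal. A (co)algebra is connected if it is (co)augmented, zero in negative degrees and $R$ in degree $0$; $n$-reduced if moreover zero in degrees $1,\dots,n$. $C_*(Y)$ is the normalized chain complex (degenerate simplices are zero) with the Alexander-Whitney coproduct. Cobar construction: $\Omega C=(T(s^{-1}\overline C),d_\Omega)$ with $d_\Omega$ the derivation determined by $d_\Omega(s^{-1}c)=-s^{-1}dc+(s^{-1}\otimes s^{-1})\overline\nabla(c)$. Write $\widetilde C=s^{-1}\overline C$. Simplicial suspension: if $X_0=*$, then $(\Sigma X)_0=\{a_0\}$,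 $a_n=s_0^n(a_0)$, and $(\Sigma X)_n=\{(i,x): i\ge1,\ x\in X_{n-i}\}$ modulo $(i,s_0^m( * ))=a_{m+i}$; face and degeneracy operators are generated by $d_0(1,x)=a_n$ for $x\in X_n$; $d_1(1,x)=a_0$ for $x\in X_0$; $d_{i+1}(1,x)=(1,d_ix)$ for $x\in X_n$, $n>0$; $s_0(i,x)=(i+1,x)$; $s_{i+1}(1,x)=(1,s_ix)$; the others being determined by the simplicial identities. Baues' coproduct: for a $1$-reduced simplicial set $Y$ ($Y_0=Y_1=*$) and $\sigma\in Y_n$, $n\ge2$, $$\nabla_0[\sigma]=\sum_{b=\{b_1<\dots<b_r\}\subset\{1,\dots,n-1\}}(-1)^\zeta[\sigma(0,\dots,b_1)|\sigma(b_1,\dots,b_2)|\cdots|\sigma(b_r,\dots,n)]\otimes[\sigma(0,b,n)],$$ $\zeta=r|\sigma(0,\dots,b_1)|+\sum_{i=2}^r(r+1-i)|\sigma(b_{i-1},\dots,b_i)|-r(r+1)/2$, extended as an algebra morphism to $\Omega C_*(Y)$. Here $\sigma(\dots)$ is the face of $\sigma$ on the indicated vertices ($\sigma(i,\dots,j)$ uses all vertices from $i$ to $j$, and $\sigma(0,b,n)$ the vertices $\{0\}\cup b\cup\{n\}$), and $[\sigma_1|\cdots|\sigma_m]$ is the tensor of the $s^{-1}\sigma_i$ over those $i$ with $\dim\sigma_i\ge2$ (one-dimensional entries are omitted). It makes $\Omega C_*(Y)$ a DG-bialgebra. The corresponding operations $E^{i,j}:\widetilde C_*(Y)\to\widetilde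 C_*(Y)^{\otimes i}\otimes\widetilde C_*(Y)^{\otimes j}$ are the components of $\nabla_0|_{\widetilde C_*(Y)}$; they vanish for $j\ge2$, $i\geq 1$, i.e. they form a homotopy G-coalgebra structure $\{E^{k,1}\}_{k\ge 1}$, and $\nabla_0(x)=x\otimes1+1\otimes x+\sum_{k\ge1}E^{k,1}(x)$ on $\widetilde C_*(Y)$. The antipode $S$ is the convolution inverse of the identity. Homotopy G-algebra: for a connected DG-algebra $\Lambda$ the bar construction $\mathcal B\Lambda$ is the tensor coalgebra $T^c(s\overline\Lambda)$ with the coderivation whose components are $-s\,d\,s^{-1}$ and $s\mu(s^{-1}\otimes s^{-1})$. A homotopy G-algebra is a connected DG-algebra $\Lambda$ with operations $E_{1,j}:\overline\Lambda\otimes\overline\Lambda^{\otimes j}\to\overline\Lambda$ of degree $j$, $j\ge1$, such that the coalgebra map $\mu_E:\mathcal B\Lambda\otimes\mathcal B\Lambda\to\mathcal B\Lambda$ with corestriction $sa\otimes(sb_1\otimes\cdots\otimes sb_j)\mapsto sE_{1,j}(a;b_1,\dots,b_j)$ for $j\geq 1$, $sa\otimes1\mapsto sa$, $1\otimes sb\mapsto sb$, and zero on all other components, makes $\mathcal B\Lambda$ an associative unital DG-bialgebra. Homotopy BV-algebra: a homotopy G-algebra $\Lambda$ with a degree one operator $\Delta$ with $d\Delta+\Delta d=0$, $\Delta^2=0$, such that for some degree $2$ linear map $H:\Lambda\otimes\Lambda\to\Lambda$ $$\{a;b\}=(-1)^{|a|}\bigl(\Delta(ab)-\Delta(a)b-(-1)^{|a|}a\Delta(b)\bigr)+dH(a;b)+H(da;b)-(-1)^{|a|}H(a;db),$$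 where $\{a;b\}=E_{1,1}(a;b)-(-1)^{(|a|+1)(|b|+1)}E_{1,1}(b;a)$. Structure on $\Omega\mathcal H$ for a $1$-reduced DG-Hopf algebra $\mathcal H$ with involutive antipode $S$ (here $\mathcal H=\Omega C_*(\Sigma^2X)$). For $a\in\mathcal H$ with iterated coproduct $a^1\otimes\cdots\otimes a^r$ and $\overline b=s^{-1}b_1\otimes\cdots\otimes s^{-1}b_r$ put $a\diamond\overline b=(-1)^{\sum_{p>q}|a^p|(|b_q|-1)}s^{-1}(a^1b_1)\otimes\cdots\otimes s^{-1}(a^rb_r)$. The homotopy G-algebra structure (Kadeishvili) is $$E_{1,k}(s^{-1}a_1\otimes\cdots\otimes s^{-1}a_n;\overline b_1,\dots,\overline b_k)=\sum_{1\le i_1<\dots<i_k\le n}\pm\, s^{-1}a_1\otimes\cdots\otimes a_{i_1}\diamond\overline b_1\otimes\cdots\otimes a_{i_k}\diamond\overline b_k\otimes\cdots\otimes s^{-1}a_n$$ (zero if $n<k$), with sign exponent $\sum_j(|\overline b_j|+1)\sum_{i>i_j}(|a_i|-1)$. The Connes-Moscovici operator $\Delta$ vanishes on tensors of length $0$ and $1$, and on length $n\ge2$ is $\Delta=\sum_{i=0}^{n-1}p_n\tau_n^i$, where $\tau_n(x_1\otimes\cdots\otimes x_n)=\pm x_2\otimes\cdots\otimes x_n\otimes x_1$ with Koszul sign and $p_n(s^{-1}a_1\otimes\cdots\otimes s^{-1}a_n)=(-1)^{|a_1|}S(a_1)\diamond(s^{-1}a_2\otimes\cdots\otimes s^{-1}a_n)$.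 *)

theory Defs
  imports "HOL-Library.Poly_Mapping"
begin

text \<open>
  Every module occurring here (normalized chains, cobar and bar constructions) is free with a
  preferred homogeneous basis. A free module on a set of basis elements of type \<open>'b\<close> is
  represented by finitely supported functions \<open>'b \<Rightarrow>\<^sub>0 'r\<close>, its tensor square by
  \<open>'b \<times> 'b \<Rightarrow>\<^sub>0 'r\<close>, and tensor words by \<open>'b list \<Rightarrow>\<^sub>0 'r\<close>. A linear (or multilinear) map is
  given by its values on basis elements and extended by \<open>lin\<close>.
\<close>

section \<open>Free modules\<close>

definition scale :: "'r::comm_ring_1 \<Rightarrow> ('b \<Rightarrow>\<^sub>0 'r) \<Rightarrow> ('b \<Rightarrow>\<^sub>0 'r)" where
  "scale c p = Poly_Mapping.map (\<lambda>x. c * x) p"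

abbreviation bvec :: "'b \<Rightarrow> ('b \<Rightarrow>\<^sub>0 'r::comm_ring_1)" where
  "bvec b \<equiv> Poly_Mapping.single b 1"

definition lin :: "('b \<Rightarrow> ('c \<Rightarrow>\<^sub>0 'r)) \<Rightarrow> ('b \<Rightarrow>\<^sub>0 'r::comm_ring_1) \<Rightarrow> ('c \<Rightarrow>\<^sub>0 'r)" where
  "lin f p = (\<Sum>b\<in>Poly_Mapping.keys p. scale (Poly_Mapping.lookup p b) (f b))"

definition lin2 ::
  "('a \<Rightarrow> 'b \<Rightarrow> ('c \<Rightarrow>\<^sub>0 'r)) \<Rightarrow> ('a \<Rightarrow>\<^sub>0 'r::comm_ring_1) \<Rightarrow> ('b \<Rightarrow>\<^sub>0 'r) \<Rightarrow> ('c \<Rightarrow>\<^sub>0 'r)" where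
  "lin2 f p q = lin (\<lambda>a. lin (f a) q) p"

definition tensor :: "('a \<Rightarrow>\<^sub>0 'r::comm_ring_1) \<Rightarrow> ('b \<Rightarrow>\<^sub>0 'r) \<Rightarrow> ('a \<times> 'b \<Rightarrow>\<^sub>0 'r)" where
  "tensor = lin2 (\<lambda>a b. bvec (a, b))"

definition conc :: "('b list \<Rightarrow>\<^sub>0 'r::comm_ring_1) \<Rightarrow> ('b list \<Rightarrow>\<^sub>0 'r) \<Rightarrow> ('b list \<Rightarrow>\<^sub>0 'r)" where
  "conc = lin2 (\<lambda>u v. bvec (u @ v))"

fun conc_list :: "('b list \<Rightarrow>\<^sub>0 'r::comm_ring_1) list \<Rightarrow> ('b list \<Rightarrow>\<^sub>0 'r)" where
  "conc_list [] = bvec []"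
| "conc_list (p # ps) = conc p (conc_list ps)"

definition letter :: "('b \<Rightarrow>\<^sub>0 'r::comm_ring_1) \<Rightarrow> ('b list \<Rightarrow>\<^sub>0 'r)" where
  "letter = lin (\<lambda>b. bvec [b])"

text \<open>The sign \<open>(-1)^k\<close> for an integer exponent.\<close>

definition ksign :: "int \<Rightarrow> 'r::comm_ring_1" where
  "ksign k = (if even k then 1 else - 1)"

section \<open>Augmented DG-modules, algebras, coalgebras, bialgebras\<close>

text \<open>
  The field \<open>one\<close> is a distinguished basis element of degree 0: \<open>R \<cdot> one\<close> is the image of the
  (co)unit/(co)augmentation, and the augmentation/counit is the coordinate functional at \<open>one\<close>.
  Hence the augmentation ideal (kernel of the counit) is free on \<open>rbasis\<close>.
\<close>

record (overloaded) ('b, 'r::zero) dgmod =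
  basis :: "'b set"
  deg :: "'b \<Rightarrow> int"
  diff :: "'b \<Rightarrow> ('b \<Rightarrow>\<^sub>0 'r)"
  one :: 'b

record (overloaded) ('b, 'r::zero) dgalg = "('b, 'r) dgmod" +
  mult :: "'b \<Rightarrow> 'b \<Rightarrow> ('b \<Rightarrow>\<^sub>0 'r)"

record (overloaded) ('b, 'r::zero) dgcoalg = "('b, 'r) dgmod" +
  comult :: "'b \<Rightarrow> ('b \<times> 'b \<Rightarrow>\<^sub>0 'r)"

record (overloaded) ('b, 'r::zero) dgbialg = "('b, 'r) dgalg" +
  bcomult :: "'b \<Rightarrow> ('b \<times> 'b \<Rightarrow>\<^sub>0 'r)"

definition bialg :: "('b, 'r::zero) dgalg \<Rightarrow> ('b \<Rightarrow> ('b \<times> 'b \<Rightarrow>\<^sub>0 'r)) \<Rightarrow> ('b, 'r) dgbialg" where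
  "bialg A nab = \<lparr>basis = basis A, deg = deg A, diff = diff A, one = one A, mult = mult A,
     bcomult = nab\<rparr>"

definition alg_part :: "('b, 'r::zero) dgbialg \<Rightarrow> ('b, 'r) dgalg" where
  "alg_part H = \<lparr>basis = basis H, deg = deg H, diff = diff H, one = one H, mult = mult H\<rparr>"

definition coalg_part :: "('b, 'r::zero) dgbialg \<Rightarrow> ('b, 'r) dgcoalg" where
  "coalg_part H = \<lparr>basis = basis H, deg = deg H, diff = diff H, one = one H,
     comult = bcomult H\<rparr>"

definition rbasis :: "('b, 'r::zero, 'm) dgmod_scheme \<Rightarrow> 'b set" where
  "rbasis M = basis M - {one M}"

definition homog :: "('b, 'r::zero, 'm) dgmod_scheme \<Rightarrow> int \<Rightarrow> ('b \<Rightarrow>\<^sub>0 'r) \<Rightarrow> bool" where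
  "homog M k p \<longleftrightarrow> Poly_Mapping.keys p \<subseteq> {c \<in> basis M. deg M c = k}"

definition homog2 :: "('b, 'r::zero, 'm) dgmod_scheme \<Rightarrow> int \<Rightarrow> ('b \<times> 'b \<Rightarrow>\<^sub>0 'r) \<Rightarrow> bool" where
  "homog2 M k p \<longleftrightarrow>
     Poly_Mapping.keys p \<subseteq> {(a, b). a \<in> basis M \<and> b \<in> basis M \<and> deg M a + deg M b = k}"

definition dg_module :: "('b, 'r::comm_ring_1, 'm) dgmod_scheme \<Rightarrow> bool" where
  "dg_module M \<longleftrightarrow>
     one M \<in> basis M \<and> deg M (one M) = 0 \<and> diff M (one M) = 0 \<and>
     (\<forall>b\<in>basis M. homog M (deg M b - 1) (diff M b) \<and> lin (diff M) (diff M b) = 0 \<and>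
        Poly_Mapping.lookup (diff M b) (one M) = 0)"

definition n_reduced :: "nat \<Rightarrow> ('b, 'r::zero, 'm) dgmod_scheme \<Rightarrow> bool" where
  "n_reduced n M \<longleftrightarrow>
     (\<forall>b\<in>basis M. deg M b \<ge> 0 \<and> (deg M b = 0 \<longrightarrow> b = one M) \<and> deg M b \<notin> {1..int n})"

abbreviation connected :: "('b, 'r::zero, 'm) dgmod_scheme \<Rightarrow> bool" where
  "connected \<equiv> n_reduced 0"

definition dg_algebra :: "('b, 'r::comm_ring_1, 'm) dgalg_scheme \<Rightarrow> bool" where
  "dg_algebra A \<longleftrightarrow> dg_module A \<and>
     (\<forall>a\<in>basis A. mult A (one A) a = bvec a \<and> mult A a (one A) = bvec a) \<and>
     (\<forall>a\<in>basis A. \<forall>b\<in>basis A.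
        homog A (deg A a + deg A b) (mult A a b) \<and>
        Poly_Mapping.lookup (mult A a b) (one A) = (if a = one A \<and> b = one A then 1 else 0) \<and>
        lin (diff A) (mult A a b) =
          lin (\<lambda>x. mult A x b) (diff A a) + scale (ksign (deg A a)) (lin (mult A a) (diff A b))) \<and>
     (\<forall>a\<in>basis A. \<forall>b\<in>basis A. \<forall>c\<in>basis A.
        lin (\<lambda>x. mult A x c) (mult A a b) = lin (mult A a) (mult A b c))"

definition tensor_diff ::
  "('b, 'r::comm_ring_1, 'm) dgmod_scheme \<Rightarrow> 'b \<times> 'b \<Rightarrow> ('b \<times> 'b \<Rightarrow>\<^sub>0 'r)" where
  "tensor_diff M = (\<lambda>(a, b). tensor (diff M a) (bvec b)
     + scale (ksign (deg M a)) (tensor (bvec a) (diff M b)))"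

definition tensor_mult :: "('b, 'r::comm_ring_1, 'm) dgalg_scheme \<Rightarrow>
    ('b \<times> 'b \<Rightarrow>\<^sub>0 'r) \<Rightarrow> ('b \<times> 'b \<Rightarrow>\<^sub>0 'r) \<Rightarrow> ('b \<times> 'b \<Rightarrow>\<^sub>0 'r)" where
  "tensor_mult A = lin2 (\<lambda>(a, b) (a', b').
     scale (ksign (deg A b * deg A a')) (tensor (mult A a a') (mult A b b')))"

definition dg_coalgebra :: "('b, 'r::comm_ring_1, 'm) dgcoalg_scheme \<Rightarrow> bool" where
  "dg_coalgebra C \<longleftrightarrow> dg_module C \<and>
     comult C (one C) = bvec (one C, one C) \<and>
     (\<forall>c\<in>basis C.
        homog2 C (deg C c) (comult C c) \<and>
        lin (\<lambda>(a, b). if a = one C then bvec b else 0) (comult C c) = bvec c \<and>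
        lin (\<lambda>(a, b). if b = one C then bvec a else 0) (comult C c) = bvec c \<and>
        lin (\<lambda>(a, b). lin (\<lambda>(a1, a2). bvec (a1, a2, b)) (comult C a)) (comult C c) =
          lin (\<lambda>(a, b). lin (\<lambda>(b1, b2). bvec (a, b1, b2)) (comult C b)) (comult C c) \<and>
        lin (tensor_diff C) (comult C c) = lin (comult C) (diff C c))"

definition dg_bialgebra :: "('b, 'r::comm_ring_1) dgbialg \<Rightarrow> bool" where
  "dg_bialgebra H \<longleftrightarrow> dg_algebra (alg_part H) \<and> dg_coalgebra (coalg_part H) \<and>
     (\<forall>a\<in>basis H. \<forall>b\<in>basis H.
        lin (bcomult H) (mult H a b) = tensor_mult H (bcomult H a) (bcomult H b))"

text \<open>
  Convolution inverse of the identity. Requiring \<open>S\<close> to vanish off the basis makes it unique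
  as a function.
\<close>

definition is_antipode ::
  "('b, 'r::comm_ring_1) dgbialg \<Rightarrow> ('b \<Rightarrow> ('b \<Rightarrow>\<^sub>0 'r)) \<Rightarrow> bool" where
  "is_antipode H S \<longleftrightarrow>
     (\<forall>b. b \<notin> basis H \<longrightarrow> S b = 0) \<and>
     (\<forall>b\<in>basis H. homog H (deg H b) (S b) \<and>
        lin (\<lambda>(a, c). lin (\<lambda>x. mult H x c) (S a)) (bcomult H b) =
          (if b = one H then bvec (one H) else 0) \<and>
        lin (\<lambda>(a, c). lin (mult H a) (S c)) (bcomult H b) =
          (if b = one H then bvec (one H) else 0))"

definition dg_hopf_algebra :: "('b, 'r::comm_ring_1) dgbialg \<Rightarrow> bool" where
  "dg_hopf_algebra H \<longleftrightarrow> dg_bialgebra H \<and> (\<exists>S. is_antipode H S)"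

definition antipode :: "('b, 'r::comm_ring_1) dgbialg \<Rightarrow> 'b \<Rightarrow> ('b \<Rightarrow>\<^sub>0 'r)" where
  "antipode H = (THE S. is_antipode H S)"

definition involutive_antipode :: "('b, 'r::comm_ring_1) dgbialg \<Rightarrow> bool" where
  "involutive_antipode H \<longleftrightarrow> (\<forall>b\<in>basis H. lin (antipode H) (antipode H b) = bvec b)"

section \<open>Cobar and bar constructions\<close>

text \<open>The word \<open>[c\<^sub>1, \<dots>, c\<^sub>n]\<close> stands for \<open>s\<^sup>-\<^sup>1c\<^sub>1 \<otimes> \<dots> \<otimes> s\<^sup>-\<^sup>1c\<^sub>n\<close>.\<close>

definition wdeg :: "('b, 'r::zero, 'm) dgmod_scheme \<Rightarrow> 'b list \<Rightarrow> int" where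
  "wdeg C w = (\<Sum>c\<leftarrow>w. deg C c - 1)"

definition reduced_comult ::
  "('b, 'r::comm_ring_1) dgcoalg \<Rightarrow> 'b \<Rightarrow> ('b \<times> 'b \<Rightarrow>\<^sub>0 'r)" where
  "reduced_comult C c = comult C c - bvec (c, one C) - bvec (one C, c)"

text \<open>\<open>d\<^sub>\<Omega>\<close> on generators; the sign in the second summand is the Koszul sign of
  \<open>(s\<^sup>-\<^sup>1 \<otimes> s\<^sup>-\<^sup>1)(a \<otimes> b)\<close>.\<close>

definition cobar_gen :: "('b, 'r::comm_ring_1) dgcoalg \<Rightarrow> 'b \<Rightarrow> ('b list \<Rightarrow>\<^sub>0 'r)" where
  "cobar_gen C c = - letter (diff C c)
     + lin (\<lambda>(a, b). scale (ksign (deg C a)) (bvec [a, b])) (reduced_comult C c)"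

definition cobar_diff :: "('b, 'r::comm_ring_1) dgcoalg \<Rightarrow> 'b list \<Rightarrow> ('b list \<Rightarrow>\<^sub>0 'r)" where
  "cobar_diff C w = (\<Sum>i<length w. scale (ksign (wdeg C (take i w)))
     (conc_list [bvec (take i w), cobar_gen C (w ! i), bvec (drop (Suc i) w)]))"

definition cobar :: "('b, 'r::comm_ring_1) dgcoalg \<Rightarrow> ('b list, 'r) dgalg" where
  "cobar C = \<lparr>basis = lists (rbasis C), deg = wdeg C, diff = cobar_diff C, one = [],
     mult = (\<lambda>u v. bvec (u @ v))\<rparr>"

text \<open>In the bar construction \<open>[a\<^sub>1, \<dots>, a\<^sub>n]\<close> stands for \<open>sa\<^sub>1 \<otimes> \<dots> \<otimes> sa\<^sub>n\<close>; the sign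
  \<open>deg a + 1\<close> in the quadratic part comes from \<open>(s\<^sup>-\<^sup>1 \<otimes> s\<^sup>-\<^sup>1)(sa \<otimes> sb)\<close>.\<close>

definition bar_deg :: "('b, 'r::zero, 'm) dgmod_scheme \<Rightarrow> 'b list \<Rightarrow> int" where
  "bar_deg A w = (\<Sum>a\<leftarrow>w. deg A a + 1)"

definition bar_diff :: "('b, 'r::comm_ring_1) dgalg \<Rightarrow> 'b list \<Rightarrow> ('b list \<Rightarrow>\<^sub>0 'r)" where
  "bar_diff A w =
     (\<Sum>i<length w. scale (ksign (bar_deg A (take i w)))
        (conc_list [bvec (take i w), - letter (diff A (w ! i)), bvec (drop (Suc i) w)]))
   + (\<Sum>i | Suc i < length w. scale (ksign (bar_deg A (take i w)))
        (conc_list [bvec (take i w),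
           scale (ksign (deg A (w ! i) + 1)) (letter (mult A (w ! i) (w ! Suc i))),
           bvec (drop (Suc (Suc i)) w)]))"

definition bar :: "('b, 'r::comm_ring_1) dgalg \<Rightarrow> ('b list, 'r) dgcoalg" where
  "bar A = \<lparr>basis = lists (rbasis A), deg = bar_deg A, diff = bar_diff A, one = [],
     comult = (\<lambda>w. \<Sum>i\<le>length w. bvec (take i w, drop i w))\<rparr>"

definition bar_bialg :: "('b, 'r::comm_ring_1) dgalg \<Rightarrow>
    ('b list \<Rightarrow> 'b list \<Rightarrow> ('b list \<Rightarrow>\<^sub>0 'r)) \<Rightarrow> ('b list, 'r) dgbialg" where
  "bar_bialg A mu = \<lparr>basis = basis (bar A), deg = deg (bar A), diff = diff (bar A),
     one = one (bar A), mult = mu, bcomult = comult (bar A)\<rparr>"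

section \<open>Homotopy G-coalgebras, homotopy G-algebras, homotopy BV-algebras\<close>

text \<open>The component of \<open>nab [c]\<close> in words of lengths \<open>i\<close> and \<open>j\<close>.\<close>

definition cobar_component :: "('b list \<Rightarrow> ('b list \<times> 'b list \<Rightarrow>\<^sub>0 'r::comm_ring_1)) \<Rightarrow>
    nat \<Rightarrow> nat \<Rightarrow> 'b \<Rightarrow> ('b list \<times> 'b list \<Rightarrow>\<^sub>0 'r)" where
  "cobar_component nab i j c =
     lin (\<lambda>(u, v). if length u = i \<and> length v = j then bvec (u, v) else 0) (nab [c])"

text \<open>
  A homotopy G-coalgebra structure is given by the coproduct on the cobar construction that it
  induces: a DG-bialgebra structure of the form
  \<open>x \<mapsto> x \<otimes> 1 + 1 \<otimes> x + \<Sum>\<^sub>k\<^sub>\<ge>\<^sub>1 E\<^sup>k\<^sup>,\<^sup>1(x)\<close> on generators, where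
  \<open>E\<^sup>k\<^sup>,\<^sup>1 = cobar_component nab k 1\<close>.
\<close>

definition homotopy_G_coalgebra :: "('b, 'r::comm_ring_1) dgcoalg \<Rightarrow>
    ('b list \<Rightarrow> ('b list \<times> 'b list \<Rightarrow>\<^sub>0 'r)) \<Rightarrow> bool" where
  "homotopy_G_coalgebra C nab \<longleftrightarrow>
     dg_coalgebra C \<and> dg_bialgebra (bialg (cobar C) nab) \<and>
     (\<forall>c\<in>rbasis C. \<forall>(u, v)\<in>Poly_Mapping.keys (nab [c] - bvec ([c], []) - bvec ([], [c])).
        length u \<ge> 1 \<and> length v = 1)"

fun G_corestriction ::
  "('b \<Rightarrow> 'b list \<Rightarrow> ('b \<Rightarrow>\<^sub>0 'r::comm_ring_1)) \<Rightarrow> 'b list \<Rightarrow> 'b list \<Rightarrow> ('b \<Rightarrow>\<^sub>0 'r)" where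
  "G_corestriction E [a] [] = bvec a"
| "G_corestriction E [] [b] = bvec b"
| "G_corestriction E [a] (b # bs) = E a (b # bs)"
| "G_corestriction E _ _ = 0"

text \<open>
  \<open>E a [b\<^sub>1, \<dots>, b\<^sub>j]\<close> is \<open>E\<^sub>1\<^sub>,\<^sub>j(a; b\<^sub>1, \<dots>, b\<^sub>j)\<close>; only \<open>j \<ge> 1\<close> matters. The map \<open>\<mu>\<^sub>E\<close> is the
  coalgebra map with the given corestriction (unique, as the tensor coalgebra is cofree); being
  a coalgebra map is part of the bialgebra condition.
\<close>

definition homotopy_G_algebra ::
  "('b, 'r::comm_ring_1) dgalg \<Rightarrow> ('b \<Rightarrow> 'b list \<Rightarrow> ('b \<Rightarrow>\<^sub>0 'r)) \<Rightarrow> bool" where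
  "homotopy_G_algebra A E \<longleftrightarrow> dg_algebra A \<and> connected A \<and>
     (\<forall>a\<in>rbasis A. \<forall>bs\<in>lists (rbasis A). bs \<noteq> [] \<longrightarrow>
        Poly_Mapping.keys (E a bs) \<subseteq> rbasis A \<and>
        homog A (deg A a + (\<Sum>b\<leftarrow>bs. deg A b) + int (length bs)) (E a bs)) \<and>
     (\<exists>mu. dg_bialgebra (bar_bialg A mu) \<and>
        (\<forall>x\<in>lists (rbasis A). \<forall>y\<in>lists (rbasis A). \<forall>c.
           Poly_Mapping.lookup (mu x y) [c] = Poly_Mapping.lookup (G_corestriction E x y) c))"

text \<open>The bracket \<open>{a; b}\<close>; as \<open>E\<^sub>1\<^sub>,\<^sub>1\<close> lives on the augmentation ideal, it is extended by zero
  to the unit.\<close>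

definition G_bracket :: "('b, 'r::comm_ring_1) dgalg \<Rightarrow>
    ('b \<Rightarrow> 'b list \<Rightarrow> ('b \<Rightarrow>\<^sub>0 'r)) \<Rightarrow> 'b \<Rightarrow> 'b \<Rightarrow> ('b \<Rightarrow>\<^sub>0 'r)" where
  "G_bracket A E a b = (if a = one A \<or> b = one A then 0
     else E a [b] - scale (ksign ((deg A a + 1) * (deg A b + 1))) (E b [a]))"

definition homotopy_BV_algebra :: "('b, 'r::comm_ring_1) dgalg \<Rightarrow>
    ('b \<Rightarrow> 'b list \<Rightarrow> ('b \<Rightarrow>\<^sub>0 'r)) \<Rightarrow> ('b \<Rightarrow> ('b \<Rightarrow>\<^sub>0 'r)) \<Rightarrow> bool" where
  "homotopy_BV_algebra A E Del \<longleftrightarrow> homotopy_G_algebra A E \<and>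
     (\<forall>a\<in>basis A. homog A (deg A a + 1) (Del a) \<and>
        lin (diff A) (Del a) + lin Del (diff A a) = 0 \<and> lin Del (Del a) = 0) \<and>
     (\<exists>h. \<forall>a\<in>basis A. \<forall>b\<in>basis A.
        homog A (deg A a + deg A b + 2) (h a b) \<and>
        G_bracket A E a b =
          scale (ksign (deg A a))
            (lin Del (mult A a b) - lin (\<lambda>x. mult A x b) (Del a)
              - scale (ksign (deg A a)) (lin (mult A a) (Del b)))
          + lin (diff A) (h a b) + lin (\<lambda>x. h x b) (diff A a)
          - scale (ksign (deg A a)) (lin (h a) (diff A b)))"

section \<open>Kadeishvili operations and the Connes-Moscovici operator on the cobar construction\<close>

text \<open>Iterated coproduct; words of length \<open>r\<close> represent elements of \<open>H\<^sup>\<otimes>\<^sup>r\<close>.\<close>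

fun iter_comult :: "('b, 'r::comm_ring_1) dgbialg \<Rightarrow> nat \<Rightarrow> 'b \<Rightarrow> ('b list \<Rightarrow>\<^sub>0 'r)" where
  "iter_comult H 0 a = (if a = one H then bvec [] else 0)"
| "iter_comult H (Suc 0) a = bvec [a]"
| "iter_comult H (Suc (Suc r)) a =
     lin (\<lambda>(a', a''). conc (bvec [a']) (iter_comult H (Suc r) a'')) (bcomult H a)"

definition diamond ::
  "('b, 'r::comm_ring_1) dgbialg \<Rightarrow> 'b \<Rightarrow> 'b list \<Rightarrow> ('b list \<Rightarrow>\<^sub>0 'r)" where
  "diamond H a bs = lin (\<lambda>as.
     scale (ksign (\<Sum>p<length bs. \<Sum>q<p. deg H (as ! p) * (deg H (bs ! q) - 1)))
       (conc_list (map2 (\<lambda>x y. letter (mult H x y)) as bs))) (iter_comult H (length bs) a)"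

text \<open>
  The sum runs over the subsets \<open>I = {i\<^sub>1 < \<dots> < i\<^sub>k}\<close> of the positions of the word \<open>as\<close>
  (counted from 0); the position \<open>i \<in> I\<close> receives the entry of \<open>bs\<close> whose index is the number
  of elements of \<open>I\<close> below \<open>i\<close>.
\<close>

definition kadeishvili ::
  "('b, 'r::comm_ring_1) dgbialg \<Rightarrow> 'b list \<Rightarrow> 'b list list \<Rightarrow> ('b list \<Rightarrow>\<^sub>0 'r)" where
  "kadeishvili H as bs = (\<Sum>I | I \<subseteq> {..<length as} \<and> card I = length bs.
     scale (ksign (\<Sum>i\<in>I. (wdeg H (bs ! card {l\<in>I. l < i}) + 1) * wdeg H (drop (Suc i) as)))
       (conc_list (map (\<lambda>i. if i \<in> I then diamond H (as ! i) (bs ! card {l\<in>I. l < i})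
                          else bvec [as ! i]) [0..<length as])))"

definition cyc :: "('b, 'r::comm_ring_1) dgbialg \<Rightarrow> 'b list \<Rightarrow> ('b list \<Rightarrow>\<^sub>0 'r)" where
  "cyc H w = scale (ksign ((deg H (hd w) - 1) * wdeg H (tl w))) (bvec (tl w @ [hd w]))"

definition cm_p :: "('b, 'r::comm_ring_1) dgbialg \<Rightarrow> 'b list \<Rightarrow> ('b list \<Rightarrow>\<^sub>0 'r)" where
  "cm_p H w = scale (ksign (deg H (hd w)))
     (lin (\<lambda>x. diamond H x (tl w)) (antipode H (hd w)))"

definition connes_moscovici :: "('b, 'r::comm_ring_1) dgbialg \<Rightarrow> 'b list \<Rightarrow> ('b list \<Rightarrow>\<^sub>0 'r)" where
  "connes_moscovici H w = (if length w < 2 then 0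
     else (\<Sum>i<length w. lin (cm_p H) ((lin (cyc H) ^^ i) (bvec w))))"

section \<open>Simplicial sets, suspension, normalized chains\<close>

text \<open>\<open>face X n i : X\<^sub>n \<rightarrow> X\<^sub>n\<^sub>-\<^sub>1\<close> and \<open>degen X n i : X\<^sub>n \<rightarrow> X\<^sub>n\<^sub>+\<^sub>1\<close>; the sets \<open>X\<^sub>n\<close> need not be
  disjoint.\<close>

record 'a sset =
  simp :: "nat \<Rightarrow> 'a set"
  face :: "nat \<Rightarrow> nat \<Rightarrow> 'a \<Rightarrow> 'a"
  degen :: "nat \<Rightarrow> nat \<Rightarrow> 'a \<Rightarrow> 'a"

definition simplicial_set :: "'a sset \<Rightarrow> bool" where
  "simplicial_set X \<longleftrightarrow>
     (\<forall>n i. \<forall>x\<in>simp X (Suc n). i \<le> Suc n \<longrightarrow> face X (Suc n) i x \<in> simp X n) \<and>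
     (\<forall>n i. \<forall>x\<in>simp X n. i \<le> n \<longrightarrow> degen X n i x \<in> simp X (Suc n)) \<and>
     (\<forall>n i j. \<forall>x\<in>simp X (Suc (Suc n)). i < j \<longrightarrow> j \<le> Suc (Suc n) \<longrightarrow>
        face X (Suc n) i (face X (Suc (Suc n)) j x) =
        face X (Suc n) (j - 1) (face X (Suc (Suc n)) i x)) \<and>
     (\<forall>n i j. \<forall>x\<in>simp X n. i \<le> j \<longrightarrow> j \<le> n \<longrightarrow>
        degen X (Suc n) i (degen X n j x) = degen X (Suc n) (Suc j) (degen X n i x)) \<and>
     (\<forall>n i j. \<forall>x\<in>simp X n. i < j \<longrightarrow> j \<le> n \<longrightarrow>
        face X (Suc n) i (degen X n j x) = degen X (n - 1) (j - 1) (face X n i x)) \<and>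
     (\<forall>n j. \<forall>x\<in>simp X n. j \<le> n \<longrightarrow>
        face X (Suc n) j (degen X n j x) = x \<and> face X (Suc n) (Suc j) (degen X n j x) = x) \<and>
     (\<forall>n i j. \<forall>x\<in>simp X n. Suc j < i \<longrightarrow> i \<le> Suc n \<longrightarrow>
        face X (Suc n) i (degen X n j x) = degen X (n - 1) j (face X n (i - 1) x))"

definition reduced_sset :: "'a sset \<Rightarrow> bool" where
  "reduced_sset X \<longleftrightarrow> (\<exists>v. simp X 0 = {v})"

definition vertex :: "'a sset \<Rightarrow> 'a" where
  "vertex X = (THE v. simp X 0 = {v})"

text \<open>\<open>s\<^sub>0\<^sup>n(*)\<close>\<close>

fun bpoint :: "'a sset \<Rightarrow> nat \<Rightarrow> 'a" where
  "bpoint X 0 = vertex X"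
| "bpoint X (Suc n) = degen X n 0 (bpoint X n)"

definition degenerate :: "'a sset \<Rightarrow> nat \<Rightarrow> 'a \<Rightarrow> bool" where
  "degenerate X n x \<longleftrightarrow> (\<exists>m i. \<exists>y\<in>simp X m. n = Suc m \<and> i \<le> m \<and> x = degen X m i y)"

text \<open>
  Normal forms for the suspension: in dimension \<open>n\<close>, \<open>Pt\<close> is \<open>a\<^sub>n\<close>, and \<open>Cone i x\<close> is the class of
  \<open>(i, x)\<close> with \<open>x \<in> X\<^sub>n\<^sub>-\<^sub>i\<close> not equal to \<open>s\<^sub>0\<^sup>n\<^sup>-\<^sup>i(*)\<close>. The function \<open>cone\<close> maps a pair \<open>(i, x)\<close>
  to the normal form of its class.
\<close>

datatype 'a susp_simplex = Pt | Cone nat 'a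

definition cone :: "'a sset \<Rightarrow> nat \<Rightarrow> nat \<Rightarrow> 'a \<Rightarrow> 'a susp_simplex" where
  "cone X n i x = (if x = bpoint X (n - i) then Pt else Cone i x)"

text \<open>
  The operators on \<open>(i, x) = s\<^sub>0\<^sup>i\<^sup>-\<^sup>1(1, x)\<close> follow from those on \<open>(1, x)\<close> by the simplicial
  identities:
  \<open>d\<^sub>j s\<^sub>0\<^sup>i\<^sup>-\<^sup>1 = s\<^sub>0\<^sup>i\<^sup>-\<^sup>2\<close> for \<open>j < i\<close>, \<open>i \<ge> 2\<close>; \<open>d\<^sub>j s\<^sub>0\<^sup>i\<^sup>-\<^sup>1 = s\<^sub>0\<^sup>i\<^sup>-\<^sup>1 d\<^sub>j\<^sub>-\<^sub>i\<^sub>+\<^sub>1\<close> for \<open>j \<ge> i\<close>;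
  \<open>s\<^sub>j s\<^sub>0\<^sup>i\<^sup>-\<^sup>1 = s\<^sub>0\<^sup>i\<close> for \<open>j < i\<close>; \<open>s\<^sub>j s\<^sub>0\<^sup>i\<^sup>-\<^sup>1 = s\<^sub>0\<^sup>i\<^sup>-\<^sup>1 s\<^sub>j\<^sub>-\<^sub>i\<^sub>+\<^sub>1\<close> for \<open>j \<ge> i\<close>.
  The rule \<open>d\<^sub>1(1, x) = a\<^sub>0\<close> for \<open>x \<in> X\<^sub>0\<close> is covered by \<open>Pt\<close>, since \<open>(1, *) = a\<^sub>1\<close>.
\<close>

fun susp_face :: "'a sset \<Rightarrow> nat \<Rightarrow> nat \<Rightarrow> 'a susp_simplex \<Rightarrow> 'a susp_simplex" where
  "susp_face X n j Pt = Pt"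
| "susp_face X n j (Cone i x) =
     (if j < i then (if i = 1 then Pt else cone X (n - 1) (i - 1) x)
      else cone X (n - 1) i (face X (n - i) (j - i) x))"

fun susp_degen :: "'a sset \<Rightarrow> nat \<Rightarrow> nat \<Rightarrow> 'a susp_simplex \<Rightarrow> 'a susp_simplex" where
  "susp_degen X n j Pt = Pt"
| "susp_degen X n j (Cone i x) =
     (if j < i then cone X (n + 1) (i + 1) x
      else cone X (n + 1) i (degen X (n - i) (j - i) x))"

definition susp :: "'a sset \<Rightarrow> 'a susp_simplex sset" where
  "susp X = \<lparr>simp = (\<lambda>n. insert Pt {cone X n i x | i x. 1 \<le> i \<and> i \<le> n \<and> x \<in> simp X (n - i)}),
     face = susp_face X, degen = susp_degen X\<rparr>"

definition chain_class :: "'a sset \<Rightarrow> nat \<Rightarrow> 'a \<Rightarrow> (nat \<times> 'a \<Rightarrow>\<^sub>0 'r::comm_ring_1)" where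
  "chain_class X n x = (if degenerate X n x then 0 else bvec (n, x))"

text \<open>\<open>delete_vertices X n [j\<^sub>1, j\<^sub>2, \<dots>]\<close> with \<open>j\<^sub>1 > j\<^sub>2 > \<dots>\<close> removes these vertices from an
  \<open>n\<close>-simplex, highest first; \<open>subsimplex X n V x\<close> is the face of \<open>x\<close> on the vertices in \<open>V\<close>.\<close>

fun delete_vertices :: "'a sset \<Rightarrow> nat \<Rightarrow> nat list \<Rightarrow> 'a \<Rightarrow> 'a" where
  "delete_vertices X n [] x = x"
| "delete_vertices X n (j # js) x = delete_vertices X (n - 1) js (face X n j x)"

definition subsimplex :: "'a sset \<Rightarrow> nat \<Rightarrow> nat set \<Rightarrow> 'a \<Rightarrow> 'a" where
  "subsimplex X n V x = delete_vertices X n (rev (sorted_list_of_set ({0..n} - V))) x"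

text \<open>Normalized chains of a simplicial set with a single vertex, with the Alexander-Whitney
  coproduct. The basis element \<open>(n, x)\<close> is the nondegenerate simplex \<open>x \<in> X\<^sub>n\<close>.\<close>

definition normalized_chains :: "'a sset \<Rightarrow> (nat \<times> 'a, 'r::comm_ring_1) dgcoalg" where
  "normalized_chains X = \<lparr>basis = {(n, x). x \<in> simp X n \<and> \<not> degenerate X n x},
     deg = (\<lambda>(n, x). int n),
     diff = (\<lambda>(n, x). if n = 0 then 0
        else (\<Sum>i\<le>n. scale ((-1) ^ i) (chain_class X (n - 1) (face X n i x)))),
     one = (0, vertex X),
     comult = (\<lambda>(n, x). \<Sum>i\<le>n. tensor (chain_class X i (subsimplex X n {0..i} x))
        (chain_class X (n - i) (subsimplex X n {i..n} x)))\<rparr>"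

section \<open>Baues' coproduct\<close>

text \<open>The bracket \<open>[\<sigma>\<^sub>1|\<dots>|\<sigma>\<^sub>m]\<close>, each simplex given with its dimension.\<close>

definition bracket :: "'a sset \<Rightarrow> (nat \<times> 'a) list \<Rightarrow> ((nat \<times> 'a) list \<Rightarrow>\<^sub>0 'r::comm_ring_1)" where
  "bracket Y ss = conc_list (map (\<lambda>(m, x). letter (chain_class Y m x)) (filter (\<lambda>(m, x). 2 \<le> m) ss))"

text \<open>
  For \<open>b = {b\<^sub>1 < \<dots> < b\<^sub>r}\<close> the list \<open>ps\<close> is \<open>[0, b\<^sub>1, \<dots>, b\<^sub>r, n]\<close>. With \<open>b\<^sub>0 = 0\<close> the first summand
  \<open>r|\<sigma>(0, \<dots>, b\<^sub>1)|\<close> of the sign exponent is the term \<open>i = 1\<close> of the sum.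
\<close>

definition baues_gen ::
  "'a sset \<Rightarrow> nat \<times> 'a \<Rightarrow> ((nat \<times> 'a) list \<times> (nat \<times> 'a) list \<Rightarrow>\<^sub>0 'r::comm_ring_1)" where
  "baues_gen Y = (\<lambda>(n, x). \<Sum>b\<in>Pow {1..n - 1}.
     let r = card b;
         ps = 0 # sorted_list_of_set b @ [n];
         zeta = (\<Sum>i=1..r. (int r + 1 - int i) * (int (ps ! i) - int (ps ! (i - 1))))
                  - int (r * (r + 1) div 2)
     in scale (ksign zeta) (tensor
          (bracket Y (map (\<lambda>i. (ps ! Suc i - ps ! i, subsimplex Y n {ps ! i..ps ! Suc i} x))
             [0..<Suc r]))
          (bracket Y [(Suc r, subsimplex Y n (insert 0 (insert n b)) x)])))"

fun baues_coproduct :: "'a sset \<Rightarrow> (nat \<times> 'a) list \<Rightarrow>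
    ((nat \<times> 'a) list \<times> (nat \<times> 'a) list \<Rightarrow>\<^sub>0 'r::comm_ring_1)" where
  "baues_coproduct Y [] = bvec ([], [])"
| "baues_coproduct Y (c # w) =
     tensor_mult (cobar (normalized_chains Y)) (baues_gen Y c) (baues_coproduct Y w)"

definition cobar_chains_hopf :: "'a sset \<Rightarrow> ((nat \<times> 'a) list, 'r::comm_ring_1) dgbialg" where
  "cobar_chains_hopf Y = bialg (cobar (normalized_chains Y)) (baues_coproduct Y)"

section \<open>The suspension is a simplicial set satisfying the defining rules\<close>

lemma simplicial_setD:
  assumes "simplicial_set X"
  shows
 "x\<in>simp X (Suc n) \<Longrightarrow> i \<le> Suc n \<Longrightarrow> face X (Suc n) i x \<in> simp X n"
 "x\<in>simp X n \<Longrightarrow> i \<le> n \<Longrightarrow> degen X n i x \<in> simp X (Suc n)"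
 "x\<in>simp X (Suc (Suc n)) \<Longrightarrow> i < j \<Longrightarrow> j \<le> Suc (Suc n) \<Longrightarrow>
        face X (Suc n) i (face X (Suc (Suc n)) j x) =
        face X (Suc n) (j - 1) (face X (Suc (Suc n)) i x)"
 "x\<in>simp X n \<Longrightarrow> i \<le> j \<Longrightarrow> j \<le> n \<Longrightarrow>
        degen X (Suc n) i (degen X n j x) = degen X (Suc n) (Suc j) (degen X n i x)"
 "x\<in>simp X n \<Longrightarrow> i < j \<Longrightarrow> j \<le> n \<Longrightarrow>
        face X (Suc n) i (degen X n j x) = degen X (n - 1) (j - 1) (face X n i x)"
 "x\<in>simp X n \<Longrightarrow> j \<le> n \<Longrightarrow> face X (Suc n) j (degen X n j x) = x"
 "x\<in>simp X n \<Longrightarrow> j \<le> n \<Longrightarrow> face X (Suc n) (Suc j) (degen X n j x) = x"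
 "x\<in>simp X n \<Longrightarrow> Suc j < i \<Longrightarrow> i \<le> Suc n \<Longrightarrow>
        face X (Suc n) i (degen X n j x) = degen X (n - 1) j (face X n (i - 1) x)"
  subgoal by (rule assms[unfolded simplicial_set_def, THEN conjunct1, rule_format])
  subgoal by (rule assms[unfolded simplicial_set_def, THEN conjunct2, THEN conjunct1, rule_format])
  subgoal by (rule assms[unfolded simplicial_set_def, THEN conjunct2, THEN conjunct2, THEN conjunct1, rule_format])
  subgoal by (rule assms[unfolded simplicial_set_def, THEN conjunct2, THEN conjunct2, THEN conjunct2, THEN conjunct1, rule_format])
  subgoal by (rule assms[unfolded simplicial_set_def, THEN conjunct2, THEN conjunct2, THEN conjunct2, THEN conjunct2, THEN conjunct1, rule_format])
  subgoal by (rule assms[unfolded simplicial_set_def, THEN conjunct2, THEN conjunct2, THEN conjunct2, THEN conjunct2, THEN conjunct2, THEN conjunct1, rule_format, THEN conjunct1])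
  subgoal by (rule assms[unfolded simplicial_set_def, THEN conjunct2, THEN conjunct2, THEN conjunct2, THEN conjunct2, THEN conjunct2, THEN conjunct1, rule_format, THEN conjunct2])
  subgoal by (rule assms[unfolded simplicial_set_def, THEN conjunct2, THEN conjunct2, THEN conjunct2, THEN conjunct2, THEN conjunct2, THEN conjunct2, rule_format])
  done

context fixes X :: "'a sset" assumes S: "simplicial_set X" and R: "reduced_sset X"
begin

lemma simp_0_eq: "simp X 0 = {vertex X}"
proof -
  obtain v where v: "simp X 0 = {v}"
    using R unfolding reduced_sset_def by (rule exE)
  show ?thesis
    unfolding vertex_def v by simp
qed

lemma bpoint_in_simp: "bpoint X n \<in> simp X n" by (induct n) (auto simp: simp_0_eq simplicial_setD[OF S])

lemma degen_bpoint: "i \<le> n \<Longrightarrow> degen X n i (bpoint X n) = bpoint X (Suc n)"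
proof (induct n arbitrary: i)
  case (Suc n) show ?case
  proof (cases i) case (Suc k)
    have "degen X (Suc n) (Suc k) (degen X n 0 (bpoint X n)) = degen X (Suc n) 0 (degen X n k (bpoint X n))"
      using simplicial_setD(4)[OF S bpoint_in_simp[of n], of 0 k] Suc Suc.prems by simp
    thus ?thesis using Suc Suc.hyps[of k] Suc.prems by simp
  qed simp
qed simp

lemma face_bpoint:
  assumes "i \<le> Suc n"
  shows "face X (Suc n) i (bpoint X (Suc n)) = bpoint X n"
proof (cases i)
  case 0
  show ?thesis
    using simplicial_setD(6)[OF S bpoint_in_simp[of n], of 0] by (simp add: 0)
next
  case (Suc k)
  then have "k \<le> n"
    using assms by simp
  from simplicial_setD(7)[OF S bpoint_in_simp this]
  show ?thesis
    unfolding degen_bpoint[OF \<open>k \<le> n\<close>] Suc .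
qed

lemma cone_bpoint [simp]: "m = n - i \<Longrightarrow> cone X n i (bpoint X m) = Pt"
  by (simp add: cone_def)

lemma cone_not_bpoint: "x \<noteq> bpoint X (n - i) \<Longrightarrow> cone X n i x = Cone i x"
  by (simp add: cone_def)

lemma susp_face_cone:
  assumes "1 \<le> i" "i \<le> n" "x \<in> simp X (n - i)" "j \<le> n"
  shows "susp_face X n j (cone X n i x) =
    (if j < i then (if i = 1 then Pt else cone X (n - 1) (i - 1) x)
     else if n = i then Pt else cone X (n - 1) i (face X (n - i) (j - i) x))"
proof (cases "x = bpoint X (n - i)")
  case False
  then have "n \<noteq> i"
    using assms(3) simp_0_eq by auto
  then show ?thesis
    by (simp only: cone_not_bpoint[OF False] susp_face.simps if_False)
next
  case x: True
  have 1: "cone X (n - 1) (i - 1) x = Pt" if "i \<noteq> 1"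
    unfolding x using assms that by (intro cone_bpoint) simp
  have 2: "cone X (n - 1) i (face X (n - i) (j - i) x) = Pt" if ni: "n \<noteq> i"
  proof -
    obtain m where m: "n - i = Suc m"
      using assms(2) ni by (cases "n - i") simp_all
    have "face X (n - i) (j - i) x = bpoint X m"
      unfolding x m using assms(4) m by (intro face_bpoint) simp
    then show ?thesis
      using m by (simp only:) (intro cone_bpoint, simp)
  qed
  have 3: "cone X n i x = Pt"
    unfolding x by (intro cone_bpoint) simp
  show ?thesis
    unfolding 3 susp_face.simps using 1 2 by presburger
qed

lemma susp_degen_cone:
  assumes "1 \<le> i" "i \<le> n" "x \<in> simp X (n - i)" "j \<le> n"
  shows "susp_degen X n j (cone X n i x) =
    (if j < i then cone X (n + 1) (i + 1) x
     else cone X (n + 1) i (degen X (n - i) (j - i) x))"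
proof (cases "x = bpoint X (n - i)")
  case False
  then show ?thesis
    by (simp only: cone_not_bpoint[OF False] susp_degen.simps)
next
  case x: True
  have 1: "cone X (n + 1) (i + 1) x = Pt"
    unfolding x by (intro cone_bpoint) simp
  have "degen X (n - i) (j - i) x = bpoint X (Suc (n - i))"
    unfolding x using assms by (intro degen_bpoint) simp
  then have 2: "cone X (n + 1) i (degen X (n - i) (j - i) x) = Pt"
    using assms by (simp only:) (intro cone_bpoint, simp)
  have 3: "cone X n i x = Pt"
    unfolding x by (intro cone_bpoint) simp
  show ?thesis
    unfolding 3 susp_degen.simps 1 2 by simp
qed

lemma susp_generators:
  "x \<in> simp X n \<Longrightarrow> face (susp X) (Suc n) 0 (cone X (Suc n) 1 x) = Pt"
  "x \<in> simp X 0 \<Longrightarrow> face (susp X) 1 1 (cone X 1 1 x) = Pt"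
  "x \<in> simp X (Suc n) \<Longrightarrow> i \<le> Suc n \<Longrightarrow> face (susp X) (Suc (Suc n)) (i+1) (cone X (Suc (Suc n)) 1 x) = cone X (Suc n) 1 (face X (Suc n) i x)"
  "1 \<le> i \<Longrightarrow> i \<le> n \<Longrightarrow> x \<in> simp X (n-i) \<Longrightarrow> degen (susp X) n 0 (cone X n i x) = cone X (Suc n) (i+1) x"
  "x \<in> simp X n \<Longrightarrow> i \<le> n \<Longrightarrow> degen (susp X) (Suc n) (i+1) (cone X (Suc n) 1 x) = cone X (Suc (Suc n)) 1 (degen X n i x)"
  by (auto simp: susp_def susp_face_cone susp_degen_cone Suc_eq_plus1[symmetric] simp del: Suc_eq_plus1 One_nat_def)

lemma susp_cases [consumes 1]: "z \<in> simp (susp X) n \<Longrightarrow> (z = Pt \<Longrightarrow> P) \<Longrightarrow> (\<And>i x m. z = cone X n i x \<Longrightarrow> 1 \<le> i \<Longrightarrow> n = m + i \<Longrightarrow> x \<in> simp X m \<Longrightarrow> P) \<Longrightarrow> P"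
  unfolding susp_def by (auto, metis One_nat_def le_add_diff_inverse2)

lemma susp_operators: "face (susp X) = susp_face X" "degen (susp X) = susp_degen X" by (auto simp: susp_def)

lemma cone_in_susp: "1 \<le> i \<Longrightarrow> i \<le> n \<Longrightarrow> x \<in> simp X (n-i) \<Longrightarrow> cone X n i x \<in> simp (susp X) n"
  by (auto simp: susp_def)

lemma Pt_in_susp: "Pt \<in> simp (susp X) n" by (auto simp: susp_def)

lemma susp_face_cone':
  assumes "1 \<le> k" "x \<in> simp X m" "n = m + k"
  shows "j < k \<Longrightarrow> k = 1 \<Longrightarrow> susp_face X n j (cone X n k x) = Pt"
    and "j < k \<Longrightarrow> k \<noteq> 1 \<Longrightarrow> susp_face X n j (cone X n k x) = cone X (n - 1) (k - 1) x"
    and "k \<le> j \<Longrightarrow> j \<le> n \<Longrightarrow> m = 0 \<Longrightarrow> susp_face X n j (cone X n k x) = Pt"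
    and "k \<le> j \<Longrightarrow> j \<le> n \<Longrightarrow> m \<noteq> 0 \<Longrightarrow>
      susp_face X n j (cone X n k x) = cone X (n - 1) k (face X m (j - k) x)"
proof -
  have x: "x \<in> simp X (n - k)" and m: "n - k = m" and k: "k \<le> n"
    using assms by simp_all
  note f = susp_face_cone[OF assms(1) k x]
  show "susp_face X n j (cone X n k x) = Pt" if "j < k" "k = 1"
    using f[of j] that k by simp
  show "susp_face X n j (cone X n k x) = cone X (n - 1) (k - 1) x" if "j < k" "k \<noteq> 1"
    using f[of j] that k by simp
  show "susp_face X n j (cone X n k x) = Pt" if "k \<le> j" "j \<le> n" "m = 0"
    using f[of j] that assms(3) by simp
  show "susp_face X n j (cone X n k x) = cone X (n - 1) k (face X m (j - k) x)"
    if "k \<le> j" "j \<le> n" "m \<noteq> 0"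
    using f[of j] that assms(3) by simp
qed

lemma susp_degen_cone':
  assumes "1 \<le> k" "x \<in> simp X m" "n = m + k"
  shows "j < k \<Longrightarrow> susp_degen X n j (cone X n k x) = cone X (Suc n) (Suc k) x"
    and "k \<le> j \<Longrightarrow> j \<le> n \<Longrightarrow>
      susp_degen X n j (cone X n k x) = cone X (Suc n) k (degen X m (j - k) x)"
proof -
  have x: "x \<in> simp X (n - k)" and m: "n - k = m" and k: "k \<le> n"
    using assms by simp_all
  note f = susp_degen_cone[OF assms(1) k x]
  show "susp_degen X n j (cone X n k x) = cone X (Suc n) (Suc k) x" if "j < k"
    using f[of j] that k by simp
  show "susp_degen X n j (cone X n k x) = cone X (Suc n) k (degen X m (j - k) x)"
    if "k \<le> j" "j \<le> n"
    using f[of j] that assms(3) by simp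
qed

lemma cone_in_susp': "1 \<le> k \<Longrightarrow> x \<in> simp X m \<Longrightarrow> n = m + k \<Longrightarrow> cone X n k x \<in> simp (susp X) n"
  by (rule cone_in_susp) simp_all

lemma susp_face_closed:
  assumes "z \<in> simp (susp X) (Suc n)" "i \<le> Suc n"
  shows "susp_face X (Suc n) i z \<in> simp (susp X) n"
  using assms(1)
proof (cases rule: susp_cases)
  case 1
  then show ?thesis by (simp add: Pt_in_susp)
next
  case Z: (2 k x m)
  note f = susp_face_cone'[OF Z(2,4,3)]
  consider "i < k" "k = 1" | "i < k" "k \<noteq> 1" | "k \<le> i" "m = 0" | p where "k \<le> i" "m = Suc p"
    by (cases m; cases "i < k"; cases "k = 1") (auto simp: not_less)
  then show ?thesis
  proof cases
    case 1
    show ?thesis unfolding Z(1) f(1)[OF 1] by (rule Pt_in_susp)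
  next
    case c: 2
    have "cone X n (k - 1) x \<in> simp (susp X) n"
      by (rule cone_in_susp'[OF _ Z(4)]) (use c Z(2,3) in auto)
    then show ?thesis unfolding Z(1) f(2)[OF c] by simp
  next
    case 3
    show ?thesis unfolding Z(1) f(3)[OF 3(1) assms(2) 3(2)] by (rule Pt_in_susp)
  next
    case 4
    have "face X m (i - k) x \<in> simp X p"
      unfolding 4 by (rule simplicial_setD(1)[OF S]) (use Z 4 assms(2) in auto)
    then have "cone X n k (face X m (i - k) x) \<in> simp (susp X) n"
      by (rule cone_in_susp'[OF Z(2)]) (use 4 Z(3) in auto)
    then show ?thesis
      using f(4)[OF 4(1) assms(2)] Z(1) 4(2) by simp
  qed
qed

lemma susp_degen_closed:
  assumes "z \<in> simp (susp X) n" "i \<le> n"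
  shows "susp_degen X n i z \<in> simp (susp X) (Suc n)"
  using assms(1)
proof (cases rule: susp_cases)
  case 1
  then show ?thesis by (simp add: Pt_in_susp)
next
  case Z: (2 k x m)
  note f = susp_degen_cone'[OF Z(2,4,3)]
  show ?thesis
  proof (cases "i < k")
    case True
    show ?thesis unfolding Z(1) f(1)[OF True] by (rule cone_in_susp'[OF _ Z(4)]) (use Z in auto)
  next
    case False
    then have "k \<le> i" by simp
    have "degen X m (i - k) x \<in> simp X (Suc m)"
      by (rule simplicial_setD(2)[OF S Z(4)]) (use Z assms(2) in auto)
    from cone_in_susp'[OF Z(2) this] show ?thesis
      unfolding Z(1) f(2)[OF \<open>k \<le> i\<close> assms(2)] using Z(3) by simp
  qed
qed

lemma susp_face_face:
  assumes "z \<in> simp (susp X) (Suc (Suc n))" "i < j" "j \<le> Suc (Suc n)"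
  shows "susp_face X (Suc n) i (susp_face X (Suc (Suc n)) j z) =
    susp_face X (Suc n) (j - 1) (susp_face X (Suc (Suc n)) i z)"
  using assms(1)
proof (cases rule: susp_cases)
  case 1
  then show ?thesis by simp
next
  case Z: (2 k x m)
  note f = susp_face_cone'[OF Z(2,4,3)]
  have i: "i \<le> Suc (Suc n)" "i \<le> Suc n" "j - 1 \<le> Suc n" using assms by simp_all
  consider "j < k" | "i < k" "k \<le> j" "k = 1" | "i < k" "k \<le> j" "k \<noteq> 1" "m = 0"
    | p where "i < k" "k \<le> j" "k \<noteq> 1" "m = Suc p"
    | "k \<le> i" "m = 0" | "k \<le> i" "m = 1" | p where "k \<le> i" "m = Suc (Suc p)"
    using assms(2)
    by (cases m; cases "m - 1"; cases "i < k"; cases "j < k"; cases "k = 1") (auto simp: not_less)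
  then show ?thesis
  proof cases
    case 1
    then obtain l where l: "k = Suc l" "1 \<le> l" using assms(2) by (cases k) auto
    have g: "Suc n = m + l" using Z l by simp
    note h = susp_face_cone'[OF l(2) Z(4) g]
    have "susp_face X (Suc (Suc n)) j z = cone X (Suc n) l x"
         "susp_face X (Suc (Suc n)) i z = cone X (Suc n) l x"
      unfolding Z(1) using f(2)[of j] f(2)[of i] 1 l assms(2) by simp_all
    then show ?thesis
      using h(1)[of i] h(1)[of "j - 1"] h(2)[of i] h(2)[of "j - 1"] 1 l assms(2)
      by (cases "l = 1") simp_all
  next
    case c: 2
    have e: "susp_face X (Suc (Suc n)) i z = Pt"
      unfolding Z(1) using f(1)[of i] c by simp
    show ?thesis
    proof (cases m)
      case 0
      then show ?thesis
        unfolding e unfolding Z(1) using f(3)[OF c(2) assms(3)] by simp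
    next
      case (Suc p)
      have y: "face X m (j - k) x \<in> simp X p"
        unfolding Suc by (rule simplicial_setD(1)[OF S]) (use Z Suc assms in auto)
      have g: "Suc n = p + k" using Z Suc by simp
      show ?thesis
        unfolding e unfolding Z(1) using f(4)[OF c(2) assms(3)] Suc
          susp_face_cone'(1)[OF Z(2) y g c(1,3)] by simp
    qed
  next
    case 3
    then obtain l where l: "k = Suc l" "1 \<le> l" using Z(2) by (cases k) auto
    have g: "Suc n = m + l" using Z l by simp
    note h = susp_face_cone'[OF l(2) Z(4) g]
    show ?thesis
      unfolding Z(1) f(3)[OF 3(2) assms(3) 3(4)] f(2)[OF 3(1,3)]
      using h(3)[of "j - 1"] 3 l i(3) by simp
  next
    case 4
    then obtain l where l: "k = Suc l" "1 \<le> l" using Z(2) by (cases k) auto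
    have g: "Suc n = m + l" using Z l by simp
    note h = susp_face_cone'[OF l(2) Z(4) g]
    have y: "face X m (j - k) x \<in> simp X p"
      unfolding 4 by (rule simplicial_setD(1)[OF S]) (use Z 4 assms in auto)
    have g': "Suc n = p + k" using Z 4 by simp
    note h' = susp_face_cone'[OF Z(2) y g']
    have m: "m \<noteq> 0" using 4 by simp
    show ?thesis
      unfolding Z(1) f(4)[OF 4(2) assms(3) m] f(2)[OF 4(1,3)]
      using h(4)[of "j - 1"] h'(2)[OF 4(1,3)] m 4(2) l i(3) by simp
  next
    case 5
    have "k \<le> j" using 5 assms(2) by simp
    then show ?thesis
      unfolding Z(1) using f(3)[of i] f(3)[of j] 5 assms i by simp
  next
    case 6
    have j: "k \<le> j" "k \<le> j - 1" using 6 assms(2) by simp_all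
    have y: "face X m l x \<in> simp X 0" if "l \<le> 1" for l
      using simplicial_setD(1)[OF S, of x 0 l] Z(4) that 6 by simp
    have g: "Suc n = 0 + k" using Z 6 by simp
    have b: "j - k \<le> 1" "i - k \<le> 1" using assms g by simp_all
    show ?thesis
      unfolding Z(1)
      using f(4)[of i] f(4)[of j] j 6 assms i susp_face_cone'(3)[OF Z(2) y[OF b(1)] g]
        susp_face_cone'(3)[OF Z(2) y[OF b(2)] g] by simp
  next
    case 7
    have j: "k \<le> j" "k \<le> j - 1" using 7 assms(2) by simp_all
    have y: "face X m l x \<in> simp X (Suc p)" if "l \<le> m" for l
      using simplicial_setD(1)[OF S, of x "Suc p" l] Z(4) that 7 by simp
    have g: "Suc n = Suc p + k" using Z 7 by simp
    have b: "j - k \<le> m" "i - k \<le> m" using assms g 7 by simp_all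
    have "face X (Suc p) (i - k) (face X m (j - k) x) =
        face X (Suc p) (j - k - 1) (face X m (i - k) x)"
      unfolding 7 by (rule simplicial_setD(3)[OF S]) (use Z(4) 7 assms b in auto)
    moreover have "j - 1 - k = j - k - 1" by simp
    ultimately show ?thesis
      unfolding Z(1)
      using f(4)[of i] f(4)[of j] j 7 assms i susp_face_cone'(4)[OF Z(2) y[OF b(1)] g, of i]
        susp_face_cone'(4)[OF Z(2) y[OF b(2)] g, of "j - 1"] by simp
  qed
qed

lemma susp_degen_degen:
  assumes "z \<in> simp (susp X) n" "i \<le> j" "j \<le> n"
  shows "susp_degen X (Suc n) i (susp_degen X n j z) =
    susp_degen X (Suc n) (Suc j) (susp_degen X n i z)"
  using assms(1)
proof (cases rule: susp_cases)
  case 1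
  then show ?thesis by simp
next
  case Z: (2 k x m)
  note f = susp_degen_cone'[OF Z(2,4,3)]
  have g: "Suc n = m + Suc k" "1 \<le> Suc k" "Suc n = Suc m + k" using Z by simp_all
  note h = susp_degen_cone'[OF g(2) Z(4) g(1)]
  consider "j < k" | "i < k" "k \<le> j" | "k \<le> i" using assms(2) by linarith
  then show ?thesis
  proof cases
    case 1
    then show ?thesis
      unfolding Z(1) using f(1)[of i] f(1)[of j] h(1)[of i] h(1)[of "Suc j"] assms by simp
  next
    case c: 2
    have y: "degen X m (j - k) x \<in> simp X (Suc m)"
      by (rule simplicial_setD(2)[OF S Z(4)]) (use Z assms in auto)
    show ?thesis
      unfolding Z(1) using f(1)[of i] f(2)[of j] h(2)[of "Suc j"] c assms
        susp_degen_cone'(1)[OF Z(2) y g(3), of i] by simp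
  next
    case 3
    have y: "degen X m l x \<in> simp X (Suc m)" if "l \<le> m" for l
      by (rule simplicial_setD(2)[OF S Z(4) that])
    have b: "j - k \<le> m" "i - k \<le> m" using assms Z(3) by simp_all
    have "degen X (Suc m) (i - k) (degen X m (j - k) x) =
        degen X (Suc m) (Suc (j - k)) (degen X m (i - k) x)"
      by (rule simplicial_setD(4)[OF S Z(4)]) (use assms b in auto)
    moreover have "Suc j - k = Suc (j - k)" using 3 assms by simp
    ultimately show ?thesis
      unfolding Z(1) using f(2)[of i] f(2)[of j] 3 assms
        susp_degen_cone'(2)[OF Z(2) y[OF b(1)] g(3), of i]
        susp_degen_cone'(2)[OF Z(2) y[OF b(2)] g(3), of "Suc j"] by simp
  qed
qed

lemma susp_face_degen_less:
  assumes "z \<in> simp (susp X) n" "i < j" "j \<le> n"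
  shows "susp_face X (Suc n) i (susp_degen X n j z) =
    susp_degen X (n - 1) (j - 1) (susp_face X n i z)"
  using assms(1)
proof (cases rule: susp_cases)
  case 1
  then show ?thesis by simp
next
  case Z: (2 k x m)
  note f = susp_face_cone'[OF Z(2,4,3)] and d = susp_degen_cone'[OF Z(2,4,3)]
  have g: "Suc n = m + Suc k" "1 \<le> Suc k" "Suc n = Suc m + k" using Z by simp_all
  have i: "i \<le> n" "i \<le> Suc n" using assms by simp_all
  note h = susp_face_cone'[OF g(2) Z(4) g(1)]
  consider "j < k" | "i < k" "k \<le> j" "k = 1" | "i < k" "k \<le> j" "k \<noteq> 1"
    | "k \<le> i" "m = 0" | p where "k \<le> i" "m = Suc p"
    using assms(2)
    by (cases m; cases "i < k"; cases "j < k"; cases "k = 1") (auto simp: not_less)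
  then show ?thesis
  proof cases
    case 1
    then obtain l where l: "k = Suc l" "1 \<le> l" using assms(2) by (cases k) auto
    have g': "n - 1 = m + l" using Z l by simp
    show ?thesis
      unfolding Z(1) using d(1)[OF 1] h(2)[of i] f(2)[of i]
        susp_degen_cone'(1)[OF l(2) Z(4) g', of "j - 1"] 1 l assms g' Z(3) by simp
  next
    case c: 2
    have y: "degen X m (j - k) x \<in> simp X (Suc m)"
      by (rule simplicial_setD(2)[OF S Z(4)]) (use Z assms in auto)
    show ?thesis
      unfolding Z(1) f(1)[OF c(1,3)] d(2)[OF c(2) assms(3)]
        susp_face_cone'(1)[OF Z(2) y g(3) c(1,3)] by simp
  next
    case 3
    then obtain l where l: "k = Suc l" "1 \<le> l" using Z(2) by (cases k) auto
    have g': "n - 1 = m + l" using Z l by simp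
    have y: "degen X m (j - k) x \<in> simp X (Suc m)"
      by (rule simplicial_setD(2)[OF S Z(4)]) (use Z assms in auto)
    show ?thesis
      unfolding Z(1) f(2)[OF 3(1,3)] d(2)[OF 3(2) assms(3)]
        susp_face_cone'(2)[OF Z(2) y g(3) 3(1,3)]
      using susp_degen_cone'(2)[OF l(2) Z(4) g', of "j - 1"] 3 l assms g' Z(3) by simp
  next
    case 4
    then have False using Z(3) assms by simp
    then show ?thesis ..
  next
    case 5
    have j: "k \<le> j" "k \<le> j - 1" using 5 assms(2) by simp_all
    have y: "degen X m (j - k) x \<in> simp X (Suc m)"
      by (rule simplicial_setD(2)[OF S Z(4)]) (use Z assms in auto)
    have y': "face X m (i - k) x \<in> simp X p"
      unfolding 5 by (rule simplicial_setD(1)[OF S]) (use Z 5 assms in auto)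
    have g': "n - 1 = p + k" using Z 5 by simp
    have "face X (Suc m) (i - k) (degen X m (j - k) x) =
        degen X (m - 1) (j - k - 1) (face X m (i - k) x)"
      by (rule simplicial_setD(5)[OF S Z(4)]) (use Z 5 assms in auto)
    moreover have "j - 1 - k = j - k - 1" by simp
    ultimately show ?thesis
      unfolding Z(1) using f(4)[OF 5(1) i(1)] d(2)[OF j(1) assms(3)]
        susp_face_cone'(4)[OF Z(2) y g(3) 5(1) i(2)]
        susp_degen_cone'(2)[OF Z(2) y' g' j(2)] assms 5(2) Z(3) g' by simp
  qed
qed

lemma susp_face_degen_eq:
  assumes "z \<in> simp (susp X) n" "j \<le> n"
  shows "susp_face X (Suc n) j (susp_degen X n j z) = z"
    and "susp_face X (Suc n) (Suc j) (susp_degen X n j z) = z"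
proof -
  have "susp_face X (Suc n) j (susp_degen X n j z) = z \<and>
      susp_face X (Suc n) (Suc j) (susp_degen X n j z) = z"
    using assms(1)
  proof (cases rule: susp_cases)
    case 1
    then show ?thesis by simp
  next
    case Z: (2 k x m)
    note d = susp_degen_cone'[OF Z(2,4,3)]
    have g: "Suc n = m + Suc k" "1 \<le> Suc k" "Suc n = Suc m + k" using Z by simp_all
    show ?thesis
    proof (cases "j < k")
      case True
      then show ?thesis
        unfolding Z(1) d(1)[OF True]
        using susp_face_cone'(2)[OF g(2) Z(4) g(1)] Z(2) by simp
    next
      case False
      then have j: "k \<le> j" "k \<le> Suc j" by simp_all
      have b: "j - k \<le> m" using assms Z(3) by simp
      have y: "degen X m (j - k) x \<in> simp X (Suc m)"
        by (rule simplicial_setD(2)[OF S Z(4) b])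
      have "Suc j - k = Suc (j - k)" using j by simp
      then show ?thesis
        unfolding Z(1) d(2)[OF j(1) assms(2)]
        using susp_face_cone'(4)[OF Z(2) y g(3) j(1)] susp_face_cone'(4)[OF Z(2) y g(3) j(2)]
          simplicial_setD(6,7)[OF S Z(4) b] assms(2) by simp
    qed
  qed
  then show "susp_face X (Suc n) j (susp_degen X n j z) = z"
    and "susp_face X (Suc n) (Suc j) (susp_degen X n j z) = z"
    by simp_all
qed

lemma susp_face_degen_greater:
  assumes "z \<in> simp (susp X) n" "Suc j < i" "i \<le> Suc n"
  shows "susp_face X (Suc n) i (susp_degen X n j z) =
    susp_degen X (n - 1) j (susp_face X n (i - 1) z)"
  using assms(1)
proof (cases rule: susp_cases)
  case 1
  then show ?thesis by simp
next
  case Z: (2 k x m)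
  note f = susp_face_cone'[OF Z(2,4,3)] and d = susp_degen_cone'[OF Z(2,4,3)]
  have g: "Suc n = m + Suc k" "1 \<le> Suc k" "Suc n = Suc m + k" using Z by simp_all
  have i: "i - 1 \<le> n" "j \<le> n" using assms by simp_all
  note h = susp_face_cone'[OF g(2) Z(4) g(1)]
  consider "i - 1 < k" | "j < k" "k \<le> i - 1" "m = 0" | p where "j < k" "k \<le> i - 1" "m = Suc p"
    | "k \<le> j" "m = 0" | p where "k \<le> j" "m = Suc p"
    using assms(2)
    by (cases m; cases "i - 1 < k"; cases "j < k") (auto simp: not_less)
  then show ?thesis
  proof cases
    case 1
    then obtain l where l: "k = Suc l" "1 \<le> l" using assms(2) by (cases k) auto
    have g': "n - 1 = m + l" using Z l by simp
    show ?thesis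
      unfolding Z(1) using d(1)[of j] h(2)[of i] f(2)[OF 1]
        susp_degen_cone'(1)[OF l(2) Z(4) g', of j] 1 l assms g' Z(3) by simp
  next
    case c: 2
    show ?thesis
      unfolding Z(1) d(1)[OF c(1)] f(3)[OF c(2) i(1) c(3)]
      using h(3)[of i] c assms by simp
  next
    case 3
    have y: "face X m (i - 1 - k) x \<in> simp X p"
      unfolding 3 by (rule simplicial_setD(1)[OF S]) (use Z 3 assms in auto)
    have g': "n - 1 = p + k" using Z 3 by simp
    have m: "m \<noteq> 0" using 3 by simp
    show ?thesis
      unfolding Z(1) d(1)[OF 3(1)] f(4)[OF 3(2) i(1) m]
        susp_degen_cone'(1)[OF Z(2) y g' 3(1)]
      using h(4)[of i] 3 assms m g' Z(2,3) by simp
  next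
    case 4
    then have False using Z(3) assms by simp
    then show ?thesis ..
  next
    case 5
    have k: "k \<le> i" "k \<le> i - 1" using 5 assms(2) by simp_all
    have y: "degen X m (j - k) x \<in> simp X (Suc m)"
      by (rule simplicial_setD(2)[OF S Z(4)]) (use Z assms in auto)
    have y': "face X m (i - 1 - k) x \<in> simp X p"
      unfolding 5 by (rule simplicial_setD(1)[OF S]) (use Z 5 assms in auto)
    have g': "n - 1 = p + k" using Z 5 by simp
    have j': "j \<le> n - 1" using assms by simp
    have "face X (Suc m) (i - k) (degen X m (j - k) x) =
        degen X (m - 1) (j - k) (face X m (i - k - 1) x)"
      by (rule simplicial_setD(8)[OF S Z(4)]) (use Z 5 assms in auto)
    moreover have "i - 1 - k = i - k - 1" by simp
    ultimately show ?thesis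
      unfolding Z(1) using f(4)[OF k(2) i(1)] d(2)[OF 5(1) i(2)]
        susp_face_cone'(4)[OF Z(2) y g(3) k(1) assms(3)]
        susp_degen_cone'(2)[OF Z(2) y' g' 5(1) j'] assms 5(2) Z(3) g' by simp
  qed
qed

lemma simplicial_set_susp: "simplicial_set (susp X)"
  unfolding simplicial_set_def susp_operators
  by (intro conjI allI ballI impI)
    (rule susp_face_closed susp_degen_closed susp_face_face susp_degen_degen
      susp_face_degen_less susp_face_degen_eq susp_face_degen_greater; assumption)+

lemma reduced_sset_susp: "reduced_sset (susp X)"
  unfolding reduced_sset_def by (rule exI[of _ Pt]) (auto simp: susp_def)

lemma susp_1_reduced: "simp (susp X) 1 = {Pt}"
  by (auto simp: susp_def cone_def simp_0_eq)

end

end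

theory Submission
  imports Defs
begin

text \<open>
  In a double suspension every nondegenerate simplex of positive dimension is \<open>(1, (1, x))\<close> with
  \<open>x\<close> nondegenerate, so it has dimension at least 3. A face missing the vertex 0, or containing 0
  but missing the vertex 1, is a base point. Hence the Alexander-Whitney coproduct is primitive,
  and in Baues' coproduct only the summands for the empty and for the full subset survive: the
  generators of \<open>\<Omega> C\<close> are primitive, all \<open>E\<^sup>k\<^sup>,\<^sup>1\<close> vanish, and \<open>\<Omega> C\<close> is a cocommutative tensor
  Hopf algebra whose antipode reverses words up to sign.

  For a cocommutative Hopf algebra \<open>H\<close> a chain homotopy on \<open>\<Omega> H\<close> is obtained by splitting a word as
  \<open>u x v\<close>, applying \<open>E\<^sub>1\<^sub>,\<^sub>1(_; b)\<close> to \<open>u\<close>, and letting \<open>S(x)\<close> act on \<open>v E\<^sub>1\<^sub>,\<^sub>1(u; b)\<close>.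
  Antisymmetrizing it in the two arguments, and adding the term \<open>E\<^sub>1\<^sub>,\<^sub>1(\<Delta> b; a)\<close>, gives a
  homotopy between the bracket and the defect of \<open>\<Delta>\<close> from being a derivation.
\<close>

section \<open>Linear maps between free modules\<close>

text \<open>The homotopy \<open>Phi\<close> obtained by splitting words does not suffice by itself.
  Up to signs its boundary at w, b is E_{1,1}(w; b) - \<open>twist w b\<close> + (Delta w) b, where
  \<open>twist w b\<close> collects the rotations of the word w b whose distinguished letter lies in
  w; \<open>twist a b\<close> and \<open>twist b a\<close> together make up Delta(a b).
  Antisymmetrization thus leaves (Delta b) a where the BV defect has a (Delta b). Since E_{1,1} is a
  homotopy for commutativity of the product, E_{1,1}(Delta b; a) exchanges these two factors.

  Cocommutativity enters whenever the factors of an iterated coproduct of the letter x have to be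
  reordered until some S(x') stands next to x'' and both cancel.

  The product on the bar construction that a homotopy G-algebra asks for is built from its
  corestriction, one output letter at a time. Its identities are checked after corestriction only,
  the tensor coalgebra being cofree.\<close>

notation scale (infixr "\<cdot>" 72)
notation conc (infixr "\<odot>" 70)

abbreviation "lk \<equiv> Poly_Mapping.lookup"
abbreviation "supp B p \<equiv> Poly_Mapping.keys p \<subseteq> B"

lemma lookup_scale [simp]: "lk (c \<cdot> p) b = c * lk p b"
  unfolding scale_def by (simp add: Poly_Mapping.map.rep_eq when_def)

lemma lookup_bvec: "lk (bvec b) c = (if b = c then 1 else 0)"
  by (simp add: lookup_single when_def)

lemma scale_simps [simp]:
  "1 \<cdot> p = p" "0 \<cdot> p = 0" "c \<cdot> 0 = 0" "a \<cdot> b \<cdot> p = (a * b) \<cdot> p"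
  by (rule poly_mapping_eqI; simp add: algebra_simps)+

lemma scale_add: "c \<cdot> (p + q) = c \<cdot> p + c \<cdot> q"
  and scale_minus: "c \<cdot> (- p) = - (c \<cdot> p)"
  and scale_diff: "c \<cdot> (p - q) = c \<cdot> p - c \<cdot> q"
  and minus_scale: "(- c) \<cdot> p = - (c \<cdot> p)"
  and add_scale: "(c + d) \<cdot> p = c \<cdot> p + d \<cdot> p"
  by (rule poly_mapping_eqI; simp add: algebra_simps lookup_add lookup_minus)+

lemma scale_sum: "c \<cdot> (\<Sum>i\<in>A. f i) = (\<Sum>i\<in>A. c \<cdot> f i)"
  by (induct A rule: infinite_finite_induct) (simp_all add: scale_add)

lemma ksign_simps [simp]:
  "ksign 0 = 1" "ksign 1 = - 1" "ksign (- k) = ksign k" "ksign k * ksign k = 1"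
  by (auto simp: ksign_def)

lemma ksign_mult: "ksign j * ksign k = ksign (j + k)"
  by (auto simp: ksign_def)

lemma ksign_cong: "even (j - k) \<Longrightarrow> ksign j = ksign k"
  by (auto simp: ksign_def)

text \<open>Linearity is a predicate with its own introduction rules, so that a compound multilinear
  expression is seen to be linear from its syntax; \<open>lmap_eqI\<close> then reduces identities
  between such expressions to basis elements.\<close>

definition lmap :: "(('b \<Rightarrow>\<^sub>0 'r::comm_ring_1) \<Rightarrow> ('c \<Rightarrow>\<^sub>0 'r)) \<Rightarrow> bool" where
  "lmap f \<longleftrightarrow> (\<forall>p q. f (p + q) = f p + f q) \<and> (\<forall>c p. f (c \<cdot> p) = c \<cdot> f p)"

named_theorems lmap_intros

lemma lmapI: "(\<And>p q. f (p + q) = f p + f q) \<Longrightarrow> (\<And>c p. f (c \<cdot> p) = c \<cdot> f p) \<Longrightarrow> lmap f"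
  by (simp add: lmap_def)

lemma lmap_add: "lmap f \<Longrightarrow> f (p + q) = f p + f q"
  and lmap_scale: "lmap f \<Longrightarrow> f (c \<cdot> p) = c \<cdot> f p"
  by (simp_all add: lmap_def)

lemma lmap_0: "lmap f \<Longrightarrow> f 0 = 0"
  using lmap_scale[of f 0 0] by simp

lemma lmap_minus: "lmap f \<Longrightarrow> f (- p) = - f p"
  using lmap_scale[of f "- 1" p] by (simp add: minus_scale)

lemma lmap_diff: "lmap f \<Longrightarrow> f (p - q) = f p - f q"
  using lmap_add[of f p "- q"] by (simp add: lmap_minus)

lemma lmap_sum: "lmap f \<Longrightarrow> f (\<Sum>i\<in>A. p i) = (\<Sum>i\<in>A. f (p i))"
  by (induct A rule: infinite_finite_induct) (simp_all add: lmap_add lmap_0)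

lemma lmap_id [lmap_intros]: "lmap (\<lambda>p. p)"
  and lmap_zero [lmap_intros]: "lmap (\<lambda>p. 0)"
  by (simp_all add: lmap_def)

lemma lmap_plus [lmap_intros]: "lmap f \<Longrightarrow> lmap g \<Longrightarrow> lmap (\<lambda>p. f p + g p)"
  and lmap_uminus [lmap_intros]: "lmap f \<Longrightarrow> lmap (\<lambda>p. - f p)"
  and lmap_sub [lmap_intros]: "lmap f \<Longrightarrow> lmap g \<Longrightarrow> lmap (\<lambda>p. f p - g p)"
  and lmap_scaled [lmap_intros]: "lmap f \<Longrightarrow> lmap (\<lambda>p. c \<cdot> f p)"
  by (simp_all add: lmap_def scale_add scale_diff scale_minus algebra_simps)

lemma lmap_sums [lmap_intros]: "(\<And>i. i \<in> A \<Longrightarrow> lmap (f i)) \<Longrightarrow> lmap (\<lambda>p. \<Sum>i\<in>A. f i p)"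
  by (induct A rule: infinite_finite_induct) (auto intro!: lmap_intros)

lemma lookup_lin: "lk (lin f p) c = (\<Sum>b\<in>Poly_Mapping.keys p. lk p b * lk (f b) c)"
  by (simp add: lin_def lookup_sum)

lemma lookup_lin_superset:
  assumes "finite A" "Poly_Mapping.keys p \<subseteq> A"
  shows "lk (lin f p) c = (\<Sum>b\<in>A. lk p b * lk (f b) c)"
  unfolding lookup_lin by (rule sum.mono_neutral_left) (use assms in \<open>auto simp: in_keys_iff\<close>)

text \<open>The sum in \<open>lin f p\<close> runs over the support of \<open>p\<close>, which is
  not additive in \<open>p\<close>; all sums are therefore extended to one common finite
  set.\<close>

lemma lmap_lin' [simp]: "lmap (lin f)"
proof (rule lmapI)
  fix p q :: "'a \<Rightarrow>\<^sub>0 'b" and c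
  let ?A = "Poly_Mapping.keys p \<union> Poly_Mapping.keys q"
  have "Poly_Mapping.keys (p + q) \<subseteq> ?A" by (rule Poly_Mapping.keys_add)
  then show "lin f (p + q) = lin f p + lin f q"
    by (intro poly_mapping_eqI)
      (simp add: lookup_add lookup_lin_superset[of ?A] distrib_right sum.distrib)
  have "Poly_Mapping.keys (c \<cdot> p) \<subseteq> Poly_Mapping.keys p"
    by (auto simp: in_keys_iff)
  then show "lin f (c \<cdot> p) = c \<cdot> lin f p"
    by (intro poly_mapping_eqI)
      (simp add: lookup_lin_superset[of "Poly_Mapping.keys p"] mult.assoc sum_distrib_left)
qed

lemmas lin_add = lmap_add[OF lmap_lin'] and lin_scale = lmap_scale[OF lmap_lin']
  and lin_0 [simp] = lmap_0[OF lmap_lin'] and lin_minus = lmap_minus[OF lmap_lin']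
  and lin_diff = lmap_diff[OF lmap_lin'] and lin_sum = lmap_sum[OF lmap_lin']

lemma lin_bvec [simp]: "lin f (bvec b) = f b"
  by (rule poly_mapping_eqI, subst lookup_lin_superset[of "{b}"]) (auto simp: lookup_bvec)

lemma lin_cong: "(\<And>b. b \<in> Poly_Mapping.keys p \<Longrightarrow> f b = g b) \<Longrightarrow> lin f p = lin g p"
  by (simp add: lin_def)

lemma lin_cong_supp: "supp B p \<Longrightarrow> (\<And>b. b \<in> B \<Longrightarrow> f b = g b) \<Longrightarrow> lin f p = lin g p"
  by (rule lin_cong) auto

lemma lin_eq_0: "supp B p \<Longrightarrow> (\<And>b. b \<in> B \<Longrightarrow> f b = 0) \<Longrightarrow> lin f p = 0"
  by (auto simp: lin_def intro!: sum.neutral)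

lemma lmap_of_lin: "lmap g \<Longrightarrow> g (lin f p) = lin (\<lambda>b. g (f b)) p"
  by (simp add: lin_def lmap_sum lmap_scale)

lemma lin_bvec_id [simp]: "lin bvec p = p"
proof (rule poly_mapping_eqI)
  fix k
  have "lk (lin bvec p) k = (\<Sum>b\<in>Poly_Mapping.keys p. if b = k then lk p b else 0)"
    unfolding lookup_lin by (rule sum.cong) (auto simp: lookup_bvec)
  also have "\<dots> = lk p k" by (auto simp: in_keys_iff)
  finally show "lk (lin bvec p) k = lk p k" .
qed

lemma lmap_expand: "lmap g \<Longrightarrow> g p = lin (\<lambda>b. g (bvec b)) p"
  using lmap_of_lin[of g bvec p] by simp

text \<open>Only basis elements in the support of \<open>p\<close> have to be compared. In this way
  the known degree of \<open>p\<close> enters and fixes the Koszul signs.\<close>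

lemma lmap_eqI:
  "lmap f \<Longrightarrow> lmap g \<Longrightarrow> (\<And>b. b \<in> Poly_Mapping.keys p \<Longrightarrow> f (bvec b) = g (bvec b)) \<Longrightarrow> f p = g p"
  by (subst lmap_expand[of f], assumption, subst lmap_expand[of g], assumption) (rule lin_cong)

lemma lmap_comp_lin [lmap_intros]: "lmap f \<Longrightarrow> lmap (\<lambda>p. lin g (f p))"
  by (auto simp: lmap_def lin_add lin_scale)

lemma lin_lin: "lin g (lin f p) = lin (\<lambda>b. lin g (f b)) p"
  by (rule lmap_of_lin) simp

lemma lin_fun_add: "lin (\<lambda>b. f b + g b) p = lin f p + lin g p"
  and lin_fun_scale: "lin (\<lambda>b. c \<cdot> f b) p = c \<cdot> lin f p"
  and lin_fun_diff: "lin (\<lambda>b. f b - g b) p = lin f p - lin g p"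
  and lin_fun_minus: "lin (\<lambda>b. - f b) p = - lin f p"
  and lin_fun_0 [simp]: "lin (\<lambda>b. 0) p = 0"
  by (simp_all add: lin_def sum.distrib scale_sum scale_add scale_minus scale_diff
      sum_subtractf sum_negf mult.commute)

lemma lin_fun_sum: "lin (\<lambda>b. \<Sum>i\<in>A. f i b) p = (\<Sum>i\<in>A. lin (f i) p)"
  by (induct A rule: infinite_finite_induct) (simp_all add: lin_fun_add)

lemma lmap_lin_fun [lmap_intros]: "(\<And>b. lmap (f b)) \<Longrightarrow> lmap (\<lambda>p. lin (\<lambda>b. f b p) q)"
  by (rule lmapI) (simp_all add: lmap_add lmap_scale lin_fun_add lin_fun_scale)

lemma lmap_lin_fun_prod [lmap_intros]:
  "(\<And>a b. lmap (f a b)) \<Longrightarrow> lmap (\<lambda>p. lin (\<lambda>(a, b). f a b p) q)"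
  using lmap_lin_fun[of "\<lambda>(a, b). f a b" q] by (simp add: case_prod_unfold)

lemma lin_swap: "lin (\<lambda>a. lin (f a) q) p = lin (\<lambda>b. lin (\<lambda>a. f a b) p) q"
  using lmap_of_lin[of "\<lambda>z. lin (\<lambda>a. lin (f a) z) p" bvec q]
  by (simp add: lmap_lin_fun[OF lmap_lin'])

lemma supp_add: "supp B p \<Longrightarrow> supp B q \<Longrightarrow> supp B (p + q)"
  using Poly_Mapping.keys_add[of p q] by blast

lemma keys_scale: "Poly_Mapping.keys (c \<cdot> p) \<subseteq> Poly_Mapping.keys p"
  by (auto simp: in_keys_iff)

lemma supp_scale: "supp B p \<Longrightarrow> supp B (c \<cdot> p)"
  using keys_scale by (rule subset_trans)

lemma supp_minus: "supp B p \<Longrightarrow> supp B (- p)"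
  for p :: "'b \<Rightarrow>\<^sub>0 'r::ab_group_add"
  by (auto simp: in_keys_iff)

lemma supp_diff: "supp B p \<Longrightarrow> supp B q \<Longrightarrow> supp B (p - q)"
  for p :: "'b \<Rightarrow>\<^sub>0 'r::ab_group_add"
  using supp_add[of p B "- q"] supp_minus[of q B] by simp

lemma supp_sum: "(\<And>i. i \<in> A \<Longrightarrow> supp B (f i)) \<Longrightarrow> supp B (\<Sum>i\<in>A. f i)"
  by (induct A rule: infinite_finite_induct) (simp_all add: supp_add)

lemma supp_bvec: "b \<in> B \<Longrightarrow> supp B (bvec b)"
  by (simp add: in_keys_iff lookup_bvec subset_iff)

lemma supp_lin: "supp A p \<Longrightarrow> (\<And>b. b \<in> A \<Longrightarrow> supp B (f b)) \<Longrightarrow> supp B (lin f p)"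
  unfolding lin_def by (intro supp_sum supp_scale) blast

lemma supp_mono: "supp A p \<Longrightarrow> A \<subseteq> B \<Longrightarrow> supp B p" by blast

lemma lookup_notin: "supp B p \<Longrightarrow> b \<notin> B \<Longrightarrow> lk p b = 0"
  by (auto simp: in_keys_iff)

lemma conc_eq_lin: "p \<odot> q = lin (\<lambda>u. lin (\<lambda>v. bvec (u @ v)) q) p"
  by (simp add: conc_def lin2_def)

lemma lmap_conc_left [lmap_intros]: "lmap f \<Longrightarrow> lmap (\<lambda>p. f p \<odot> q)"
  unfolding conc_eq_lin by (intro lmap_intros)

lemma lmap_conc_right [lmap_intros]: "lmap f \<Longrightarrow> lmap (\<lambda>p. q \<odot> f p)"
  unfolding conc_eq_lin by (intro lmap_intros)

lemma lmap_letter [lmap_intros]: "lmap f \<Longrightarrow> lmap (\<lambda>p. letter (f p))"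
  unfolding letter_def by (intro lmap_intros)

lemma conc_bvec [simp]: "bvec u \<odot> bvec v = bvec (u @ v)"
  by (simp add: conc_eq_lin)

lemma letter_bvec [simp]: "letter (bvec b) = bvec [b]"
  by (simp add: letter_def)

lemma conc_1 [simp]: "bvec [] \<odot> p = p" "p \<odot> bvec [] = p"
  by (simp_all add: conc_eq_lin)

lemma conc_lin_left: "lin f p \<odot> q = lin (\<lambda>b. f b \<odot> q) p"
  and conc_lin_right: "q \<odot> lin f p = lin (\<lambda>b. q \<odot> f b) p"
  and letter_lin: "letter (lin g r) = lin (\<lambda>b. letter (g b)) r"
  by (rule lmap_of_lin, intro lmap_intros)+

lemma conc_add_left: "(p + p') \<odot> q = p \<odot> q + p' \<odot> q"
  and conc_add_right: "q \<odot> (p + p') = q \<odot> p + q \<odot> p'"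
  and conc_diff_left: "(p - p') \<odot> q = p \<odot> q - p' \<odot> q"
  and conc_diff_right: "q \<odot> (p - p') = q \<odot> p - q \<odot> p'"
  and conc_minus_left: "(- p) \<odot> q = - (p \<odot> q)"
  and conc_minus_right: "q \<odot> (- p) = - (q \<odot> p)"
  and conc_scale_left: "(c \<cdot> p) \<odot> q = c \<cdot> (p \<odot> q)"
  and conc_scale_right: "q \<odot> (c \<cdot> p) = c \<cdot> (q \<odot> p)"
  by (simp_all add: conc_eq_lin lin_add lin_diff lin_minus lin_scale
      lin_fun_add lin_fun_diff lin_fun_minus lin_fun_scale)

lemma conc_0 [simp]: "0 \<odot> p = 0" "p \<odot> 0 = 0"
  by (simp_all add: conc_eq_lin)

lemma letter_add: "letter (p + q) = letter p + letter q"
  and letter_diff: "letter (p - q) = letter p - letter q"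
  and letter_minus: "letter (- p) = - letter p"
  and letter_scale: "letter (c \<cdot> p) = c \<cdot> letter p"
  and letter_0 [simp]: "letter 0 = 0"
  by (simp_all add: letter_def lin_add lin_diff lin_minus lin_scale)

lemmas linear_simps = conc_add_left conc_add_right conc_diff_left conc_diff_right
  conc_minus_left conc_minus_right conc_scale_left conc_scale_right
  letter_add letter_diff letter_minus letter_scale
  lin_add lin_diff lin_minus lin_scale lin_lin conc_lin_left conc_lin_right letter_lin
  lin_fun_add lin_fun_diff lin_fun_minus
  scale_add scale_diff scale_minus minus_scale

lemma conc_assoc: "(p \<odot> q) \<odot> r = p \<odot> q \<odot> r"
  by (simp add: conc_eq_lin lin_lin)

lemma supp_conc:
  "supp A p \<Longrightarrow> supp B q \<Longrightarrow> (\<And>u v. u \<in> A \<Longrightarrow> v \<in> B \<Longrightarrow> u @ v \<in> C) \<Longrightarrow> supp C (p \<odot> q)"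
  unfolding conc_eq_lin by (rule supp_lin, assumption, rule supp_lin, assumption, rule supp_bvec)

lemma supp_letter: "supp A p \<Longrightarrow> (\<And>b. b \<in> A \<Longrightarrow> [b] \<in> C) \<Longrightarrow> supp C (letter p)"
  unfolding letter_def by (rule supp_lin) (auto intro!: supp_bvec)

lemma tensor_bvec [simp]: "tensor (bvec a) (bvec b) = bvec (a, b)"
  by (simp add: tensor_def lin2_def)

lemma tensor_eq_lin: "tensor p q = lin (\<lambda>a. lin (\<lambda>b. bvec (a, b)) q) p"
  by (simp add: tensor_def lin2_def)

lemma lin_tensor: "lin f (tensor p q) = lin (\<lambda>a. lin (\<lambda>b. f (a, b)) q) p"
  by (simp add: tensor_eq_lin lin_lin)

lemma lmap_tensor_left [lmap_intros]: "lmap f \<Longrightarrow> lmap (\<lambda>p. tensor (f p) q)"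
  and lmap_tensor_right [lmap_intros]: "lmap f \<Longrightarrow> lmap (\<lambda>p. tensor q (f p))"
  unfolding tensor_eq_lin by (intro lmap_intros; simp)+

lemma lookup_tensor: "lk (tensor p q) (a, b) = lk p a * lk q b"
proof -
  have "lk (lin (\<lambda>b. bvec (a', b)) q) (a, b) = (if a' = a then lk q b else 0)" for a'
  proof -
    have "lk (lin (\<lambda>b. bvec (a', b)) q) (a, b) =
        (\<Sum>b'\<in>Poly_Mapping.keys q. if b' = b then (if a' = a then lk q b else 0) else 0)"
      unfolding lookup_lin by (rule sum.cong) (auto simp: lookup_bvec)
    also have "\<dots> = (if a' = a then lk q b else 0)" by (auto simp: in_keys_iff)
    finally show ?thesis .
  qed
  then have "lk (tensor p q) (a, b) =
      (\<Sum>a'\<in>Poly_Mapping.keys p. if a' = a then lk p a * lk q b else 0)"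
    unfolding tensor_eq_lin lookup_lin[of _ p] by (intro sum.cong) auto
  also have "\<dots> = lk p a * lk q b" by (auto simp: in_keys_iff)
  finally show ?thesis .
qed

section \<open>The cobar construction\<close>

lemma wdeg_simps [simp]:
  "wdeg C [] = 0" "wdeg C (c # w) = deg C c - 1 + wdeg C w"
  "wdeg C (u @ v) = wdeg C u + wdeg C v"
  by (simp_all add: wdeg_def)

text \<open>Sweedler notation: the two arguments of \<open>F\<close> play the role of the coproduct
  factors of \<open>x\<close>. The coalgebra axioms are restated for \<open>sw\<close>, so that
  computations take place under the summation sign.\<close>

definition sw :: "('b, 'r::comm_ring_1) dgcoalg \<Rightarrow> 'b \<Rightarrow> ('b \<Rightarrow> 'b \<Rightarrow> ('c \<Rightarrow>\<^sub>0 'r)) \<Rightarrow> ('c \<Rightarrow>\<^sub>0 'r)" where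
  "sw C x F = lin (\<lambda>(a, b). F a b) (comult C x)"

lemma lmap_of_sw: "lmap g \<Longrightarrow> g (sw C x F) = sw C x (\<lambda>a b. g (F a b))"
  unfolding sw_def by (subst lmap_of_lin, assumption) (simp add: case_prod_unfold)

lemma lmap_sw [lmap_intros]: "(\<And>a b. lmap (f a b)) \<Longrightarrow> lmap (\<lambda>p. sw C x (\<lambda>a b. f a b p))"
  unfolding sw_def by (rule lmap_lin_fun_prod)

lemma lin_sw: "lin g (sw C x F) = sw C x (\<lambda>a b. lin g (F a b))"
  and conc_sw_left: "sw C x G \<odot> q = sw C x (\<lambda>a b. G a b \<odot> q)"
  and conc_sw_right: "q \<odot> sw C x G = sw C x (\<lambda>a b. q \<odot> G a b)"
  and letter_sw: "letter (sw C x K) = sw C x (\<lambda>a b. letter (K a b))"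
  and scale_sw: "c \<cdot> sw C x F = sw C x (\<lambda>a b. c \<cdot> F a b)"
  by (rule lmap_of_sw, intro lmap_intros)+

lemma sw_add: "sw C x (\<lambda>a b. F a b + G a b) = sw C x F + sw C x G"
  and sw_diff: "sw C x (\<lambda>a b. F a b - G a b) = sw C x F - sw C x G"
  and sw_minus: "sw C x (\<lambda>a b. - F a b) = - sw C x F"
  and sw_0 [simp]: "sw C x (\<lambda>a b. 0) = 0"
  by (simp_all add: sw_def case_prod_unfold lin_fun_add lin_fun_diff lin_fun_minus)

lemma sw_lin: "sw C x (\<lambda>a b. lin (F a b) p) = lin (\<lambda>y. sw C x (\<lambda>a b. F a b y)) p"
  unfolding sw_def case_prod_unfold by (rule lin_swap)

lemma sw_swap: "sw C x (\<lambda>a b. sw D y (\<lambda>c d. F a b c d)) = sw D y (\<lambda>c d. sw C x (\<lambda>a b. F a b c d))"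
  unfolding sw_def case_prod_unfold by (rule lin_swap)

lemmas sw_simps = lin_sw conc_sw_left conc_sw_right letter_sw sw_add sw_diff sw_minus

definition ucobar_gen :: "('b, 'r::comm_ring_1) dgcoalg \<Rightarrow> 'b \<Rightarrow> ('b list \<Rightarrow>\<^sub>0 'r)" where
  "ucobar_gen C c = - letter (diff C c) + sw C c (\<lambda>a b. ksign (deg C a) \<cdot> bvec [a, b])"

text \<open>
  The differential of the unreduced cobar construction, on words that may contain the unit as a
  letter \<open>e\<close>. It satisfies \<open>d e = e e\<close>, and the reduced differential is \<open>d - [e, _]\<close>; working with
  the unreduced one removes all boundary terms.
\<close>

fun ucobar_diff :: "('b, 'r::comm_ring_1) dgcoalg \<Rightarrow> 'b list \<Rightarrow> ('b list \<Rightarrow>\<^sub>0 'r)" where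
  "ucobar_diff C [] = 0"
| "ucobar_diff C (c # w) = ucobar_gen C c \<odot> bvec w
     + ksign (deg C c - 1) \<cdot> (bvec [c] \<odot> ucobar_diff C w)"

lemma conc_bvec_assoc [simp]: "bvec u \<odot> bvec v \<odot> p = bvec (u @ v) \<odot> p"
  by (simp add: conc_assoc[symmetric])

lemma cobar_diff_Nil [simp]: "cobar_diff C [] = 0"
  by (simp add: cobar_diff_def)

lemma cobar_diff_Cons: "cobar_diff C (c # w) = cobar_gen C c \<odot> bvec w
     + ksign (deg C c - 1) \<cdot> (bvec [c] \<odot> cobar_diff C w)"
  by (simp add: cobar_diff_def sum.lessThan_Suc_shift conc_eq_lin lin_sum scale_sum lin_scale
      lin_lin ksign_mult del: sum.lessThan_Suc)

lemma cobar_diff_append: "cobar_diff C (u @ v) = cobar_diff C u \<odot> bvec v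
    + ksign (wdeg C u) \<cdot> (bvec u \<odot> cobar_diff C v)"
  by (induct u) (simp_all add: cobar_diff_Cons linear_simps conc_assoc ksign_mult)

lemma ucobar_diff_append: "ucobar_diff C (u @ v) = ucobar_diff C u \<odot> bvec v
    + ksign (wdeg C u) \<cdot> (bvec u \<odot> ucobar_diff C v)"
  by (induct u) (simp_all add: linear_simps conc_assoc ksign_mult)

lemma ucobar_leibniz: "lin (ucobar_diff C) (bvec u \<odot> q) =
    ucobar_diff C u \<odot> q + ksign (wdeg C u) \<cdot> (bvec u \<odot> lin (ucobar_diff C) q)"
  by (rule lmap_eqI[of _ _ q]) (intro lmap_intros | simp add: ucobar_diff_append)+

lemma ksign_odd: "ksign (k - 1) = - ksign k" "ksign (k + 1) = - ksign k" "ksign (1 + k) = - ksign k"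
  by (auto simp: ksign_def)

lemma ksign_cancel [simp]: "ksign k * (ksign k * c) = c"
  by (simp add: mult.assoc[symmetric])

lemma ksign_add: "ksign (j + k) = ksign j * ksign k"
  and ksign_diff: "ksign (j - k) = ksign j * ksign k"
  and ksign_add_mult: "ksign ((j + k) * l) = ksign (j * l) * ksign (k * l)"
    "ksign (l * (j + k)) = ksign (l * j) * ksign (l * k)"
    "ksign ((j - k) * l) = ksign (j * l) * ksign (k * l)"
    "ksign (l * (j - k)) = ksign (l * j) * ksign (l * k)"
  and ksign_square [simp]: "ksign (k * k) = ksign k" "ksign (k * 2) = 1" "ksign (2 * k) = 1" "ksign 2 = 1"
  by (auto simp: ksign_def)

lemmas ksign_expand = ksign_add ksign_diff ksign_add_mult mult_ac minus_scale

abbreviation "whomog C k \<equiv> supp {w \<in> lists (basis C). wdeg C w = k}"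

lemma dg_moduleD:
  assumes "dg_module M"
  shows "one M \<in> basis M" "deg M (one M) = 0" "diff M (one M) = 0"
    "b \<in> basis M \<Longrightarrow> supp {c \<in> basis M. deg M c = deg M b - 1} (diff M b)"
    "b \<in> basis M \<Longrightarrow> lin (diff M) (diff M b) = 0"
    "b \<in> basis M \<Longrightarrow> lk (diff M b) (one M) = 0"
  using assms by (auto simp: dg_module_def homog_def)

lemma scale_ksign_cong: "even (j - k) \<Longrightarrow> p = q \<Longrightarrow> ksign j \<cdot> p = ksign k \<cdot> q"
  using ksign_cong by metis

section \<open>The unreduced and the reduced cobar differential square to zero\<close>

locale coalgebra =
  fixes C :: "('b, 'r::comm_ring_1) dgcoalg"
  assumes dgc: "dg_coalgebra C"
begin

lemma dgm: "dg_module C" using dgc by (simp add: dg_coalgebra_def)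

lemmas [simp] = dg_moduleD(1,2,3)[OF dgm]

lemma sw_one: "sw C (one C) F = F (one C) (one C)"
  using dgc by (simp add: sw_def dg_coalgebra_def)

lemma sw_cong:
  assumes "x \<in> basis C"
    "\<And>a b. a \<in> basis C \<Longrightarrow> b \<in> basis C \<Longrightarrow> deg C x = deg C a + deg C b \<Longrightarrow> F a b = G a b"
  shows "sw C x F = sw C x G"
proof -
  have "supp {(a, b). a \<in> basis C \<and> b \<in> basis C \<and> deg C a + deg C b = deg C x} (comult C x)"
    using dgc assms(1) by (simp add: dg_coalgebra_def homog2_def)
  then show ?thesis unfolding sw_def by (rule lin_cong_supp) (use assms(2) in auto)
qed

lemma sw_coassoc:
  assumes "x \<in> basis C"
  shows "sw C x (\<lambda>a b. sw C a (\<lambda>a1 a2. F a1 a2 b)) = sw C x (\<lambda>a b. sw C b (\<lambda>b1 b2. F a b1 b2))"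
proof -
  have "lin (\<lambda>(a, b). lin (\<lambda>(a1, a2). bvec (a1, a2, b)) (comult C a)) (comult C x) =
      lin (\<lambda>(a, b). lin (\<lambda>(b1, b2). bvec (a, b1, b2)) (comult C b)) (comult C x)"
    using dgc assms by (simp add: dg_coalgebra_def)
  then have "lin (\<lambda>(a, b, c). F a b c) (lin (\<lambda>(a, b). lin (\<lambda>(a1, a2). bvec (a1, a2, b)) (comult C a)) (comult C x)) =
      lin (\<lambda>(a, b, c). F a b c) (lin (\<lambda>(a, b). lin (\<lambda>(b1, b2). bvec (a, b1, b2)) (comult C b)) (comult C x))"
    by simp
  then show ?thesis by (simp add: lin_lin case_prod_unfold sw_def)
qed

lemma sw_counit_left:
  assumes "x \<in> basis C" "\<And>a b. a \<noteq> one C \<Longrightarrow> F a b = 0"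
  shows "sw C x F = F (one C) x"
proof -
  have "lin (\<lambda>(a, b). if a = one C then bvec b else 0) (comult C x) = bvec x"
    using dgc assms by (simp add: dg_coalgebra_def)
  then have "lin (F (one C)) (lin (\<lambda>(a, b). if a = one C then bvec b else 0) (comult C x)) = F (one C) x"
    by simp
  moreover have "lin (F (one C)) (if a = one C then bvec b else 0) = F a b" for a b
    using assms(2)[of a b] by simp
  ultimately show ?thesis by (simp add: lin_lin case_prod_unfold sw_def)
qed

lemma sw_counit_right:
  assumes "x \<in> basis C" "\<And>a b. b \<noteq> one C \<Longrightarrow> F a b = 0"
  shows "sw C x F = F x (one C)"
proof -
  have "lin (\<lambda>(a, b). if b = one C then bvec a else 0) (comult C x) = bvec x"
    using dgc assms by (simp add: dg_coalgebra_def)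
  then have "lin (\<lambda>a. F a (one C)) (lin (\<lambda>(a, b). if b = one C then bvec a else 0) (comult C x)) = F x (one C)"
    by simp
  moreover have "lin (\<lambda>a. F a (one C)) (if b = one C then bvec a else 0) = F a b" for a b
    using assms(2)[of b a] by simp
  ultimately show ?thesis by (simp add: lin_lin case_prod_unfold sw_def)
qed

lemma sw_coderivation:
  assumes "x \<in> basis C"
  shows "lin (\<lambda>z. sw C z F) (diff C x) = sw C x (\<lambda>a b. lin (\<lambda>a'. F a' b) (diff C a)
      + ksign (deg C a) \<cdot> lin (F a) (diff C b))"
proof -
  have "lin (tensor_diff C) (comult C x) = lin (comult C) (diff C x)"
    using dgc assms by (simp add: dg_coalgebra_def)
  then have "lin (\<lambda>(a, b). F a b) (lin (comult C) (diff C x)) =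
      lin (\<lambda>(a, b). F a b) (lin (tensor_diff C) (comult C x))"
    by simp
  also have "\<dots> = sw C x (\<lambda>a b. lin (\<lambda>a'. F a' b) (diff C a) + ksign (deg C a) \<cdot> lin (F a) (diff C b))"
    unfolding lin_lin sw_def tensor_diff_def case_prod_unfold
    by (simp add: lin_add lin_scale lin_tensor)
  finally show ?thesis by (simp add: lin_lin sw_def)
qed

lemma supp_sw:
  assumes "x \<in> basis C"
    "\<And>a b. a \<in> basis C \<Longrightarrow> b \<in> basis C \<Longrightarrow> deg C a + deg C b = deg C x \<Longrightarrow> supp B (F a b)"
  shows "supp B (sw C x F)"
proof -
  have "supp {(a, b). a \<in> basis C \<and> b \<in> basis C \<and> deg C a + deg C b = deg C x} (comult C x)"
    using dgc assms(1) by (simp add: dg_coalgebra_def homog2_def)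
  then show ?thesis unfolding sw_def by (rule supp_lin) (use assms(2) in auto)
qed

lemma cobar_gen_eq: "cobar_gen C c = ucobar_gen C c - ksign (deg C c) \<cdot> bvec [c, one C] - bvec [one C, c]"
  by (simp add: cobar_gen_def ucobar_gen_def sw_def reduced_comult_def lin_diff)

text \<open>The corrections telescope: a unit letter inserted after one letter cancels against the
  unit letter inserted before the next one, so only the two ends of the word remain.\<close>

lemma cobar_diff_eq: "cobar_diff C w = ucobar_diff C w - bvec (one C # w)
    + ksign (wdeg C w) \<cdot> bvec (w @ [one C])"
proof (induct w)
  case (Cons c w)
  then show ?case
    by (simp add: cobar_diff_Cons cobar_gen_eq linear_simps ksign_expand)
qed simp

lemma whomog_ucobar_gen:
  assumes "c \<in> basis C" shows "whomog C (deg C c - 2) (ucobar_gen C c)"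
  unfolding ucobar_gen_def
  by (intro supp_add supp_minus supp_letter[OF dg_moduleD(4)[OF dgm assms]] supp_sw[OF assms]
      supp_scale supp_bvec) auto

lemma whomog_ucobar_diff:
  "w \<in> lists (basis C) \<Longrightarrow> whomog C (wdeg C w - 1) (ucobar_diff C w)"
proof (induct w)
  case (Cons c w)
  have "c \<in> basis C" using Cons by simp
  have "whomog C (wdeg C w - 1) (ucobar_diff C w)" using Cons by simp
  then show ?case unfolding ucobar_diff.simps
    by (intro supp_add supp_scale supp_conc[OF whomog_ucobar_gen[OF \<open>c \<in> basis C\<close>], where B = "{w}"]
      supp_conc[where A = "{[c]}"] supp_bvec) (use Cons in auto)
qed simp

lemma ucobar_leibniz_whomog:
  assumes "whomog C k p"
  shows "lin (ucobar_diff C) (p \<odot> q) = lin (ucobar_diff C) p \<odot> q + ksign k \<cdot> (p \<odot> lin (ucobar_diff C) q)"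
  by (rule lmap_eqI[of _ _ p]) (use assms in \<open>auto intro!: lmap_intros simp: ucobar_leibniz\<close>)

text \<open>Sorted by word length, the components vanish by d^2 = 0 in \<open>C\<close>, by the
  coderivation property and by coassociativity. \<open>?G\<close> and \<open>?K\<close> are the
  mixed terms of length two, in which the differential hits the first or the second coproduct
  factor.\<close>

lemma ucobar_diff_gen:
  assumes c: "c \<in> basis C"
  shows "lin (ucobar_diff C) (ucobar_gen C c) = 0"
proof -
  let ?G = "\<lambda>a b. ksign (deg C a) \<cdot> letter (diff C a) \<odot> bvec [b]"
  let ?K = "\<lambda>a b. bvec [a] \<odot> letter (diff C b)"
  have u1: "ucobar_diff C [x] = ucobar_gen C x" for x by simp
  have "lin (ucobar_diff C) (letter (diff C c)) = lin (ucobar_gen C) (diff C c)"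
    by (simp add: letter_def lin_lin)
  also have "\<dots> = - letter (lin (diff C) (diff C c)) + lin (\<lambda>z. sw C z (\<lambda>a b. ksign (deg C a) \<cdot> bvec [a, b])) (diff C c)"
    by (simp add: ucobar_gen_def[abs_def] linear_simps)
  also have "\<dots> = sw C c (\<lambda>a b. lin (\<lambda>a'. ksign (deg C a') \<cdot> bvec [a', b]) (diff C a)
      + ksign (deg C a) \<cdot> lin (\<lambda>b'. ksign (deg C a) \<cdot> bvec [a, b']) (diff C b))"
    by (simp add: dg_moduleD(5)[OF dgm c] sw_coderivation[OF c])
  also have "\<dots> = sw C c (\<lambda>a b. - ?G a b + ?K a b)"
  proof (rule sw_cong[OF c])
    fix a b assume ab: "a \<in> basis C" "b \<in> basis C"
    have "lin (\<lambda>a'. ksign (deg C a') \<cdot> bvec [a', b]) (diff C a) =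
       lin (\<lambda>a'. - (ksign (deg C a) \<cdot> bvec [a', b])) (diff C a)"
      by (rule lin_cong_supp[OF dg_moduleD(4)[OF dgm ab(1)]]) (auto simp: ksign_odd minus_scale)
    then show "lin (\<lambda>a'. ksign (deg C a') \<cdot> bvec [a', b]) (diff C a)
      + ksign (deg C a) \<cdot> lin (\<lambda>b'. ksign (deg C a) \<cdot> bvec [a, b']) (diff C b) = - ?G a b + ?K a b"
      by (simp add: letter_def linear_simps lin_fun_scale)
  qed
  finally have 1: "lin (ucobar_diff C) (letter (diff C c)) = sw C c (\<lambda>a b. - ?G a b + ?K a b)" .
  have "lin (ucobar_diff C) (sw C c (\<lambda>a b. ksign (deg C a) \<cdot> bvec [a, b])) =
      sw C c (\<lambda>a b. ksign (deg C a) \<cdot> (ucobar_gen C a \<odot> bvec [b]) - bvec [a] \<odot> ucobar_gen C b)"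
    by (simp add: lin_sw lin_scale scale_add scale_diff ksign_mult ksign_odd minus_scale scale_minus)
  also have "\<dots> = sw C c (\<lambda>a b. - ?G a b + ?K a b)
      + (sw C c (\<lambda>a b. sw C a (\<lambda>a1 a2. ksign (deg C a) \<cdot> ksign (deg C a1) \<cdot> bvec [a1, a2, b]))
      - sw C c (\<lambda>a b. sw C b (\<lambda>b1 b2. ksign (deg C b1) \<cdot> bvec [a, b1, b2])))"
    by (simp add: ucobar_gen_def linear_simps sw_simps scale_sw)
  also have "sw C c (\<lambda>a b. sw C a (\<lambda>a1 a2. ksign (deg C a) \<cdot> ksign (deg C a1) \<cdot> bvec [a1, a2, b]))
      = sw C c (\<lambda>a b. sw C a (\<lambda>a1 a2. ksign (deg C a2) \<cdot> bvec [a1, a2, b]))"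
    by (intro sw_cong c) (auto simp: ksign_expand intro!: sw_cong)
  also have "\<dots> = sw C c (\<lambda>a b. sw C b (\<lambda>b1 b2. ksign (deg C b1) \<cdot> bvec [a, b1, b2]))"
    by (rule sw_coassoc[OF c])
  finally show ?thesis using 1
    by (simp add: ucobar_gen_def lin_add lin_minus lin_diff)
qed

lemma ucobar_diff_diff:
  "w \<in> lists (basis C) \<Longrightarrow> lin (ucobar_diff C) (ucobar_diff C w) = 0"
proof (induct w)
  case (Cons c w)
  then have c: "c \<in> basis C" by simp
  show ?case
    by (simp add: lin_add lin_scale ucobar_leibniz ucobar_leibniz_whomog[OF whomog_ucobar_gen[OF c]]
        ucobar_diff_gen[OF c] Cons scale_add)
      (use Cons in \<open>simp add: ksign_def minus_scale\<close>)
qed simp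

text \<open>With d the unreduced differential and e the unit letter, the square of d - [e, _] is d^2
  - [d e - e e, _], and d e = e e because the unit is grouplike.\<close>

lemma cobar_diff_diff:
  assumes w: "w \<in> lists (basis C)"
  shows "lin (cobar_diff C) (cobar_diff C w) = 0"
proof -
  have e: "ucobar_gen C (one C) = bvec [one C, one C]"
    by (simp add: ucobar_gen_def sw_one)
  have h: "lin (cobar_diff C) p = lin (ucobar_diff C) p - bvec [one C] \<odot> p + ksign k \<cdot> (p \<odot> bvec [one C])"
    if "whomog C k p" for p k
    by (rule lmap_eqI[of _ _ p])
      (use that in \<open>auto intro!: lmap_intros simp: cobar_diff_eq\<close>)
  have u: "whomog C (wdeg C w - 1) (cobar_diff C w)"
    unfolding cobar_diff_eq
    by (intro supp_add supp_diff supp_scale supp_bvec whomog_ucobar_diff w) (use w in auto)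
  show ?thesis
    unfolding h[OF u] unfolding cobar_diff_eq
    by (simp add: linear_simps ucobar_diff_diff[OF w] e ucobar_diff_append ksign_expand)
qed

end

lemma lookup_lin_fst: "lk (lin (\<lambda>(a, b). if a = x then bvec b else 0) p) y = lk p (x, y)"
proof -
  have "lk (lin (\<lambda>(a, b). if a = x then bvec b else 0) p) y =
      (\<Sum>k\<in>Poly_Mapping.keys p. if k = (x, y) then lk p (x, y) else 0)"
    unfolding lookup_lin by (rule sum.cong) (auto simp: lookup_bvec split: if_splits)
  also have "\<dots> = lk p (x, y)" by (auto simp: in_keys_iff)
  finally show ?thesis .
qed

lemma lookup_lin_snd: "lk (lin (\<lambda>(a, b). if b = y then bvec a else 0) p) x = lk p (x, y)"
proof -
  have "lk (lin (\<lambda>(a, b). if b = y then bvec a else 0) p) x =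
      (\<Sum>k\<in>Poly_Mapping.keys p. if k = (x, y) then lk p (x, y) else 0)"
    unfolding lookup_lin by (rule sum.cong) (auto simp: lookup_bvec split: if_splits)
  also have "\<dots> = lk p (x, y)" by (auto simp: in_keys_iff)
  finally show ?thesis .
qed

lemma cobar_sel [simp]: "basis (cobar C) = lists (rbasis C)" "deg (cobar C) = wdeg C"
  "diff (cobar C) = cobar_diff C" "one (cobar C) = []" "mult (cobar C) = (\<lambda>u v. bvec (u @ v))"
  by (simp_all add: cobar_def)

section \<open>The reduced cobar construction as a DG-algebra\<close>

context coalgebra
begin

text \<open>Read in coordinates, the counit axioms say that the coefficients of the coproduct of c
  at (1, y) and (x, 1) are 1 for y = c, x = c and 0 otherwise. Subtracting the two primitive terms
  therefore removes every term with a unit factor.\<close>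

lemma supp_reduced_comult:
  assumes c: "c \<in> rbasis C"
  shows "supp {(a, b). a \<in> rbasis C \<and> b \<in> rbasis C \<and> deg C a + deg C b = deg C c} (reduced_comult C c)"
proof
  fix ab assume ab: "ab \<in> Poly_Mapping.keys (reduced_comult C c)"
  obtain a b where [simp]: "ab = (a, b)" by (cases ab)
  have cb: "c \<in> basis C" "c \<noteq> one C" using c by (auto simp: rbasis_def)
  have 1: "lk (comult C c) (one C, y) = (if y = c then 1 else 0)" for y
    using lookup_lin_fst[of "one C" "comult C c" y] dgc cb
    by (auto simp: dg_coalgebra_def lookup_bvec)
  have 2: "lk (comult C c) (x, one C) = (if x = c then 1 else 0)" for x
    using lookup_lin_snd[of "one C" "comult C c" x] dgc cb
    by (auto simp: dg_coalgebra_def lookup_bvec)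
  have nz: "lk (reduced_comult C c) (a, b) \<noteq> 0" using ab by (simp add: in_keys_iff)
  have "a \<noteq> one C" "b \<noteq> one C"
    using nz cb 1[of b] 2[of a] by (auto simp: reduced_comult_def lookup_minus lookup_bvec split: if_splits)
  moreover have "lk (comult C c) (a, b) \<noteq> 0"
    using nz calculation by (auto simp: reduced_comult_def lookup_minus lookup_bvec split: if_splits)
  then have "(a, b) \<in> Poly_Mapping.keys (comult C c)" by (simp add: in_keys_iff)
  then have "a \<in> basis C" "b \<in> basis C" "deg C a + deg C b = deg C c"
    using dgc cb by (auto simp: dg_coalgebra_def homog2_def)
  ultimately show "ab \<in> {(a, b). a \<in> rbasis C \<and> b \<in> rbasis C \<and> deg C a + deg C b = deg C c}"
    by (simp add: rbasis_def)
qed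

lemma rbasisD: "c \<in> rbasis C \<Longrightarrow> c \<in> basis C" by (simp add: rbasis_def)

lemma lists_rbasisD: "w \<in> lists (rbasis C) \<Longrightarrow> w \<in> lists (basis C)"
  by (auto simp: rbasis_def)

lemma supp_diff_rbasis:
  assumes "c \<in> rbasis C"
  shows "supp {b \<in> rbasis C. deg C b = deg C c - 1} (diff C c)"
  using dg_moduleD(4,6)[OF dgm rbasisD[OF assms]] by (auto simp: rbasis_def in_keys_iff)

abbreviation "chomog k p \<equiv> supp {w \<in> lists (rbasis C). wdeg C w = k} p"

lemma supp_cobar_gen:
  assumes "c \<in> rbasis C"
  shows "supp {w \<in> lists (rbasis C). wdeg C w = deg C c - 2 \<and> w \<noteq> []} (cobar_gen C c)"
  unfolding cobar_gen_def case_prod_unfold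
  by (intro supp_add supp_minus supp_letter[OF supp_diff_rbasis[OF assms]]
      supp_lin[OF supp_reduced_comult[OF assms]] supp_scale supp_bvec) auto

text \<open>The condition \<open>v \<noteq> []\<close> records that boundaries have augmentation
  zero, as \<open>dg_module\<close> demands.\<close>

lemma supp_cobar_diff:
  assumes "w \<in> lists (rbasis C)"
  shows "supp {v \<in> lists (rbasis C). wdeg C v = wdeg C w - 1 \<and> v \<noteq> []} (cobar_diff C w)"
  using assms
proof (induct w)
  case (Cons c w)
  then have c: "c \<in> rbasis C" by simp
  have "supp {v \<in> lists (rbasis C). wdeg C v = wdeg C w - 1 \<and> v \<noteq> []} (cobar_diff C w)"
    using Cons by simp
  then show ?case unfolding cobar_diff_Cons
    by (intro supp_add supp_scale supp_conc[OF supp_cobar_gen[OF c], where B = "{w}"]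
      supp_conc[where A = "{[c]}"] supp_bvec) (use Cons in auto)
qed simp

lemma chomog_cobar_diff:
  "w \<in> lists (rbasis C) \<Longrightarrow> chomog (wdeg C w - 1) (cobar_diff C w)"
  using supp_cobar_diff by (rule supp_mono) auto

lemma dg_algebra_cobar: "dg_algebra (cobar C)"
proof -
  have "dg_module (cobar C)"
    unfolding dg_module_def
    using chomog_cobar_diff cobar_diff_diff[OF lists_rbasisD] lookup_notin[OF supp_cobar_diff, of _ "[]"]
    by (simp add: homog_def)
  then show ?thesis
    by (auto simp: dg_algebra_def homog_def lookup_bvec cobar_diff_append conc_eq_lin)
qed

end

section \<open>The action of a bialgebra on its tensor words\<close>

lemma part_sel [simp]:
  "basis (coalg_part H) = basis H" "deg (coalg_part H) = deg H" "diff (coalg_part H) = diff H"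
  "one (coalg_part H) = one H" "comult (coalg_part H) = bcomult H"
  "basis (alg_part H) = basis H" "deg (alg_part H) = deg H" "diff (alg_part H) = diff H"
  "one (alg_part H) = one H" "mult (alg_part H) = mult H"
  by (simp_all add: coalg_part_def alg_part_def)

lemma wdeg_part [simp]: "wdeg (coalg_part H) = wdeg H" "rbasis (coalg_part H) = rbasis H"
  by (simp_all add: wdeg_def[abs_def] rbasis_def)

locale bialgebra =
  fixes H :: "('b, 'r::comm_ring_1) dgbialg"
  assumes dgb: "dg_bialgebra H"
begin

sublocale coalgebra "coalg_part H"
  using dgb by unfold_locales (simp add: dg_bialgebra_def)

abbreviation "B \<equiv> basis H"
abbreviation "hsw \<equiv> sw (coalg_part H)"
abbreviation "ud \<equiv> ucobar_diff (coalg_part H)"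
abbreviation "WH k p \<equiv> supp {w \<in> lists B. wdeg H w = k} p"

lemmas hsw_one = sw_one[unfolded part_sel]
  and hsw_cong = sw_cong[unfolded part_sel]
  and hsw_coassoc = sw_coassoc[unfolded part_sel]
  and hsw_counit_left = sw_counit_left[unfolded part_sel]
  and hsw_counit_right = sw_counit_right[unfolded part_sel]
  and hsw_coderivation = sw_coderivation[unfolded part_sel]
  and supp_hsw = supp_sw[unfolded part_sel]

lemma dga: "dg_algebra (alg_part H)" using dgb by (simp add: dg_bialgebra_def)

lemma one_B [simp]: "one H \<in> B" "deg H (one H) = 0" "diff H (one H) = 0"
  using dg_moduleD(1,2,3)[OF dgm] by simp_all

lemma mult_one [simp]: "a \<in> B \<Longrightarrow> mult H (one H) a = bvec a" "a \<in> B \<Longrightarrow> mult H a (one H) = bvec a"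
  using dga by (auto simp: dg_algebra_def)

lemma supp_mult: "a \<in> B \<Longrightarrow> b \<in> B \<Longrightarrow> supp {c \<in> B. deg H c = deg H a + deg H b} (mult H a b)"
  using dga by (auto simp: dg_algebra_def homog_def)

lemma lookup_mult_one: "a \<in> B \<Longrightarrow> b \<in> B \<Longrightarrow>
    lk (mult H a b) (one H) = (if a = one H \<and> b = one H then 1 else 0)"
  using dga by (auto simp: dg_algebra_def)

lemma mult_leibniz: "a \<in> B \<Longrightarrow> b \<in> B \<Longrightarrow> lin (diff H) (mult H a b) =
    lin (\<lambda>x. mult H x b) (diff H a) + ksign (deg H a) \<cdot> lin (mult H a) (diff H b)"
  using dga by (auto simp: dg_algebra_def)

lemma mult_assoc: "a \<in> B \<Longrightarrow> b \<in> B \<Longrightarrow> c \<in> B \<Longrightarrow>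
    lin (\<lambda>x. mult H x c) (mult H a b) = lin (mult H a) (mult H b c)"
  using dga by (auto simp: dg_algebra_def)

lemma supp_mult_r: "a \<in> B \<Longrightarrow> b \<in> rbasis H \<Longrightarrow> supp {c \<in> rbasis H. deg H c = deg H a + deg H b} (mult H a b)"
  using supp_mult[of a b] lookup_mult_one[of a b] by (auto simp: rbasis_def in_keys_iff)

lemma supp_diff: "a \<in> B \<Longrightarrow> supp {c \<in> B. deg H c = deg H a - 1} (diff H a)"
  using dg_moduleD(4)[OF dgm] by simp

lemma sw_mult:
  assumes "x \<in> B" "y \<in> B"
  shows "lin (\<lambda>z. hsw z F) (mult H x y) = hsw x (\<lambda>x1 x2. hsw y (\<lambda>y1 y2.
      ksign (deg H x2 * deg H y1) \<cdot> lin (\<lambda>z1. lin (F z1) (mult H x2 y2)) (mult H x1 y1)))"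
proof -
  have "lin (bcomult H) (mult H x y) = tensor_mult H (bcomult H x) (bcomult H y)"
    using dgb assms by (simp add: dg_bialgebra_def)
  then have "lin (\<lambda>(a, b). F a b) (lin (bcomult H) (mult H x y)) =
      lin (\<lambda>(a, b). F a b) (tensor_mult H (bcomult H x) (bcomult H y))" by simp
  then show ?thesis
    by (simp add: lin_lin sw_def tensor_mult_def lin2_def case_prod_unfold lin_scale lin_tensor)
qed

lemma iter_comult_Suc_Suc: "iter_comult H (Suc (Suc r)) x = hsw x (\<lambda>a b. bvec [a] \<odot> iter_comult H (Suc r) b)"
  by (simp add: sw_def)

lemma supp_iter_comult:
  "x \<in> B \<Longrightarrow> supp {as \<in> lists B. length as = n \<and> (\<Sum>a\<leftarrow>as. deg H a) = deg H x} (iter_comult H n x)"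
proof (induct n arbitrary: x rule: induct_nat_012)
  case 0
  then show ?case by (auto split: if_splits)
next
  case 1
  then show ?case by (auto split: if_splits)
next
  case (ge2 n)
  show ?case unfolding iter_comult_Suc_Suc
    by (rule supp_sw, simp add: ge2, rule supp_conc[where A = "{[a]}" for a],
        rule supp_bvec, simp, rule ge2) auto
qed

lemma diamond_Nil: "diamond H x [] = (if x = one H then bvec [] else 0)"
  by (simp add: diamond_def)

text \<open>Splits off the first coproduct factor. In the sign of \<open>diamond\<close> the pairs
  with q = 0 contribute the total degree of the remaining factors times \<open>deg H c - 1\<close>,
  and that total is the degree of \<open>b\<close>.\<close>

lemma diamond_Cons:
  assumes x: "x \<in> B"
  shows "diamond H x (c # w) = hsw x (\<lambda>a b. ksign (deg H b * (deg H c - 1)) \<cdot>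
      (letter (mult H a c) \<odot> diamond H b w))"
proof (cases w)
  case Nil
  \<comment> \<open>A one-letter word involves no coproduct at all, so here the recursion is the
    right counit axiom.\<close>
  have "hsw x (\<lambda>a b. ksign (deg H b * (deg H c - 1)) \<cdot> (letter (mult H a c) \<odot> diamond H b w)) =
     letter (mult H x c)"
    unfolding Nil by (subst sw_counit_right) (auto simp: x diamond_Nil)
  then show ?thesis by (simp add: diamond_def Nil)
next
  case (Cons d v)
  have len: "length w = Suc (length v)" by (simp add: Cons)
  let ?s = "\<lambda>as bs. ksign (\<Sum>p<length bs. \<Sum>q<p. deg H (as ! p) * (deg H (bs ! q) - 1)) :: 'r"
  have "diamond H x (c # w) = hsw x (\<lambda>a b. lin (\<lambda>as. ?s (a # as) (c # w) \<cdot>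
      (letter (mult H a c) \<odot> conc_list (map2 (\<lambda>x y. letter (mult H x y)) as w))) (iter_comult H (length w) b))"
    unfolding diamond_def by (simp add: len iter_comult_Suc_Suc lin_sw conc_eq_lin lin_lin
        del: iter_comult.simps sum.lessThan_Suc)
  also have "\<dots> = hsw x (\<lambda>a b. ksign (deg H b * (deg H c - 1)) \<cdot> (letter (mult H a c) \<odot> diamond H b w))"
  proof (rule sw_cong, simp add: x)
    fix a b assume ab: "b \<in> basis (coalg_part H)"
    have "lin (\<lambda>as. ?s (a # as) (c # w) \<cdot>
      (letter (mult H a c) \<odot> conc_list (map2 (\<lambda>x y. letter (mult H x y)) as w))) (iter_comult H (length w) b)
      = lin (\<lambda>as. ksign (deg H b * (deg H c - 1)) \<cdot> (letter (mult H a c) \<odot> ?s as w \<cdot>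
       conc_list (map2 (\<lambda>x y. letter (mult H x y)) as w))) (iter_comult H (length w) b)"
    proof (rule lin_cong_supp[OF supp_iter_comult])
      fix as assume as: "as \<in> {as \<in> lists B. length as = length w \<and> sum_list (map (deg H) as) = deg H b}"
      have "(\<Sum>p<length (c # w). \<Sum>q<p. deg H ((a # as) ! p) * (deg H ((c # w) ! q) - 1)) =
         (\<Sum>p<length w. deg H (as ! p) * (deg H c - 1) + (\<Sum>q<p. deg H (as ! p) * (deg H (w ! q) - 1)))"
        by (simp add: sum.lessThan_Suc_shift del: sum.lessThan_Suc)
      also have "\<dots> = deg H b * (deg H c - 1) +
         (\<Sum>p<length w. \<Sum>q<p. deg H (as ! p) * (deg H (w ! q) - 1))"
        using as by (auto simp add: sum.distrib sum_distrib_right[symmetric] sum_list_sum_nth atLeast0LessThan)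
      finally show "?s (a # as) (c # w) \<cdot>
      (letter (mult H a c) \<odot> conc_list (map2 (\<lambda>x y. letter (mult H x y)) as w)) =
       ksign (deg H b * (deg H c - 1)) \<cdot> (letter (mult H a c) \<odot> ?s as w \<cdot>
       conc_list (map2 (\<lambda>x y. letter (mult H x y)) as w))"
        by (simp only: ksign_mult conc_scale_right scale_simps)
    qed (use ab in simp)
    then show "lin (\<lambda>as. ?s (a # as) (c # w) \<cdot>
      (letter (mult H a c) \<odot> conc_list (map2 (\<lambda>x y. letter (mult H x y)) as w))) (iter_comult H (length w) b)
      = ksign (deg H b * (deg H c - 1)) \<cdot> (letter (mult H a c) \<odot> diamond H b w)"
      by (simp add: diamond_def conc_lin_right lin_fun_scale)
  qed
  finally show ?thesis .
qed

lemma diamond_single [simp]: "x \<in> B \<Longrightarrow> diamond H x [c] = letter (mult H x c)"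
  by (simp add: diamond_def)

lemma WH_letter_mult: "a \<in> B \<Longrightarrow> c \<in> B \<Longrightarrow> WH (deg H a + deg H c - 1) (letter (mult H a c))"
  by (rule supp_letter[OF supp_mult]) auto

lemma WH_diamond: "x \<in> B \<Longrightarrow> w \<in> lists B \<Longrightarrow> WH (deg H x + wdeg H w) (diamond H x w)"
proof (induct w arbitrary: x)
  case Nil
  then show ?case by (auto simp: diamond_Nil)
next
  case (Cons c w)
  show ?case unfolding diamond_Cons[OF Cons(2)]
  proof (rule supp_sw)
    fix a b assume ab: "a \<in> basis (coalg_part H)" "b \<in> basis (coalg_part H)"
      "deg (coalg_part H) a + deg (coalg_part H) b = deg (coalg_part H) x"
    have "WH (deg H a + deg H c - 1) (letter (mult H a c))"
      by (rule WH_letter_mult) (use ab Cons in auto)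
    moreover have "WH (deg H b + wdeg H w) (diamond H b w)"
      by (rule Cons(1)) (use ab Cons in auto)
    ultimately show "WH (deg H x + wdeg H (c # w)) (ksign (deg H b * (deg H c - 1)) \<cdot> (letter (mult H a c) \<odot> diamond H b w))"
      by (intro supp_scale, elim supp_conc) (use ab in auto)
  qed (use Cons in simp)
qed

lemma supp_diamond: "x \<in> B \<Longrightarrow> w \<in> lists (rbasis H) \<Longrightarrow> supp {v \<in> lists (rbasis H). length v = length w} (diamond H x w)"
proof (induct w arbitrary: x)
  case Nil
  then show ?case by (auto simp: diamond_Nil)
next
  case (Cons c w)
  show ?case unfolding diamond_Cons[OF Cons(2)]
    by (rule supp_sw, use Cons in simp,
     intro supp_scale supp_conc[where A = "{v \<in> lists (rbasis H). length v = 1}"]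
        supp_letter[OF supp_mult_r] Cons(1)) (use Cons in auto)
qed

lemma diamond_one: "w \<in> lists B \<Longrightarrow> diamond H (one H) w = bvec w"
  by (induct w) (simp_all add: diamond_Nil diamond_Cons hsw_one)

text \<open>Coassociativity regroups the coproduct factors of \<open>x\<close> that act on the
  letters of \<open>u\<close> into one factor. Thus the words form a module algebra over H.\<close>

lemma diamond_append:
  "x \<in> B \<Longrightarrow> diamond H x (u @ v) =
    hsw x (\<lambda>a b. ksign (deg H b * wdeg H u) \<cdot> (diamond H a u \<odot> diamond H b v))"
proof (induct u arbitrary: x)
  case Nil
  then show ?case by (subst sw_counit_left) (auto simp: diamond_Nil)
next
  case (Cons c u)
  let ?G = "\<lambda>a1 a2 b. ksign (deg H a2 * (deg H c - 1) + deg H b * wdeg H (c # u)) \<cdot>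
     (letter (mult H a1 c) \<odot> diamond H a2 u \<odot> diamond H b v)"
  have "diamond H x ((c # u) @ v) = hsw x (\<lambda>a b. hsw b (\<lambda>b1 b2. ?G a b1 b2))"
    by (simp add: diamond_Cons[OF Cons(2)])
     (rule sw_cong, use Cons in simp, simp add: Cons sw_simps scale_sw linear_simps,
      rule sw_cong, simp, simp add: ksign_expand)
  also have "\<dots> = hsw x (\<lambda>a b. hsw a (\<lambda>a1 a2. ?G a1 a2 b))"
    by (rule sw_coassoc[symmetric]) (use Cons in simp)
  also have "\<dots> = hsw x (\<lambda>a b. ksign (deg H b * wdeg H (c # u)) \<cdot> (diamond H a (c # u) \<odot> diamond H b v))"
    by (rule sw_cong, use Cons in simp) (simp add: diamond_Cons sw_simps scale_sw linear_simps conc_assoc ksign_expand)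
  finally show ?case .
qed

lemma act_conc:
  assumes "x \<in> B" "WH k p"
  shows "lin (diamond H x) (p \<odot> q) = hsw x (\<lambda>a b. ksign (deg H b * k) \<cdot> (lin (diamond H a) p \<odot> lin (diamond H b) q))"
proof -
  have "lin (diamond H x) (bvec u \<odot> q) =
     hsw x (\<lambda>a b. ksign (deg H b * wdeg H u) \<cdot> (diamond H a u \<odot> lin (diamond H b) q))" for u
    by (rule lmap_eqI[of _ _ q]) (intro lmap_intros | simp add: diamond_append assms)+
  note * = this
  show ?thesis
  proof (rule lmap_eqI[of _ _ p])
    fix u assume "u \<in> Poly_Mapping.keys p"
    then have "wdeg H u = k" using assms by auto
    then show "lin (diamond H x) (bvec u \<odot> q) = hsw x (\<lambda>a b. ksign (deg H b * k) \<cdot>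
        (lin (diamond H a) (bvec u) \<odot> lin (diamond H b) q))"
      using * by simp
  qed (intro lmap_intros)+
qed

lemma act_letter: "x \<in> B \<Longrightarrow> lin (diamond H x) (letter p) = letter (lin (mult H x) p)"
  by (simp add: letter_def lin_lin diamond_single[unfolded letter_def])

text \<open>The action is associative because the coproduct is multiplicative: the factors of the
  iterated coproduct of x y are products of those of x and of y, up to the Koszul sign.\<close>

lemma diamond_diamond:
  "x \<in> B \<Longrightarrow> y \<in> B \<Longrightarrow> w \<in> lists B \<Longrightarrow>
    lin (diamond H x) (diamond H y w) = lin (\<lambda>z. diamond H z w) (mult H x y)"
proof (induct w arbitrary: x y)
  case Nil
  \<comment> \<open>On the empty word the action is the counit, so this case is the multiplicativity
    of the counit.\<close>
  have "lin (\<lambda>z. if z = one H then bvec [] else 0 :: 'b list \<Rightarrow>\<^sub>0 'r) p = lk p (one H) \<cdot> bvec []" for p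
    by (rule lmap_eqI[of _ _ p]) (auto intro!: lmapI simp: lin_add lin_scale lookup_add add_scale lookup_bvec)
  then show ?case
    using lookup_mult_one[OF Nil(1,2)] by (auto simp: diamond_Nil[abs_def])
next
  case (Cons c w)
  have c: "c \<in> B" "w \<in> lists B" using Cons by simp_all
  have "lin (diamond H x) (diamond H y (c # w)) = hsw y (\<lambda>y1 y2. hsw x (\<lambda>x1 x2.
     ksign (deg H x2 * deg H y1) \<cdot> ksign ((deg H x2 + deg H y2) * (deg H c - 1)) \<cdot>
       (letter (lin (mult H x1) (mult H y1 c)) \<odot> lin (diamond H x2) (diamond H y2 w))))"
    unfolding diamond_Cons[OF Cons(3)] lin_sw
    by (rule hsw_cong[OF Cons(3)], simp add: act_conc[OF Cons(2) WH_letter_mult] c lin_scale scale_sw,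
       rule hsw_cong[OF Cons(2)], simp add: act_letter ksign_expand)
  also have "\<dots> = hsw y (\<lambda>y1 y2. hsw x (\<lambda>x1 x2.
     ksign (deg H x2 * deg H y1) \<cdot> lin (\<lambda>z1. lin (\<lambda>z2. ksign (deg H z2 * (deg H c - 1)) \<cdot>
       (letter (mult H z1 c) \<odot> diamond H z2 w)) (mult H x2 y2)) (mult H x1 y1)))"
  proof (intro sw_cong, goal_cases)
    case (3 y1 y2 x1 x2)
    have "lin (\<lambda>z2. ksign (deg H z2 * (deg H c - 1)) \<cdot> (letter (mult H z1 c) \<odot> diamond H z2 w)) (mult H x2 y2)
      = lin (\<lambda>z2. ksign ((deg H x2 + deg H y2) * (deg H c - 1)) \<cdot> (letter (mult H z1 c) \<odot> diamond H z2 w)) (mult H x2 y2)" for z1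
      by (rule lin_cong_supp[OF supp_mult]) (use 3 in auto)
    then show ?case using 3 c
      by (simp add: Cons(1) mult_assoc[symmetric] lin_fun_scale conc_lin_left conc_lin_right letter_lin lin_lin)
        (subst lin_swap, rule refl)
  qed (use Cons in simp_all)
  also have "\<dots> = lin (\<lambda>z. diamond H z (c # w)) (mult H x y)"
    by (subst sw_swap, subst sw_mult[symmetric], simp_all add: Cons(2,3))
     (rule lin_cong_supp[OF supp_mult[OF Cons(2,3)]], simp add: diamond_Cons)
  finally show ?case .
qed

text \<open>The one-letter case of \<open>ud_diamond\<close>: the Leibniz rule of H accounts for the
  linear part of the differential, multiplicativity of the coproduct for the quadratic part.\<close>

lemma ud_letter_mult:
  assumes a: "a \<in> B" and c: "c \<in> B"
  shows "lin ud (letter (mult H a c)) = ksign (deg H a) \<cdot> lin (diamond H a) (ud [c])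
     - letter (lin (\<lambda>x. mult H x c) (diff H a))"
proof -
  let ?F = "\<lambda>p q. ksign (deg H p) \<cdot> bvec [p, q]"
  have "lin ud (letter (mult H a c)) = lin (ucobar_gen (coalg_part H)) (mult H a c)"
    by (simp add: letter_def lin_lin)
  also have "\<dots> = - letter (lin (diff H) (mult H a c)) + lin (\<lambda>z. hsw z ?F) (mult H a c)"
    by (simp add: ucobar_gen_def[abs_def] linear_simps)
  also have "lin (\<lambda>z. hsw z ?F) (mult H a c) = hsw c (\<lambda>c1 c2. hsw a (\<lambda>a1 a2.
      ksign (deg H a2 * deg H c1) \<cdot> ksign (deg H a1 + deg H c1) \<cdot> (letter (mult H a1 c1) \<odot> letter (mult H a2 c2))))"
    unfolding sw_mult[OF a c]
  proof (subst sw_swap, intro sw_cong, goal_cases)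
    case (3 c1 c2 a1 a2)
    have "lin (\<lambda>z1. lin (?F z1) (mult H a2 c2)) (mult H a1 c1) =
        lin (\<lambda>z1. lin (\<lambda>z2. ksign (deg H a1 + deg H c1) \<cdot> bvec [z1, z2]) (mult H a2 c2)) (mult H a1 c1)"
      by (rule lin_cong_supp[OF supp_mult]) (use 3 in auto)
    then show ?case by (simp add: letter_def conc_eq_lin lin_lin lin_fun_scale)
  qed (simp_all add: a c)
  also have "\<dots> = hsw c (\<lambda>c1 c2. ksign (deg H a) \<cdot> ksign (deg H c1) \<cdot> diamond H a [c1, c2])"
  proof (intro sw_cong, goal_cases)
    case (2 c1 c2)
    show ?case unfolding diamond_Cons[OF a] scale_sw
      by (rule sw_cong, simp add: a) (simp add: ksign_expand)
  qed (simp add: c)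
  finally show ?thesis
    using a c by (simp add: mult_leibniz ucobar_gen_def linear_simps lin_sw scale_sw letter_def lin_lin)
qed

text \<open>Free of correction terms only for the unreduced differential: acting on the unit letter
  produces the letter [x], so the commutator with the unit letter is not compatible with the
  action.\<close>

lemma ud_diamond:
  "x \<in> B \<Longrightarrow> w \<in> lists B \<Longrightarrow> lin ud (diamond H x w) =
    ksign (deg H x) \<cdot> lin (diamond H x) (ud w) - lin (\<lambda>y. diamond H y w) (diff H x)"
proof (induct w arbitrary: x)
  case Nil
  \<comment> \<open>For the empty word the claim is that the counit vanishes on boundaries.\<close>
  have "lin (\<lambda>z. if z = one H then bvec [] else 0 :: 'b list \<Rightarrow>\<^sub>0 'r) p = lk p (one H) \<cdot> bvec []" for p
    by (rule lmap_eqI[of _ _ p]) (auto intro!: lmapI simp: lin_add lin_scale lookup_add add_scale lookup_bvec)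
  then show ?case
    using dg_moduleD(6)[OF dgm] Nil by (auto simp: diamond_Nil[abs_def])
next
  case (Cons c w)
  have c: "c \<in> B" "w \<in> lists B" and x: "x \<in> B" using Cons by simp_all
  have gen: "WH (deg H c - 2) (ucobar_gen (coalg_part H) c)" using whomog_ucobar_gen[of c] c by simp
  have WHc: "WH (deg H c - 1) (bvec [c])" by (rule supp_bvec) (simp add: c)
  let ?P = "\<lambda>a b. ksign (deg H b * (deg H c - 1))"
  let ?Q = "\<lambda>a b. letter (lin (\<lambda>z. mult H z c) (diff H a)) \<odot> diamond H b w"
  let ?R = "\<lambda>a b. letter (mult H a c) \<odot> lin (\<lambda>y. diamond H y w) (diff H b)"
  have "lin (\<lambda>y. diamond H y (c # w)) (diff H x) = lin (\<lambda>y. hsw y (\<lambda>a b. ?P a b \<cdot> (letter (mult H a c) \<odot> diamond H b w))) (diff H x)"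
    by (rule lin_cong_supp[OF supp_diff[OF x]]) (simp add: diamond_Cons)
  also have "\<dots> = hsw x (\<lambda>a b. lin (\<lambda>a'. ?P a' b \<cdot> (letter (mult H a' c) \<odot> diamond H b w)) (diff H a) +
       ksign (deg H a) \<cdot> lin (\<lambda>b'. ?P a b' \<cdot> (letter (mult H a c) \<odot> diamond H b' w)) (diff H b))"
    using sw_coderivation[of x] x by simp
  also have "\<dots> = hsw x (\<lambda>a b. ?P a b \<cdot> ?Q a b + ksign (deg H a) \<cdot> ksign ((deg H b - 1) * (deg H c - 1)) \<cdot> ?R a b)"
  proof (intro sw_cong, goal_cases)
    case (2 a b)
    have "lin (\<lambda>b'. ?P a b' \<cdot> (letter (mult H a c) \<odot> diamond H b' w)) (diff H b) =
       lin (\<lambda>b'. ksign ((deg H b - 1) * (deg H c - 1)) \<cdot> (letter (mult H a c) \<odot> diamond H b' w)) (diff H b)"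
      by (rule lin_cong_supp[OF supp_diff]) (use 2 in auto)
    then show ?case by (simp add: lin_fun_scale letter_lin conc_lin_left conc_lin_right)
  qed (simp add: x)
  finally have 1: "lin (\<lambda>y. diamond H y (c # w)) (diff H x) =
     hsw x (\<lambda>a b. ?P a b \<cdot> ?Q a b + ksign (deg H a) \<cdot> ksign ((deg H b - 1) * (deg H c - 1)) \<cdot> ?R a b)" .
  have 2: "lin (diamond H x) (ud (c # w)) = hsw x (\<lambda>a b.
     ksign (deg H b * (deg H c - 2)) \<cdot> (lin (diamond H a) (ud [c]) \<odot> diamond H b w)
     + ksign (deg H c - 1) \<cdot> ksign (deg H b * (deg H c - 1)) \<cdot> (letter (mult H a c) \<odot> lin (diamond H b) (ud w)))"
    unfolding ucobar_diff.simps lin_add lin_scale part_sel act_conc[OF x gen] act_conc[OF x WHc] sw_add scale_sw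
    by (rule arg_cong2[where f = "(+)"]; rule sw_cong) (simp_all add: x)
  have "lin ud (diamond H x (c # w)) = hsw x (\<lambda>a b. ?P a b \<cdot> (lin ud (letter (mult H a c)) \<odot> diamond H b w
     + ksign (deg H a + deg H c - 1) \<cdot> (letter (mult H a c) \<odot> lin ud (diamond H b w))))"
    unfolding diamond_Cons[OF x] lin_sw
    by (rule sw_cong) (use c x in \<open>simp_all add: lin_scale ucobar_leibniz_whomog[simplified, OF WH_letter_mult]\<close>)
  also have "\<dots> = hsw x (\<lambda>a b. ?P a b \<cdot> (lin ud (letter (mult H a c)) \<odot> diamond H b w)
     + ?P a b \<cdot> ksign (deg H a + deg H c - 1) \<cdot> (letter (mult H a c) \<odot>
       (ksign (deg H b) \<cdot> lin (diamond H b) (ud w) - lin (\<lambda>y. diamond H y w) (diff H b))))"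
    by (rule sw_cong) (use c x Cons(1) in \<open>simp_all add: scale_add\<close>)
  also have "\<dots> = ksign (deg H x) \<cdot> lin (diamond H x) (ud (c # w)) - lin (\<lambda>y. diamond H y (c # w)) (diff H x)"
    unfolding 1 2 scale_sw sw_diff[symmetric]
    by (rule sw_cong, simp add: x)
      (use c in \<open>simp add: ud_letter_mult linear_simps ksign_expand del: ucobar_diff.simps\<close>)
  finally show ?case .
qed

end

section \<open>Splittings of words\<close>

text \<open>The counterpart of \<open>sw\<close> for deconcatenation. Values may lie in any
  commutative monoid, so that coefficients can be summed as well as vectors.\<close>

definition cuts :: "'a list \<Rightarrow> ('a list \<Rightarrow> 'a list \<Rightarrow> 'z::comm_monoid_add) \<Rightarrow> 'z" where
  "cuts Y F = (\<Sum>i\<le>length Y. F (take i Y) (drop i Y))"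

lemma cuts_Nil [simp]: "cuts [] F = F [] []"
  by (simp add: cuts_def)

lemma cuts_Cons: "cuts (y # Y) F = F [] (y # Y) + cuts Y (\<lambda>u v. F (y # u) v)"
  by (simp add: cuts_def sum.atMost_Suc_shift del: sum.atMost_Suc)

lemma cuts_cong: "(\<And>u v. u @ v = Y \<Longrightarrow> F u v = G u v) \<Longrightarrow> cuts Y F = cuts Y G"
  by (simp add: cuts_def)

lemma cuts_add: "cuts Y (\<lambda>u v. F u v + G u v) = cuts Y F + cuts Y G"
  by (simp add: cuts_def sum.distrib)

lemma cuts_diff: "cuts Y (\<lambda>u v. F u v - G u v) = cuts Y F - (cuts Y G :: 'z::ab_group_add)"
  by (simp add: cuts_def sum_subtractf)

lemma cuts_0 [simp]: "cuts Y (\<lambda>u v. 0) = 0"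
  by (simp add: cuts_def)

lemma cuts_neutral: "(\<And>u v. u @ v = Y \<Longrightarrow> F u v = 0) \<Longrightarrow> cuts Y F = 0"
  using cuts_cong[of Y F "\<lambda>_ _. 0"] by simp

lemma cuts_coassoc: "cuts Y (\<lambda>u v. cuts u (\<lambda>a b. F a b v)) = cuts Y (\<lambda>u v. cuts v (\<lambda>b c. F u b c))"
  by (induct Y arbitrary: F) (simp_all add: cuts_Cons cuts_add add.assoc)

lemma cuts_left: "(\<And>u v. u \<noteq> [] \<Longrightarrow> F u v = 0) \<Longrightarrow> cuts Y F = F [] Y"
  by (cases Y) (simp_all add: cuts_Cons)

lemma cuts_right: "(\<And>u v. v \<noteq> [] \<Longrightarrow> F u v = 0) \<Longrightarrow> cuts Y F = F Y []"
  by (induct Y arbitrary: F) (simp_all add: cuts_Cons)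

lemma lmap_of_cuts: "lmap g \<Longrightarrow> g (cuts Y F) = cuts Y (\<lambda>u v. g (F u v))"
  by (simp add: cuts_def lmap_sum)

lemma lmap_cuts [lmap_intros]: "(\<And>u v. lmap (f u v)) \<Longrightarrow> lmap (\<lambda>p. cuts Y (\<lambda>u v. f u v p))"
  unfolding cuts_def by (intro lmap_intros)

lemma lin_cuts: "lin g (cuts Y F) = cuts Y (\<lambda>a b. lin g (F a b))"
  and conc_cuts_left: "cuts Y G \<odot> q = cuts Y (\<lambda>a b. G a b \<odot> q)"
  and conc_cuts_right: "q \<odot> cuts Y G = cuts Y (\<lambda>a b. q \<odot> G a b)"
  and letter_cuts: "letter (cuts Y K) = cuts Y (\<lambda>a b. letter (K a b))"
  and scale_cuts: "c \<cdot> cuts Y F = cuts Y (\<lambda>a b. c \<cdot> F a b)"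
  by (rule lmap_of_cuts, intro lmap_intros)+

lemma cuts_lin: "cuts Y (\<lambda>u v. lin (F u v) p) = lin (\<lambda>y. cuts Y (\<lambda>u v. F u v y)) p"
  by (simp add: cuts_def lin_fun_sum)

lemma lookup_cuts: "lk (cuts Y F) x = cuts Y (\<lambda>u v. lk (F u v) x)"
  by (simp add: cuts_def lookup_sum)

lemma supp_cuts: "(\<And>u v. u @ v = Y \<Longrightarrow> supp B (F u v)) \<Longrightarrow> supp B (cuts Y F)"
  unfolding cuts_def by (rule supp_sum) simp

lemma cuts_swap: "cuts X (\<lambda>a b. cuts Y (\<lambda>c d. F a b c d)) = cuts Y (\<lambda>c d. cuts X (\<lambda>a b. F a b c d))"
  unfolding cuts_def by (rule sum.swap)

text \<open>The coproduct of a tensor product of two tensor coalgebras. The arguments of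
  \<open>F\<close> come as first pair, then second pair; the Koszul sign for exchanging
  \<open>X2\<close> and \<open>Y1\<close> is written out at each use.\<close>

definition cuts2 :: "'a list \<Rightarrow> 'b list \<Rightarrow>
    ('a list \<Rightarrow> 'b list \<Rightarrow> 'a list \<Rightarrow> 'b list \<Rightarrow> 'z::comm_monoid_add) \<Rightarrow> 'z" where
  "cuts2 X Y F = cuts X (\<lambda>X1 X2. cuts Y (\<lambda>Y1 Y2. F X1 Y1 X2 Y2))"

lemma cuts2_cong:
  "(\<And>X1 X2 Y1 Y2. X1 @ X2 = X \<Longrightarrow> Y1 @ Y2 = Y \<Longrightarrow> F X1 Y1 X2 Y2 = G X1 Y1 X2 Y2) \<Longrightarrow>
    cuts2 X Y F = cuts2 X Y G"
  unfolding cuts2_def by (intro cuts_cong)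

lemma cuts2_coassoc:
  "cuts2 X Y (\<lambda>X1 Y1 X2 Y2. cuts2 X1 Y1 (\<lambda>a c b d. F a c b d X2 Y2)) =
   cuts2 X Y (\<lambda>X1 Y1 X2 Y2. cuts2 X2 Y2 (\<lambda>a c b d. F X1 Y1 a c b d))"
proof -
  have "cuts2 X Y (\<lambda>X1 Y1 X2 Y2. cuts2 X1 Y1 (\<lambda>a c b d. F a c b d X2 Y2)) =
     cuts X (\<lambda>X1 X2. cuts X1 (\<lambda>a b. cuts Y (\<lambda>Y1 Y2. cuts Y1 (\<lambda>c d. F a c b d X2 Y2))))"
    unfolding cuts2_def by (rule cuts_cong, subst cuts_swap, rule refl)
  also have "\<dots> = cuts X (\<lambda>X1 X2. cuts X2 (\<lambda>a b. cuts Y (\<lambda>Y1 Y2. cuts Y2 (\<lambda>c d. F X1 Y1 a c b d))))"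
    by (subst cuts_coassoc) (rule cuts_cong, rule cuts_cong, rule cuts_coassoc)
  also have "\<dots> = cuts2 X Y (\<lambda>X1 Y1 X2 Y2. cuts2 X2 Y2 (\<lambda>a c b d. F X1 Y1 a c b d))"
    unfolding cuts2_def by (rule cuts_cong, subst cuts_swap, rule refl)
  finally show ?thesis .
qed

lemma cuts2_add: "cuts2 X Y (\<lambda>a b c d. F a b c d + G a b c d) = cuts2 X Y F + cuts2 X Y G"
  by (simp add: cuts2_def cuts_add)

lemma cuts2_0 [simp]: "cuts2 X Y (\<lambda>a b c d. 0) = 0"
  by (simp add: cuts2_def)

lemma lmap_of_cuts2: "lmap g \<Longrightarrow> g (cuts2 X Y F) = cuts2 X Y (\<lambda>a b c d. g (F a b c d))"
  by (simp add: cuts2_def lmap_of_cuts)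

lemma lin_cuts2: "lin g (cuts2 X Y F) = cuts2 X Y (\<lambda>a b c d. lin g (F a b c d))"
  and scale_cuts2: "c \<cdot> cuts2 X Y F = cuts2 X Y (\<lambda>a b c' d. c \<cdot> F a b c' d)"
  by (rule lmap_of_cuts2, intro lmap_intros)+

lemma cuts2_lin: "cuts2 X Y (\<lambda>a b c d. lin (F a b c d) p) = lin (\<lambda>y. cuts2 X Y (\<lambda>a b c d. F a b c d y)) p"
  by (simp add: cuts2_def cuts_lin)

lemma cuts2_left:
  "(\<And>a b c d. \<not> (a = [] \<and> b = []) \<Longrightarrow> F a b c d = 0) \<Longrightarrow> cuts2 X Y F = F [] [] X Y"
  unfolding cuts2_def by (subst cuts_left) (auto intro!: cuts_left cuts_neutral)

lemma cuts2_right: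
  "(\<And>a b c d. \<not> (c = [] \<and> d = []) \<Longrightarrow> F a b c d = 0) \<Longrightarrow> cuts2 X Y F = F X Y [] []"
  unfolding cuts2_def by (subst cuts_right) (auto intro!: cuts_right cuts_neutral)

lemma lookup_cuts2: "lk (cuts2 X Y F) x = cuts2 X Y (\<lambda>a b c d. lk (F a b c d) x)"
  by (simp add: cuts2_def lookup_cuts)

section \<open>Cofreeness of the tensor coalgebra\<close>

abbreviation deconc :: "('b list \<Rightarrow>\<^sub>0 'r::comm_ring_1) \<Rightarrow> ('b list \<times> 'b list \<Rightarrow>\<^sub>0 'r)" where
  "deconc \<equiv> lin (\<lambda>w. cuts w (\<lambda>u v. bvec (u, v)))"

lemma cuts_indicator: "cuts w (\<lambda>a b. if a = u \<and> b = v then 1 else 0 :: 'r::comm_ring_1) = (if w = u @ v then 1 else 0)"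
proof (induct w arbitrary: u)
  case (Cons x w)
  show ?case
  proof (cases u)
    case Nil
    have "cuts w (\<lambda>a b. if x # a = u \<and> b = v then 1 else 0 :: 'r) = 0"
      by (rule cuts_neutral) (simp add: Nil)
    then show ?thesis unfolding cuts_Cons by (simp add: Nil)
  next
    case (Cons y u')
    have "cuts w (\<lambda>a b. if x # a = u \<and> b = v then 1 else 0 :: 'r) =
        (if x = y then cuts w (\<lambda>a b. if a = u' \<and> b = v then 1 else 0) else 0)"
      by (auto simp: Cons intro!: cuts_cong)
    then show ?thesis unfolding cuts_Cons Cons.hyps by (simp add: Cons)
  qed
qed simp

text \<open>Among all words only u v has the cut (u, v), and has it once. Hence the coefficient at a
  long word can be read off the coproduct, where it is indexed by shorter words.\<close>

lemma lookup_deconc: "lk (deconc p) (u, v) = lk p (u @ v)"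
proof -
  have "lk (deconc p) (u, v) = (\<Sum>w\<in>Poly_Mapping.keys p. if w = u @ v then lk p (u @ v) else 0)"
    unfolding lookup_lin lookup_cuts lookup_bvec
    by (rule sum.cong) (auto simp: cuts_indicator)
  also have "\<dots> = lk p (u @ v)" by (auto simp: in_keys_iff)
  finally show ?thesis .
qed

lemma lookup_lin_single:
  assumes "\<And>b. b \<in> Poly_Mapping.keys p \<Longrightarrow> b \<noteq> b0 \<Longrightarrow> lk (f b) c = 0"
  shows "lk (lin f p) c = lk p b0 * lk (f b0) c"
proof -
  have "lk (lin f p) c = (\<Sum>b\<in>Poly_Mapping.keys p. if b = b0 then lk p b0 * lk (f b0) c else 0)"
    unfolding lookup_lin by (rule sum.cong) (auto simp: assms)
  also have "\<dots> = lk p b0 * lk (f b0) c" by (auto simp: in_keys_iff)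
  finally show ?thesis .
qed

text \<open>The projection of the tensor coalgebra onto its cogenerators; composing with it gives
  the corestriction of a map.\<close>

definition core :: "('b list \<Rightarrow>\<^sub>0 'r::comm_ring_1) \<Rightarrow> ('b \<Rightarrow>\<^sub>0 'r)" where
  "core = lin (\<lambda>w. case w of [c] \<Rightarrow> bvec c | _ \<Rightarrow> 0)"

lemma lmap_core [lmap_intros]: "lmap f \<Longrightarrow> lmap (\<lambda>p. core (f p))"
  unfolding core_def by (intro lmap_intros)

lemma core_bvec: "core (bvec w) = (case w of [c] \<Rightarrow> bvec c | _ \<Rightarrow> 0)"
  by (simp add: core_def)

lemma core_lin: "core (lin f p) = lin (\<lambda>b. core (f b)) p"
  by (simp add: core_def lin_lin)

lemma lookup_core: "lk (core p) c = lk p [c]"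
  unfolding core_def
  by (subst lookup_lin_single[where ?b0.0 = "[c]"]) (auto simp: lookup_bvec split: list.splits)

text \<open>Uniqueness in the cofreeness property, by induction on the output word. A whole family
  is treated at once because splitting off the first output letter replaces the input
  \<open>k\<close> by other members of \<open>K\<close>.\<close>

lemma cofree_zero:
  assumes "\<And>k. k \<in> K \<Longrightarrow> lk (f k) [] = 0"
    and "\<And>k c cs. k \<in> K \<Longrightarrow> (\<And>k'. k' \<in> K \<Longrightarrow> lk (f k') cs = 0) \<Longrightarrow> lk (f k) (c # cs) = 0"
    and "k \<in> K"
  shows "f k = (0 :: 'b list \<Rightarrow>\<^sub>0 'r::comm_ring_1)"
proof (rule poly_mapping_eqI)
  fix w
  have "\<forall>k\<in>K. lk (f k) w = 0" using assms(1,2) by (induct w) blast+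
  then show "lk (f k) w = lk 0 w" using assms(3) by simp
qed

section \<open>The bar construction\<close>

lemma bar_deg_simps [simp]:
  "bar_deg A [] = 0" "bar_deg A (c # w) = deg A c + 1 + bar_deg A w"
  "bar_deg A (u @ v) = bar_deg A u + bar_deg A v"
  by (simp_all add: bar_deg_def)

text \<open>The part of the bar differential that multiplies the first two letters; it is 0 if there
  is no second letter.\<close>

definition merge :: "('b, 'r::comm_ring_1) dgalg \<Rightarrow> 'b \<Rightarrow> 'b list \<Rightarrow> ('b list \<Rightarrow>\<^sub>0 'r)" where
  "merge A a X = (case X of [] \<Rightarrow> 0 | b # X' \<Rightarrow> ksign (deg A a + 1) \<cdot> (letter (mult A a b) \<odot> bvec X'))"

lemma bar_diff_Nil [simp]: "bar_diff A [] = 0"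
  by (simp add: bar_diff_def)

lemma bar_diff_Cons: "bar_diff A (a # X) = - (letter (diff A a) \<odot> bvec X) + merge A a X
    + ksign (deg A a + 1) \<cdot> (bvec [a] \<odot> bar_diff A X)"
proof -
  have 1: "{i. Suc i < length (a # X)} = {..<length X}" by auto
  have 2: "{i. Suc i < length X} = {..<length X - 1}" by auto
  show ?thesis
  proof (cases X)
    case Nil
    then show ?thesis by (simp add: bar_diff_def merge_def conc_minus_left)
  next
    case (Cons b X')
    have 3: "{..<length X} = {..<Suc (length X')}" by (simp add: Cons)
    have l: "length X - 1 = length X'" by (simp add: Cons)
    show ?thesis
      unfolding bar_diff_def 1 2 l lmap_add[OF lmap_conc_right[OF lmap_id]]
        scale_add lmap_sum[OF lmap_conc_right[OF lmap_id]] scale_sum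
      by (simp add: sum.lessThan_Suc_shift merge_def Cons linear_simps ksign_mult add.assoc
          del: sum.lessThan_Suc)
  qed
qed

text \<open>The two components -s d s^{-1} and s mu (s^{-1} x s^{-1}) by which the bar differential
  is determined as a coderivation.\<close>

definition bar_core :: "('b, 'r::comm_ring_1) dgalg \<Rightarrow> 'b list \<Rightarrow> ('b \<Rightarrow>\<^sub>0 'r)" where
  "bar_core A X = (case X of [a] \<Rightarrow> - diff A a | [a, b] \<Rightarrow> ksign (deg A a + 1) \<cdot> mult A a b | _ \<Rightarrow> 0)"

lemma lmap_lookup [lmap_intros]: "lmap (\<lambda>p. lk p x \<cdot> q)"
  by (rule lmapI) (simp_all add: lookup_add add_scale)

lemma core_letter_conc: "core (letter p \<odot> q) = lk q [] \<cdot> p"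
proof (rule lmap_eqI[of "\<lambda>q. core (letter p \<odot> q)" "\<lambda>q. lk q [] \<cdot> p"])
  fix w
  show "core (letter p \<odot> bvec w) = lk (bvec w) [] \<cdot> p"
    by (cases w) (simp_all add: letter_def conc_lin_left core_lin core_bvec lookup_bvec)
qed (intro lmap_intros)+

lemma lookup_letter_conc_Nil: "lk (letter p \<odot> q) [] = 0"
  by (simp add: letter_def conc_lin_left conc_eq_lin lookup_lin lookup_bvec lin_lin)

lemma lookup_bar_diff_Nil: "lk (bar_diff A X) [] = 0"
  for A :: "('b, 'r::comm_ring_1) dgalg"
proof (cases X)
  case (Cons a X')
  have "lk (bvec [a] \<odot> p) [] = 0" for p :: "'b list \<Rightarrow>\<^sub>0 'r"
    using lookup_letter_conc_Nil[of "bvec a" p] by simp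
  then show ?thesis
    by (simp add: Cons bar_diff_Cons lookup_add lookup_minus merge_def lookup_letter_conc_Nil
        split: list.split)
qed simp

lemma core_bar_diff: "core (bar_diff A X) = bar_core A X"
  for A :: "('b, 'r::comm_ring_1) dgalg"
proof (cases X)
  case (Cons a X')
  have 1: "core (bvec [a] \<odot> p) = lk p [] \<cdot> bvec a" for p :: "'b list \<Rightarrow>\<^sub>0 'r"
    using core_letter_conc[of "bvec a" p] by simp
  have 2: "core (p + q) = core p + core q" "core (- p) = - core p" "core (p - q) = core p - core q" "core (c \<cdot> p) = c \<cdot> core p"
    for p q :: "'b list \<Rightarrow>\<^sub>0 'r" and c
    by (simp_all add: core_def lin_add lin_minus lin_scale lin_diff)
  have 3: "core 0 = (0 :: 'b \<Rightarrow>\<^sub>0 'r)" by (simp add: core_def)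
  show ?thesis
    using core_letter_conc[of "diff A a" "bvec []"]
    by (simp add: Cons bar_diff_Cons 1 2 3 lookup_bar_diff_Nil core_letter_conc merge_def bar_core_def
        lookup_bvec split: list.split)
qed (simp add: bar_core_def core_def)

lemma bar_coderivation: "lin (\<lambda>w. cuts w F) (bar_diff A X) =
    cuts X (\<lambda>u v. lin (\<lambda>u'. F u' v) (bar_diff A u) + ksign (bar_deg A u) \<cdot> lin (F u) (bar_diff A v))"
proof (induct X arbitrary: F)
  case (Cons a X)
  have m: "lin (\<lambda>w. cuts w F) (merge A a X) = lin (F []) (merge A a X) +
      cuts X (\<lambda>u v. lin (\<lambda>u'. F u' v) (merge A a u))"
    by (cases X) (simp_all add: merge_def lin_scale letter_def lin_lin conc_eq_lin cuts_Cons
        lin_fun_add scale_add cuts_lin scale_cuts[symmetric] lin_fun_scale)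
  have "lin (\<lambda>w. cuts w F) (bvec [a] \<odot> bar_diff A X) = lin (F []) (bvec [a] \<odot> bar_diff A X) +
     lin (\<lambda>w. cuts w (\<lambda>u v. F (a # u) v)) (bar_diff A X)"
    by (simp add: conc_eq_lin lin_lin cuts_Cons lin_fun_add)
  also have "lin (\<lambda>w. cuts w (\<lambda>u v. F (a # u) v)) (bar_diff A X) =
      cuts X (\<lambda>u v. lin (\<lambda>u'. F u' v) (bvec [a] \<odot> bar_diff A u)
       + ksign (bar_deg A u) \<cdot> lin (F (a # u)) (bar_diff A v))"
    unfolding Cons by (simp add: conc_eq_lin lin_lin)
  finally have b: "lin (\<lambda>w. cuts w F) (bvec [a] \<odot> bar_diff A X) = lin (F []) (bvec [a] \<odot> bar_diff A X) +
      cuts X (\<lambda>u v. lin (\<lambda>u'. F u' v) (bvec [a] \<odot> bar_diff A u)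
       + ksign (bar_deg A u) \<cdot> lin (F (a # u)) (bar_diff A v))" .
  have d: "lin (\<lambda>w. cuts w F) (letter (diff A a) \<odot> bvec X) = lin (F []) (letter (diff A a) \<odot> bvec X) +
      cuts X (\<lambda>u v. lin (\<lambda>u'. F u' v) (letter (diff A a) \<odot> bvec u))"
    by (simp add: letter_def conc_eq_lin lin_lin cuts_Cons lin_fun_add cuts_lin)
  show ?case
    by (simp add: bar_diff_Cons lin_add lin_minus lin_diff lin_scale m b d cuts_Cons cuts_add cuts_diff
        scale_add scale_cuts ksign_mult add.assoc)
qed simp

locale dg_alg =
  fixes A :: "('b, 'r::comm_ring_1) dgalg"
  assumes dgA: "dg_algebra A"
begin

abbreviation "bd \<equiv> bar_deg A"
abbreviation "RW \<equiv> lists (rbasis A)"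

lemma dgmA: "dg_module A" using dgA by (simp add: dg_algebra_def)

lemma leibnizA: "a \<in> basis A \<Longrightarrow> b \<in> basis A \<Longrightarrow> lin (diff A) (mult A a b) =
    lin (\<lambda>x. mult A x b) (diff A a) + ksign (deg A a) \<cdot> lin (mult A a) (diff A b)"
  using dgA by (auto simp: dg_algebra_def)

lemma assocA: "a \<in> basis A \<Longrightarrow> b \<in> basis A \<Longrightarrow> c \<in> basis A \<Longrightarrow>
    lin (\<lambda>x. mult A x c) (mult A a b) = lin (mult A a) (mult A b c)"
  using dgA by (auto simp: dg_algebra_def)

lemma supp_diffA: "a \<in> rbasis A \<Longrightarrow> supp {b \<in> rbasis A. deg A b = deg A a - 1} (diff A a)"
  using dg_moduleD(4,6)[OF dgmA, of a] by (auto simp: rbasis_def in_keys_iff)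

lemma supp_multA: "a \<in> rbasis A \<Longrightarrow> b \<in> rbasis A \<Longrightarrow>
    supp {c \<in> rbasis A. deg A c = deg A a + deg A b} (mult A a b)"
proof -
  assume ab: "a \<in> rbasis A" "b \<in> rbasis A"
  then have "supp {c \<in> basis A. deg A c = deg A a + deg A b} (mult A a b)"
    "lk (mult A a b) (one A) = 0"
    using dgA by (auto simp: dg_algebra_def homog_def rbasis_def)
  then show ?thesis by (auto simp: rbasis_def in_keys_iff)
qed

lemma rbA: "a \<in> rbasis A \<Longrightarrow> a \<in> basis A" by (simp add: rbasis_def)

lemma supp_letter_image: "supp S p \<Longrightarrow> supp ((\<lambda>b. [b]) ` S) (letter p)"
  by (rule supp_letter) auto

lemma supp_merge: "a \<in> rbasis A \<Longrightarrow> X \<in> RW \<Longrightarrow>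
    supp {w \<in> RW. bd w = bd (a # X) - 1 \<and> length w \<ge> length X} (merge A a X)"
proof (cases X)
  case (Cons b X')
  assume a: "a \<in> rbasis A" and X: "X \<in> RW"
  show ?thesis unfolding merge_def Cons list.case
    by (rule supp_scale, rule supp_conc[OF supp_letter_image[OF supp_multA[OF a]], where B = "{X'}"])
      (use X Cons in auto)
qed (simp add: merge_def)

lemma supp_bar_diff: "X \<in> RW \<Longrightarrow>
    supp {w \<in> RW. bd w = bd X - 1 \<and> Suc (length w) \<ge> length X} (bar_diff A X)"
proof (induct X)
  case (Cons a X)
  then have a: "a \<in> rbasis A" and X: "X \<in> RW" by auto
  have 1: "supp {w \<in> RW. bd w = bd (a # X) - 1 \<and> Suc (length w) \<ge> length (a # X)} (merge A a X)"
    using supp_merge[OF a X] by (rule supp_mono) auto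
  show ?case unfolding bar_diff_Cons
    by (intro supp_add supp_minus supp_scale 1 supp_conc[OF supp_letter_image[OF supp_diffA[OF a]], where B = "{X}"]
        supp_conc[OF _ Cons(1)[OF X], where A = "{[a]}"] supp_bvec) (use a X in auto)
qed simp

lemma lin_bar_core_long:
  "supp {w. length w \<ge> 3} p \<Longrightarrow> lin (bar_core A) p = 0"
  by (rule lin_eq_0) (auto simp: bar_core_def split: list.split)

text \<open>Words of length one, two and three give d^2 = 0, the Leibniz rule and associativity. On
  longer words nothing is left: the differential shortens a word by at most one letter, and
  \<open>bar_core\<close> sees at most two.\<close>

lemma core_bar_diff_diff:
  assumes "X \<in> RW"
  shows "lin (bar_core A) (bar_diff A X) = 0"
proof -
  consider "X = []" | a where "X = [a]" | a b where "X = [a, b]" | a b c where "X = [a, b, c]"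
    | "length X \<ge> 4"
    by (cases X rule: remdups_adj.cases; cases "tl (tl X)"; cases "tl (tl (tl X))") auto
  then show ?thesis
  proof cases
    case 2
    then have "lin (bar_core A) (bar_diff A X) = lin (diff A) (diff A a)"
      by (simp add: bar_diff_Cons merge_def lin_minus letter_def lin_lin bar_core_def lin_fun_minus)
    then show ?thesis using dg_moduleD(5)[OF dgmA] assms 2 rbA by auto
  next
    case 3
    then have ab: "a \<in> rbasis A" "b \<in> rbasis A" using assms by auto
    have "lin (\<lambda>a'. ksign (deg A a' + 1) \<cdot> mult A a' b) (diff A a) =
        lin (\<lambda>a'. ksign (deg A a) \<cdot> mult A a' b) (diff A a)"
      by (rule lin_cong_supp[OF supp_diffA[OF ab(1)]]) (auto simp: ksign_odd)
    then show ?thesis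
      unfolding 3
      by (simp add: bar_diff_Cons merge_def linear_simps letter_def bar_core_def conc_eq_lin
          leibnizA rbA ab ksign_odd lin_fun_scale)
  next
    case 4
    then have abc: "a \<in> rbasis A" "b \<in> rbasis A" "c \<in> rbasis A" using assms by auto
    have z: "bar_core A [x, y, z] = 0" for x y z by (simp add: bar_core_def)
    have "lin (\<lambda>x. ksign (deg A x + 1) \<cdot> mult A x c) (mult A a b) =
      lin (\<lambda>x. ksign (deg A a + deg A b + 1) \<cdot> mult A x c) (mult A a b)"
      by (rule lin_cong_supp[OF supp_multA[OF abc(1,2)]]) auto
    then show ?thesis
      unfolding 4
      by (simp add: bar_diff_Cons merge_def linear_simps letter_def bar_core_def conc_eq_lin
          assocA rbA abc ksign_expand lin_fun_scale)
  next
    case 5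
    then show ?thesis using supp_bar_diff[OF assms] by (intro lin_bar_core_long) auto
  qed simp
qed

text \<open>The square of an odd coderivation is again a coderivation, hence zero as soon as its
  corestriction is.\<close>

lemma bar_diff_diff:
  assumes "X \<in> RW" shows "lin (bar_diff A) (bar_diff A X) = 0"
  using assms
proof (rule cofree_zero[where K = RW and f = "\<lambda>X. lin (bar_diff A) (bar_diff A X)", rotated -1])
  show "lk (lin (bar_diff A) (bar_diff A X)) [] = 0" for X
    by (simp add: lookup_lin lookup_bar_diff_Nil)
next
  fix X c cs assume X: "X \<in> RW" and 0: "\<And>X. X \<in> RW \<Longrightarrow> lk (lin (bar_diff A) (bar_diff A X)) cs = 0"
  have c0: "core (lin (bar_diff A) (bar_diff A X)) = 0" if "X \<in> RW" for X
    by (simp add: core_lin core_bar_diff core_bar_diff_diff that)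
  have z: "lk (lin (bar_diff A) (bar_diff A X)) [c] = 0" if "X \<in> RW" for X
    using c0[OF that] lookup_core by (metis lookup_zero)
  let ?F = "\<lambda>u v. bvec (u, v) :: _ \<Rightarrow>\<^sub>0 'r"
  have "deconc (lin (bar_diff A) (bar_diff A X)) =
    lin (\<lambda>w. cuts w (\<lambda>u v. lin (\<lambda>u'. ?F u' v) (bar_diff A u) + ksign (bd u) \<cdot> lin (?F u) (bar_diff A v)))
     (bar_diff A X)"
    by (simp add: lin_lin bar_coderivation)
  also have "\<dots> = cuts X (\<lambda>u v. tensor (lin (bar_diff A) (bar_diff A u)) (bvec v)
     + tensor (bvec u) (lin (bar_diff A) (bar_diff A v)))"
    unfolding bar_coderivation
  proof (rule cuts_cong)
    fix u v assume "u @ v = X"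
    then have "u \<in> RW" using X by auto
    \<comment> \<open>The differential lowers the degree of \<open>u\<close> by one, so the two
      mixed terms occur with opposite signs.\<close>
    have "lin (\<lambda>u'. ksign (bd u') \<cdot> lin (?F u') (bar_diff A v)) (bar_diff A u) =
       lin (\<lambda>u'. ksign (bd u - 1) \<cdot> lin (?F u') (bar_diff A v)) (bar_diff A u)"
      by (rule lin_cong_supp[OF supp_bar_diff[OF \<open>u \<in> RW\<close>]]) auto
    moreover have "lin (\<lambda>b. lin (\<lambda>u'. ?F u' b) (bar_diff A u)) (bar_diff A v) =
        lin (\<lambda>u'. lin (?F u') (bar_diff A v)) (bar_diff A u)"
      by (rule lin_swap)
    ultimately show "lin (\<lambda>u'. lin (\<lambda>u'. ?F u' v) (bar_diff A u') + ksign (bd u') \<cdot> lin (?F u') (bar_diff A v)) (bar_diff A u)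
      + ksign (bd u) \<cdot> lin (\<lambda>v'. lin (\<lambda>u'. ?F u' v') (bar_diff A u) + ksign (bd u) \<cdot> lin (?F u) (bar_diff A v')) (bar_diff A v)
      = tensor (lin (bar_diff A) (bar_diff A u)) (bvec v) + tensor (bvec u) (lin (bar_diff A) (bar_diff A v))"
      by (simp add: lin_fun_add lin_fun_scale lin_fun_minus scale_add ksign_odd minus_scale tensor_eq_lin lin_lin)
  qed
  finally have "lk (lin (bar_diff A) (bar_diff A X)) (c # cs) =
     lk (cuts X (\<lambda>u v. tensor (lin (bar_diff A) (bar_diff A u)) (bvec v)
     + tensor (bvec u) (lin (bar_diff A) (bar_diff A v)))) ([c], cs)"
    using lookup_deconc[of "lin (bar_diff A) (bar_diff A X)" "[c]" cs] by simp
  also have "\<dots> = 0" unfolding lookup_cuts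
  proof (rule cuts_neutral)
    fix u v assume "u @ v = X"
    then have "u \<in> RW" "v \<in> RW" using X by auto
    then show "lk (tensor (lin (bar_diff A) (bar_diff A u)) (bvec v)
     + tensor (bvec u) (lin (bar_diff A) (bar_diff A v))) ([c], cs) = 0"
      unfolding lookup_add lookup_tensor z[OF \<open>u \<in> RW\<close>] 0[OF \<open>v \<in> RW\<close>] by simp
  qed
  finally show "lk (lin (bar_diff A) (bar_diff A X)) (c # cs) = 0" .
qed

end

lemma bar_sel [simp]: "basis (bar A) = lists (rbasis A)" "deg (bar A) = bar_deg A"
  "diff (bar A) = bar_diff A" "one (bar A) = []" "comult (bar A) = (\<lambda>w. cuts w (\<lambda>u v. bvec (u, v)))"
  by (simp_all add: bar_def cuts_def)

context dg_alg
begin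

lemma dg_coalgebra_bar: "dg_coalgebra (bar A)"
proof -
  have m: "dg_module (bar A)"
    unfolding dg_module_def homog_def
    using supp_bar_diff bar_diff_diff lookup_bar_diff_Nil by (auto simp: subset_iff)
  have 1: "cuts c (\<lambda>u v. if u = [] then bvec v else 0) = (bvec c :: 'b list \<Rightarrow>\<^sub>0 'r)" for c
    by (subst cuts_left) auto
  have 2: "cuts c (\<lambda>u v. if v = [] then bvec u else 0) = (bvec c :: 'b list \<Rightarrow>\<^sub>0 'r)" for c
    by (subst cuts_right) auto
  have 3: "supp {(a, b). a \<in> RW \<and> b \<in> RW \<and> bd a + bd b = bd c} (cuts c (\<lambda>u v. bvec (u, v) :: _ \<Rightarrow>\<^sub>0 'r))"
    if "c \<in> RW" for c
    by (rule supp_cuts, rule supp_bvec) (use that in auto)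
  have 4: "lin (tensor_diff (bar A)) (cuts c (\<lambda>u v. bvec (u, v))) =
      lin (comult (bar A)) (bar_diff A c)" for c
    by (simp add: bar_coderivation lin_cuts tensor_diff_def tensor_eq_lin)
  show ?thesis
    unfolding dg_coalgebra_def
    using m 1 2 3 4 by (simp add: homog2_def lin_cuts cuts_coassoc)
qed

end

section \<open>Homotopy G-algebras from module algebras over the bar construction\<close>

text \<open>The coalgebra map with corestriction \<open>G_corestriction E\<close>, one output letter
  at a time: that letter is made from prefixes of both words, the rest is recursion. A pair of empty
  prefixes is excluded because it would not shorten the words.\<close>

function G_mult :: "('b, 'r::comm_ring_1) dgalg \<Rightarrow> ('b \<Rightarrow> 'b list \<Rightarrow> ('b \<Rightarrow>\<^sub>0 'r)) \<Rightarrow>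
    'b list \<Rightarrow> 'b list \<Rightarrow> ('b list \<Rightarrow>\<^sub>0 'r)" where
  "G_mult A E X Y = (if X = [] \<and> Y = [] then bvec [] else
    (\<Sum>i\<le>length X. \<Sum>j\<le>length Y. if i = 0 \<and> j = 0 then 0 else
      ksign (bar_deg A (drop i X) * bar_deg A (take j Y)) \<cdot>
        (letter (G_corestriction E (take i X) (take j Y)) \<odot> G_mult A E (drop i X) (drop j Y))))"
  by pat_completeness auto
termination
  by (relation "measure (\<lambda>(A, E, X, Y). length X + length Y)") auto

declare G_mult.simps [simp del]

lemma G_corestriction_simps:
  "G_corestriction E [] Y = core (bvec Y)"
  "G_corestriction E (a # b # X) Y = 0"
  by (cases Y rule: remdups_adj.cases; simp add: core_bvec)+

text \<open>The corestriction vanishes on two empty words, so the excluded summand may be put back.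
  Only a sum over all cuts is subject to \<open>cuts2_coassoc\<close>.\<close>

lemma G_mult_rec: "G_mult A E X Y = (if X = [] \<and> Y = [] then bvec [] else 0) +
    cuts2 X Y (\<lambda>X1 Y1 X2 Y2. ksign (bar_deg A X2 * bar_deg A Y1) \<cdot>
      (letter (G_corestriction E X1 Y1) \<odot> G_mult A E X2 Y2))"
proof (cases "X = [] \<and> Y = []")
  case True
  then show ?thesis by (simp add: G_mult.simps cuts2_def)
next
  case False
  have "(if i = 0 \<and> j = 0 then 0 else ksign (bar_deg A (drop i X) * bar_deg A (take j Y)) \<cdot>
        (letter (G_corestriction E (take i X) (take j Y)) \<odot> G_mult A E (drop i X) (drop j Y))) =
     ksign (bar_deg A (drop i X) * bar_deg A (take j Y)) \<cdot>
        (letter (G_corestriction E (take i X) (take j Y)) \<odot> G_mult A E (drop i X) (drop j Y))" for i j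
    by simp
  note * = this
  have "G_mult A E X Y = (\<Sum>i\<le>length X. \<Sum>j\<le>length Y. if i = 0 \<and> j = 0 then 0 else
      ksign (bar_deg A (drop i X) * bar_deg A (take j Y)) \<cdot>
        (letter (G_corestriction E (take i X) (take j Y)) \<odot> G_mult A E (drop i X) (drop j Y)))"
    by (subst G_mult.simps) (simp only: False if_False)
  then show ?thesis
    unfolding * cuts2_def cuts_def by (simp only: False if_False add_0)
qed

lemma tensor_lin: "tensor (lin f p) (lin g q) = lin (\<lambda>a. lin (\<lambda>b. tensor (f a) (g b)) q) p"
proof -
  have "tensor (lin f p) (lin g q) = lin (\<lambda>a. tensor (f a) (lin g q)) p"
    by (rule lmap_of_lin, intro lmap_intros)
  moreover have "tensor (f a) (lin g q) = lin (\<lambda>b. tensor (f a) (g b)) q" for a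
    by (rule lmap_of_lin, intro lmap_intros)
  ultimately show ?thesis by simp
qed

text \<open>What is needed for \<open>G_mult\<close> to be a homogeneous coalgebra map. Normalizing
  \<open>E a []\<close> to the identity makes \<open>E a Y\<close> the corestriction for every
  \<open>Y\<close>, the empty one included.\<close>

locale pre_brace = dg_alg A for A :: "('b, 'r::comm_ring_1) dgalg" +
  fixes E :: "'b \<Rightarrow> 'b list \<Rightarrow> ('b \<Rightarrow>\<^sub>0 'r)"
  assumes E_Nil: "a \<in> rbasis A \<Longrightarrow> E a [] = bvec a"
    and supp_E: "a \<in> rbasis A \<Longrightarrow> Y \<in> lists (rbasis A) \<Longrightarrow>
      supp {c \<in> rbasis A. deg A c = deg A a + bar_deg A Y} (E a Y)"
begin

abbreviation "mu \<equiv> G_mult A E"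
abbreviation "p1 \<equiv> G_corestriction E"
abbreviation "sg X Y \<equiv> ksign (bd X * bd Y) :: 'r"

lemma p1_single: "a \<in> rbasis A \<Longrightarrow> p1 [a] Y = E a Y"
  by (cases Y) (simp_all add: E_Nil)

lemma p1_single': "a \<in> rbasis A \<Longrightarrow> p1 [a] = E a"
  by (rule HOL.ext) (rule p1_single)

lemma lin_mu_rec: "lin g (mu X Y) = (if X = [] \<and> Y = [] then g [] else 0) +
    cuts2 X Y (\<lambda>X1 Y1 X2 Y2. sg X2 Y1 \<cdot> lin (\<lambda>c. lin (\<lambda>w. g (c # w)) (mu X2 Y2)) (p1 X1 Y1))"
  by (subst G_mult_rec) (simp add: lin_add lin_cuts2 lin_scale letter_def conc_eq_lin lin_lin)

text \<open>By induction on the total length: a cut of the output is either before its first letter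
  or a cut of the rest, and coassociativity rearranges the inputs in the second case.\<close>

lemma mu_deconc: "lin (\<lambda>w. cuts w F) (mu X Y) = cuts2 X Y (\<lambda>X1 Y1 X2 Y2.
    sg X2 Y1 \<cdot> lin (\<lambda>p. lin (F p) (mu X2 Y2)) (mu X1 Y1))"
proof (induct "length X + length Y" arbitrary: X Y F rule: less_induct)
  case less
  let ?K = "\<lambda>a b c d e f. ksign ((bd c + bd e) * bd b + bd e * bd d) \<cdot>
     lin (\<lambda>x. lin (\<lambda>p. lin (F (x # p)) (mu e f)) (mu c d)) (p1 a b)"
  have "cuts2 X Y (\<lambda>X1 Y1 X2 Y2. sg X2 Y1 \<cdot>
      lin (\<lambda>c. lin (\<lambda>w. cuts w (\<lambda>u v. F (c # u) v)) (mu X2 Y2)) (p1 X1 Y1)) =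
    cuts2 X Y (\<lambda>X1 Y1 X2 Y2. cuts2 X2 Y2 (\<lambda>a b c d. ?K X1 Y1 a b c d))"
  proof (rule cuts2_cong)
    fix X1 X2 Y1 Y2 assume XY: "X1 @ X2 = X" "Y1 @ Y2 = Y"
    show "sg X2 Y1 \<cdot> lin (\<lambda>c. lin (\<lambda>w. cuts w (\<lambda>u v. F (c # u) v)) (mu X2 Y2)) (p1 X1 Y1) =
      cuts2 X2 Y2 (\<lambda>a b c d. ?K X1 Y1 a b c d)"
    proof (cases "X1 = [] \<and> Y1 = []")
      case True
      then show ?thesis by (simp add: G_corestriction_simps core_bvec cuts2_def)
    next
      case False
      then have "length X2 + length Y2 < length X + length Y" using XY by auto
      then have "sg X2 Y1 \<cdot> lin (\<lambda>c. lin (\<lambda>w. cuts w (\<lambda>u v. F (c # u) v)) (mu X2 Y2)) (p1 X1 Y1) =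
         sg X2 Y1 \<cdot> lin (\<lambda>x. cuts2 X2 Y2 (\<lambda>a b c d. sg c b \<cdot> lin (\<lambda>p. lin (F (x # p)) (mu c d)) (mu a b))) (p1 X1 Y1)"
        by (simp add: less)
      also have "\<dots> = cuts2 X2 Y2 (\<lambda>a b c d. (sg X2 Y1 * sg c b) \<cdot>
          lin (\<lambda>x. lin (\<lambda>p. lin (F (x # p)) (mu c d)) (mu a b)) (p1 X1 Y1))"
        by (simp add: cuts2_lin[symmetric] lin_fun_scale[symmetric] scale_cuts2)
      also have "\<dots> = cuts2 X2 Y2 (\<lambda>a b c d. ?K X1 Y1 a b c d)"
        by (rule cuts2_cong) (auto simp: ksign_mult)
      finally show ?thesis .
    qed
  qed
  also have "\<dots> = cuts2 X Y (\<lambda>X1 Y1 X2 Y2. cuts2 X1 Y1 (\<lambda>a b c d. ?K a b c d X2 Y2))"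
    by (rule cuts2_coassoc[symmetric])
  also have "\<dots> = cuts2 X Y (\<lambda>X1 Y1 X2 Y2. sg X2 Y1 \<cdot> cuts2 X1 Y1 (\<lambda>a b c d. sg c b \<cdot>
      lin (\<lambda>x. lin (\<lambda>p. lin (F (x # p)) (mu X2 Y2)) (mu c d)) (p1 a b)))"
    unfolding scale_cuts2
    by (intro cuts2_cong) (auto simp: ksign_expand)
  finally have 1: "cuts2 X Y (\<lambda>X1 Y1 X2 Y2. sg X2 Y1 \<cdot>
      lin (\<lambda>c. lin (\<lambda>w. cuts w (\<lambda>u v. F (c # u) v)) (mu X2 Y2)) (p1 X1 Y1)) = \<dots>" .
  \<comment> \<open>The cut before the first output letter corresponds to the summand in which the
    first factor \<open>mu X1 Y1\<close> is the unit.\<close>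
  have 2: "cuts2 X Y (\<lambda>X1 Y1 X2 Y2. sg X2 Y1 \<cdot> (if X1 = [] \<and> Y1 = [] then lin (F []) (mu X2 Y2) else 0)) =
     lin (F []) (mu X Y)"
    by (subst cuts2_left) auto
  have "lin (\<lambda>w. cuts w F) (mu X Y) = lin (F []) (mu X Y) + cuts2 X Y (\<lambda>X1 Y1 X2 Y2. sg X2 Y1 \<cdot>
      lin (\<lambda>c. lin (\<lambda>w. cuts w (\<lambda>u v. F (c # u) v)) (mu X2 Y2)) (p1 X1 Y1))"
    unfolding lin_mu_rec[of _ X Y]
    by (simp add: cuts_Cons lin_fun_add scale_add cuts2_add add.assoc)
  also have "\<dots> = cuts2 X Y (\<lambda>X1 Y1 X2 Y2. sg X2 Y1 \<cdot> lin (\<lambda>p. lin (F p) (mu X2 Y2)) (mu X1 Y1))"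
    unfolding 1 unfolding 2[symmetric] cuts2_add[symmetric]
    by (rule cuts2_cong) (simp only: lin_mu_rec[of "\<lambda>p. lin (F p) (mu _ _)"] scale_add)
  finally show ?case .
qed

lemma lookup_mu_Nil: "lk (mu X Y) [] = (if X = [] \<and> Y = [] then 1 else 0)"
  by (subst G_mult_rec)
    (simp add: lookup_add lookup_cuts2 lookup_letter_conc_Nil lookup_bvec)

lemma core_mu: "core (mu X Y) = p1 X Y"
proof -
  have *: "lmap (core :: ('b list \<Rightarrow>\<^sub>0 'r) \<Rightarrow> _)" by (intro lmap_intros)
  have "core (mu X Y) = cuts2 X Y (\<lambda>X1 Y1 X2 Y2. sg X2 Y1 \<cdot> core (letter (p1 X1 Y1) \<odot> mu X2 Y2))"
    by (subst G_mult_rec) (simp add: lmap_add[OF *] lmap_of_cuts2[OF *] lmap_scale[OF *] lmap_0[OF *] core_bvec)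
  also have "\<dots> = p1 X Y"
    unfolding core_letter_conc lookup_mu_Nil by (subst cuts2_right) auto
  finally show ?thesis .
qed

lemma supp_p1:
  assumes "X \<in> RW" "Y \<in> RW"
  shows "supp {c \<in> rbasis A. deg A c + 1 = bd X + bd Y} (p1 X Y)"
proof -
  consider "X = []" | a where "X = [a]" | a b X' where "X = a # b # X'"
    by (cases X rule: remdups_adj.cases) auto
  then show ?thesis
  proof cases
    case 1
    then show ?thesis using assms
      by (cases Y rule: remdups_adj.cases) (auto simp: G_corestriction_simps core_bvec)
  next
    case 2
    then show ?thesis using assms supp_E[of a Y] by (auto simp: p1_single subset_iff)
  qed (simp add: G_corestriction_simps)
qed

lemma supp_mu: "X \<in> RW \<Longrightarrow> Y \<in> RW \<Longrightarrow> supp {w \<in> RW. bd w = bd X + bd Y} (mu X Y)"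
proof (induct "length X + length Y" arbitrary: X Y rule: less_induct)
  case less
  have "supp {w \<in> RW. bd w = bd X + bd Y} (cuts2 X Y (\<lambda>X1 Y1 X2 Y2. sg X2 Y1 \<cdot> (letter (p1 X1 Y1) \<odot> mu X2 Y2)))"
    unfolding cuts2_def
  proof (intro supp_cuts)
    fix X1 X2 Y1 Y2 assume XY: "X1 @ X2 = X" "Y1 @ Y2 = Y"
    show "supp {w \<in> RW. bd w = bd X + bd Y} (sg X2 Y1 \<cdot> (letter (p1 X1 Y1) \<odot> mu X2 Y2))"
    proof (cases "X1 = [] \<and> Y1 = []")
      case True
      then show ?thesis by (simp add: G_corestriction_simps core_bvec)
    next
      case False
      then have l: "length X2 + length Y2 < length X + length Y" using XY by auto
      have R: "X1 \<in> RW" "X2 \<in> RW" "Y1 \<in> RW" "Y2 \<in> RW" using XY less(2,3) by auto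
      show ?thesis
        by (rule supp_scale, rule supp_conc[OF supp_letter_image[OF supp_p1[OF R(1,3)]] less(1)[OF l R(2,4)]])
          (use XY in auto)
    qed
  qed
  then show ?case by (subst G_mult_rec) (rule supp_add[rotated], auto)
qed

text \<open>
  Both sides of an identity between coalgebra maps (or coderivations along a coalgebra map) into
  the tensor coalgebra are determined by their corestrictions.
\<close>

lemma mu_assoc_aux:
  fixes f :: "'b list \<Rightarrow> 'b list \<Rightarrow> 'b list \<Rightarrow> ('b list \<Rightarrow>\<^sub>0 'r)"
  defines "cond \<equiv> \<lambda>f. \<forall>X\<in>RW. \<forall>Y\<in>RW. \<forall>Z\<in>RW. deconc (f X Y Z) =
     cuts2 X Y (\<lambda>X1 Y1 X2 Y2. cuts Z (\<lambda>Z1 Z2. ksign (bd X2 * bd Y1 + (bd X2 + bd Y2) * bd Z1) \<cdot>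
       tensor (f X1 Y1 Z1) (f X2 Y2 Z2)))"
  assumes f: "cond f" and g: "cond g"
    and Nil: "\<And>X Y Z. X \<in> RW \<Longrightarrow> Y \<in> RW \<Longrightarrow> Z \<in> RW \<Longrightarrow> lk (f X Y Z) [] = lk (g X Y Z) []"
    and core: "\<And>X Y Z. X \<in> RW \<Longrightarrow> Y \<in> RW \<Longrightarrow> Z \<in> RW \<Longrightarrow> core (f X Y Z) = core (g X Y Z)"
    and XYZ: "X \<in> RW" "Y \<in> RW" "Z \<in> RW"
  shows "f X Y Z = g X Y Z"
proof -
  have "\<forall>X\<in>RW. \<forall>Y\<in>RW. \<forall>Z\<in>RW. lk (f X Y Z) w = lk (g X Y Z) w" for w
  proof (induct w)
    case (Cons c w)
    show ?case
    proof (intro ballI)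
      fix X Y Z assume R: "X \<in> RW" "Y \<in> RW" "Z \<in> RW"
      have *: "lk (h X Y Z) (c # w) = cuts2 X Y (\<lambda>X1 Y1 X2 Y2. cuts Z (\<lambda>Z1 Z2.
          ksign (bd X2 * bd Y1 + (bd X2 + bd Y2) * bd Z1) * (lk (core (h X1 Y1 Z1)) c * lk (h X2 Y2 Z2) w)))"
        if "cond h" for h
      proof -
        have "lk (h X Y Z) (c # w) = lk (deconc (h X Y Z)) ([c], w)"
          by (subst lookup_deconc) simp
        also have "deconc (h X Y Z) = cuts2 X Y (\<lambda>X1 Y1 X2 Y2. cuts Z (\<lambda>Z1 Z2.
            ksign (bd X2 * bd Y1 + (bd X2 + bd Y2) * bd Z1) \<cdot> tensor (h X1 Y1 Z1) (h X2 Y2 Z2)))"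
          using that R by (simp add: cond_def)
        finally show ?thesis by (simp add: lookup_cuts2 lookup_cuts lookup_tensor lookup_core)
      qed
      show "lk (f X Y Z) (c # w) = lk (g X Y Z) (c # w)"
        unfolding *[OF f] *[OF g]
      proof (intro cuts2_cong cuts_cong, goal_cases)
        case (1 X1 X2 Y1 Y2 Z1 Z2)
        then have "X1 \<in> RW" "X2 \<in> RW" "Y1 \<in> RW" "Y2 \<in> RW" "Z1 \<in> RW" "Z2 \<in> RW" using R by auto
        then show ?case using Cons by (simp only: core)
      qed
    qed
  qed (use Nil in blast)
  then show ?thesis using XYZ by (intro poly_mapping_eqI) blast
qed

end

text \<open>The identities are corestrictions of the conditions on \<open>mu\<close> with first
  factor X. \<open>E_diff\<close> and \<open>E_mult\<close> give the Leibniz rule for X of length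
  one and two, \<open>E_assoc\<close> gives associativity for X of length one. In
  \<open>E_diff\<close> the factors \<open>core (bvec _)\<close> select the cuts that separate a
  single letter at one end of Y.\<close>

locale brace = pre_brace A E
  for A :: "('b, 'r::comm_ring_1) dgalg" and E :: "'b \<Rightarrow> 'b list \<Rightarrow> ('b \<Rightarrow>\<^sub>0 'r)" +
  assumes conn: "connected A"
    and E_mult: "a \<in> rbasis A \<Longrightarrow> b \<in> rbasis A \<Longrightarrow> Y \<in> lists (rbasis A) \<Longrightarrow>
      lin (\<lambda>c. E c Y) (mult A a b) = cuts Y (\<lambda>Y1 Y2. ksign (bar_deg A Y1 * deg A b) \<cdot>
        lin (\<lambda>x. lin (mult A x) (E b Y2)) (E a Y1))"
    and E_diff: "a \<in> rbasis A \<Longrightarrow> Y \<in> lists (rbasis A) \<Longrightarrow> lin (diff A) (E a Y) =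
      lin (\<lambda>c. E c Y) (diff A a) + ksign (deg A a) \<cdot> lin (E a) (bar_diff A Y) +
      cuts Y (\<lambda>Y1 Y2. ksign (bar_deg A Y1 * deg A a) \<cdot> lin (\<lambda>x. lin (mult A x) (E a Y2)) (core (bvec Y1))
        - ksign (deg A a + bar_deg A Y1) \<cdot> lin (\<lambda>x. lin (mult A x) (core (bvec Y2))) (E a Y1))"
    and E_assoc: "a \<in> rbasis A \<Longrightarrow> Y \<in> lists (rbasis A) \<Longrightarrow> Z \<in> lists (rbasis A) \<Longrightarrow>
      lin (\<lambda>c. E c Z) (E a Y) = lin (E a) (G_mult A E Y Z)"
begin

lemma p1_mu: "X \<in> RW \<Longrightarrow> Y \<in> RW \<Longrightarrow> Z \<in> RW \<Longrightarrow> lin (\<lambda>q. p1 q Z) (mu X Y) = lin (p1 X) (mu Y Z)"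
proof -
  assume R: "X \<in> RW" "Y \<in> RW" "Z \<in> RW"
  \<comment> \<open>As a function of \<open>q\<close>, the corestriction only sees the empty word
    and the words of length one; both components of \<open>mu X Y\<close> are known.\<close>
  have "p1 q Z = lk (bvec q) [] \<cdot> core (bvec Z) + lin (\<lambda>a. p1 [a] Z) (core (bvec q))" for q
    by (cases q rule: remdups_adj.cases) (auto simp: G_corestriction_simps core_bvec lookup_bvec)
  note pq = this
  have "lin (\<lambda>q. p1 q Z) p = lk p [] \<cdot> core (bvec Z) + lin (\<lambda>a. p1 [a] Z) (core p)" for p
    by (rule lmap_eqI[of "lin (\<lambda>q. p1 q Z)" "\<lambda>p. lk p [] \<cdot> core (bvec Z) + lin (\<lambda>a. p1 [a] Z) (core p)"])
      (intro lmap_intros | simp only: lin_bvec, rule pq)+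
  then have f: "lin (\<lambda>q. p1 q Z) (mu X Y) =
      (if X = [] \<and> Y = [] then core (bvec Z) else 0) + lin (\<lambda>a. p1 [a] Z) (p1 X Y)"
    by (simp add: core_mu lookup_mu_Nil)
  consider "X = []" | a where "X = [a]" | a b X' where "X = a # b # X'"
    by (cases X rule: remdups_adj.cases) auto
  then show ?thesis
  proof cases
    case 1
    have "p1 [] = (\<lambda>q. core (bvec q))" by (rule HOL.ext) (rule G_corestriction_simps)
    then have "lin (p1 []) (mu Y Z) = p1 Y Z"
      unfolding core_mu[symmetric] by (simp add: core_def)
    moreover have "(if Y = [] then core (bvec Z) else 0) + lin (\<lambda>a. p1 [a] Z) (core (bvec Y)) = p1 Y Z"
      by (cases Y rule: remdups_adj.cases) (auto simp: G_corestriction_simps core_bvec)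
    ultimately show ?thesis unfolding f by (simp add: 1 G_corestriction_simps)
  next
    case 2
    then have a: "a \<in> rbasis A" using R by simp
    have "lin (\<lambda>c. p1 [c] Z) (E a Y) = lin (\<lambda>c. E c Z) (E a Y)"
      by (rule lin_cong_supp[OF supp_E[OF a R(2)]]) (simp add: p1_single)
    then show ?thesis unfolding f by (simp add: 2 p1_single'[OF a] E_assoc a R)
  next
    case 3
    then have "p1 X = (\<lambda>_. 0)" "X \<noteq> []" by (auto simp: G_corestriction_simps)
    then show ?thesis unfolding f by simp
  qed
qed

text \<open>Both bracketings are coalgebra maps on the threefold tensor product, with the same
  Koszul sign for sorting the cut words into first and second halves. They agree since their
  corestrictions do, by \<open>p1_mu\<close>.\<close>

lemma mu_assoc:
  assumes R: "X \<in> RW" "Y \<in> RW" "Z \<in> RW"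
  shows "lin (\<lambda>p. mu p Z) (mu X Y) = lin (mu X) (mu Y Z)"
proof (rule mu_assoc_aux[where f = "\<lambda>X Y Z. lin (\<lambda>p. mu p Z) (mu X Y)" and g = "\<lambda>X Y Z. lin (mu X) (mu Y Z)", OF _ _ _ _ R])
  show "\<forall>X\<in>RW. \<forall>Y\<in>RW. \<forall>Z\<in>RW. deconc (lin (\<lambda>p. mu p Z) (mu X Y)) =
     cuts2 X Y (\<lambda>X1 Y1 X2 Y2. cuts Z (\<lambda>Z1 Z2. ksign (bd X2 * bd Y1 + (bd X2 + bd Y2) * bd Z1) \<cdot>
       tensor (lin (\<lambda>p. mu p Z1) (mu X1 Y1)) (lin (\<lambda>p. mu p Z2) (mu X2 Y2))))"
  proof (intro ballI)
    fix X Y Z assume R: "X \<in> RW" "Y \<in> RW" "Z \<in> RW"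
    have "deconc (lin (\<lambda>p. mu p Z) (mu X Y)) = lin (\<lambda>p. cuts p (\<lambda>P1 P2. cuts Z (\<lambda>Z1 Z2. sg P2 Z1 \<cdot>
       tensor (mu P1 Z1) (mu P2 Z2)))) (mu X Y)"
      by (simp add: lin_lin mu_deconc tensor_eq_lin cuts2_def)
    also have "\<dots> = cuts2 X Y (\<lambda>X1 Y1 X2 Y2. cuts Z (\<lambda>Z1 Z2. ksign (bd X2 * bd Y1 + (bd X2 + bd Y2) * bd Z1) \<cdot>
       tensor (lin (\<lambda>p. mu p Z1) (mu X1 Y1)) (lin (\<lambda>p. mu p Z2) (mu X2 Y2))))"
      unfolding mu_deconc
    proof (rule cuts2_cong)
      fix X1 X2 Y1 Y2 assume XY: "X1 @ X2 = X" "Y1 @ Y2 = Y"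
      have R2: "X2 \<in> RW" "Y2 \<in> RW" using XY R by auto
      have "lin (\<lambda>P1. lin (\<lambda>P2. cuts Z (\<lambda>Z1 Z2. sg P2 Z1 \<cdot> tensor (mu P1 Z1) (mu P2 Z2))) (mu X2 Y2)) (mu X1 Y1)
        = lin (\<lambda>P1. lin (\<lambda>P2. cuts Z (\<lambda>Z1 Z2. ksign ((bd X2 + bd Y2) * bd Z1) \<cdot> tensor (mu P1 Z1) (mu P2 Z2))) (mu X2 Y2)) (mu X1 Y1)"
        by (rule lin_cong, rule lin_cong_supp[OF supp_mu[OF R2]]) auto
      also have "\<dots> = cuts Z (\<lambda>Z1 Z2. ksign ((bd X2 + bd Y2) * bd Z1) \<cdot>
         lin (\<lambda>P1. lin (\<lambda>P2. tensor (mu P1 Z1) (mu P2 Z2)) (mu X2 Y2)) (mu X1 Y1))"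
        by (simp add: cuts_lin[symmetric] lin_fun_scale)
      also have "\<dots> = cuts Z (\<lambda>Z1 Z2. ksign ((bd X2 + bd Y2) * bd Z1) \<cdot>
         tensor (lin (\<lambda>p. mu p Z1) (mu X1 Y1)) (lin (\<lambda>p. mu p Z2) (mu X2 Y2)))"
        by (simp only: tensor_lin)
      finally show "sg X2 Y1 \<cdot> lin (\<lambda>P1. lin (\<lambda>P2. cuts Z (\<lambda>Z1 Z2. sg P2 Z1 \<cdot> tensor (mu P1 Z1) (mu P2 Z2))) (mu X2 Y2)) (mu X1 Y1)
        = cuts Z (\<lambda>Z1 Z2. ksign (bd X2 * bd Y1 + (bd X2 + bd Y2) * bd Z1) \<cdot>
         tensor (lin (\<lambda>p. mu p Z1) (mu X1 Y1)) (lin (\<lambda>p. mu p Z2) (mu X2 Y2)))"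
        by (simp add: scale_cuts ksign_add)
    qed
    finally show "deconc (lin (\<lambda>p. mu p Z) (mu X Y)) = \<dots>" .
  qed
  show "\<forall>X\<in>RW. \<forall>Y\<in>RW. \<forall>Z\<in>RW. deconc (lin (mu X) (mu Y Z)) =
     cuts2 X Y (\<lambda>X1 Y1 X2 Y2. cuts Z (\<lambda>Z1 Z2. ksign (bd X2 * bd Y1 + (bd X2 + bd Y2) * bd Z1) \<cdot>
       tensor (lin (mu X1) (mu Y1 Z1)) (lin (mu X2) (mu Y2 Z2))))"
  proof (intro ballI)
    fix X Y Z assume R: "X \<in> RW" "Y \<in> RW" "Z \<in> RW"
    have "deconc (lin (mu X) (mu Y Z)) = lin (\<lambda>p. cuts p (\<lambda>P1 P2. cuts X (\<lambda>X1 X2. sg X2 P1 \<cdot>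
       tensor (mu X1 P1) (mu X2 P2)))) (mu Y Z)"
    proof -
      have "deconc (mu X P) = cuts P (\<lambda>P1 P2. cuts X (\<lambda>X1 X2. sg X2 P1 \<cdot> tensor (mu X1 P1) (mu X2 P2)))" for P
        by (subst cuts_swap) (simp add: mu_deconc tensor_eq_lin cuts2_def)
      then show ?thesis by (simp add: lin_lin)
    qed
    also have "\<dots> = cuts2 Y Z (\<lambda>Y1 Z1 Y2 Z2. cuts X (\<lambda>X1 X2. ksign (bd X2 * bd Y1 + (bd X2 + bd Y2) * bd Z1) \<cdot>
       tensor (lin (mu X1) (mu Y1 Z1)) (lin (mu X2) (mu Y2 Z2))))"
      unfolding mu_deconc
    proof (rule cuts2_cong)
      fix Y1 Y2 Z1 Z2 assume YZ: "Y1 @ Y2 = Y" "Z1 @ Z2 = Z"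
      have R1: "Y1 \<in> RW" "Z1 \<in> RW" using YZ R by auto
      have "lin (\<lambda>P1. lin (\<lambda>P2. cuts X (\<lambda>X1 X2. sg X2 P1 \<cdot> tensor (mu X1 P1) (mu X2 P2))) (mu Y2 Z2)) (mu Y1 Z1)
        = lin (\<lambda>P1. lin (\<lambda>P2. cuts X (\<lambda>X1 X2. ksign (bd X2 * (bd Y1 + bd Z1)) \<cdot> tensor (mu X1 P1) (mu X2 P2))) (mu Y2 Z2)) (mu Y1 Z1)"
        by (rule lin_cong_supp[OF supp_mu[OF R1]]) auto
      also have "\<dots> = cuts X (\<lambda>X1 X2. ksign (bd X2 * (bd Y1 + bd Z1)) \<cdot>
         lin (\<lambda>P1. lin (\<lambda>P2. tensor (mu X1 P1) (mu X2 P2)) (mu Y2 Z2)) (mu Y1 Z1))"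
        by (simp add: cuts_lin[symmetric] lin_fun_scale)
      also have "\<dots> = cuts X (\<lambda>X1 X2. ksign (bd X2 * (bd Y1 + bd Z1)) \<cdot>
         tensor (lin (mu X1) (mu Y1 Z1)) (lin (mu X2) (mu Y2 Z2)))"
        by (simp only: tensor_lin)
      finally show "sg Y2 Z1 \<cdot> lin (\<lambda>P1. lin (\<lambda>P2. cuts X (\<lambda>X1 X2. sg X2 P1 \<cdot> tensor (mu X1 P1) (mu X2 P2))) (mu Y2 Z2)) (mu Y1 Z1)
        = cuts X (\<lambda>X1 X2. ksign (bd X2 * bd Y1 + (bd X2 + bd Y2) * bd Z1) \<cdot>
         tensor (lin (mu X1) (mu Y1 Z1)) (lin (mu X2) (mu Y2 Z2)))"
        by (simp add: scale_cuts ksign_expand)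
    qed
    also have "\<dots> = cuts2 X Y (\<lambda>X1 Y1 X2 Y2. cuts Z (\<lambda>Z1 Z2. ksign (bd X2 * bd Y1 + (bd X2 + bd Y2) * bd Z1) \<cdot>
       tensor (lin (mu X1) (mu Y1 Z1)) (lin (mu X2) (mu Y2 Z2))))"
      unfolding cuts2_def
      by (subst (2) cuts_swap, rule cuts_swap[THEN trans], rule refl)
    finally show "deconc (lin (mu X) (mu Y Z)) = \<dots>" .
  qed
  fix X Y Z assume R: "X \<in> RW" "Y \<in> RW" "Z \<in> RW"
  have "lk (lin (\<lambda>p. mu p Z) (mu X Y)) [] = lk (mu X Y) [] * lk (mu [] Z) []"
    by (rule lookup_lin_single) (simp add: lookup_mu_Nil)
  moreover have "lk (lin (mu X) (mu Y Z)) [] = lk (mu Y Z) [] * lk (mu X []) []"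
    by (rule lookup_lin_single) (simp add: lookup_mu_Nil)
  ultimately show "lk (lin (\<lambda>p. mu p Z) (mu X Y)) [] = lk (lin (mu X) (mu Y Z)) []"
    by (simp add: lookup_mu_Nil)
  show "core (lin (\<lambda>p. mu p Z) (mu X Y)) = core (lin (mu X) (mu Y Z))"
    by (simp add: core_lin core_mu p1_mu R)
qed

end

lemma core_expand: "core p = lin (\<lambda>w. core (bvec w)) p"
  by (rule lmap_expand) (intro lmap_intros)

abbreviation bilin :: "('a \<Rightarrow> 'b \<Rightarrow> ('c \<Rightarrow>\<^sub>0 'r::comm_ring_1)) \<Rightarrow> ('a \<Rightarrow>\<^sub>0 'r) \<Rightarrow> ('b \<Rightarrow>\<^sub>0 'r) \<Rightarrow> ('c \<Rightarrow>\<^sub>0 'r)" where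
  "bilin F p q \<equiv> lin (\<lambda>a. lin (F a) q) p"

lemma cuts2_diff: "cuts2 X Y (\<lambda>a b c d. F a b c d - G a b c d) = cuts2 X Y F - (cuts2 X Y G :: 'z::ab_group_add)"
  by (simp add: cuts2_def cuts_diff)

section \<open>The bar differential and the product \<open>mu\<close>\<close>

context pre_brace
begin

abbreviation "bD \<equiv> bar_diff A"

text \<open>This and its two analogues show that each term of the Leibniz rule is a coderivation
  along the coalgebra map \<open>mu\<close>, so that the defect of the rule is determined by its
  corestriction.\<close>

lemma mu_bar_diff_left_deconc:
  assumes R: "X \<in> RW" "Y \<in> RW"
  shows "lin (\<lambda>z. cuts z F) (lin (\<lambda>p. mu p Y) (bD X)) = cuts2 X Y (\<lambda>X1 Y1 X2 Y2.
    sg X2 Y1 \<cdot> (bilin F (lin (\<lambda>p. mu p Y1) (bD X1)) (mu X2 Y2)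
      + ksign (bd X1 + bd Y1) \<cdot> bilin F (mu X1 Y1) (lin (\<lambda>p. mu p Y2) (bD X2))))"
proof -
  have "lin (\<lambda>z. cuts z F) (lin (\<lambda>p. mu p Y) (bD X)) =
     lin (\<lambda>p. cuts p (\<lambda>X1 X2. cuts Y (\<lambda>Y1 Y2. sg X2 Y1 \<cdot> bilin F (mu X1 Y1) (mu X2 Y2)))) (bD X)"
    by (simp add: lin_lin mu_deconc cuts2_def)
  also have "\<dots> = cuts2 X Y (\<lambda>X1 Y1 X2 Y2.
    sg X2 Y1 \<cdot> (bilin F (lin (\<lambda>p. mu p Y1) (bD X1)) (mu X2 Y2)
      + ksign (bd X1 + bd Y1) \<cdot> bilin F (mu X1 Y1) (lin (\<lambda>p. mu p Y2) (bD X2))))"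
    unfolding bar_coderivation cuts2_def
  proof (rule cuts_cong)
    fix X1 X2 assume X: "X1 @ X2 = X"
    have "X2 \<in> RW" using X R by auto
    have "lin (\<lambda>X2'. cuts Y (\<lambda>Y1 Y2. sg X2' Y1 \<cdot> bilin F (mu X1 Y1) (mu X2' Y2))) (bD X2) =
       lin (\<lambda>X2'. cuts Y (\<lambda>Y1 Y2. ksign ((bd X2 - 1) * bd Y1) \<cdot> bilin F (mu X1 Y1) (mu X2' Y2))) (bD X2)"
      by (rule lin_cong_supp[OF supp_bar_diff[OF \<open>X2 \<in> RW\<close>]]) auto
    also have "\<dots> = cuts Y (\<lambda>Y1 Y2. ksign ((bd X2 - 1) * bd Y1) \<cdot> bilin F (mu X1 Y1) (lin (\<lambda>p. mu p Y2) (bD X2)))"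
      unfolding cuts_lin[symmetric] lin_fun_scale lin_lin
      by (rule cuts_cong, subst lin_swap) (rule refl)
    finally show "lin (\<lambda>X1'. cuts Y (\<lambda>Y1 Y2. sg X2 Y1 \<cdot> bilin F (mu X1' Y1) (mu X2 Y2))) (bD X1) +
       ksign (bd X1) \<cdot> lin (\<lambda>X2'. cuts Y (\<lambda>Y1 Y2. sg X2' Y1 \<cdot> bilin F (mu X1 Y1) (mu X2' Y2))) (bD X2) =
      cuts Y (\<lambda>Y1 Y2. sg X2 Y1 \<cdot> (bilin F (lin (\<lambda>p. mu p Y1) (bD X1)) (mu X2 Y2)
      + ksign (bd X1 + bd Y1) \<cdot> bilin F (mu X1 Y1) (lin (\<lambda>p. mu p Y2) (bD X2))))"
      by (simp add: cuts_lin[symmetric] lin_fun_scale lin_lin scale_add cuts_add scale_cuts ksign_expand)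
  qed
  finally show ?thesis .
qed

lemma mu_bar_diff_right_deconc:
  assumes R: "X \<in> RW" "Y \<in> RW"
  shows "ksign (bd X) \<cdot> lin (\<lambda>z. cuts z F) (lin (mu X) (bD Y)) = cuts2 X Y (\<lambda>X1 Y1 X2 Y2.
    sg X2 Y1 \<cdot> (ksign (bd X1) \<cdot> bilin F (lin (mu X1) (bD Y1)) (mu X2 Y2)
      + ksign (bd X1 + bd Y1) \<cdot> ksign (bd X2) \<cdot> bilin F (mu X1 Y1) (lin (mu X2) (bD Y2))))"
proof -
  have *: "lin (\<lambda>w. cuts w F) (mu X P) = cuts P (\<lambda>P1 P2. cuts X (\<lambda>X1 X2. sg X2 P1 \<cdot> bilin F (mu X1 P1) (mu X2 P2)))" for P
    by (subst cuts_swap) (simp add: mu_deconc cuts2_def)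
  have "lin (\<lambda>z. cuts z F) (lin (mu X) (bD Y)) =
     lin (\<lambda>p. cuts p (\<lambda>Y1 Y2. cuts X (\<lambda>X1 X2. sg X2 Y1 \<cdot> bilin F (mu X1 Y1) (mu X2 Y2)))) (bD Y)"
    by (simp add: lin_lin *)
  also have "\<dots> = cuts Y (\<lambda>Y1 Y2. cuts X (\<lambda>X1 X2. ksign (bd X2 * (bd Y1 - 1)) \<cdot> bilin F (lin (mu X1) (bD Y1)) (mu X2 Y2)
      + ksign (bd Y1) \<cdot> sg X2 Y1 \<cdot> bilin F (mu X1 Y1) (lin (mu X2) (bD Y2))))"
    unfolding bar_coderivation
  proof (rule cuts_cong)
    fix Y1 Y2 assume Y: "Y1 @ Y2 = Y"
    have "Y1 \<in> RW" using Y R by auto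
    have "lin (\<lambda>Y1'. cuts X (\<lambda>X1 X2. sg X2 Y1' \<cdot> bilin F (mu X1 Y1') (mu X2 Y2))) (bD Y1) =
       lin (\<lambda>Y1'. cuts X (\<lambda>X1 X2. ksign (bd X2 * (bd Y1 - 1)) \<cdot> bilin F (mu X1 Y1') (mu X2 Y2))) (bD Y1)"
      by (rule lin_cong_supp[OF supp_bar_diff[OF \<open>Y1 \<in> RW\<close>]]) auto
    moreover have "lin (\<lambda>Y2'. cuts X (\<lambda>X1 X2. sg X2 Y1 \<cdot> bilin F (mu X1 Y1) (mu X2 Y2'))) (bD Y2) =
       cuts X (\<lambda>X1 X2. sg X2 Y1 \<cdot> bilin F (mu X1 Y1) (lin (mu X2) (bD Y2)))"
      unfolding cuts_lin[symmetric] lin_fun_scale lin_lin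
      by (rule cuts_cong, subst lin_swap) (rule refl)
    ultimately show "lin (\<lambda>Y1'. cuts X (\<lambda>X1 X2. sg X2 Y1' \<cdot> bilin F (mu X1 Y1') (mu X2 Y2))) (bD Y1) +
       ksign (bd Y1) \<cdot> lin (\<lambda>Y2'. cuts X (\<lambda>X1 X2. sg X2 Y1 \<cdot> bilin F (mu X1 Y1) (mu X2 Y2'))) (bD Y2) =
       cuts X (\<lambda>X1 X2. ksign (bd X2 * (bd Y1 - 1)) \<cdot> bilin F (lin (mu X1) (bD Y1)) (mu X2 Y2)
      + ksign (bd Y1) \<cdot> sg X2 Y1 \<cdot> bilin F (mu X1 Y1) (lin (mu X2) (bD Y2)))"
      by (simp add: cuts_lin[symmetric] lin_fun_scale lin_lin cuts_add scale_cuts)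
  qed
  also have "\<dots> = cuts2 X Y (\<lambda>X1 Y1 X2 Y2. ksign (bd X2 * (bd Y1 - 1)) \<cdot> bilin F (lin (mu X1) (bD Y1)) (mu X2 Y2)
      + ksign (bd Y1) \<cdot> sg X2 Y1 \<cdot> bilin F (mu X1 Y1) (lin (mu X2) (bD Y2)))"
    unfolding cuts2_def by (rule cuts_swap)
  finally show ?thesis
    by (simp add: scale_cuts2) (rule cuts2_cong, auto simp: ksign_expand scale_add)
qed

lemma bar_diff_mu_deconc:
  assumes R: "X \<in> RW" "Y \<in> RW"
  shows "lin (\<lambda>z. cuts z F) (lin bD (mu X Y)) = cuts2 X Y (\<lambda>X1 Y1 X2 Y2.
    sg X2 Y1 \<cdot> (bilin F (lin bD (mu X1 Y1)) (mu X2 Y2)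
      + ksign (bd X1 + bd Y1) \<cdot> bilin F (mu X1 Y1) (lin bD (mu X2 Y2))))"
proof -
  have "lin (\<lambda>z. cuts z F) (lin bD (mu X Y)) =
     lin (\<lambda>z. cuts z (\<lambda>u v. lin (\<lambda>u'. F u' v) (bD u) + ksign (bd u) \<cdot> lin (F u) (bD v))) (mu X Y)"
    by (simp add: lin_lin bar_coderivation)
  also have "\<dots> = cuts2 X Y (\<lambda>X1 Y1 X2 Y2.
    sg X2 Y1 \<cdot> (bilin F (lin bD (mu X1 Y1)) (mu X2 Y2)
      + ksign (bd X1 + bd Y1) \<cdot> bilin F (mu X1 Y1) (lin bD (mu X2 Y2))))"
    unfolding mu_deconc
  proof (rule cuts2_cong)
    fix X1 X2 Y1 Y2 assume XY: "X1 @ X2 = X" "Y1 @ Y2 = Y"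
    have R1: "X1 \<in> RW" "Y1 \<in> RW" using XY R by auto
    have "lin (\<lambda>p. ksign (bd p) \<cdot> lin (\<lambda>q. lin (F p) (bD q)) (mu X2 Y2)) (mu X1 Y1) =
       lin (\<lambda>p. ksign (bd X1 + bd Y1) \<cdot> lin (\<lambda>q. lin (F p) (bD q)) (mu X2 Y2)) (mu X1 Y1)"
      by (rule lin_cong_supp[OF supp_mu[OF R1]]) auto
    moreover have "lin (\<lambda>q. lin (\<lambda>u'. F u' q) (bD p)) (mu X2 Y2) = lin (\<lambda>u'. lin (F u') (mu X2 Y2)) (bD p)" for p
      by (rule lin_swap)
    ultimately show "sg X2 Y1 \<cdot> lin (\<lambda>p. lin (\<lambda>q. lin (\<lambda>u'. F u' q) (bD p) + ksign (bd p) \<cdot> lin (F p) (bD q)) (mu X2 Y2)) (mu X1 Y1) =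
     sg X2 Y1 \<cdot> (bilin F (lin bD (mu X1 Y1)) (mu X2 Y2)
      + ksign (bd X1 + bd Y1) \<cdot> bilin F (mu X1 Y1) (lin bD (mu X2 Y2)))"
      by (simp add: lin_fun_add lin_fun_scale lin_lin)
  qed
  finally show ?thesis .
qed

text \<open>Expresses the quadratic component through the coproduct and \<open>core\<close>, so that
  on \<open>mu X Y\<close> it can be evaluated by \<open>mu_deconc\<close>: a cut with two
  one-letter halves exists exactly for words of length two.\<close>

lemma lin_bar_core: "lin (bar_core A) p = - lin (diff A) (core p)
    + lin (\<lambda>w. cuts w (\<lambda>u v. bilin (\<lambda>a b. ksign (deg A a + 1) \<cdot> mult A a b) (core (bvec u)) (core (bvec v)))) p"
proof (rule lmap_eqI[of _ _ p])
  fix w :: "'b list"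
  let ?G = "\<lambda>u v. bilin (\<lambda>a b. ksign (deg A a + 1) \<cdot> mult A a b) (core (bvec u)) (core (bvec v))"
  consider "w = []" | a where "w = [a]" | a b where "w = [a, b]" | "length w \<ge> 3"
    by (cases w rule: remdups_adj.cases; cases "tl (tl w)") auto
  then have "bar_core A w = - lin (diff A) (core (bvec w)) + cuts w ?G"
  proof cases
    case 4
    have "cuts w ?G = 0"
    proof (rule cuts_neutral)
      fix u v assume "u @ v = w"
      then have "length u + length v \<ge> 3" using 4 by auto
      then have "length u \<noteq> 1 \<or> length v \<noteq> 1" by auto
      then show "?G u v = 0"
        by (auto simp: core_bvec split: list.splits)
    qed
    then show ?thesis using 4 by (auto simp: core_bvec bar_core_def split: list.splits)
  qed (simp_all add: cuts_Cons core_bvec bar_core_def)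
  then show "lin (bar_core A) (bvec w) = - lin (diff A) (core (bvec w)) + lin (\<lambda>w. cuts w ?G) (bvec w)"
    by simp
qed (intro lmap_intros)+

lemma core_bar_diff_mu: "core (lin bD (mu X Y)) = - lin (diff A) (p1 X Y) +
    cuts2 X Y (\<lambda>X1 Y1 X2 Y2. sg X2 Y1 \<cdot> bilin (\<lambda>a b. ksign (deg A a + 1) \<cdot> mult A a b) (p1 X1 Y1) (p1 X2 Y2))"
proof -
  have "bilin (\<lambda>u v. bilin G (core (bvec u)) (core (bvec v))) p q = bilin G (core p) (core q)"
    for G :: "'b \<Rightarrow> 'b \<Rightarrow> ('b \<Rightarrow>\<^sub>0 'r)" and p q
  proof -
    have "bilin G (core p) (core q) = lin (\<lambda>u. lin (\<lambda>a. lin (\<lambda>v. lin (G a) (core (bvec v))) q) (core (bvec u))) p"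
      by (subst (1) core_expand, subst core_expand[of q], simp only: lin_lin)
    moreover have "lin (\<lambda>a. lin (\<lambda>v. lin (G a) (core (bvec v))) q) (core (bvec u)) =
        lin (\<lambda>v. bilin G (core (bvec u)) (core (bvec v))) q" for u
      by (rule lin_swap)
    ultimately show ?thesis by simp
  qed
  then show ?thesis
    by (simp add: core_lin core_bar_diff lin_bar_core core_mu mu_deconc)
qed

lemma mu_Nil_left: "mu [] Y = bvec Y"
proof (induct Y)
  case (Cons y Y)
  have "mu [] (y # Y) = cuts Y (\<lambda>u v. letter (core (bvec (y # u))) \<odot> mu [] v)"
    by (subst G_mult_rec) (simp add: cuts2_def cuts_Cons G_corestriction_simps core_bvec)
  also have "\<dots> = letter (core (bvec [y])) \<odot> mu [] Y"
    by (rule cuts_left) (auto simp: core_bvec split: list.splits)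
  finally show ?case by (simp add: Cons core_bvec)
qed (simp add: G_mult.simps)

lemma mu_Nil_right: "mu X [] = bvec X"
proof (induct X)
  case (Cons y Y)
  have "mu (y # Y) [] = cuts Y (\<lambda>u v. letter (p1 (y # u) []) \<odot> mu v [])"
    by (subst G_mult_rec) (simp add: cuts2_def cuts_Cons G_corestriction_simps core_bvec)
  also have "\<dots> = letter (p1 [y] []) \<odot> mu Y []"
  proof (rule cuts_left)
    fix u v :: "'b list" assume "u \<noteq> []"
    then show "letter (p1 (y # u) []) \<odot> mu v [] = 0" by (cases u) simp_all
  qed
  finally show ?case by (simp add: Cons)
qed (simp add: G_mult.simps)

end

context brace
begin

text \<open>The corestriction of \<open>mu\<close> accepts at most one letter of X, and the
  differential either applies it twice or merges two letters. So X of length at least three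
  contributes nothing, and lengths one and two are the axioms \<open>E_diff\<close> and
  \<open>E_mult\<close>.\<close>

lemma core_leibniz:
  assumes R: "X \<in> RW" "Y \<in> RW"
  shows "core (lin bD (mu X Y)) = core (lin (\<lambda>p. mu p Y) (bD X) + ksign (bd X) \<cdot> lin (mu X) (bD Y))"
proof -
  let ?m = "\<lambda>a b. ksign (deg A a + 1) \<cdot> mult A a b"
  have c: "core (p + q) = core p + core q" "core (c \<cdot> p) = c \<cdot> core p" for p q :: "'b list \<Rightarrow>\<^sub>0 'r" and c
    by (simp_all add: core_def lin_add lin_scale)
  have rhs: "core (lin (\<lambda>p. mu p Y) (bD X) + ksign (bd X) \<cdot> lin (mu X) (bD Y)) =
      lin (\<lambda>q. p1 q Y) (bD X) + ksign (bd X) \<cdot> lin (p1 X) (bD Y)"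
    by (simp add: c core_lin core_mu)
  have m1: "bilin ?m (E a Y1) q = ksign (deg A a + bd Y1 + 1) \<cdot> bilin (mult A) (E a Y1) q"
    if "a \<in> rbasis A" "Y1 \<in> RW" for a Y1 q
    unfolding lin_fun_scale[symmetric]
    by (rule lin_cong_supp[OF supp_E[OF that]]) (auto simp: lin_fun_scale)
  have m2: "bilin ?m (core (bvec Y1)) q = ksign (bd Y1) \<cdot> bilin (mult A) (core (bvec Y1)) q" for Y1 q
    by (cases Y1 rule: remdups_adj.cases) (simp_all add: core_bvec lin_fun_scale)
  consider "X = []" | a where "X = [a]" | a b where "X = [a, b]" | "length X \<ge> 3"
    by (cases X rule: remdups_adj.cases; cases "tl (tl X)") auto
  then show ?thesis
  proof cases
    case 1
    have "p1 [] = (\<lambda>q. core (bvec q))" by (rule HOL.ext) (rule G_corestriction_simps)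
    then have "lin (p1 []) (bD Y) = core (bD Y)" by (simp add: core_def)
    also have "\<dots> = lin (bar_core A) (bvec Y)" by (simp add: core_bar_diff)
    finally show ?thesis unfolding rhs core_bar_diff_mu
      unfolding 1 lin_bar_core by (simp add: cuts2_def G_corestriction_simps)
  next
    case 2
    then have a: "a \<in> rbasis A" using R by simp
    have d: "lin (\<lambda>c. p1 [c] Y) (diff A a) = lin (\<lambda>c. E c Y) (diff A a)"
      by (rule lin_cong_supp[OF supp_diffA[OF a]]) (simp add: p1_single)
    have "cuts2 [a] Y (\<lambda>X1 Y1 X2 Y2. sg X2 Y1 \<cdot> bilin ?m (p1 X1 Y1) (p1 X2 Y2)) =
      cuts Y (\<lambda>Y1 Y2. ksign (deg A a * bd Y1) \<cdot> bilin (mult A) (core (bvec Y1)) (E a Y2)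
        - ksign (deg A a + bd Y1) \<cdot> bilin (mult A) (E a Y1) (core (bvec Y2)))"
    proof -
      have "cuts2 [a] Y (\<lambda>X1 Y1 X2 Y2. sg X2 Y1 \<cdot> bilin ?m (p1 X1 Y1) (p1 X2 Y2)) =
        cuts Y (\<lambda>Y1 Y2. ksign ((deg A a + 1) * bd Y1) \<cdot> bilin ?m (core (bvec Y1)) (E a Y2)
          + bilin ?m (E a Y1) (core (bvec Y2)))"
        unfolding cuts2_def
        by (simp add: cuts_Cons cuts_add G_corestriction_simps(1) p1_single'[OF a])
      also have "\<dots> = cuts Y (\<lambda>Y1 Y2. ksign (deg A a * bd Y1) \<cdot> bilin (mult A) (core (bvec Y1)) (E a Y2)
        - ksign (deg A a + bd Y1) \<cdot> bilin (mult A) (E a Y1) (core (bvec Y2)))"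
      proof (rule cuts_cong)
        fix Y1 Y2 assume "Y1 @ Y2 = Y"
        then have "Y1 \<in> RW" using R by auto
        show "ksign ((deg A a + 1) * bd Y1) \<cdot> bilin ?m (core (bvec Y1)) (E a Y2)
          + bilin ?m (E a Y1) (core (bvec Y2)) = ksign (deg A a * bd Y1) \<cdot> bilin (mult A) (core (bvec Y1)) (E a Y2)
        - ksign (deg A a + bd Y1) \<cdot> bilin (mult A) (E a Y1) (core (bvec Y2))"
          unfolding m2 m1[OF a \<open>Y1 \<in> RW\<close>] by (simp add: ksign_expand)
      qed
      finally show ?thesis .
    qed
    then show ?thesis
      unfolding rhs core_bar_diff_mu unfolding 2 p1_single'[OF a]
      by (simp add: E_diff[OF a R(2)] bar_diff_Cons merge_def lin_minus letter_def lin_lin d ksign_odd minus_scale mult.commute)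
  next
    case 3
    then have ab: "a \<in> rbasis A" "b \<in> rbasis A" using R by auto
    have 0: "p1 [a, b] = (\<lambda>_. 0)" by (rule HOL.ext) simp
    have D: "lin (\<lambda>q. p1 q Y) (bD [a, b]) = ksign (deg A a + 1) \<cdot> lin (\<lambda>c. E c Y) (mult A a b)"
    proof -
      have "lin (\<lambda>c. p1 [c] Y) (mult A a b) = lin (\<lambda>c. E c Y) (mult A a b)"
        by (rule lin_cong_supp[OF supp_multA[OF ab]]) (simp add: p1_single)
      then show ?thesis
        by (simp add: bar_diff_Cons merge_def linear_simps letter_def conc_eq_lin)
    qed
    have "cuts2 [a, b] Y (\<lambda>X1 Y1 X2 Y2. sg X2 Y1 \<cdot> bilin ?m (p1 X1 Y1) (p1 X2 Y2)) =
       cuts Y (\<lambda>Y1 Y2. ksign ((deg A b + 1) * bd Y1) \<cdot> bilin ?m (E a Y1) (E b Y2))"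
      unfolding cuts2_def by (simp add: cuts_Cons 0 p1_single'[OF ab(1)] p1_single'[OF ab(2)])
    also have "\<dots> = ksign (deg A a + 1) \<cdot> cuts Y (\<lambda>Y1 Y2. ksign (bd Y1 * deg A b) \<cdot> bilin (mult A) (E a Y1) (E b Y2))"
      unfolding scale_cuts
    proof (rule cuts_cong)
      fix Y1 Y2 assume "Y1 @ Y2 = Y"
      then have "Y1 \<in> RW" using R by auto
      show "ksign ((deg A b + 1) * bd Y1) \<cdot> bilin ?m (E a Y1) (E b Y2) =
        ksign (deg A a + 1) \<cdot> ksign (bd Y1 * deg A b) \<cdot> bilin (mult A) (E a Y1) (E b Y2)"
        unfolding m1[OF ab(1) \<open>Y1 \<in> RW\<close>] by (simp add: ksign_expand scale_minus)
    qed
    finally show ?thesis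
      unfolding rhs core_bar_diff_mu unfolding 3 0 D
      by (simp add: E_mult[OF ab R(2)])
  next
    case 4
    have z: "p1 q Z = 0" if "length q \<ge> 2" for q Z
      using that by (cases q rule: remdups_adj.cases) auto
    have "p1 X = (\<lambda>_. 0)" by (rule HOL.ext, rule z) (use 4 in simp)
    moreover have "cuts2 X Y (\<lambda>X1 Y1 X2 Y2. sg X2 Y1 \<cdot> bilin ?m (p1 X1 Y1) (p1 X2 Y2)) =
       cuts2 X Y (\<lambda>X1 Y1 X2 Y2. 0)"
    proof (rule cuts2_cong)
      fix X1 X2 Y1 Y2 assume "X1 @ X2 = X"
      then have "length X1 \<ge> 2 \<or> length X2 \<ge> 2" using 4 by auto
      then show "sg X2 Y1 \<cdot> bilin ?m (p1 X1 Y1) (p1 X2 Y2) = 0"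
        using z by auto
    qed
    moreover have "lin (\<lambda>q. p1 q Y) (bD X) = 0"
      by (rule lin_eq_0[OF supp_bar_diff[OF R(1)]]) (use 4 z in auto)
    ultimately show ?thesis unfolding rhs core_bar_diff_mu by simp
  qed
qed

lemma mu_leibniz:
  assumes R: "X \<in> RW" "Y \<in> RW"
  shows "lin bD (mu X Y) = lin (\<lambda>p. mu p Y) (bD X) + ksign (bd X) \<cdot> lin (mu X) (bD Y)"
proof -
  \<comment> \<open>The defect of the Leibniz rule: a coderivation along \<open>mu\<close> with
    vanishing corestriction.\<close>
  define f where "f = (\<lambda>(X, Y). lin bD (mu X Y) - (lin (\<lambda>p. mu p Y) (bD X) + ksign (bd X) \<cdot> lin (mu X) (bD Y)))"
  have "f (X, Y) = 0"
  proof (rule cofree_zero[where K = "RW \<times> RW"])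
    fix k :: "'b list \<times> 'b list" assume k: "k \<in> RW \<times> RW"
    obtain X Y where [simp]: "k = (X, Y)" by (cases k)
    have R: "X \<in> RW" "Y \<in> RW" using k by auto
    have "lk (lin (\<lambda>p. mu p Y) (bD X)) [] = lk (bD X) [] * lk (mu [] Y) []"
      by (rule lookup_lin_single) (simp add: lookup_mu_Nil)
    moreover have "lk (lin (mu X) (bD Y)) [] = lk (bD Y) [] * lk (mu X []) []"
      by (rule lookup_lin_single) (simp add: lookup_mu_Nil)
    moreover have "lk (lin bD (mu X Y)) [] = 0"
      by (simp add: lookup_lin lookup_bar_diff_Nil)
    ultimately show "lk (f k) [] = 0"
      by (simp add: f_def lookup_minus lookup_add lookup_bar_diff_Nil)
  next
    fix k c cs assume k: "k \<in> RW \<times> RW" and 0: "\<And>k'. k' \<in> RW \<times> RW \<Longrightarrow> lk (f k') cs = 0"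
    obtain X Y where [simp]: "k = (X, Y)" by (cases k)
    have R: "X \<in> RW" "Y \<in> RW" using k by auto
    let ?t = "\<lambda>u v. bvec (u, v) :: _ \<Rightarrow>\<^sub>0 'r"
    have "deconc (f (X, Y)) = cuts2 X Y (\<lambda>X1 Y1 X2 Y2. sg X2 Y1 \<cdot>
        (tensor (f (X1, Y1)) (mu X2 Y2) + ksign (bd X1 + bd Y1) \<cdot> tensor (mu X1 Y1) (f (X2, Y2))))"
    proof -
      have "deconc (f (X, Y)) = deconc (lin bD (mu X Y)) - (deconc (lin (\<lambda>p. mu p Y) (bD X)) + ksign (bd X) \<cdot> deconc (lin (mu X) (bD Y)))"
        by (simp add: f_def lin_diff lin_add lin_scale)
      also have "\<dots> = cuts2 X Y (\<lambda>X1 Y1 X2 Y2. sg X2 Y1 \<cdot>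
        (tensor (f (X1, Y1)) (mu X2 Y2) + ksign (bd X1 + bd Y1) \<cdot> tensor (mu X1 Y1) (f (X2, Y2))))"
        unfolding bar_diff_mu_deconc[OF R] mu_bar_diff_left_deconc[OF R] mu_bar_diff_right_deconc[OF R]
          cuts2_add[symmetric] cuts2_diff[symmetric]
        by (intro cuts2_cong) (simp add: f_def tensor_eq_lin lin_diff lin_add lin_scale lin_fun_diff
          lin_fun_add lin_fun_scale scale_add scale_diff mult_ac)
      finally show ?thesis .
    qed
    then have "lk (f (X, Y)) (c # cs) = lk (cuts2 X Y (\<lambda>X1 Y1 X2 Y2. sg X2 Y1 \<cdot>
        (tensor (f (X1, Y1)) (mu X2 Y2) + ksign (bd X1 + bd Y1) \<cdot> tensor (mu X1 Y1) (f (X2, Y2))))) ([c], cs)"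
      using lookup_deconc[of "f (X, Y)" "[c]" cs] by simp
    also have "\<dots> = cuts2 X Y (\<lambda>X1 Y1 X2 Y2. 0)"
      unfolding lookup_cuts2
    proof (rule cuts2_cong)
      fix X1 X2 Y1 Y2 assume XY: "X1 @ X2 = X" "Y1 @ Y2 = Y"
      have R': "X1 \<in> RW" "Y1 \<in> RW" "(X2, Y2) \<in> RW \<times> RW" using XY R by auto
      have "core (f (X1, Y1)) = 0"
        unfolding f_def prod.case lmap_diff[OF lmap_core[OF lmap_id]] core_leibniz[OF R'(1,2)] by simp
      then have "lk (f (X1, Y1)) [c] = 0" using lookup_core[of "f (X1, Y1)" c] by simp
      then show "lk (sg X2 Y1 \<cdot> (tensor (f (X1, Y1)) (mu X2 Y2) + ksign (bd X1 + bd Y1) \<cdot> tensor (mu X1 Y1) (f (X2, Y2)))) ([c], cs) = 0"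
        using 0[OF R'(3)] by (simp add: lookup_add lookup_tensor)
    qed
    finally show "lk (f k) (c # cs) = 0" by (simp add: cuts2_def)
  qed (use R in simp)
  then show ?thesis by (simp add: f_def)
qed

lemma dg_bialgebra_bar: "dg_bialgebra (bar_bialg A mu)"
proof -
  have sel: "basis (bar_bialg A mu) = RW" "deg (bar_bialg A mu) = bd" "diff (bar_bialg A mu) = bD"
    "one (bar_bialg A mu) = []" "mult (bar_bialg A mu) = mu" "bcomult (bar_bialg A mu) = comult (bar A)"
    by (simp_all add: bar_bialg_def)
  have co: "coalg_part (bar_bialg A mu) = bar A"
    by (simp add: coalg_part_def sel)
  have "dg_module (bar A)" using dg_coalgebra_bar by (simp add: dg_coalgebra_def)
  then have "dg_module (alg_part (bar_bialg A mu))"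
    by (simp add: dg_module_def homog_def sel)
  then have alg: "dg_algebra (alg_part (bar_bialg A mu))"
    unfolding dg_algebra_def part_sel sel homog_def
    by (simp add: mu_Nil_left mu_Nil_right supp_mu lookup_mu_Nil mu_leibniz mu_assoc)
  have mult: "lin (comult (bar A)) (mu X Y) = tensor_mult (bar_bialg A mu) (comult (bar A) X) (comult (bar A) Y)" for X Y
    by (simp add: mu_deconc tensor_mult_def lin2_def sel lin_cuts cuts2_def tensor_eq_lin)
  show ?thesis
    unfolding dg_bialgebra_def co using alg mult dg_coalgebra_bar by (simp add: sel)
qed

theorem homotopy_G_algebra_brace: "homotopy_G_algebra A E"
proof -
  have "bd Y = (\<Sum>b\<leftarrow>Y. deg A b) + int (length Y)" for Y
    by (induct Y) simp_all
  then have "homog A (deg A a + (\<Sum>b\<leftarrow>Y. deg A b) + int (length Y)) (E a Y)" "supp (rbasis A) (E a Y)"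
    if "a \<in> rbasis A" "Y \<in> RW" for a Y
    using supp_E[OF that] by (auto simp: homog_def rbasis_def subset_iff add.assoc)
  moreover have "lk (mu x y) [c] = lk (p1 x y) c" for x y c
    by (metis lookup_core core_mu)
  ultimately show ?thesis
    unfolding homotopy_G_algebra_def using dgA conn dg_bialgebra_bar by blast
qed

end

section \<open>Kadeishvili's operations\<close>

lemma kadeishvili_Nil: "kadeishvili H [] Y = (if Y = [] then bvec [] else 0)"
proof -
  have "{I. I \<subseteq> {..<length ([] :: 'a list)} \<and> card I = length Y} = (if Y = [] then {{}} else {})" by auto
  then show ?thesis by (simp add: kadeishvili_def)
qed

text \<open>Distinguishes whether position 0 is selected; all other positions are shifted by
  \<open>Suc\<close>. By \<open>c1\<close> and \<open>c2\<close> the counting index of a shifted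
  position stays the same if 0 is not selected and grows by one if it is, 0 then receiving the first
  entry of \<open>Y\<close>.\<close>

lemma kadeishvili_Cons:
  "kadeishvili H (c # w) Y = bvec [c] \<odot> kadeishvili H w Y + (case Y of [] \<Rightarrow> 0 | y # Y' \<Rightarrow>
     ksign ((wdeg H y + 1) * wdeg H w) \<cdot> (diamond H c y \<odot> kadeishvili H w Y'))"
proof -
  let ?m = "length w"
  define t where "t = (\<lambda>as bs I. ksign (\<Sum>i\<in>I. (wdeg H (bs ! card {l \<in> I. l < i}) + 1) * wdeg H (drop (Suc i) as)) \<cdot>
       (conc_list (map (\<lambda>i. if i \<in> I then diamond H (as ! i) (bs ! card {l\<in>I. l < i})
                          else bvec [as ! i]) [0..<length as])))"
  define S where "S = (\<lambda>k. {I. I \<subseteq> {..<?m} \<and> card I = k})"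
  have k: "kadeishvili H as bs = (\<Sum>I | I \<subseteq> {..<length as} \<and> card I = length bs. t as bs I)" for as bs
    by (simp add: kadeishvili_def t_def)
  have fin: "finite (S k)" for k unfolding S_def by (rule finite_subset[of _ "Pow {..<?m}"]) auto
  have finI: "finite I" if "I \<in> S k" for I k using that unfolding S_def by (auto intro: finite_subset)
  have split: "{I. I \<subseteq> {..<length (c # w)} \<and> card I = n} =
      (image Suc) ` S n \<union> (\<lambda>J. insert 0 (Suc ` J)) ` {J. J \<subseteq> {..<?m} \<and> Suc (card J) = n}" for n
  proof (intro equalityI subsetI)
    fix I assume I: "I \<in> {I. I \<subseteq> {..<length (c # w)} \<and> card I = n}"
    let ?J = "{j. Suc j \<in> I}"
    have J: "?J \<subseteq> {..<?m}" using I by auto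
    then have fJ: "finite ?J" by (rule finite_subset) simp
    have "I = Suc ` ?J \<or> I = insert 0 (Suc ` ?J)"
    proof (cases "0 \<in> I")
      case True
      have "x \<in> insert 0 (Suc ` ?J)" if "x \<in> I" for x using that by (cases x) auto
      then show ?thesis using True by blast
    next
      case False
      have "x \<in> Suc ` ?J" if "x \<in> I" for x using that False by (cases x) auto
      then show ?thesis by blast
    qed
    then show "I \<in> (image Suc) ` S n \<union> (\<lambda>J. insert 0 (Suc ` J)) ` {J. J \<subseteq> {..<?m} \<and> Suc (card J) = n}"
    proof
      assume e: "I = Suc ` ?J"
      have "card I = card ?J" by (subst e) (rule card_image, simp)
      then have "?J \<in> S n" using J I unfolding S_def by simp
      then show ?thesis using e by blast
    next
      assume e: "I = insert 0 (Suc ` ?J)"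
      have "card I = Suc (card (Suc ` ?J))" by (subst e) (rule card_insert_disjoint, use fJ in auto)
      then have "Suc (card ?J) = n" using I by (simp add: card_image)
      then show ?thesis using e J by blast
    qed
  next
    fix I assume "I \<in> (image Suc) ` S n \<union> (\<lambda>J. insert 0 (Suc ` J)) ` {J. J \<subseteq> {..<?m} \<and> Suc (card J) = n}"
    then consider J where "J \<in> S n" "I = Suc ` J" | J where "J \<subseteq> {..<?m}" "Suc (card J) = n" "I = insert 0 (Suc ` J)"
      by blast
    then show "I \<in> {I. I \<subseteq> {..<length (c # w)} \<and> card I = n}"
    proof cases
      case 1
      then show ?thesis unfolding S_def by (auto simp: card_image)
    next
      case 2
      then have "finite J" by (auto intro: finite_subset)
      then show ?thesis using 2 by (auto simp: card_image)
    qed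
  qed
  have inj1: "inj_on (image Suc) A" for A by (rule inj_onI) (auto simp: inj_image_eq_iff)
  have inj2: "inj_on (\<lambda>J. insert 0 (Suc ` J)) A" for A
  proof (rule inj_onI)
    fix J K assume "insert 0 (Suc ` J) = insert 0 (Suc ` K)"
    then have "Suc ` J = Suc ` K" by (metis Zero_not_Suc image_iff insert_ident)
    then show "J = K" by (simp add: inj_image_eq_iff)
  qed
  have c1: "card {l \<in> Suc ` J. l < Suc i} = card {l \<in> J. l < i}" for J i
  proof -
    have "{l \<in> Suc ` J. l < Suc i} = Suc ` {l \<in> J. l < i}" by auto
    then show ?thesis by (simp add: card_image)
  qed
  have c2: "card {l. (l = 0 \<or> l \<in> Suc ` J) \<and> l < Suc i} = Suc (card {l \<in> J. l < i})" if "finite J" for J i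
  proof -
    have "{l. (l = 0 \<or> l \<in> Suc ` J) \<and> l < Suc i} = insert 0 (Suc ` {l \<in> J. l < i})" by auto
    then show ?thesis using that by (simp add: card_image)
  qed
  have mem: "Suc i \<in> Suc ` J \<longleftrightarrow> i \<in> J" "0 \<notin> Suc ` J" for i J by auto
  have map0: "map f [0..<length (c # w)] = f 0 # map (\<lambda>i. f (Suc i)) [0..<?m]" for f :: "nat \<Rightarrow> 'z"
    by (simp add: upt_conv_Cons map_Suc_upt[symmetric] del: upt_Suc)
  have t1: "t (c # w) bs (Suc ` J) = bvec [c] \<odot> t w bs J" for bs J
    unfolding t_def map0
    by (simp add: sum.reindex c1 mem conc_scale_right cong: if_cong)
  have t2: "t (c # w) (y # bs) (insert 0 (Suc ` J)) =
     ksign ((wdeg H y + 1) * wdeg H w) \<cdot> (diamond H c y \<odot> t w bs J)" if "finite J" for y bs J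
    unfolding t_def map0
    using that by (simp add: sum.reindex c2 mem conc_scale_right ksign_mult cong: if_cong)
  have "kadeishvili H (c # w) Y = (\<Sum>I\<in>S (length Y). t (c # w) Y (Suc ` I)) +
     (\<Sum>J\<in>{J. J \<subseteq> {..<?m} \<and> Suc (card J) = length Y}. t (c # w) Y (insert 0 (Suc ` J)))"
    unfolding k split
    by (subst sum.union_disjoint)
      (use fin in \<open>auto simp: sum.reindex[OF inj1] sum.reindex[OF inj2] intro: finite_subset[of _ "Pow {..<?m}"]\<close>)
  also have "(\<Sum>I\<in>S (length Y). t (c # w) Y (Suc ` I)) = bvec [c] \<odot> kadeishvili H w Y"
    unfolding t1 k S_def by (simp add: lmap_sum[OF lmap_conc_right[OF lmap_id]])
  also have "(\<Sum>J\<in>{J. J \<subseteq> {..<?m} \<and> Suc (card J) = length Y}. t (c # w) Y (insert 0 (Suc ` J))) =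
     (case Y of [] \<Rightarrow> 0 | y # Y' \<Rightarrow> ksign ((wdeg H y + 1) * wdeg H w) \<cdot> (diamond H c y \<odot> kadeishvili H w Y'))"
  proof (cases Y)
    case (Cons y Y')
    have "{J. J \<subseteq> {..<?m} \<and> Suc (card J) = length Y} = S (length Y')" by (auto simp: Cons S_def)
    moreover have "t (c # w) Y (insert 0 (Suc ` J)) =
       ksign ((wdeg H y + 1) * wdeg H w) \<cdot> (diamond H c y \<odot> t w Y' J)" if "J \<in> S (length Y')" for J
      unfolding Cons by (rule t2, rule finI[OF that])
    ultimately show ?thesis unfolding k
      by (simp add: Cons S_def lmap_sum[OF lmap_conc_right[OF lmap_id]] scale_sum)
  qed simp
  finally show ?thesis .
qed

lemma rbasis_cobar: "rbasis (cobar C) = lists (rbasis C) - {[]}"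
  by (simp add: rbasis_def)

context bialgebra
begin

abbreviation "CA \<equiv> cobar (coalg_part H)"
abbreviation "bd \<equiv> bar_deg (cobar (coalg_part H))"
abbreviation "RC \<equiv> rbasis (cobar (coalg_part H))"
abbreviation "ext \<equiv> kadeishvili H"

sublocale CA: dg_alg "cobar (coalg_part H)"
  by unfold_locales (rule dg_algebra_cobar)

lemma RC_D: "y \<in> RC \<Longrightarrow> y \<in> lists (rbasis H)" "y \<in> RC \<Longrightarrow> y \<in> lists B" "y \<in> RC \<Longrightarrow> y \<noteq> []"
  by (auto simp: rbasis_cobar rbasis_def)

lemma ext_Nil_right [simp]: "ext w [] = bvec w"
  by (induct w) (simp_all add: kadeishvili_Nil kadeishvili_Cons)

lemma ext_Nil_left: "ext [] Y = (if Y = [] then bvec [] else 0)"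
  by (rule kadeishvili_Nil)

lemma ext_Cons: "ext (c # w) (y # Y) = bvec [c] \<odot> ext w (y # Y) +
    ksign ((wdeg H y + 1) * wdeg H w) \<cdot> (diamond H c y \<odot> ext w Y)"
  by (simp add: kadeishvili_Cons)

lemma ext_single [simp]: "ext [c] [y] = diamond H c y" "ext [c] (y # z # Y) = 0"
  by (simp_all add: ext_Cons ext_Nil_left)

lemma ext_short: "length w < length Y \<Longrightarrow> ext w Y = 0"
proof (induct w arbitrary: Y)
  case (Cons c w)
  then show ?case by (cases Y) (simp_all add: ext_Cons)
qed (auto simp: ext_Nil_left)

lemma ext_Cons_cuts: "ext (c # w) Y = cuts Y (\<lambda>Y1 Y2. ksign (bd Y1 * wdeg H w) \<cdot> (ext [c] Y1 \<odot> ext w Y2))"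
proof (cases Y)
  case (Cons y Y')
  have "cuts Y' (\<lambda>u v. ksign (bd (y # u) * wdeg H w) \<cdot> (ext [c] (y # u) \<odot> ext w v)) =
     ksign (bd [y] * wdeg H w) \<cdot> (ext [c] [y] \<odot> ext w Y')"
  proof (rule cuts_left)
    fix u v :: "'b list list" assume "u \<noteq> []"
    then show "ksign (bd (y # u) * wdeg H w) \<cdot> (ext [c] (y # u) \<odot> ext w v) = 0" by (cases u) simp_all
  qed
  then show ?thesis by (simp add: Cons cuts_Cons ext_Cons[of c w])
qed simp

text \<open>Each argument is inserted into \<open>u\<close> or into \<open>v\<close>, and their
  order is kept. This is why the product in the first variable is respected strictly, as
  \<open>E_mult\<close> requires.\<close>

lemma ext_append: "ext (u @ v) Y = cuts Y (\<lambda>Y1 Y2. ksign (bd Y1 * wdeg H v) \<cdot> (ext u Y1 \<odot> ext v Y2))"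
proof (induct u arbitrary: Y)
  case Nil
  then show ?case by (subst cuts_left) (simp_all add: ext_Nil_left)
next
  case (Cons c u)
  let ?G = "\<lambda>Y1 Y2 Y3. ksign (bd Y1 * (wdeg H u + wdeg H v) + bd Y2 * wdeg H v) \<cdot> (ext [c] Y1 \<odot> ext u Y2 \<odot> ext v Y3)"
  have "ext ((c # u) @ v) Y = cuts Y (\<lambda>Y1 Y'. cuts Y' (\<lambda>Y2 Y3. ?G Y1 Y2 Y3))"
    by (simp add: ext_Cons_cuts[of c "u @ v"] Cons conc_cuts_right scale_cuts conc_scale_right ksign_mult)
  also have "\<dots> = cuts Y (\<lambda>Y' Y3. cuts Y' (\<lambda>Y1 Y2. ?G Y1 Y2 Y3))"
    by (rule cuts_coassoc[symmetric])
  also have "\<dots> = cuts Y (\<lambda>Y' Y3. ksign (bd Y' * wdeg H v) \<cdot> (ext (c # u) Y' \<odot> ext v Y3))"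
    unfolding ext_Cons_cuts[of c u] conc_cuts_left scale_cuts
    by (intro cuts_cong) (auto simp: conc_scale_left conc_assoc ksign_expand)
  finally show ?case .
qed

lemma ext_conc:
  assumes "supp {w. wdeg H w = k} q"
  shows "lin (\<lambda>w. ext w Y) (p \<odot> q) =
    cuts Y (\<lambda>Y1 Y2. ksign (bd Y1 * k) \<cdot> (lin (\<lambda>w. ext w Y1) p \<odot> lin (\<lambda>w. ext w Y2) q))"
proof (rule lmap_eqI[of "\<lambda>p. lin (\<lambda>w. ext w Y) (p \<odot> q)"])
  fix u
  show "lin (\<lambda>w. ext w Y) (bvec u \<odot> q) =
    cuts Y (\<lambda>Y1 Y2. ksign (bd Y1 * k) \<cdot> (lin (\<lambda>w. ext w Y1) (bvec u) \<odot> lin (\<lambda>w. ext w Y2) q))"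
  proof (rule lmap_eqI[of "\<lambda>q. lin (\<lambda>w. ext w Y) (bvec u \<odot> q)"])
    fix v assume "v \<in> Poly_Mapping.keys q"
    then have "wdeg H v = k" using assms by auto
    then show "lin (\<lambda>w. ext w Y) (bvec u \<odot> bvec v) = cuts Y (\<lambda>Y1 Y2.
       ksign (bd Y1 * k) \<cdot> (lin (\<lambda>w. ext w Y1) (bvec u) \<odot> lin (\<lambda>w. ext w Y2) (bvec v)))"
      by (simp add: ext_append)
  qed (intro lmap_intros)+
qed (intro lmap_intros)+

lemma WH_ext:
  "w \<in> lists B \<Longrightarrow> Y \<in> lists (lists B) \<Longrightarrow> WH (wdeg H w + bd Y) (ext w Y)"
proof (induct w arbitrary: Y)
  case Nil
  then show ?case by (auto simp: ext_Nil_left)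
next
  case (Cons c w)
  then have c: "c \<in> B" "w \<in> lists B" by simp_all
  show ?case
  proof (cases Y)
    case Nil
    show ?thesis unfolding Nil ext_Nil_right by (rule supp_bvec) (use c in simp)
  next
    case (Cons y Y')
    have y: "y \<in> lists B" "Y' \<in> lists (lists B)" using Cons.prems Cons by simp_all
    have 1: "WH (wdeg H w + bd (y # Y')) (ext w (y # Y'))" by (rule Cons.hyps) (use c y in simp_all)
    have 2: "WH (wdeg H w + bd Y') (ext w Y')" by (rule Cons.hyps) (use c y in simp_all)
    show ?thesis unfolding Cons ext_Cons
      by (intro supp_add supp_scale supp_conc[OF supp_bvec 1, where A = "{[c]}"]
        supp_conc[OF WH_diamond[OF c(1) y(1)] 2]) (use c in auto)
  qed
qed

lemma supp_ext:
  "w \<in> lists (rbasis H) \<Longrightarrow> Y \<in> lists RC \<Longrightarrow>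
    supp {v \<in> lists (rbasis H). length v \<ge> length w} (ext w Y)"
proof (induct w arbitrary: Y)
  case Nil
  then show ?case by (auto simp: ext_Nil_left)
next
  case (Cons c w)
  then have c: "c \<in> rbasis H" "c \<in> B" "w \<in> lists (rbasis H)" by (simp_all add: rbasis_def)
  show ?case
  proof (cases Y)
    case Nil
    show ?thesis unfolding Nil ext_Nil_right by (rule supp_bvec) (use c in simp)
  next
    case (Cons y Y')
    have y: "y \<in> RC" "Y' \<in> lists RC" using Cons.prems Cons by simp_all
    have 1: "supp {v \<in> lists (rbasis H). length v \<ge> length w} (ext w (y # Y'))" by (rule Cons.hyps) (use c y in simp_all)
    have 2: "supp {v \<in> lists (rbasis H). length v \<ge> length w} (ext w Y')" by (rule Cons.hyps) (use c y in simp_all)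
    have "length y \<ge> 1" using RC_D(3)[OF y(1)] by (cases y) auto
    then show ?thesis unfolding Cons ext_Cons
      by (intro supp_add supp_scale supp_conc[OF supp_bvec 1, where A = "{[c]}"]
        supp_conc[OF supp_diamond[OF c(2) RC_D(1)[OF y(1)]] 2]) (use c in auto)
  qed
qed

sublocale CA: pre_brace "cobar (coalg_part H)" ext
proof unfold_locales
  fix a Y assume a: "a \<in> RC" and Y: "Y \<in> lists RC"
  have "Y \<in> lists (lists B)" using Y RC_D(2) by auto
  then have 1: "WH (wdeg H a + bd Y) (ext a Y)" by (rule WH_ext[OF RC_D(2)[OF a]])
  have 2: "supp {v \<in> lists (rbasis H). length v \<ge> length a} (ext a Y)"
    by (rule supp_ext[OF RC_D(1)[OF a] Y])
  show "supp {c \<in> RC. deg CA c = deg CA a + bd Y} (ext a Y)"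
  proof
    fix v assume v: "v \<in> Poly_Mapping.keys (ext a Y)"
    have "wdeg H v = wdeg H a + bd Y" "v \<in> lists (rbasis H)" "length v \<ge> length a"
      using subsetD[OF 1 v] subsetD[OF 2 v] by auto
    moreover have "a \<noteq> []" by (rule RC_D(3)[OF a])
    ultimately show "v \<in> {c \<in> RC. deg CA c = deg CA a + bd Y}" by (auto simp: rbasis_cobar)
  qed
qed simp

lemma lin_ext_Nil: "lin (ext []) p = lk p [] \<cdot> bvec []"
  by (rule lmap_eqI[of _ _ p]) (intro lmap_intros | simp add: ext_Nil_left lookup_bvec)+

lemma lin_ext_single: "lin (ext [c]) p = lk p [] \<cdot> bvec [c] + lin (diamond H c) (core p)"
proof (rule lmap_eqI[of _ _ p])
  fix q
  show "lin (ext [c]) (bvec q) = lk (bvec q) [] \<cdot> bvec [c] + lin (diamond H c) (core (bvec q))"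
    by (cases q rule: remdups_adj.cases) (simp_all add: core_bvec lookup_bvec)
qed (intro lmap_intros)+

text \<open>Inserting into a letter c' x means that c' acts on what is inserted into x, by
  associativity of the action. The coproduct factors of \<open>c\<close> thus follow the letters of
  \<open>b\<close> also after the insertion.\<close>

lemma ext_diamond:
  "c \<in> B \<Longrightarrow> b \<in> lists B \<Longrightarrow> Z \<in> lists (lists B) \<Longrightarrow>
    lin (\<lambda>w. ext w Z) (diamond H c b) = lin (diamond H c) (ext b Z)"
proof (induct b arbitrary: c Z)
  case Nil
  then show ?case by (auto simp: diamond_Nil ext_Nil_left)
next
  case (Cons x b)
  have x: "x \<in> B" "b \<in> lists B" using Cons by simp_all
  have 1: "lin (\<lambda>w. ext w Z) (letter (mult H a x)) = lin (diamond H a) (ext [x] Z)"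
    if "a \<in> B" "Z \<in> lists (lists B)" for a Z
  proof (cases Z rule: remdups_adj.cases)
    case (2 z)
    then show ?thesis using that x by (simp add: letter_def lin_lin diamond_diamond)
  qed (use that x in \<open>simp_all add: letter_def lin_lin diamond_single[unfolded letter_def]\<close>)
  have WHx: "WH (deg H x - 1 + bd Z1) (ext [x] Z1)" if "Z1 \<in> lists (lists B)" for Z1
    using WH_ext[OF _ that, of "[x]"] x by simp
  have "lin (\<lambda>w. ext w Z) (diamond H c (x # b)) = hsw c (\<lambda>c1 c2. cuts Z (\<lambda>Z1 Z2.
     ksign (bd Z1 * wdeg H b + deg H c2 * (deg H x - 1 + bd Z1)) \<cdot>
       (lin (diamond H c1) (ext [x] Z1) \<odot> lin (diamond H c2) (ext b Z2))))"
    unfolding diamond_Cons[OF Cons(2)] lin_sw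
  proof (rule hsw_cong[OF Cons(2)])
    fix c1 c2 assume c: "c1 \<in> B" "c2 \<in> B"
    have s: "supp {w. wdeg H w = deg H c2 + wdeg H b} (diamond H c2 b)"
      using WH_diamond[OF c(2) x(2)] by auto
    show "lin (\<lambda>w. ext w Z) (ksign (deg H c2 * (deg H x - 1)) \<cdot> (letter (mult H c1 x) \<odot> diamond H c2 b)) =
      cuts Z (\<lambda>Z1 Z2. ksign (bd Z1 * wdeg H b + deg H c2 * (deg H x - 1 + bd Z1)) \<cdot>
       (lin (diamond H c1) (ext [x] Z1) \<odot> lin (diamond H c2) (ext b Z2)))"
      unfolding lin_scale ext_conc[OF s] scale_cuts
    proof (rule cuts_cong)
      fix Z1 Z2 assume "Z1 @ Z2 = Z"
      then have Z: "Z1 \<in> lists (lists B)" "Z2 \<in> lists (lists B)" using Cons(4) by auto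
      show "ksign (deg H c2 * (deg H x - 1)) \<cdot> ksign (bd Z1 * (deg H c2 + wdeg H b)) \<cdot>
        (lin (\<lambda>w. ext w Z1) (letter (mult H c1 x)) \<odot> lin (\<lambda>w. ext w Z2) (diamond H c2 b)) =
        ksign (bd Z1 * wdeg H b + deg H c2 * (deg H x - 1 + bd Z1)) \<cdot>
       (lin (diamond H c1) (ext [x] Z1) \<odot> lin (diamond H c2) (ext b Z2))"
        by (simp add: 1[OF c(1) Z(1)] Cons(1)[OF c(2) x(2) Z(2)] ksign_expand)
    qed
  qed
  also have "\<dots> = lin (diamond H c) (ext (x # b) Z)"
    unfolding ext_Cons_cuts[of x b Z] lin_cuts lin_scale
  proof -
    have "cuts Z (\<lambda>Z1 Z2. ksign (bd Z1 * wdeg H b) \<cdot> lin (diamond H c) (ext [x] Z1 \<odot> ext b Z2)) =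
      cuts Z (\<lambda>Z1 Z2. hsw c (\<lambda>c1 c2. ksign (bd Z1 * wdeg H b + deg H c2 * (deg H x - 1 + bd Z1)) \<cdot>
       (lin (diamond H c1) (ext [x] Z1) \<odot> lin (diamond H c2) (ext b Z2))))"
    proof (rule cuts_cong)
      fix Z1 Z2 assume "Z1 @ Z2 = Z"
      then have Z: "Z1 \<in> lists (lists B)" using Cons(4) by auto
      show "ksign (bd Z1 * wdeg H b) \<cdot> lin (diamond H c) (ext [x] Z1 \<odot> ext b Z2) =
        hsw c (\<lambda>c1 c2. ksign (bd Z1 * wdeg H b + deg H c2 * (deg H x - 1 + bd Z1)) \<cdot>
         (lin (diamond H c1) (ext [x] Z1) \<odot> lin (diamond H c2) (ext b Z2)))"
        unfolding act_conc[OF Cons(2) WHx[OF Z]] scale_sw by (simp add: ksign_mult)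
    qed
    also have "\<dots> = hsw c (\<lambda>c1 c2. cuts Z (\<lambda>Z1 Z2. ksign (bd Z1 * wdeg H b + deg H c2 * (deg H x - 1 + bd Z1)) \<cdot>
       (lin (diamond H c1) (ext [x] Z1) \<odot> lin (diamond H c2) (ext b Z2))))"
      unfolding sw_def case_prod_unfold by (rule cuts_lin)
    finally show "hsw c (\<lambda>c1 c2. cuts Z (\<lambda>Z1 Z2. ksign (bd Z1 * wdeg H b + deg H c2 * (deg H x - 1 + bd Z1)) \<cdot>
       (lin (diamond H c1) (ext [x] Z1) \<odot> lin (diamond H c2) (ext b Z2)))) =
       cuts Z (\<lambda>Z1 Z2. ksign (bd Z1 * wdeg H b) \<cdot> lin (diamond H c) (ext [x] Z1 \<odot> ext b Z2))" by simp
  qed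
  finally show ?case .
qed

lemma lists_RC_D: "Y \<in> lists RC \<Longrightarrow> Y \<in> lists (lists B)"
  using RC_D(2) by auto

text \<open>A single letter accepts at most one argument, so it sees only the corestriction of
  \<open>mu Y Z\<close> and its coefficient at the empty word. Longer words follow because
  \<open>mu\<close> is a coalgebra map.\<close>

lemma ext_ext:
  "w \<in> lists B \<Longrightarrow> Y \<in> lists RC \<Longrightarrow> Z \<in> lists RC \<Longrightarrow>
    lin (\<lambda>v. ext v Z) (ext w Y) = lin (ext w) (CA.mu Y Z)"
proof (induct w arbitrary: Y Z)
  case Nil
  then show ?case by (simp add: ext_Nil_left[of Y] lin_ext_Nil CA.lookup_mu_Nil) (simp add: ext_Nil_left)
next
  case (Cons c w)
  then have c: "c \<in> B" "w \<in> lists B" by simp_all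
  have 1: "lin (\<lambda>v. ext v Z) (ext [c] Y) = lin (ext [c]) (CA.mu Y Z)"
    if YZ: "Y \<in> lists RC" "Z \<in> lists RC" for Y Z
  proof (cases Y rule: remdups_adj.cases)
    case 1
    then show ?thesis by (simp add: CA.mu_Nil_left)
  next
    case (2 b)
    then have b: "b \<in> RC" using YZ by simp
    show ?thesis unfolding 2
      by (simp add: lin_ext_single CA.core_mu CA.lookup_mu_Nil CA.p1_single[OF b]
          ext_diamond[OF c(1) RC_D(2)[OF b] lists_RC_D[OF YZ(2)]])
  next
    case (3 x y Y')
    then show ?thesis
      by (simp add: lin_ext_single CA.core_mu CA.lookup_mu_Nil G_corestriction_simps)
  qed
  have "lin (\<lambda>v. ext v Z) (ext (c # w) Y) = cuts2 Y Z (\<lambda>Y1 Z1 Y2 Z2.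
     ksign (bd Y1 * wdeg H w + bd Z1 * (wdeg H w + bd Y2)) \<cdot>
     (lin (\<lambda>v. ext v Z1) (ext [c] Y1) \<odot> lin (\<lambda>v. ext v Z2) (ext w Y2)))"
    unfolding ext_Cons_cuts[of c w Y] lin_cuts cuts2_def
  proof (rule cuts_cong)
    fix Y1 Y2 assume "Y1 @ Y2 = Y"
    then have "Y2 \<in> lists RC" using Cons(3) by auto
    then have "WH (wdeg H w + bd Y2) (ext w Y2)" by (intro WH_ext c lists_RC_D)
    then have s: "supp {v. wdeg H v = wdeg H w + bd Y2} (ext w Y2)" by auto
    show "lin (\<lambda>v. ext v Z) (ksign (bd Y1 * wdeg H w) \<cdot> (ext [c] Y1 \<odot> ext w Y2)) =
      cuts Z (\<lambda>Z1 Z2. ksign (bd Y1 * wdeg H w + bd Z1 * (wdeg H w + bd Y2)) \<cdot>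
     (lin (\<lambda>v. ext v Z1) (ext [c] Y1) \<odot> lin (\<lambda>v. ext v Z2) (ext w Y2)))"
      by (simp add: lin_scale ext_conc[OF s] scale_cuts ksign_mult)
  qed
  also have "\<dots> = cuts2 Y Z (\<lambda>Y1 Z1 Y2 Z2. ksign (bd Y2 * bd Z1) \<cdot>
     lin (\<lambda>q1. lin (\<lambda>q2. ksign (bd q1 * wdeg H w) \<cdot> (ext [c] q1 \<odot> ext w q2)) (CA.mu Y2 Z2)) (CA.mu Y1 Z1))"
  proof (rule cuts2_cong)
    fix Y1 Y2 Z1 Z2 assume "Y1 @ Y2 = Y" "Z1 @ Z2 = Z"
    then have R: "Y1 \<in> lists RC" "Y2 \<in> lists RC" "Z1 \<in> lists RC" "Z2 \<in> lists RC" using Cons(3,4) by auto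
    have "lin (\<lambda>q1. lin (\<lambda>q2. ksign (bd q1 * wdeg H w) \<cdot> (ext [c] q1 \<odot> ext w q2)) (CA.mu Y2 Z2)) (CA.mu Y1 Z1) =
      lin (\<lambda>q1. lin (\<lambda>q2. ksign ((bd Y1 + bd Z1) * wdeg H w) \<cdot> (ext [c] q1 \<odot> ext w q2)) (CA.mu Y2 Z2)) (CA.mu Y1 Z1)"
      by (rule lin_cong_supp[OF CA.supp_mu[OF R(1,3)]]) auto
    also have "\<dots> = ksign ((bd Y1 + bd Z1) * wdeg H w) \<cdot> (lin (ext [c]) (CA.mu Y1 Z1) \<odot> lin (ext w) (CA.mu Y2 Z2))"
      by (simp add: lin_fun_scale conc_lin_left conc_lin_right) (subst lin_swap, rule refl)
    finally show "ksign (bd Y1 * wdeg H w + bd Z1 * (wdeg H w + bd Y2)) \<cdot>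
     (lin (\<lambda>v. ext v Z1) (ext [c] Y1) \<odot> lin (\<lambda>v. ext v Z2) (ext w Y2)) =
     ksign (bd Y2 * bd Z1) \<cdot>
     lin (\<lambda>q1. lin (\<lambda>q2. ksign (bd q1 * wdeg H w) \<cdot> (ext [c] q1 \<odot> ext w q2)) (CA.mu Y2 Z2)) (CA.mu Y1 Z1)"
      by (simp add: 1[OF R(1,3)] Cons(1)[OF c(2) R(2,4)] ksign_expand)
  qed
  also have "\<dots> = lin (ext (c # w)) (CA.mu Y Z)"
    unfolding ext_Cons_cuts[of c w, abs_def] CA.mu_deconc by simp
  finally show ?case .
qed

end

section \<open>The differential of Kadeishvili's operations\<close>

context bialgebra
begin

lemma cobar_diff_eq_ud: "cobar_diff (coalg_part H) w = ud w - bvec (one H # w) + ksign (wdeg H w) \<cdot> bvec (w @ [one H])"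
  using cobar_diff_eq[of w] by simp

lemma lin_cobar_diff: "WH k p \<Longrightarrow> lin (cobar_diff (coalg_part H)) p =
    lin ud p - bvec [one H] \<odot> p + ksign k \<cdot> (p \<odot> bvec [one H])"
  by (rule lmap_eqI[of _ _ p], intro lmap_intros, intro lmap_intros) (auto simp: cobar_diff_eq_ud)

text \<open>One argument: the coproduct of \<open>c\<close> accounts for the difference between
  \<open>ud\<close> and the reduced differential of \<open>b\<close>. Two arguments: it matches the
  product of the arguments in the bar differential. With more arguments every term is zero.\<close>

lemma ud_ext_single:
  assumes c: "c \<in> B" and Y: "Y \<in> lists RC"
  shows "lin ud (ext [c] Y) = lin (\<lambda>v. ext v Y) (ud [c]) + ksign (deg H c - 1) \<cdot> lin (ext [c]) (bar_diff CA Y)"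
proof -
  have ext_d: "lin (\<lambda>v. ext v Y) (letter (diff H c)) = lin (\<lambda>y. ext [y] Y) (diff H c)"
    by (simp add: letter_def lin_lin)
  have udc: "lin (\<lambda>v. ext v Y) (ud [c]) = - lin (\<lambda>y. ext [y] Y) (diff H c)
      + hsw c (\<lambda>c1 c2. ksign (deg H c1) \<cdot> ext [c1, c2] Y)"
    by (simp add: ucobar_gen_def lin_add lin_diff lin_minus ext_d lin_sw lin_scale)
  have c2: "ext [c1, c2] [b] = bvec [c1] \<odot> diamond H c2 b + ksign ((wdeg H b + 1) * (deg H c2 - 1)) \<cdot> (diamond H c1 b \<odot> bvec [c2])" for c1 c2 b
    by (simp add: ext_Cons[of c1 "[c2]"])
  consider "Y = []" | b where "Y = [b]" | b1 b2 where "Y = [b1, b2]" | "length Y \<ge> 3"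
    by (cases Y rule: remdups_adj.cases; cases "tl (tl Y)") auto
  then show ?thesis
  proof cases
    case 2
    then have b: "b \<in> lists B" using Y RC_D(2) by simp
    \<comment> \<open>A unit letter at either end of \<open>b\<close> takes up one coproduct factor
      of \<open>c\<close> and becomes that factor. These are the terms by which the reduced
      differential of \<open>b\<close> differs from \<open>ud\<close>.\<close>
    have e1: "diamond H c (one H # b) = hsw c (\<lambda>c1 c2. ksign (deg H c2) \<cdot> (bvec [c1] \<odot> diamond H c2 b))"
      unfolding diamond_Cons[OF c] by (rule hsw_cong[OF c]) simp
    have e2: "diamond H c (b @ [one H]) = hsw c (\<lambda>c1 c2. ksign (deg H c2 * wdeg H b) \<cdot> (diamond H c1 b \<odot> bvec [c2]))"
      unfolding diamond_append[OF c] by (rule hsw_cong[OF c]) simp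
    have "hsw c (\<lambda>c1 c2. ksign (deg H c1) \<cdot> ext [c1, c2] [b]) =
       ksign (deg H c) \<cdot> diamond H c (one H # b) - ksign (deg H c + wdeg H b) \<cdot> diamond H c (b @ [one H])"
      unfolding e1 e2 scale_sw sw_diff[symmetric] c2
      by (rule hsw_cong[OF c]) (simp add: ksign_expand scale_add scale_diff scale_minus)
    then have "lin (\<lambda>v. ext v Y) (ud [c]) = - lin (\<lambda>y. diamond H y b) (diff H c)
       + ksign (deg H c) \<cdot> (diamond H c (one H # b) - ksign (wdeg H b) \<cdot> diamond H c (b @ [one H]))"
      unfolding udc by (simp add: 2 scale_diff ksign_mult)
    moreover have "lin (ext [c]) (bar_diff CA Y) = - lin (diamond H c) (cobar_diff (coalg_part H) b)"
      by (simp add: 2 bar_diff_Cons merge_def lin_minus letter_def lin_lin)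
    ultimately show ?thesis unfolding cobar_diff_eq_ud
      by (simp add: 2 ud_diamond[OF c b] linear_simps ksign_odd del: ucobar_diff.simps)
  next
    case 3
    have z: "ext [y] Y = 0" for y by (simp add: 3)
    have "ext [c1, c2] Y = ksign ((wdeg H b1 + 1) * (deg H c2 - 1)) \<cdot> (diamond H c1 b1 \<odot> diamond H c2 b2)" for c1 c2
      by (simp add: 3 ext_Cons[of c1 "[c2]"])
    then have 1: "lin (\<lambda>v. ext v Y) (ud [c]) =
        hsw c (\<lambda>c1 c2. ksign (deg H c1 + (wdeg H b1 + 1) * (deg H c2 - 1)) \<cdot> (diamond H c1 b1 \<odot> diamond H c2 b2))"
      unfolding udc z by (simp add: ksign_mult)
    have "lin (ext [c]) (bar_diff CA Y) = ksign (wdeg H b1 + 1) \<cdot> diamond H c (b1 @ b2)"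
      by (simp add: 3 bar_diff_Cons merge_def linear_simps letter_def conc_eq_lin)
    also have "\<dots> = hsw c (\<lambda>c1 c2. ksign (wdeg H b1 + 1 + deg H c2 * wdeg H b1) \<cdot> (diamond H c1 b1 \<odot> diamond H c2 b2))"
      unfolding diamond_append[OF c] scale_sw by (simp add: ksign_mult)
    finally have 2: "ksign (deg H c - 1) \<cdot> lin (ext [c]) (bar_diff CA Y) =
        - hsw c (\<lambda>c1 c2. ksign (deg H c1 + (wdeg H b1 + 1) * (deg H c2 - 1)) \<cdot> (diamond H c1 b1 \<odot> diamond H c2 b2))"
      unfolding sw_minus[symmetric]
      by (simp only: scale_sw, intro hsw_cong[OF c]) (simp add: ksign_expand scale_minus scale_diff)
    show ?thesis unfolding 1 2 by (simp add: z)
  next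
    case 4
    have z: "ext w Y = 0" if "length w \<le> 2" for w by (rule ext_short) (use 4 that in simp)
    have "lin (ext [c]) (bar_diff CA Y) = 0"
    proof (rule lin_eq_0[OF CA.supp_bar_diff[OF Y]])
      fix q assume "q \<in> {w \<in> lists RC. bd w = bd Y - 1 \<and> length Y \<le> Suc (length w)}"
      then show "ext [c] q = 0" using 4 by (intro ext_short) auto
    qed
    then show ?thesis unfolding udc by (simp add: z)
  qed simp
qed

text \<open>The multiplication terms of \<open>E_diff\<close> are absent here; they arise only from
  the commutator with the unit letter, in \<open>cobar_diff_ext\<close>.\<close>

lemma ud_ext:
  "w \<in> lists B \<Longrightarrow> Y \<in> lists RC \<Longrightarrow>
    lin ud (ext w Y) = lin (\<lambda>v. ext v Y) (ud w) + ksign (wdeg H w) \<cdot> lin (ext w) (bar_diff CA Y)"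
proof (induct w arbitrary: Y)
  case Nil
  then show ?case by (simp add: ext_Nil_left[of Y] lin_ext_Nil lookup_bar_diff_Nil)
next
  case (Cons c w)
  have c: "c \<in> B" "w \<in> lists B" using Cons by simp_all
  have WHg: "supp {v. wdeg H v = wdeg H w} (bvec w)" by (rule supp_bvec) simp
  have WHu: "supp {v. wdeg H v = wdeg H w - 1} (ud w)"
    using whomog_ucobar_diff[of w] c by auto
  let ?s = "\<lambda>Y1. ksign (bd Y1 * wdeg H w)"
  have A1: "lin (\<lambda>v. ext v Y) (ud (c # w)) = cuts Y (\<lambda>Y1 Y2. ?s Y1 \<cdot> (lin (\<lambda>v. ext v Y1) (ud [c]) \<odot> ext w Y2)
      + ksign (deg H c - 1) \<cdot> ksign (bd Y1 * (wdeg H w - 1)) \<cdot> (ext [c] Y1 \<odot> lin (\<lambda>v. ext v Y2) (ud w)))"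
    by (simp add: lin_add lin_scale ext_conc[OF WHg] ext_conc[OF WHu] cuts_add scale_cuts)
  have A2: "lin (ext (c # w)) (bar_diff CA Y) = cuts Y (\<lambda>Y1 Y2.
      ksign ((bd Y1 - 1) * wdeg H w) \<cdot> (lin (ext [c]) (bar_diff CA Y1) \<odot> ext w Y2)
      + ksign (bd Y1) \<cdot> ?s Y1 \<cdot> (ext [c] Y1 \<odot> lin (ext w) (bar_diff CA Y2)))"
    unfolding ext_Cons_cuts[of c w, abs_def] bar_coderivation
  proof (rule cuts_cong)
    fix Y1 Y2 assume "Y1 @ Y2 = Y"
    then have "Y1 \<in> lists RC" using Cons(3) by auto
    have "lin (\<lambda>u. ?s u \<cdot> (ext [c] u \<odot> ext w Y2)) (bar_diff CA Y1) =
       lin (\<lambda>u. ksign ((bd Y1 - 1) * wdeg H w) \<cdot> (ext [c] u \<odot> ext w Y2)) (bar_diff CA Y1)"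
      by (rule lin_cong_supp[OF CA.supp_bar_diff[OF \<open>Y1 \<in> lists RC\<close>]]) auto
    then show "lin (\<lambda>u. ?s u \<cdot> (ext [c] u \<odot> ext w Y2)) (bar_diff CA Y1) +
        ksign (bd Y1) \<cdot> lin (\<lambda>Y2. ?s Y1 \<cdot> (ext [c] Y1 \<odot> ext w Y2)) (bar_diff CA Y2) =
      ksign ((bd Y1 - 1) * wdeg H w) \<cdot> (lin (ext [c]) (bar_diff CA Y1) \<odot> ext w Y2)
      + ksign (bd Y1) \<cdot> ?s Y1 \<cdot> (ext [c] Y1 \<odot> lin (ext w) (bar_diff CA Y2))"
      by (simp add: lin_fun_scale conc_lin_left conc_lin_right)
  qed
  have "lin ud (ext (c # w) Y) = cuts Y (\<lambda>Y1 Y2. ?s Y1 \<cdot> (lin ud (ext [c] Y1) \<odot> ext w Y2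
      + ksign (deg H c - 1 + bd Y1) \<cdot> (ext [c] Y1 \<odot> lin ud (ext w Y2))))"
    unfolding ext_Cons_cuts[of c w] lin_cuts lin_scale
  proof (rule cuts_cong)
    fix Y1 Y2 assume "Y1 @ Y2 = Y"
    then have "Y1 \<in> lists RC" using Cons(3) by auto
    then have "WH (deg H c - 1 + bd Y1) (ext [c] Y1)"
      using WH_ext[of "[c]" Y1] lists_RC_D c by simp
    then show "?s Y1 \<cdot> lin ud (ext [c] Y1 \<odot> ext w Y2) = ?s Y1 \<cdot> (lin ud (ext [c] Y1) \<odot> ext w Y2
      + ksign (deg H c - 1 + bd Y1) \<cdot> (ext [c] Y1 \<odot> lin ud (ext w Y2)))"
      using ucobar_leibniz_whomog[of "ext [c] Y1" "deg H c - 1 + bd Y1" "ext w Y2"] by simp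
  qed
  also have "\<dots> = lin (\<lambda>v. ext v Y) (ud (c # w)) + ksign (wdeg H (c # w)) \<cdot> lin (ext (c # w)) (bar_diff CA Y)"
    unfolding A1 A2 scale_cuts cuts_add[symmetric]
  proof (rule cuts_cong)
    fix Y1 Y2 assume "Y1 @ Y2 = Y"
    then have R: "Y1 \<in> lists RC" "Y2 \<in> lists RC" using Cons(3) by auto
    show "?s Y1 \<cdot> (lin ud (ext [c] Y1) \<odot> ext w Y2
      + ksign (deg H c - 1 + bd Y1) \<cdot> (ext [c] Y1 \<odot> lin ud (ext w Y2))) =
      ?s Y1 \<cdot> (lin (\<lambda>v. ext v Y1) (ud [c]) \<odot> ext w Y2)
      + ksign (deg H c - 1) \<cdot> ksign (bd Y1 * (wdeg H w - 1)) \<cdot> (ext [c] Y1 \<odot> lin (\<lambda>v. ext v Y2) (ud w)) +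
      ksign (wdeg H (c # w)) \<cdot> (ksign ((bd Y1 - 1) * wdeg H w) \<cdot> (lin (ext [c]) (bar_diff CA Y1) \<odot> ext w Y2)
      + ksign (bd Y1) \<cdot> ?s Y1 \<cdot> (ext [c] Y1 \<odot> lin (ext w) (bar_diff CA Y2)))"
      unfolding ud_ext_single[OF c(1) R(1)] Cons(1)[OF c(2) R(2)]
      by (simp add: conc_add_left conc_add_right conc_scale_left conc_scale_right conc_diff_left
          conc_diff_right conc_minus_left conc_minus_right scale_add scale_diff scale_minus ksign_expand del: ucobar_diff.simps)
  qed
  finally show ?case .
qed

lemma ext_one_single:
  assumes "Y \<in> lists RC"
  shows "ext [one H] Y = (if Y = [] then bvec [one H] else 0) + core (bvec Y)"
proof (cases Y rule: remdups_adj.cases)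
  case (2 y)
  then have "y \<in> lists B" using assms RC_D(2) by simp
  then show ?thesis by (simp add: 2 core_bvec diamond_one)
qed (simp_all add: core_bvec)

text \<open>The unit acts as the identity, so an argument inserted into the leading unit letter
  simply replaces it. This is the source of the products with one argument on the outside.\<close>

lemma ext_one_Cons:
  assumes "Y \<in> lists RC"
  shows "ext (one H # w) Y = bvec [one H] \<odot> ext w Y + cuts Y (\<lambda>Y1 Y2. ksign (bd Y1 * wdeg H w) \<cdot> (core (bvec Y1) \<odot> ext w Y2))"
proof -
  have "ext (one H # w) Y = cuts Y (\<lambda>Y1 Y2. (if Y1 = [] then bvec [one H] \<odot> ext w Y2 else 0)
      + ksign (bd Y1 * wdeg H w) \<cdot> (core (bvec Y1) \<odot> ext w Y2))"
    unfolding ext_Cons_cuts[of "one H" w]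
  proof (rule cuts_cong)
    fix Y1 Y2 assume "Y1 @ Y2 = Y"
    then have "Y1 \<in> lists RC" using assms by auto
    then show "ksign (bd Y1 * wdeg H w) \<cdot> (ext [one H] Y1 \<odot> ext w Y2) = (if Y1 = [] then bvec [one H] \<odot> ext w Y2 else 0)
      + ksign (bd Y1 * wdeg H w) \<cdot> (core (bvec Y1) \<odot> ext w Y2)"
      by (simp add: ext_one_single conc_add_left scale_add)
  qed
  also have "\<dots> = bvec [one H] \<odot> ext w Y + cuts Y (\<lambda>Y1 Y2. ksign (bd Y1 * wdeg H w) \<cdot> (core (bvec Y1) \<odot> ext w Y2))"
    unfolding cuts_add by (subst cuts_left) simp_all
  finally show ?thesis .
qed

lemma ext_append_one:
  assumes "Y \<in> lists RC"
  shows "ext (w @ [one H]) Y = ksign (bd Y) \<cdot> (ext w Y \<odot> bvec [one H]) + cuts Y (\<lambda>Y1 Y2. ksign (bd Y1) \<cdot> (ext w Y1 \<odot> core (bvec Y2)))"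
proof -
  have "ext (w @ [one H]) Y = cuts Y (\<lambda>Y1 Y2. (if Y2 = [] then ksign (bd Y1) \<cdot> (ext w Y1 \<odot> bvec [one H]) else 0)
      + ksign (bd Y1) \<cdot> (ext w Y1 \<odot> core (bvec Y2)))"
    unfolding ext_append
  proof (rule cuts_cong)
    fix Y1 Y2 assume "Y1 @ Y2 = Y"
    then have "Y2 \<in> lists RC" using assms by auto
    then show "ksign (bd Y1 * wdeg H [one H]) \<cdot> (ext w Y1 \<odot> ext [one H] Y2) = (if Y2 = [] then ksign (bd Y1) \<cdot> (ext w Y1 \<odot> bvec [one H]) else 0)
      + ksign (bd Y1) \<cdot> (ext w Y1 \<odot> core (bvec Y2))"
      by (simp add: ext_one_single conc_add_right scale_add)
  qed
  also have "\<dots> = ksign (bd Y) \<cdot> (ext w Y \<odot> bvec [one H]) + cuts Y (\<lambda>Y1 Y2. ksign (bd Y1) \<cdot> (ext w Y1 \<odot> core (bvec Y2)))"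
    unfolding cuts_add by (subst cuts_right) simp_all
  finally show ?thesis .
qed

lemma cobar_diff_ext:
  assumes w: "w \<in> lists B" and Y: "Y \<in> lists RC"
  shows "lin (cobar_diff (coalg_part H)) (ext w Y) = lin (\<lambda>v. ext v Y) (cobar_diff (coalg_part H) w)
    + ksign (wdeg H w) \<cdot> lin (ext w) (bar_diff CA Y)
    + cuts Y (\<lambda>Y1 Y2. ksign (bd Y1 * wdeg H w) \<cdot> (core (bvec Y1) \<odot> ext w Y2)
        - ksign (wdeg H w + bd Y1) \<cdot> (ext w Y1 \<odot> core (bvec Y2)))"
  unfolding lin_cobar_diff[OF WH_ext[OF w lists_RC_D[OF Y]]] cobar_diff_eq_ud ud_ext[OF w Y]
    lin_add lin_diff lin_scale lin_bvec ext_one_Cons[OF Y] ext_append_one[OF Y]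
  by (simp add: scale_add cuts_diff scale_cuts ksign_mult)

text \<open>Reducedness in degree 1 makes every desuspended letter positive in degree, so the empty
  word is the only one of degree 0.\<close>

lemma connected_cobar:
  assumes "n_reduced 1 H"
  shows "connected (cobar (coalg_part H))"
proof -
  have d: "deg H c \<ge> 2" if "c \<in> rbasis H" for c
    using assms that by (auto simp: n_reduced_def rbasis_def)
  have "wdeg H w \<ge> int (length w)" if "w \<in> lists (rbasis H)" for w
    using that by (induct w) (use d in force)+
  then show ?thesis by (fastforce simp: n_reduced_def)
qed

theorem kadeishvili_brace:
  assumes "n_reduced 1 H"
  shows "brace (cobar (coalg_part H)) (kadeishvili H)"
proof unfold_locales
  show "connected CA" by (rule connected_cobar[OF assms])
next
  fix a b Y
  show "lin (\<lambda>c. ext c Y) (mult CA a b) = cuts Y (\<lambda>Y1 Y2. ksign (bd Y1 * deg CA b) \<cdot> bilin (mult CA) (ext a Y1) (ext b Y2))"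
    by (simp add: ext_append conc_eq_lin)
next
  fix a Y assume "a \<in> RC" "Y \<in> lists RC"
  then show "lin (diff CA) (ext a Y) = lin (\<lambda>c. ext c Y) (diff CA a) + ksign (deg CA a) \<cdot> lin (ext a) (bar_diff CA Y) +
      cuts Y (\<lambda>Y1 Y2. ksign (bd Y1 * deg CA a) \<cdot> bilin (mult CA) (core (bvec Y1)) (ext a Y2)
        - ksign (deg CA a + bd Y1) \<cdot> bilin (mult CA) (ext a Y1) (core (bvec Y2)))"
    using cobar_diff_ext[OF RC_D(2)] by (simp add: conc_eq_lin)
next
  fix a Y Z assume "a \<in> RC" "Y \<in> lists RC" "Z \<in> lists RC"
  then show "lin (\<lambda>c. ext c Z) (ext a Y) = lin (ext a) (G_mult CA ext Y Z)"
    by (intro ext_ext RC_D(2))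
qed

end

section \<open>Cocommutative Hopf algebras\<close>

text \<open>In general the antipode reverses coproducts; with cocommutativity it is a coalgebra map,
  which is the form used. Its properties are assumptions of the locale since for the tensor Hopf
  algebra each can be verified on the explicit formula.\<close>

locale cocomm_hopf = bialgebra H for H :: "('b, 'r::comm_ring_1) dgbialg" +
  assumes cocomm: "x \<in> basis H \<Longrightarrow>
      bcomult H x = lin (\<lambda>(a, b). ksign (deg H a * deg H b) \<cdot> bvec (b, a)) (bcomult H x)"
    and supp_S: "x \<in> basis H \<Longrightarrow> supp {s \<in> basis H. deg H s = deg H x} (antipode H x)"
    and S_comult: "x \<in> basis H \<Longrightarrow> lin (bcomult H) (antipode H x) =
      lin (\<lambda>(a, b). tensor (antipode H a) (antipode H b)) (bcomult H x)"
    and S_diff: "x \<in> basis H \<Longrightarrow> lin (antipode H) (diff H x) = lin (diff H) (antipode H x)"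
    and S_mult: "x \<in> basis H \<Longrightarrow> y \<in> basis H \<Longrightarrow> lin (antipode H) (mult H x y) =
      ksign (deg H x * deg H y) \<cdot> lin (\<lambda>s. lin (mult H s) (antipode H x)) (antipode H y)"
    and S_left: "x \<in> basis H \<Longrightarrow> lin (\<lambda>(a, b). lin (\<lambda>s. mult H s b) (antipode H a)) (bcomult H x) =
      (if x = one H then bvec (one H) else 0)"
    and red: "n_reduced 1 H"
begin

abbreviation "S \<equiv> antipode H"
abbreviation "e \<equiv> bvec [one H] :: 'b list \<Rightarrow>\<^sub>0 'r"
abbreviation "A x p \<equiv> lin (\<lambda>s. lin (diamond H s) p) (S x)"

lemma hsw_cocomm:
  assumes "x \<in> B" shows "hsw x F = hsw x (\<lambda>a b. ksign (deg H a * deg H b) \<cdot> F b a)"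
proof -
  have "hsw x F = lin (\<lambda>(a, b). F a b) (lin (\<lambda>(a, b). ksign (deg H a * deg H b) \<cdot> bvec (b, a)) (bcomult H x))"
    by (subst cocomm[symmetric, OF assms]) (simp add: sw_def)
  then show ?thesis by (simp add: lin_lin lin_scale case_prod_unfold sw_def)
qed

lemma S_sw: "x \<in> B \<Longrightarrow> lin (\<lambda>s. hsw s F) (S x) = hsw x (\<lambda>a b. lin (\<lambda>s. lin (F s) (S b)) (S a))"
proof -
  assume "x \<in> B"
  then have "lin (\<lambda>(a, b). F a b) (lin (bcomult H) (S x)) =
    lin (\<lambda>(a, b). F a b) (lin (\<lambda>(a, b). tensor (S a) (S b)) (bcomult H x))"
    by (simp only: S_comult)
  then show ?thesis by (simp add: lin_lin case_prod_unfold sw_def lin_tensor)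
qed

lemma S_contract: "x \<in> B \<Longrightarrow> hsw x (\<lambda>a b. lin (\<lambda>s. lin G (mult H s b)) (S a)) = (if x = one H then G (one H) else 0)"
proof -
  assume x: "x \<in> B"
  have "lin G (lin (\<lambda>(a, b). lin (\<lambda>s. mult H s b) (S a)) (bcomult H x)) = (if x = one H then G (one H) else 0)"
    by (simp add: S_left[OF x])
  then show ?thesis by (simp add: lin_lin case_prod_unfold sw_def)
qed

lemma S_one: "S (one H) = bvec (one H)"
proof -
  have "lin (\<lambda>s. mult H s (one H)) (S (one H)) = bvec (one H)"
    using S_contract[of "one H" bvec] by (simp add: hsw_one)
  moreover have "lin (\<lambda>s. mult H s (one H)) (S (one H)) = lin bvec (S (one H))"
    by (rule lin_cong_supp[OF supp_S]) simp_all
  ultimately show ?thesis by simp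
qed

text \<open>The antipode preserves degrees, and the unit is the only basis element of degree
  0.\<close>

lemma S_ne_one: "x \<in> rbasis H \<Longrightarrow> supp (rbasis H) (S x)"
  using supp_S[of x] red by (fastforce simp: rbasis_def n_reduced_def)

lemma A_one: "supp (lists B) p \<Longrightarrow> A (one H) p = p"
proof -
  assume "supp (lists B) p"
  then have "lin (diamond H (one H)) p = lin bvec p"
    by (rule lin_cong_supp) (rule diamond_one)
  then show ?thesis by (simp add: S_one)
qed

text \<open>As S is a coalgebra map, acting through S distributes over concatenation just as the
  action itself does.\<close>

lemma A_conc:
  assumes x: "x \<in> B" and p: "WH k p"
  shows "A x (p \<odot> q) = hsw x (\<lambda>a b. ksign (deg H b * k) \<cdot> (A a p \<odot> A b q))"
proof -
  have "A x (p \<odot> q) = lin (\<lambda>s. hsw s (\<lambda>a b. ksign (deg H b * k) \<cdot> (lin (diamond H a) p \<odot> lin (diamond H b) q))) (S x)"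
    by (rule lin_cong_supp[OF supp_S[OF x]]) (simp add: act_conc[OF _ p])
  also have "\<dots> = hsw x (\<lambda>a b. lin (\<lambda>s. lin (\<lambda>t. ksign (deg H t * k) \<cdot> (lin (diamond H s) p \<odot> lin (diamond H t) q)) (S b)) (S a))"
    by (rule S_sw[OF x])
  also have "\<dots> = hsw x (\<lambda>a b. ksign (deg H b * k) \<cdot> (A a p \<odot> A b q))"
  proof (rule hsw_cong[OF x])
    fix a b assume b: "b \<in> B"
    have "lin (\<lambda>t. ksign (deg H t * k) \<cdot> (lin (diamond H s) p \<odot> lin (diamond H t) q)) (S b) =
       lin (\<lambda>t. ksign (deg H b * k) \<cdot> (lin (diamond H s) p \<odot> lin (diamond H t) q)) (S b)" for s
      by (rule lin_cong_supp[OF supp_S[OF b]]) simp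
    moreover have "A a p \<odot> A b q = lin (\<lambda>s. lin (\<lambda>t. lin (diamond H s) p \<odot> lin (diamond H t) q) (S b)) (S a)"
      unfolding lmap_of_lin[OF lmap_conc_left[OF lmap_id], of _ "S a"]
        lmap_of_lin[OF lmap_conc_right[OF lmap_id], of _ _ "S b"] by (rule lin_swap)
    ultimately show "lin (\<lambda>s. lin (\<lambda>t. ksign (deg H t * k) \<cdot> (lin (diamond H s) p \<odot> lin (diamond H t) q)) (S b)) (S a) =
       ksign (deg H b * k) \<cdot> (A a p \<odot> A b q)"
      by (simp only: lin_fun_scale)
  qed
  finally show ?thesis .
qed

lemma WH_act: "x \<in> B \<Longrightarrow> WH k p \<Longrightarrow> WH (deg H x + k) (lin (diamond H x) p)"
  by (rule supp_lin, assumption) (use WH_diamond in fastforce)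

lemma WH_A:
  assumes "x \<in> B" "WH k p" shows "WH (deg H x + k) (A x p)"
proof (rule supp_lin[OF supp_S[OF assms(1)]])
  fix s assume "s \<in> {s \<in> B. deg H s = deg H x}"
  then show "WH (deg H x + k) (lin (diamond H s) p)" using WH_act[OF _ assms(2), of s] by simp
qed

lemma ud_A:
  assumes x: "x \<in> B" and p: "supp (lists B) p"
  shows "lin ud (A x p) = ksign (deg H x) \<cdot> A x (lin ud p) - lin (\<lambda>y. A y p) (diff H x)"
proof (rule lmap_eqI[of "\<lambda>p. lin ud (A x p)" _ p])
  fix w assume "w \<in> Poly_Mapping.keys p"
  then have w: "w \<in> lists B" using p by blast
  have "lin ud (A x (bvec w)) = lin (\<lambda>s. ksign (deg H x) \<cdot> lin (diamond H s) (ud w) - lin (\<lambda>y. diamond H y w) (diff H s)) (S x)"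
    unfolding lin_lin by (rule lin_cong_supp[OF supp_S[OF x]]) (simp add: ud_diamond w)
  also have "\<dots> = ksign (deg H x) \<cdot> A x (ud w) - lin (\<lambda>y. diamond H y w) (lin (diff H) (S x))"
    by (simp add: lin_fun_diff lin_fun_scale lin_lin)
  also have "lin (\<lambda>y. diamond H y w) (lin (diff H) (S x)) = lin (\<lambda>y. A y (bvec w)) (diff H x)"
    by (simp add: S_diff[OF x, symmetric] lin_lin)
  finally show "lin ud (A x (bvec w)) = ksign (deg H x) \<cdot> A x (lin ud (bvec w)) - lin (\<lambda>y. A y (bvec w)) (diff H x)"
    by simp
qed (intro lmap_intros)+

lemma act_act:
  assumes "s \<in> B" "y \<in> B" "supp (lists B) p"
  shows "lin (diamond H s) (lin (diamond H y) p) = lin (\<lambda>z. lin (diamond H z) p) (mult H s y)"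
proof (rule lmap_eqI[of "\<lambda>p. lin (diamond H s) (lin (diamond H y) p)" _ p])
  fix w assume "w \<in> Poly_Mapping.keys p"
  then have "w \<in> lists B" using assms by blast
  then show "lin (diamond H s) (lin (diamond H y) (bvec w)) = lin (\<lambda>z. lin (diamond H z) (bvec w)) (mult H s y)"
    using assms by (simp add: diamond_diamond)
qed (intro lmap_intros)+

lemma act_A:
  assumes "x \<in> B" "y \<in> B" "supp (lists B) p"
  shows "A x (lin (diamond H y) p) = lin (\<lambda>s. lin (\<lambda>z. lin (diamond H z) p) (mult H s y)) (S x)"
  by (rule lin_cong_supp[OF supp_S[OF assms(1)]]) (simp add: act_act assms)

lemma A_act_contract:
  assumes "x \<in> B" "supp (lists B) p"
  shows "hsw x (\<lambda>a b. A a (lin (diamond H b) p)) = (if x = one H then p else 0)"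
proof -
  have "hsw x (\<lambda>a b. A a (lin (diamond H b) p)) =
      hsw x (\<lambda>a b. lin (\<lambda>s. lin (\<lambda>z. lin (diamond H z) p) (mult H s b)) (S a))"
    by (rule hsw_cong[OF assms(1)]) (simp add: act_A assms(2))
  moreover have "lin (diamond H (one H)) p = p" using A_one[OF assms(2)] by (simp add: S_one)
  ultimately show ?thesis by (simp add: S_contract[OF assms(1)])
qed

text \<open>By cocommutativity the sum is that of S(x') applied to p (x'' y), that is S(x') p times
  S(x'') x''' y. The last two factors contract to the counit, leaving S(x) p times y.\<close>

lemma A_absorb_right:
  assumes x: "x \<in> B" and p: "WH k p" and y: "y \<in> lists B"
  shows "hsw x (\<lambda>a b. ksign (deg H a * (deg H b + k)) \<cdot> A b (p \<odot> diamond H a y)) = A x p \<odot> bvec y"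
proof -
  have supp_y: "supp (lists B) (bvec y)" using y by (rule supp_bvec)
  have d: "diamond H a y = lin (diamond H a) (bvec y)" for a by simp
  have "hsw x (\<lambda>a b. ksign (deg H a * (deg H b + k)) \<cdot> A b (p \<odot> diamond H a y)) =
    hsw x (\<lambda>a b. hsw a (\<lambda>a1 a2. ksign (deg H b * k + deg H a2 * k) \<cdot> (A a1 p \<odot> A a2 (lin (diamond H b) (bvec y)))))"
    unfolding d
    by (subst hsw_cocomm[OF x], rule hsw_cong[OF x], subst A_conc[OF _ p], assumption,
      simp only: scale_sw scale_simps, rule hsw_cong, assumption) (simp add: ksign_expand)
  also have "\<dots> = hsw x (\<lambda>a b. hsw b (\<lambda>b1 b2. ksign (deg H b2 * k + deg H b1 * k) \<cdot> (A a p \<odot> A b1 (lin (diamond H b2) (bvec y)))))"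
    by (rule hsw_coassoc[OF x])
  also have "\<dots> = hsw x (\<lambda>a b. ksign (deg H b * k) \<cdot> (A a p \<odot> (if b = one H then bvec y else 0)))"
  proof (rule hsw_cong[OF x])
    fix a b assume b: "b \<in> B"
    have "hsw b (\<lambda>b1 b2. ksign (deg H b2 * k + deg H b1 * k) \<cdot> (A a p \<odot> A b1 (lin (diamond H b2) (bvec y)))) =
       hsw b (\<lambda>b1 b2. ksign (deg H b * k) \<cdot> (A a p \<odot> A b1 (lin (diamond H b2) (bvec y))))"
      by (rule hsw_cong[OF b]) (simp add: ksign_expand)
    then show "hsw b (\<lambda>b1 b2. ksign (deg H b2 * k + deg H b1 * k) \<cdot> (A a p \<odot> A b1 (lin (diamond H b2) (bvec y)))) =
       ksign (deg H b * k) \<cdot> (A a p \<odot> (if b = one H then bvec y else 0))"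
      by (simp only: scale_sw[symmetric] conc_sw_right[symmetric] A_act_contract[OF b supp_y])
  qed
  also have "\<dots> = A x p \<odot> bvec y"
    by (subst hsw_counit_right[OF x]) auto
  finally show ?thesis .
qed

text \<open>Here S(x') x''' e is multiplied by S(x'') p; cocommutativity exchanges x'' and x''',
  after which S(x') and its neighbour contract.\<close>

lemma A_absorb_left:
  assumes x: "x \<in> B"
  shows "hsw x (\<lambda>a b. A a (bvec [b] \<odot> p)) = ksign (deg H x) \<cdot> (e \<odot> A x p)"
proof -
  \<comment> \<open>A letter b is the result of b acting on the unit letter; this turns the
    splitting of letters by the differential into a statement about the action.\<close>
  have b: "bvec [b] = lin (diamond H b) e" "WH (deg H b - 1) (bvec [b])" if "b \<in> B" for b
    using that by (simp_all add: supp_bvec)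
  have supp_e: "supp (lists B) e" by (rule supp_bvec) simp
  let ?G = "\<lambda>a b c. ksign (deg H c) \<cdot> (A a (lin (diamond H b) e) \<odot> A c p)"
  have "hsw x (\<lambda>a b. A a (bvec [b] \<odot> p)) = hsw x (\<lambda>a b. hsw a (\<lambda>a1 a2. ksign (deg H a2 * deg H b) \<cdot> ?G a1 b a2))"
    by (rule hsw_cong[OF x], subst A_conc[OF _ b(2)], assumption, assumption, rule hsw_cong, assumption)
      (simp only: b(1)[symmetric] scale_simps ksign_mult, rule scale_ksign_cong, simp_all add: algebra_simps)
  also have "\<dots> = hsw x (\<lambda>a b. hsw b (\<lambda>b1 b2. ksign (deg H b1 * deg H b2) \<cdot> ?G a b2 b1))"
    by (rule hsw_coassoc[OF x])
  also have "\<dots> = hsw x (\<lambda>a b. hsw b (\<lambda>b1 b2. ?G a b1 b2))"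
    by (rule hsw_cong[OF x], subst (2) hsw_cocomm, assumption, rule refl)
  also have "\<dots> = hsw x (\<lambda>a b. hsw a (\<lambda>a1 a2. ?G a1 a2 b))"
    by (rule hsw_coassoc[OF x, symmetric])
  also have "\<dots> = hsw x (\<lambda>a b. ksign (deg H b) \<cdot> ((if a = one H then e else 0) \<odot> A b p))"
    by (rule hsw_cong[OF x])
      (simp only: scale_sw[symmetric] conc_sw_left[symmetric] A_act_contract[OF _ supp_e])
  also have "\<dots> = ksign (deg H x) \<cdot> (e \<odot> A x p)"
    by (subst hsw_counit_left[OF x]) auto
  finally show ?thesis .
qed

end

section \<open>Sums over the letters of a word\<close>

fun spl :: "('b list \<Rightarrow> 'b \<Rightarrow> 'b list \<Rightarrow> 'z::comm_monoid_add) \<Rightarrow> 'b list \<Rightarrow> 'z" where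
  "spl F [] = 0"
| "spl F (c # w) = F [] c w + spl (\<lambda>u. F (c # u)) w"

lemma spl_cong: "(\<And>u x v. u @ x # v = w \<Longrightarrow> F u x v = G u x v) \<Longrightarrow> spl F w = spl G w"
proof (induct w arbitrary: F G)
  case (Cons c w)
  have "F [] c w = G [] c w" by (rule Cons.prems) simp
  moreover have "spl (\<lambda>u. F (c # u)) w = spl (\<lambda>u. G (c # u)) w"
    by (rule Cons.hyps, rule Cons.prems) simp
  ultimately show ?case by simp
qed simp

lemma spl_add: "spl (\<lambda>u x v. F u x v + G u x v) w = spl F w + spl G w"
  by (induct w arbitrary: F G) (simp_all add: add_ac)

lemma lmap_of_spl: "lmap g \<Longrightarrow> g (spl F w) = spl (\<lambda>u x v. g (F u x v)) w"
  by (induct w arbitrary: F) (simp_all add: lmap_0 lmap_add)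

lemma spl_minus: "spl (\<lambda>u x v. - F u x v) w = - (spl F w :: 'z::ab_group_add)"
  by (induct w arbitrary: F) simp_all

lemma lin_spl: "lin g (spl F w) = spl (\<lambda>a x b. lin g (F a x b)) w"
  and conc_spl_left: "spl G w \<odot> q = spl (\<lambda>a x b. G a x b \<odot> q) w"
  and conc_spl_right: "q \<odot> spl G w = spl (\<lambda>a x b. q \<odot> G a x b) w"
  and scale_spl: "c \<cdot> spl F w = spl (\<lambda>a x b. c \<cdot> F a x b) w"
  by (rule lmap_of_spl, intro lmap_intros)+

lemma spl_lin: "spl (\<lambda>u x v. lin (F u x v) p) w = lin (\<lambda>y. spl (\<lambda>u x v. F u x v y) w) p"
  by (induct w arbitrary: F) (simp_all add: lin_fun_add)

lemma spl_sw: "spl (\<lambda>u x v. sw C y (F u x v)) w = sw C y (\<lambda>a b. spl (\<lambda>u x v. F u x v a b) w)"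
  by (induct w arbitrary: F) (simp_all add: sw_add)

lemma supp_spl: "(\<And>u x v. u @ x # v = w \<Longrightarrow> supp B (F u x v)) \<Longrightarrow> supp B (spl F w)"
proof (induct w arbitrary: F)
  case (Cons c w)
  have "supp B (F [] c w)" by (rule Cons.prems) simp
  moreover have "supp B (spl (\<lambda>u. F (c # u)) w)"
    by (rule Cons.hyps, rule Cons.prems) simp
  ultimately show ?case by (simp add: supp_add)
qed simp

lemma spl_append: "spl F (a @ b) = spl (\<lambda>u x v. F u x (v @ b)) a + spl (\<lambda>u. F (a @ u)) b"
  by (induct a arbitrary: F) (simp_all add: add.assoc)

lemma spl_eq_sum: "spl F w = (\<Sum>i<length w. F (take i w) (w ! i) (drop (Suc i) w))"
  by (induct w arbitrary: F) (simp_all add: sum.lessThan_Suc_shift del: sum.lessThan_Suc)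

text \<open>The differential hits the part before the chosen letter, the letter itself or the part
  after it. If it splits the chosen letter, either half may be the chosen letter of the new
  word.\<close>

lemma spl_ucobar_diff: "lin (spl F) (ucobar_diff C w) = spl (\<lambda>u x v.
    lin (\<lambda>u'. F u' x v) (ucobar_diff C u)
    + ksign (wdeg C u) \<cdot> (- lin (\<lambda>x'. F u x' v) (diff C x)
        + sw C x (\<lambda>a b. ksign (deg C a) \<cdot> (F u a (b # v) + F (u @ [a]) b v)))
    + ksign (wdeg C u + deg C x - 1) \<cdot> lin (F u x) (ucobar_diff C v)) w"
  for C :: "('b, 'r::comm_ring_1) dgcoalg" and F :: "'b list \<Rightarrow> 'b \<Rightarrow> 'b list \<Rightarrow> ('c \<Rightarrow>\<^sub>0 'r)"
proof (induct w arbitrary: F)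
  case (Cons c w)
  have g: "lin G (ucobar_gen C c \<odot> bvec u) = - lin (\<lambda>x'. G (x' # u)) (diff C c)
      + sw C c (\<lambda>a b. ksign (deg C a) \<cdot> G (a # b # u))" for G :: "'b list \<Rightarrow> ('c \<Rightarrow>\<^sub>0 'r)" and u
    by (simp add: ucobar_gen_def linear_simps letter_def conc_eq_lin lin_sw)
  have i: "lin (spl F) (bvec [c] \<odot> ucobar_diff C w) = lin (F [] c) (ucobar_diff C w) + lin (spl (\<lambda>u. F (c # u))) (ucobar_diff C w)"
    by (simp add: conc_eq_lin lin_lin lin_fun_add)
  have j: "lin G (bvec [c] \<odot> ucobar_diff C u) = lin (\<lambda>u'. G (c # u')) (ucobar_diff C u)" for G :: "'b list \<Rightarrow> ('c \<Rightarrow>\<^sub>0 'r)" and u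
    by (simp add: conc_eq_lin lin_lin)
  have s: "spl (\<lambda>u x v. lin (\<lambda>u'. F u' x v) (ucobar_gen C c \<odot> bvec u)) w =
     - lin (\<lambda>x'. spl (\<lambda>u. F (x' # u)) w) (diff C c) + sw C c (\<lambda>a b. ksign (deg C a) \<cdot> spl (\<lambda>u. F (a # b # u)) w)"
    unfolding g spl_add spl_minus spl_lin spl_sw scale_spl by (simp add: spl_lin[symmetric])
  have "lin (spl F) (ucobar_diff C (c # w)) = - lin (\<lambda>x'. F [] x' w) (diff C c)
      + sw C c (\<lambda>a b. ksign (deg C a) \<cdot> (F [] a (b # w) + F [a] b w))
      + ksign (deg C c - 1) \<cdot> lin (F [] c) (ucobar_diff C w)
      + (spl (\<lambda>u x v. lin (\<lambda>u'. F u' x v) (ucobar_gen C c \<odot> bvec u)) w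
      + ksign (deg C c - 1) \<cdot> lin (spl (\<lambda>u. F (c # u))) (ucobar_diff C w))"
    by (subst s) (simp add: lin_add lin_scale g i lin_fun_add scale_add sw_add add_ac)
  then show ?case
    unfolding Cons scale_spl spl_add[symmetric]
    by (simp add: lin_add lin_scale j scale_add ksign_mult add_ac scale_minus scale_diff algebra_simps)
qed simp

lemma spl_diff: "spl (\<lambda>u x v. F u x v - G u x v) w = spl F w - (spl G w :: 'z::ab_group_add)"
  by (induct w arbitrary: F G) simp_all

section \<open>The rotation operators\<close>

text \<open>
  For \<open>f = bvec\<close> this is the Connes-Moscovici operator; for \<open>f u = E\<^sub>1\<^sub>,\<^sub>1(u; b)\<close> it is the chain
  homotopy between the bracket and the defect of \<open>\<Delta>\<close> from being a derivation.
\<close>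

definition rot :: "('b, 'r::comm_ring_1) dgbialg \<Rightarrow> ('b list \<Rightarrow> ('b list \<Rightarrow>\<^sub>0 'r)) \<Rightarrow> 'b list \<Rightarrow> ('b list \<Rightarrow>\<^sub>0 'r)" where
  "rot H f = spl (\<lambda>u x v. ksign (wdeg H u * (wdeg H v + deg H x - 1) + deg H x) \<cdot>
     lin (\<lambda>s. lin (diamond H s) (bvec v \<odot> f u)) (antipode H x))"

context cocomm_hopf
begin

lemma A_linear:
  "A x (p + q) = A x p + A x q" "A x (p - q) = A x p - A x q" "A x (- p) = - A x p"
  "A x (c \<cdot> p) = c \<cdot> A x p" "A x 0 = 0"
  by (simp_all add: lin_add lin_diff lin_minus lin_scale lin_fun_add lin_fun_diff lin_fun_minus lin_fun_scale)

lemma splitD: "u @ x # v = w \<Longrightarrow> w \<in> lists B \<Longrightarrow>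
    u \<in> lists B \<and> x \<in> B \<and> v \<in> lists B \<and> wdeg H w = wdeg H u + (deg H x - 1) + wdeg H v"
  by auto

lemma WH_bvec_conc: "v \<in> lists B \<Longrightarrow> WH k p \<Longrightarrow> WH (wdeg H v + k) (bvec v \<odot> p)"
  by (rule supp_conc[OF supp_bvec, where A = "{v}"]) auto

lemma WH_rot:
  assumes w: "w \<in> lists B" and f: "\<And>u. u \<in> lists B \<Longrightarrow> WH (wdeg H u + \<phi>) (f u)"
  shows "WH (wdeg H w + 1 + \<phi>) (rot H f w)"
  unfolding rot_def
proof (rule supp_spl, rule supp_scale)
  fix u x v assume "u @ x # v = w"
  note s = splitD[OF this w]
  have "WH (deg H x + (wdeg H v + (wdeg H u + \<phi>))) (A x (bvec v \<odot> f u))"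
    by (intro WH_A WH_bvec_conc f) (use s in auto)
  then show "WH (wdeg H w + 1 + \<phi>) (A x (bvec v \<odot> f u))"
    by (rule supp_mono) (use s in auto)
qed

text \<open>\<open>\<phi>\<close> is the degree of \<open>f\<close>, and \<open>g\<close> measures
  its failure to commute with appending a letter. When the chosen letter is split, one half is
  chosen again and the absorption lemmas turn the other half into a unit letter at an end of the
  result. What remains is a commutator with the unit letter and the defects of
  \<open>f\<close>.\<close>

lemma ud_rot:
  fixes f :: "'b list \<Rightarrow> ('b list \<Rightarrow>\<^sub>0 'r)"
  assumes w: "w \<in> lists B"
    and f1: "\<And>u. u \<in> lists B \<Longrightarrow> WH (wdeg H u + \<phi>) (f u)"
    and f2: "\<And>u x. u \<in> lists B \<Longrightarrow> x \<in> B \<Longrightarrow> f (u @ [x]) = ksign (\<phi> * (deg H x - 1)) \<cdot> (f u \<odot> bvec [x]) + g u x"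
  shows "lin ud (rot H f w) + lin (rot H f) (ud w) =
    e \<odot> rot H f w - ksign (wdeg H w + 1 + \<phi>) \<cdot> (rot H f w \<odot> e)
    + spl (\<lambda>u x v. ksign (wdeg H u * (wdeg H v + deg H x - 1) + wdeg H v) \<cdot>
        A x (bvec v \<odot> (lin ud (f u) - lin f (ud u)))) w
    + spl (\<lambda>u x v. hsw x (\<lambda>a b. ksign (wdeg H u + deg H a + (wdeg H u + deg H a - 1) * (wdeg H v + deg H b - 1) + deg H b) \<cdot>
        A b (bvec v \<odot> g u a))) w"
proof -
  let ?K = "\<lambda>u x v. ksign (wdeg H u * (wdeg H v + deg H x - 1) + deg H x) \<cdot> A x (bvec v \<odot> f u)"
  have K: "rot H f = spl ?K" by (simp add: rot_def)
  show ?thesis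
    unfolding K spl_ucobar_diff lin_spl conc_spl_left conc_spl_right scale_spl spl_diff[symmetric] spl_add[symmetric]
  proof (rule spl_cong, goal_cases)
    case (1 u x v)
    note s = splitD[OF 1 w]
    then have u: "u \<in> lists B" and x: "x \<in> B" and v: "v \<in> lists B" by auto
    let ?p = "bvec v \<odot> f u"
    let ?U = "wdeg H u" and ?V = "wdeg H v" and ?X = "deg H x"
    have p: "WH (?V + (?U + \<phi>)) ?p" by (intro WH_bvec_conc v f1 u)
    then have pB: "supp (lists B) ?p" by (rule supp_mono) auto
    have P1: "lin (\<lambda>u'. ?K u' x v) (ud u) = ksign ((?U - 1) * (?V + ?X - 1) + ?X) \<cdot> A x (bvec v \<odot> lin f (ud u))"
    proof -
      have "lin (\<lambda>u'. ?K u' x v) (ud u) = lin (\<lambda>u'. ksign ((?U - 1) * (?V + ?X - 1) + ?X) \<cdot> A x (bvec v \<odot> f u')) (ud u)"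
        by (rule lin_cong_supp[OF whomog_ucobar_diff]) (use u in auto)
      also have "\<dots> = ksign ((?U - 1) * (?V + ?X - 1) + ?X) \<cdot> A x (bvec v \<odot> lin f (ud u))"
        unfolding lin_fun_scale by (rule arg_cong, rule lmap_of_lin[symmetric], intro lmap_intros)
      finally show ?thesis .
    qed
    have P2: "lin (\<lambda>x'. ?K u x' v) (diff H x) = ksign (?U * (?V + ?X - 2) + ?X - 1) \<cdot> lin (\<lambda>y. A y ?p) (diff H x)"
    proof -
      have "lin (\<lambda>x'. ?K u x' v) (diff H x) = lin (\<lambda>x'. ksign (?U * (?V + ?X - 2) + ?X - 1) \<cdot> A x' ?p) (diff H x)"
        by (rule lin_cong_supp[OF supp_diff[OF x]]) (auto simp: ksign_expand)
      then show ?thesis by (simp only: lin_fun_scale)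
    qed
    have P3: "lin (?K u x) (ud v) = ksign (?U * (?V - 1 + ?X - 1) + ?X) \<cdot> A x (ud v \<odot> f u)"
    proof -
      have "lin (?K u x) (ud v) = lin (\<lambda>v'. ksign (?U * (?V - 1 + ?X - 1) + ?X) \<cdot> A x (bvec v' \<odot> f u)) (ud v)"
        by (rule lin_cong_supp[OF whomog_ucobar_diff]) (use v in auto)
      also have "\<dots> = ksign (?U * (?V - 1 + ?X - 1) + ?X) \<cdot> A x (lin bvec (ud v) \<odot> f u)"
        unfolding lin_fun_scale by (rule arg_cong, rule lmap_of_lin[symmetric, of "\<lambda>q. A x (q \<odot> f u)"], intro lmap_intros)
      finally show ?thesis by simp
    qed
    \<comment> \<open>The first half of the split letter stays chosen, and the second half heads the
      word on which S acts.\<close>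
    have P4: "hsw x (\<lambda>a b. ksign (deg H a) \<cdot> ?K u a (b # v)) = ksign (?U * (?V + ?X) + ?X) \<cdot> (e \<odot> A x ?p)"
    proof -
      have "hsw x (\<lambda>a b. ksign (deg H a) \<cdot> ?K u a (b # v)) = hsw x (\<lambda>a b. ksign (?U * (?V + ?X)) \<cdot> A a (bvec [b] \<odot> ?p))"
        by (rule hsw_cong[OF x]) (simp add: ksign_expand)
      then show ?thesis
        by (simp only: scale_sw[symmetric] A_absorb_left[OF x] scale_simps ksign_mult)
    qed
    \<comment> \<open>The second half stays chosen, and the first half is appended to
      \<open>u\<close>; \<open>f2\<close> moves it out of \<open>f\<close> to the right end, at the
      price of the \<open>g\<close> term.\<close>
    have P5: "hsw x (\<lambda>a b. ksign (deg H a) \<cdot> ?K (u @ [a]) b v) =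
        ksign (?U * ?V + ?U * ?X + ?U + ?V + 1 + \<phi>) \<cdot> (A x ?p \<odot> e)
        + hsw x (\<lambda>a b. ksign (deg H a + (?U + deg H a - 1) * (?V + deg H b - 1) + deg H b) \<cdot> A b (bvec v \<odot> g u a))"
    proof -
      have "hsw x (\<lambda>a b. ksign (deg H a) \<cdot> ?K (u @ [a]) b v) =
         hsw x (\<lambda>a b. ksign (?U * ?V + ?U * ?X + ?U + ?V + 1 + \<phi>) \<cdot> ksign (deg H a * (deg H b + (?V + (?U + \<phi>)))) \<cdot> A b (?p \<odot> diamond H a [one H])
         + ksign (deg H a + (?U + deg H a - 1) * (?V + deg H b - 1) + deg H b) \<cdot> A b (bvec v \<odot> g u a))"
        by (rule hsw_cong[OF x])
          (simp add: f2 u conc_add_right conc_scale_right A_linear conc_assoc ksign_expand scale_add scale_diff scale_minus)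
      then show ?thesis
        by (simp only: sw_add scale_sw[symmetric] A_absorb_right[OF x p, of "[one H]"]) (simp add: A_absorb_right[OF x p, of "[one H]"])
    qed
    have q: "hsw x (\<lambda>a b. ksign (deg H a) \<cdot> (?K u a (b # v) + ?K (u @ [a]) b v)) =
       hsw x (\<lambda>a b. ksign (deg H a) \<cdot> ?K u a (b # v)) + hsw x (\<lambda>a b. ksign (deg H a) \<cdot> ?K (u @ [a]) b v)"
      by (simp only: scale_add sw_add)
    have E: "hsw x (\<lambda>a b. ksign (?U + deg H a + (?U + deg H a - 1) * (?V + deg H b - 1) + deg H b) \<cdot> A b (bvec v \<odot> g u a)) =
       ksign ?U \<cdot> hsw x (\<lambda>a b. ksign (deg H a + (?U + deg H a - 1) * (?V + deg H b - 1) + deg H b) \<cdot> A b (bvec v \<odot> g u a))"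
      unfolding scale_sw by (rule hsw_cong[OF x]) (simp only: scale_simps ksign_mult add.assoc)
    have W: "wdeg H w = ?U + (?X - 1) + ?V" using s by simp
    show ?case
      unfolding part_sel wdeg_part q P1 P2 P3 P4 P5 E W lin_scale ud_A[OF x pB] ucobar_leibniz
      by (simp add: A_linear ksign_expand scale_add scale_diff scale_minus conc_diff_right conc_scale_left conc_scale_right)
  qed
qed

lemma rot_one_Cons:
  assumes "w \<in> lists B" "supp (lists B) (f [])"
  shows "rot H f (one H # w) = bvec w \<odot> f [] + spl (\<lambda>u x v.
     ksign ((wdeg H u - 1) * (wdeg H v + deg H x - 1) + deg H x) \<cdot> A x (bvec v \<odot> f (one H # u))) w"
proof -
  have "supp (lists B) (bvec w \<odot> f [])"
    by (rule supp_conc[OF supp_bvec assms(2), where A = "{w}"]) (use assms in auto)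
  then show ?thesis by (simp add: rot_def A_one)
qed

lemma rot_append_one:
  assumes "w \<in> lists B" "supp (lists B) (f w)"
  shows "rot H f (w @ [one H]) = spl (\<lambda>u x v.
     ksign (wdeg H u * (wdeg H v - 1 + deg H x - 1) + deg H x) \<cdot> A x (bvec v \<odot> e \<odot> f u)) w
     + ksign (wdeg H w) \<cdot> f w"
  using A_one[OF assms(2)] by (simp add: rot_def spl_append)

text \<open>The new terms \<open>f w\<close> and \<open>bvec w \<odot> f []\<close> come from the
  commutator with the unit letter, namely from choosing the added unit itself: S(1) acts as the
  identity on what remains.\<close>

lemma cobar_diff_rot:
  fixes f :: "'b list \<Rightarrow> ('b list \<Rightarrow>\<^sub>0 'r)"
  assumes w: "w \<in> lists B"
    and f1: "\<And>u. u \<in> lists B \<Longrightarrow> WH (wdeg H u + \<phi>) (f u)"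
    and f2: "\<And>u x. u \<in> lists B \<Longrightarrow> x \<in> B \<Longrightarrow> f (u @ [x]) = ksign (\<phi> * (deg H x - 1)) \<cdot> (f u \<odot> bvec [x]) + g u x"
  shows "lin (cobar_diff (coalg_part H)) (rot H f w) + lin (rot H f) (cobar_diff (coalg_part H) w) =
    f w - bvec w \<odot> f []
    + spl (\<lambda>u x v. ksign (wdeg H u * (wdeg H v + deg H x - 1) + wdeg H v) \<cdot>
        A x (bvec v \<odot> (lin ud (f u) - lin f (ud u) + f (one H # u) - e \<odot> f u))) w
    + spl (\<lambda>u x v. hsw x (\<lambda>a b. ksign (wdeg H u + deg H a + (wdeg H u + deg H a - 1) * (wdeg H v + deg H b - 1) + deg H b) \<cdot>
        A b (bvec v \<odot> g u a))) w"
    (is "_ = _ + spl ?T w + spl ?R w")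
proof -
  have fB: "supp (lists B) (f u)" if "u \<in> lists B" for u
    using f1[OF that] by (rule supp_mono) auto
  let ?Y1 = "\<lambda>u x v. ksign ((wdeg H u - 1) * (wdeg H v + deg H x - 1) + deg H x) \<cdot> A x (bvec v \<odot> f (one H # u))"
  let ?Y2 = "\<lambda>u x v. ksign (wdeg H u * (wdeg H v - 1 + deg H x - 1) + deg H x) \<cdot> A x (bvec v \<odot> e \<odot> f u)"
  let ?X = "\<lambda>u x v. ksign (wdeg H u * (wdeg H v + deg H x - 1) + wdeg H v) \<cdot> A x (bvec v \<odot> (lin ud (f u) - lin f (ud u)))"
  have T: "spl ?T w = spl ?X w - spl ?Y1 w + ksign (wdeg H w) \<cdot> spl ?Y2 w"
    unfolding scale_spl spl_diff[symmetric] spl_add[symmetric]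
  proof (rule spl_cong, goal_cases)
    case (1 u x v)
    have W: "wdeg H w = wdeg H u + (deg H x - 1) + wdeg H v" using splitD[OF 1 w] by simp
    show ?case unfolding W
      by (simp add: A_linear ksign_expand scale_add scale_diff scale_minus conc_diff_right conc_add_right)
  qed
  have "lin (cobar_diff (coalg_part H)) (rot H f w) + lin (rot H f) (cobar_diff (coalg_part H) w) =
     (lin ud (rot H f w) + lin (rot H f) (ud w)) - e \<odot> rot H f w + ksign (wdeg H w + 1 + \<phi>) \<cdot> (rot H f w \<odot> e)
     - rot H f (one H # w) + ksign (wdeg H w) \<cdot> rot H f (w @ [one H])"
  proof -
    have "lin (rot H f) (cobar_diff (coalg_part H) w) =
      lin (rot H f) (ud w) - rot H f (one H # w) + ksign (wdeg H w) \<cdot> rot H f (w @ [one H])"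
      by (simp add: cobar_diff_eq_ud lin_add lin_diff lin_scale)
    then show ?thesis using lin_cobar_diff[OF WH_rot[OF w f1]] by simp
  qed
  also have "lin ud (rot H f w) + lin (rot H f) (ud w) = e \<odot> rot H f w - ksign (wdeg H w + 1 + \<phi>) \<cdot> (rot H f w \<odot> e)
    + spl ?X w + spl ?R w"
    by (rule ud_rot[OF w f1 f2])
  also have "rot H f (one H # w) = bvec w \<odot> f [] + spl ?Y1 w"
    by (rule rot_one_Cons[OF w fB]) simp
  also have "rot H f (w @ [one H]) = spl ?Y2 w + ksign (wdeg H w) \<cdot> f w"
    by (rule rot_append_one[of w f, OF w fB[OF w]])
  finally show ?thesis unfolding T by (simp add: scale_add)
qed

lemma supp_rot:
  assumes w: "w \<in> lists (rbasis H)" and f: "\<And>u. u \<in> lists (rbasis H) \<Longrightarrow> supp (lists (rbasis H)) (f u)"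
  shows "supp (lists (rbasis H)) (rot H f w)"
  unfolding rot_def
proof (rule supp_spl, rule supp_scale)
  fix u x v assume "u @ x # v = w"
  then have u: "u \<in> lists (rbasis H)" and v: "v \<in> lists (rbasis H)" and x: "x \<in> B"
    using w by (auto simp: rbasis_def)
  have p: "supp (lists (rbasis H)) (bvec v \<odot> f u)"
    by (rule supp_conc[OF supp_bvec f[OF u], where A = "{v}"]) (use v in auto)
  show "supp (lists (rbasis H)) (A x (bvec v \<odot> f u))"
  proof (rule supp_lin[OF supp_S[OF x]], rule supp_lin[OF p])
    fix s y assume "s \<in> {s \<in> B. deg H s = deg H x}" "y \<in> lists (rbasis H)"
    then show "supp (lists (rbasis H)) (diamond H s y)"
      using supp_diamond[of s y] by auto
  qed
qed

lemma cyc_iterate: "i \<le> length w \<Longrightarrow> (lin (cyc H) ^^ i) (bvec w) =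
    ksign (wdeg H (take i w) * wdeg H (drop i w)) \<cdot> bvec (drop i w @ take i w)"
proof (induct i)
  case (Suc i)
  then have i: "i < length w" by simp
  have "drop i w = w ! i # drop (Suc i) w" using i by (simp add: Cons_nth_drop_Suc)
  moreover have "take (Suc i) w = take i w @ [w ! i]" using i by (simp add: take_Suc_conv_app_nth)
  ultimately show ?case
    using Suc i by (simp add: lin_scale cyc_def ksign_mult) (rule scale_ksign_cong, simp_all add: algebra_simps)
qed simp

text \<open>Rotating by i brings the letter at position i to the front. Length one is special: the
  Connes-Moscovici operator is zero there by definition, and \<open>rot\<close> is zero because the
  action on the empty word is the counit and S preserves the augmentation ideal.\<close>

lemma connes_moscovici_eq_rot:
  assumes w: "w \<in> lists (rbasis H)"
  shows "connes_moscovici H w = rot H bvec w"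
proof -
  consider "w = []" | x where "w = [x]" | "length w \<ge> 2"
    by (cases w rule: remdups_adj.cases) auto
  then show ?thesis
  proof cases
    case 2
    then have "x \<in> rbasis H" using w by simp
    then have "A x (bvec []) = 0"
      by (intro lin_eq_0[OF S_ne_one]) (auto simp: diamond_Nil rbasis_def)
    then show ?thesis by (simp add: connes_moscovici_def rot_def 2)
  next
    case 3
    have "connes_moscovici H w = (\<Sum>i<length w. lin (cm_p H) ((lin (cyc H) ^^ i) (bvec w)))"
      using 3 by (simp add: connes_moscovici_def)
    also have "\<dots> = rot H bvec w"
      unfolding rot_def spl_eq_sum
    proof (rule sum.cong, rule refl)
      fix i assume "i \<in> {..<length w}"
      then have i: "i < length w" by simp
      have "drop i w = w ! i # drop (Suc i) w" using i by (simp add: Cons_nth_drop_Suc)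
      then show "lin (cm_p H) ((lin (cyc H) ^^ i) (bvec w)) = ksign (wdeg H (take i w) *
         (wdeg H (drop (Suc i) w) + deg H (w ! i) - 1) + deg H (w ! i)) \<cdot> A (w ! i) (bvec (drop (Suc i) w) \<odot> bvec (take i w))"
        using i by (simp add: cyc_iterate lin_scale cm_p_def ksign_mult)
         (rule scale_ksign_cong, simp_all add: algebra_simps)
    qed
    finally show ?thesis .
  qed (simp add: connes_moscovici_def rot_def)
qed

text \<open>For \<open>bvec\<close> all defects in \<open>cobar_diff_rot\<close> vanish and its two
  main terms coincide.\<close>

lemma rot_bvec_chain:
  assumes w: "w \<in> lists B"
  shows "lin (cobar_diff (coalg_part H)) (rot H bvec w) + lin (rot H bvec) (cobar_diff (coalg_part H) w) = 0"
proof -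
  have "lin (cobar_diff (coalg_part H)) (rot H bvec w) + lin (rot H bvec) (cobar_diff (coalg_part H) w) =
    bvec w - bvec w \<odot> bvec [] + spl (\<lambda>u x v. ksign (wdeg H u * (wdeg H v + deg H x - 1) + wdeg H v) \<cdot>
        A x (bvec v \<odot> (lin ud (bvec u) - lin bvec (ud u) + bvec (one H # u) - e \<odot> bvec u))) w
    + spl (\<lambda>u x v. hsw x (\<lambda>a b. ksign (wdeg H u + deg H a + (wdeg H u + deg H a - 1) * (wdeg H v + deg H b - 1) + deg H b) \<cdot>
        A b (bvec v \<odot> 0))) w"
    by (rule cobar_diff_rot[OF w, where \<phi> = 0]) (simp_all add: supp_bvec)
  then show ?thesis
    using lmap_0[OF lmap_scaled[OF lmap_id]]
    by (simp add: A_linear spl_eq_sum)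
qed

text \<open>Three coproduct factors of \<open>x\<close> act on the prefix, on the chosen letter and
  on the suffix. This evaluates a rotation on a word on which H has already acted.\<close>

lemma spl_diamond:
  fixes F :: "'b list \<Rightarrow> 'b \<Rightarrow> 'b list \<Rightarrow> ('c \<Rightarrow>\<^sub>0 'r)"
  shows "x \<in> B \<Longrightarrow> lin (spl F) (diamond H x q) = spl (\<lambda>u y v. hsw x (\<lambda>x1 x'. hsw x' (\<lambda>x2 x3.
    ksign (deg H x' * wdeg H u + deg H x3 * (deg H y - 1)) \<cdot>
      lin (\<lambda>u'. lin (\<lambda>y'. lin (F u' y') (diamond H x3 v)) (mult H x2 y)) (diamond H x1 u)))) q"
proof (induct q arbitrary: x F)
  case Nil
  then show ?case by (simp add: diamond_Nil)
next
  case (Cons c q)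
  note x = Cons(2)
  let ?T = "\<lambda>F x2 x3 y v u'. lin (\<lambda>y'. lin (F u' y') (diamond H x3 v)) (mult H x2 y) :: 'c \<Rightarrow>\<^sub>0 'r"
  let ?G = "\<lambda>u y v a b1 b'. hsw b' (\<lambda>b2 b3. ksign ((deg H b1 + deg H b') * (deg H c - 1) + deg H b' * wdeg H u + deg H b3 * (deg H y - 1)) \<cdot>
     lin (\<lambda>z. lin (\<lambda>u'. ?T F b2 b3 y v (z # u')) (diamond H b1 u)) (mult H a c))"
  have conc: "lin g (letter m \<odot> r) = lin (\<lambda>z. lin (\<lambda>w. g (z # w)) r) m" for g :: "'b list \<Rightarrow> ('c \<Rightarrow>\<^sub>0 'r)" and m r
    by (simp add: letter_def conc_eq_lin lin_lin)
  have "lin (spl F) (diamond H x (c # q)) = hsw x (\<lambda>a b. ksign (deg H b * (deg H c - 1)) \<cdot>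
      lin (\<lambda>z. lin (F [] z) (diamond H b q) + lin (spl (\<lambda>u. F (z # u))) (diamond H b q)) (mult H a c))"
    unfolding diamond_Cons[OF x] lin_sw by (simp add: lin_scale conc lin_fun_add)
  also have "\<dots> = hsw x (\<lambda>a b. ksign (deg H b * (deg H c - 1)) \<cdot> lin (\<lambda>z. lin (F [] z) (diamond H b q)) (mult H a c))
      + hsw x (\<lambda>a b. ksign (deg H b * (deg H c - 1)) \<cdot> lin (\<lambda>z. lin (spl (\<lambda>u. F (z # u))) (diamond H b q)) (mult H a c))"
    by (simp add: lin_fun_add scale_add sw_add)
  also have "hsw x (\<lambda>a b. ksign (deg H b * (deg H c - 1)) \<cdot> lin (\<lambda>z. lin (spl (\<lambda>u. F (z # u))) (diamond H b q)) (mult H a c)) =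
     spl (\<lambda>u y v. hsw x (\<lambda>a b. hsw b (\<lambda>b1 b'. ?G u y v a b1 b'))) q"
  proof (subst spl_sw, rule hsw_cong[OF x])
    fix a b assume b: "b \<in> B"
    have "lin (\<lambda>z. lin (spl (\<lambda>u. F (z # u))) (diamond H b q)) (mult H a c) =
       lin (\<lambda>z. spl (\<lambda>u y v. hsw b (\<lambda>b1 b'. hsw b' (\<lambda>b2 b3. ksign (deg H b' * wdeg H u + deg H b3 * (deg H y - 1)) \<cdot>
         lin (\<lambda>u'. ?T F b2 b3 y v (z # u')) (diamond H b1 u)))) q) (mult H a c)"
      by (rule lin_cong) (rule Cons(1)[OF b])
    also have "\<dots> = spl (\<lambda>u y v. hsw b (\<lambda>b1 b'. hsw b' (\<lambda>b2 b3. ksign (deg H b' * wdeg H u + deg H b3 * (deg H y - 1)) \<cdot>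
         lin (\<lambda>z. lin (\<lambda>u'. ?T F b2 b3 y v (z # u')) (diamond H b1 u)) (mult H a c)))) q"
      by (simp add: spl_lin[symmetric] sw_lin[symmetric] lin_fun_scale)
    finally show "ksign (deg H b * (deg H c - 1)) \<cdot> lin (\<lambda>z. lin (spl (\<lambda>u. F (z # u))) (diamond H b q)) (mult H a c) =
       spl (\<lambda>u y v. hsw b (\<lambda>b1 b'. ?G u y v a b1 b')) q"
      by (simp add: scale_spl scale_sw)
       (intro spl_cong hsw_cong[OF b], simp add: ksign_mult, rule hsw_cong, simp_all add: add.assoc)
  qed
  also have "spl (\<lambda>u y v. hsw x (\<lambda>a b. hsw b (\<lambda>b1 b'. ?G u y v a b1 b'))) q =
     spl (\<lambda>u y v. hsw x (\<lambda>x1 x'. hsw x' (\<lambda>x2 x3. ksign (deg H x' * wdeg H (c # u) + deg H x3 * (deg H y - 1)) \<cdot>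
      lin (?T F x2 x3 y v) (diamond H x1 (c # u))))) q"
  proof (intro spl_cong, subst hsw_coassoc[OF x, symmetric], intro hsw_cong[OF x], goal_cases)
    case (1 u y v x1 x')
    have "hsw x1 (\<lambda>b1 b2. ?G u y v b1 b2 x') = hsw x' (\<lambda>x2 x3. hsw x1 (\<lambda>b1 b2.
       ksign ((deg H b2 + deg H x') * (deg H c - 1) + deg H x' * wdeg H u + deg H x3 * (deg H y - 1)) \<cdot>
        lin (\<lambda>z. lin (\<lambda>u'. ?T F x2 x3 y v (z # u')) (diamond H b2 u)) (mult H b1 c)))"
      by (rule sw_swap)
    also have "\<dots> = hsw x' (\<lambda>x2 x3. ksign (deg H x' * wdeg H (c # u) + deg H x3 * (deg H y - 1)) \<cdot>
      lin (?T F x2 x3 y v) (diamond H x1 (c # u)))"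
      unfolding diamond_Cons[OF 1(2)] lin_sw lin_scale conc scale_sw
      by (intro hsw_cong 1) (simp add: ksign_expand)
    finally show ?case .
  qed
  also have "hsw x (\<lambda>a b. ksign (deg H b * (deg H c - 1)) \<cdot> lin (\<lambda>z. lin (F [] z) (diamond H b q)) (mult H a c)) =
     hsw x (\<lambda>x1 x'. hsw x' (\<lambda>x2 x3. ksign (deg H x' * wdeg H [] + deg H x3 * (deg H c - 1)) \<cdot>
      lin (?T F x2 x3 c q) (diamond H x1 [])))"
    by (subst hsw_counit_left[OF x]) (simp_all add: diamond_Nil)
  finally show ?case by (simp only: spl.simps)
qed

lemma A_mult:
  assumes x: "x \<in> B" and y: "y \<in> B" and p: "supp (lists B) p"
  shows "lin (\<lambda>z. A z p) (mult H x y) = ksign (deg H x * deg H y) \<cdot> A y (A x p)"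
proof -
  have "lin (\<lambda>z. A z p) (mult H x y) = lin (\<lambda>s. lin (diamond H s) p) (lin S (mult H x y))"
    by (simp add: lin_lin)
  also have "\<dots> = ksign (deg H x * deg H y) \<cdot> lin (\<lambda>s. lin (\<lambda>t. lin (\<lambda>z. lin (diamond H z) p) (mult H s t)) (S x)) (S y)"
    by (simp add: S_mult[OF x y] lin_scale lin_lin)
  also have "lin (\<lambda>s. lin (\<lambda>t. lin (\<lambda>z. lin (diamond H z) p) (mult H s t)) (S x)) (S y) = A y (A x p)"
  proof (rule lin_cong_supp[OF supp_S[OF y]])
    fix s assume s: "s \<in> {s \<in> B. deg H s = deg H y}"
    have "lin (diamond H s) (A x p) = lin (\<lambda>t. lin (diamond H s) (lin (diamond H t) p)) (S x)"
      by (simp add: lin_lin)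
    also have "\<dots> = lin (\<lambda>t. lin (\<lambda>z. lin (diamond H z) p) (mult H s t)) (S x)"
    proof (rule lin_cong_supp[OF supp_S[OF x]])
      fix t assume t: "t \<in> {s \<in> B. deg H s = deg H x}"
      show "lin (diamond H s) (lin (diamond H t) p) = lin (\<lambda>z. lin (diamond H z) p) (mult H s t)"
        using s t by (simp add: act_act p)
    qed
    finally show "lin (\<lambda>t. lin (\<lambda>z. lin (diamond H z) p) (mult H s t)) (S x) = lin (diamond H s) (A x p)" ..
  qed
  finally show ?thesis .
qed

text \<open>The rotation turns the factors x1, x2, x3 into S(y) S(x2) acting on (x3 v)(x1 u). A
  cyclic permutation of the factors, allowed by cocommutativity, makes the last two act jointly on v
  u, where S(x2) contracts them to the counit.\<close>

lemma rot_diamond: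
  assumes x: "x \<in> B" and q: "q \<in> lists B"
  shows "lin (rot H bvec) (diamond H x q) = (if x = one H then rot H bvec q else 0)"
proof -
  let ?s = "\<lambda>u y v. wdeg H u * (wdeg H v + deg H y - 1) + deg H y"
  have "lin (rot H bvec) (diamond H x q) = spl (\<lambda>u y v. ksign (?s u y v + deg H x * (deg H y + 1)) \<cdot>
     A y (if x = one H then bvec (v @ u) else 0)) q"
    unfolding rot_def spl_diamond[OF x]
  proof (rule spl_cong)
    fix u y v assume "u @ y # v = q"
    then have u: "u \<in> lists B" and y: "y \<in> B" and v: "v \<in> lists B" using q by auto
    let ?U = "wdeg H u" and ?V = "wdeg H v" and ?Y = "deg H y"
    have vu: "supp (lists B) (bvec (v @ u))" by (rule supp_bvec) (use u v in simp)
    have "hsw x (\<lambda>x1 x'. hsw x' (\<lambda>x2 x3. ksign (deg H x' * ?U + deg H x3 * (?Y - 1)) \<cdot>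
      lin (\<lambda>u'. lin (\<lambda>y'. lin (\<lambda>v'. ksign (?s u' y' v') \<cdot> A y' (bvec v' \<odot> bvec u')) (diamond H x3 v)) (mult H x2 y)) (diamond H x1 u))) =
     hsw x (\<lambda>x1 x'. hsw x' (\<lambda>x2 x3. ksign (deg H x' * deg H x1) \<cdot> ksign (?s u y v + (deg H x1 + deg H x2 + deg H x3) * (?Y + 1)) \<cdot> ksign (deg H x1 * ?V) \<cdot>
       A y (A x2 (diamond H x3 v \<odot> diamond H x1 u))))"
    proof (intro hsw_cong x, goal_cases)
      case (2 x1 x' x2 x3)
      then have x123: "x1 \<in> B" "x2 \<in> B" "x3 \<in> B" by auto
      let ?e = "(?U + deg H x1) * ((?V + deg H x3) + (?Y + deg H x2) - 1) + (?Y + deg H x2)"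
      let ?p = "diamond H x3 v \<odot> diamond H x1 u"
      have "lin (\<lambda>u'. lin (\<lambda>y'. lin (\<lambda>v'. ksign (?s u' y' v') \<cdot> A y' (bvec v' \<odot> bvec u')) (diamond H x3 v)) (mult H x2 y)) (diamond H x1 u) =
        lin (\<lambda>u'. lin (\<lambda>y'. lin (\<lambda>v'. ksign ?e \<cdot> A y' (bvec v' \<odot> bvec u')) (diamond H x3 v)) (mult H x2 y)) (diamond H x1 u)"
        by (rule lin_cong_supp[OF WH_diamond[OF x123(1) u]], rule lin_cong_supp[OF supp_mult[OF x123(2) y]],
            rule lin_cong_supp[OF WH_diamond[OF x123(3) v]]) (auto simp: add_ac)
      also have "\<dots> = ksign ?e \<cdot> lin (\<lambda>u'. lin (\<lambda>y'. lin (\<lambda>v'. A y' (bvec v' \<odot> bvec u')) (diamond H x3 v)) (mult H x2 y)) (diamond H x1 u)"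
        by (simp only: lin_fun_scale)
      also have "lin (\<lambda>u'. lin (\<lambda>y'. lin (\<lambda>v'. A y' (bvec v' \<odot> bvec u')) (diamond H x3 v)) (mult H x2 y)) (diamond H x1 u) =
        lin (\<lambda>y'. A y' ?p) (mult H x2 y)"
      proof -
        have "A y' ?p = lin (\<lambda>u'. lin (\<lambda>v'. A y' (bvec v' \<odot> bvec u')) (diamond H x3 v)) (diamond H x1 u)" for y'
        proof -
          have "A y' ?p = A y' (lin (\<lambda>u'. lin (\<lambda>v'. bvec v' \<odot> bvec u') (diamond H x3 v)) (diamond H x1 u))"
            by (subst lin_swap) (simp add: conc_eq_lin)
          also have "\<dots> = lin (\<lambda>u'. A y' (lin (\<lambda>v'. bvec v' \<odot> bvec u') (diamond H x3 v))) (diamond H x1 u)"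
            by (rule lmap_of_lin) (intro lmap_intros)
          also have "\<dots> = lin (\<lambda>u'. lin (\<lambda>v'. A y' (bvec v' \<odot> bvec u')) (diamond H x3 v)) (diamond H x1 u)"
            by (rule lin_cong, rule lmap_of_lin) (intro lmap_intros)
          finally show ?thesis .
        qed
        then show ?thesis by (simp only:) (rule lin_swap)
      qed
      also have "lin (\<lambda>y'. A y' ?p) (mult H x2 y) = ksign (deg H x2 * ?Y) \<cdot> A y (A x2 ?p)"
      proof (rule A_mult[OF x123(2) y])
        show "supp (lists B) ?p"
          by (rule supp_conc[OF WH_diamond[OF x123(3) v] WH_diamond[OF x123(1) u]]) auto
      qed
      finally show ?case using 2 by (simp add: ksign_expand)
    qed (use x in auto)
    also have "\<dots> = hsw x (\<lambda>x' x1. hsw x' (\<lambda>x2 x3. ksign (?s u y v + (deg H x1 + deg H x2 + deg H x3) * (?Y + 1)) \<cdot> ksign (deg H x1 * ?V) \<cdot>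
       A y (A x2 (diamond H x3 v \<odot> diamond H x1 u))))"
      by (subst hsw_cocomm[OF x]) (simp add: scale_sw mult.commute[of "deg H _" "deg H _"])
    also have "\<dots> = hsw x (\<lambda>x2 r. hsw r (\<lambda>x3 x1. ksign (?s u y v + (deg H x1 + deg H x2 + deg H x3) * (?Y + 1)) \<cdot> ksign (deg H x1 * ?V) \<cdot>
       A y (A x2 (diamond H x3 v \<odot> diamond H x1 u))))"
      by (rule hsw_coassoc[OF x])
    also have "\<dots> = hsw x (\<lambda>x2 r. ksign (?s u y v + deg H x * (?Y + 1)) \<cdot> A y (A x2 (lin (diamond H r) (bvec (v @ u)))))"
    proof (rule hsw_cong[OF x])
      fix x2 r assume r: "r \<in> B" and dx: "deg H x = deg H x2 + deg H r"
      have "hsw r (\<lambda>x3 x1. ksign (?s u y v + (deg H x1 + deg H x2 + deg H x3) * (?Y + 1)) \<cdot> ksign (deg H x1 * ?V) \<cdot>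
       A y (A x2 (diamond H x3 v \<odot> diamond H x1 u))) =
       hsw r (\<lambda>x3 x1. ksign (?s u y v + deg H x * (?Y + 1)) \<cdot> A y (A x2 (ksign (deg H x1 * ?V) \<cdot> (diamond H x3 v \<odot> diamond H x1 u))))"
        by (rule hsw_cong[OF r]) (simp add: dx A_linear add_ac mult.commute)
      also have "\<dots> = ksign (?s u y v + deg H x * (?Y + 1)) \<cdot> A y (A x2 (hsw r (\<lambda>x3 x1. ksign (deg H x1 * ?V) \<cdot> (diamond H x3 v \<odot> diamond H x1 u))))"
      proof -
        have "lmap (\<lambda>p. A y (A x2 p))" by (intro lmap_intros)
        note * = lmap_of_sw[OF this]
        show ?thesis by (subst *) (rule scale_sw[symmetric])
      qed
      finally show "hsw r (\<lambda>x3 x1. ksign (?s u y v + (deg H x1 + deg H x2 + deg H x3) * (?Y + 1)) \<cdot> ksign (deg H x1 * ?V) \<cdot>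
       A y (A x2 (diamond H x3 v \<odot> diamond H x1 u))) = ksign (?s u y v + deg H x * (?Y + 1)) \<cdot> A y (A x2 (lin (diamond H r) (bvec (v @ u))))"
        by (simp only: lin_bvec diamond_append[OF r])
    qed
    also have "\<dots> = ksign (?s u y v + deg H x * (?Y + 1)) \<cdot> A y (hsw x (\<lambda>x2 r. A x2 (lin (diamond H r) (bvec (v @ u)))))"
    proof -
      have "lmap (\<lambda>p. A y p)" by (intro lmap_intros)
      note * = lmap_of_sw[OF this]
        show ?thesis by (subst *) (rule scale_sw[symmetric])
    qed
    also have "hsw x (\<lambda>x2 r. A x2 (lin (diamond H r) (bvec (v @ u)))) = (if x = one H then bvec (v @ u) else 0)"
      by (rule A_act_contract[OF x vu])
    finally show "hsw x (\<lambda>x1 x'. hsw x' (\<lambda>x2 x3. ksign (deg H x' * ?U + deg H x3 * (?Y - 1)) \<cdot>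
      lin (\<lambda>u'. lin (\<lambda>y'. lin (\<lambda>v'. ksign (?s u' y' v') \<cdot> A y' (bvec v' \<odot> bvec u')) (diamond H x3 v)) (mult H x2 y)) (diamond H x1 u))) =
      ksign (?s u y v + deg H x * (?Y + 1)) \<cdot> A y (if x = one H then bvec (v @ u) else 0)" .
  qed
  also have "\<dots> = (if x = one H then rot H bvec q else 0)"
    by (auto simp: rot_def spl_eq_sum)
  finally show ?thesis .
qed

text \<open>Every summand of the inner rotation is an element of the augmentation ideal acting on a
  word, hence killed by \<open>rot_diamond\<close>.\<close>

lemma rot_rot:
  assumes w: "w \<in> lists (rbasis H)"
  shows "lin (rot H bvec) (rot H bvec w) = 0"
proof -
  have "lin (rot H bvec) (rot H bvec w) = spl (\<lambda>u x v. ksign (wdeg H u * (wdeg H v + deg H x - 1) + deg H x) \<cdot>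
     lin (rot H bvec) (A x (bvec (v @ u)))) w"
    by (subst (2) rot_def) (simp add: lin_spl lin_scale)
  also have "\<dots> = spl (\<lambda>u x v. 0) w"
  proof (rule spl_cong)
    fix u x v assume "u @ x # v = w"
    then have u: "v @ u \<in> lists B" and x: "x \<in> rbasis H" using w by (auto simp: rbasis_def)
    have "lin (rot H bvec) (A x (bvec (v @ u))) = lin (\<lambda>s. lin (rot H bvec) (diamond H s (v @ u))) (S x)"
      by (simp add: lin_lin)
    also have "\<dots> = 0"
      by (rule lin_eq_0[OF S_ne_one[OF x]]) (use u in \<open>simp add: rot_diamond rbasis_def\<close>)
    finally show "ksign (wdeg H u * (wdeg H v + deg H x - 1) + deg H x) \<cdot> lin (rot H bvec) (A x (bvec (v @ u))) = 0"
      by simp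
  qed
  finally show ?thesis by (simp add: spl_eq_sum)
qed

end

section \<open>The homotopy BV-algebra structure\<close>

context cocomm_hopf
begin

abbreviation "cd \<equiv> cobar_diff (coalg_part H)"
abbreviation "Phi w b \<equiv> rot H (\<lambda>u. ext u [b]) w"
abbreviation "Psi a b \<equiv> lin (\<lambda>w. ext w [a]) (rot H bvec b)"

text \<open>The part of Delta(a b) in which the chosen letter lies in \<open>a\<close>.\<close>

definition twist :: "'b list \<Rightarrow> 'b list \<Rightarrow> ('b list \<Rightarrow>\<^sub>0 'r)" where
  "twist a b = spl (\<lambda>u x v. ksign (wdeg H u * (wdeg H v + deg H x - 1) + deg H x + wdeg H b * wdeg H u) \<cdot>
     A x (bvec (v @ b @ u))) a"

lemma rot_bvec_append:
  "rot H bvec (a @ b) = twist a b + ksign (wdeg H a * wdeg H b) \<cdot> twist b a"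
  unfolding rot_def twist_def spl_append scale_spl
  by (intro arg_cong2[where f = "(+)"] spl_cong)
    (simp_all add: ksign_mult, (rule scale_ksign_cong, auto simp: algebra_simps)+)

lemma bar_diff_single: "lin F (bar_diff CA [b]) = - lin (\<lambda>y. F [y]) (cd b)"
  by (simp add: bar_diff_Cons merge_def lin_minus letter_def lin_lin)

text \<open>An instance of \<open>cobar_diff_rot\<close>: E_{1,1}(_; b) has degree |b| + 1, and
  appending a letter x to u adds the term u (x b), in which b is inserted into the new
  letter.\<close>

lemma cobar_diff_Phi:
  assumes w: "w \<in> lists B" and b: "b \<in> RC"
  shows "lin cd (Phi w b) + lin (\<lambda>w. Phi w b) (cd w) = ext w [b] + ksign (wdeg H w) \<cdot> lin (Phi w) (cd b)
    - ksign (wdeg H w) \<cdot> twist w b + ksign (wdeg H w) \<cdot> (rot H bvec w \<odot> bvec b)"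
proof -
  have bB: "b \<in> lists B" using b by (rule RC_D)
  have "lin cd (Phi w b) + lin (\<lambda>w. Phi w b) (cd w) = ext w [b] - bvec w \<odot> ext [] [b]
    + spl (\<lambda>u x v. ksign (wdeg H u * (wdeg H v + deg H x - 1) + wdeg H v) \<cdot>
        A x (bvec v \<odot> (lin ud (ext u [b]) - lin (\<lambda>u. ext u [b]) (ud u) + ext (one H # u) [b] - e \<odot> ext u [b]))) w
    + spl (\<lambda>u x v. hsw x (\<lambda>a c. ksign (wdeg H u + deg H a + (wdeg H u + deg H a - 1) * (wdeg H v + deg H c - 1) + deg H c) \<cdot>
        A c (bvec v \<odot> (bvec u \<odot> diamond H a b)))) w"
  proof (rule cobar_diff_rot[OF w, where \<phi> = "wdeg H b + 1"])
    fix u assume u: "u \<in> lists B"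
    show "WH (wdeg H u + (wdeg H b + 1)) (ext u [b])" using WH_ext[OF u, of "[b]"] bB by simp
    fix x
    show "ext (u @ [x]) [b] = ksign ((wdeg H b + 1) * (deg H x - 1)) \<cdot> (ext u [b] \<odot> bvec [x]) + bvec u \<odot> diamond H x b"
      by (simp add: ext_append cuts_Cons)
  qed
  \<comment> \<open>In these terms a coproduct factor of \<open>x\<close> acts on \<open>b\<close>
    at the right end; \<open>A_absorb_right\<close> removes it and leaves (Delta w) b.\<close>
  also have "spl (\<lambda>u x v. hsw x (\<lambda>a c. ksign (wdeg H u + deg H a + (wdeg H u + deg H a - 1) * (wdeg H v + deg H c - 1) + deg H c) \<cdot>
        A c (bvec v \<odot> (bvec u \<odot> diamond H a b)))) w = ksign (wdeg H w) \<cdot> (rot H bvec w \<odot> bvec b)"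
    unfolding rot_def conc_spl_left scale_spl
  proof (rule spl_cong, goal_cases)
    case (1 u x v)
    note s = splitD[OF 1 w]
    have vu: "WH (wdeg H v + wdeg H u) (bvec (v @ u))" by (rule supp_bvec) (use s in auto)
    have "hsw x (\<lambda>a c. ksign (wdeg H u + deg H a + (wdeg H u + deg H a - 1) * (wdeg H v + deg H c - 1) + deg H c) \<cdot>
        A c (bvec v \<odot> (bvec u \<odot> diamond H a b))) =
      hsw x (\<lambda>a c. ksign (wdeg H u * (wdeg H v + deg H x - 1) + deg H x + wdeg H w) \<cdot>
        ksign (deg H a * (deg H c + (wdeg H v + wdeg H u))) \<cdot> A c (bvec (v @ u) \<odot> diamond H a b))"
      by (rule hsw_cong) (use s in \<open>simp_all add: conc_assoc[symmetric] ksign_expand\<close>)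
    then show ?case
      unfolding scale_sw[symmetric]
      using s by (simp only: A_absorb_right[OF _ vu bB]) (simp add: ksign_expand conc_scale_left)
  qed
  \<comment> \<open>Two things keep E_{1,1}(_; b) from being a chain map here: the boundary of
    \<open>b\<close>, and an added unit letter being replaced by \<open>b\<close>. The latter yields
    \<open>twist\<close>.\<close>
  also have "spl (\<lambda>u x v. ksign (wdeg H u * (wdeg H v + deg H x - 1) + wdeg H v) \<cdot>
        A x (bvec v \<odot> (lin ud (ext u [b]) - lin (\<lambda>u. ext u [b]) (ud u) + ext (one H # u) [b] - e \<odot> ext u [b]))) w =
     ksign (wdeg H w) \<cdot> lin (Phi w) (cd b) - ksign (wdeg H w) \<cdot> twist w b"
    unfolding rot_def twist_def spl_lin[symmetric] scale_spl spl_diff[symmetric]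
  proof (rule spl_cong, goal_cases)
    case (1 u x v)
    note s = splitD[OF 1 w]
    have "lin ud (ext u [b]) - lin (\<lambda>u. ext u [b]) (ud u) + ext (one H # u) [b] - e \<odot> ext u [b] =
      - ksign (wdeg H u) \<cdot> lin (\<lambda>y. ext u [y]) (cd b) + ksign ((wdeg H b + 1) * wdeg H u) \<cdot> bvec (b @ u)"
      using ud_ext[of u "[b]"] s b by (simp add: bar_diff_single ext_Cons diamond_one bB scale_minus minus_scale)
    moreover have "A x (bvec v \<odot> lin (\<lambda>y. ext u [y]) (cd b)) = lin (\<lambda>y. A x (bvec v \<odot> ext u [y])) (cd b)"
      by (rule lmap_of_lin) (intro lmap_intros)
    ultimately show ?case
      using s by (simp add: lin_fun_scale A_linear conc_add_right conc_diff_right conc_scale_right conc_minus_right ksign_expand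
          scale_add scale_minus scale_diff)
  qed
  finally show ?thesis by (simp add: ext_Nil_left)
qed

text \<open>E_{1,1} is a homotopy between the product and the opposite product; here it is applied
  to Delta b and a, with Delta anticommuting with the differential.\<close>

lemma cobar_diff_Psi:
  assumes a: "a \<in> RC" and b: "b \<in> lists B"
  shows "lin cd (Psi a b) + lin (Psi a) (cd b) + ksign (wdeg H b + 1) \<cdot> lin (\<lambda>a. Psi a b) (cd a) =
    ksign (wdeg H b) \<cdot> (rot H bvec b \<odot> bvec a) + ksign ((wdeg H a + 1) * (wdeg H b + 1)) \<cdot> (bvec a \<odot> rot H bvec b)"
proof -
  let ?D = "rot H bvec b"
  have D: "WH (wdeg H b + 1) ?D" using WH_rot[OF b, of bvec 0] by (simp add: supp_bvec)
  have "lin (\<lambda>w. lin cd (ext w [a])) ?D = lin (\<lambda>w. lin (\<lambda>v. ext v [a]) (cd w)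
     - ksign (wdeg H b + 1) \<cdot> lin (\<lambda>y. ext w [y]) (cd a)
     + (ksign ((wdeg H a + 1) * (wdeg H b + 1)) \<cdot> (bvec a \<odot> bvec w) - ksign (wdeg H b + 1) \<cdot> (bvec w \<odot> bvec a))) ?D"
  proof (rule lin_cong_supp[OF D])
    fix w assume "w \<in> {w \<in> lists B. wdeg H w = wdeg H b + 1}"
    then show "lin cd (ext w [a]) = lin (\<lambda>v. ext v [a]) (cd w) - ksign (wdeg H b + 1) \<cdot> lin (\<lambda>y. ext w [y]) (cd a)
     + (ksign ((wdeg H a + 1) * (wdeg H b + 1)) \<cdot> (bvec a \<odot> bvec w) - ksign (wdeg H b + 1) \<cdot> (bvec w \<odot> bvec a))"
      using cobar_diff_ext[of w "[a]"] a by (simp add: bar_diff_single cuts_Cons core_bvec scale_minus)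
  qed
  also have "\<dots> = lin (\<lambda>v. ext v [a]) (lin cd ?D) - ksign (wdeg H b + 1) \<cdot> lin (\<lambda>y. Psi y b) (cd a)
     + (ksign ((wdeg H a + 1) * (wdeg H b + 1)) \<cdot> (bvec a \<odot> ?D) - ksign (wdeg H b + 1) \<cdot> (?D \<odot> bvec a))"
  proof -
    have "lin (\<lambda>w. bvec a \<odot> bvec w) ?D = bvec a \<odot> ?D" "lin (\<lambda>w. bvec w \<odot> bvec a) ?D = ?D \<odot> bvec a"
      by (simp_all add: conc_lin_left[symmetric] conc_lin_right[symmetric] del: conc_bvec)
    moreover have "lin (\<lambda>w. lin (\<lambda>y. ext w [y]) (cd a)) ?D = lin (\<lambda>y. Psi y b) (cd a)"
      by (rule lin_swap)
    ultimately show ?thesis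
      by (simp only: lin_fun_add lin_fun_diff lin_fun_scale lin_lin)
  qed
  also have "lin cd ?D = - lin (rot H bvec) (cd b)"
    using rot_bvec_chain[OF b] by (simp add: eq_neg_iff_add_eq_0)
  finally show ?thesis by (simp add: lin_lin lin_minus ksign_expand)
qed

lemma supp_cd_RC: "a \<in> RC \<Longrightarrow> supp {c \<in> RC. wdeg H c = wdeg H a - 1} (cd a)"
  using dg_algebra_cobar
  by (auto simp: dg_algebra_def dg_module_def homog_def rbasis_cobar in_keys_iff lists_eq_set)

text \<open>The value 0 at the unit matches the convention for the bracket; there the BV identity
  reduces to Delta(1) = 0.\<close>

definition BV_homotopy :: "'b list \<Rightarrow> 'b list \<Rightarrow> ('b list \<Rightarrow>\<^sub>0 'r)" where
  "BV_homotopy a b = (if a = [] \<or> b = [] then 0 else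
     Phi a b - ksign ((wdeg H a + 1) * (wdeg H b + 1)) \<cdot> Phi b a
     + ksign ((wdeg H a + 1) * (wdeg H b + 1)) \<cdot> Psi a b)"

lemma homog_cobar: "homog CA k p \<longleftrightarrow> supp (lists (rbasis H)) p \<and> WH k p"
  by (auto simp: homog_def rbasis_def)

lemma homog_rot: "w \<in> lists (rbasis H) \<Longrightarrow> homog CA (wdeg H w + 1) (rot H bvec w)"
  using supp_rot[of w bvec] WH_rot[of w bvec 0] by (auto simp: homog_cobar supp_bvec rbasis_def)

lemma homog_ext: "w \<in> lists (rbasis H) \<Longrightarrow> b \<in> RC \<Longrightarrow> homog CA (wdeg H w + (wdeg H b + 1)) (ext w [b])"
  using supp_ext[of w "[b]"] WH_ext[of w "[b]"] RC_D(2)[of b] by (auto simp: homog_cobar rbasis_def)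

lemma homog_Phi:
  assumes a: "a \<in> RC" and b: "b \<in> RC"
  shows "homog CA (wdeg H a + wdeg H b + 2) (Phi a b)"
proof -
  have "supp (lists (rbasis H)) (Phi a b)"
    by (rule supp_rot[OF RC_D(1)[OF a]]) (use homog_ext b in \<open>auto simp: homog_cobar\<close>)
  moreover have "WH (wdeg H a + 1 + (wdeg H b + 1)) (Phi a b)"
    by (rule WH_rot[OF RC_D(2)[OF a]]) (use WH_ext[of _ "[b]"] RC_D(2)[OF b] in auto)
  ultimately show ?thesis by (simp add: homog_cobar add_ac)
qed

lemma homog_Psi:
  assumes a: "a \<in> RC" and b: "b \<in> RC"
  shows "homog CA (wdeg H a + wdeg H b + 2) (Psi a b)"
proof -
  have "supp {c \<in> lists (rbasis H). wdeg H c = wdeg H b + 1} (rot H bvec b)"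
    using homog_rot[OF RC_D(1)[OF b]] by (auto simp: homog_def)
  then have "supp {c \<in> basis CA. deg CA c = wdeg H a + wdeg H b + 2} (Psi a b)"
  proof (rule supp_lin)
    fix w assume w: "w \<in> {c \<in> lists (rbasis H). wdeg H c = wdeg H b + 1}"
    then have "homog CA (wdeg H w + (wdeg H a + 1)) (ext w [a])" using a by (intro homog_ext) auto
    then show "supp {c \<in> basis CA. deg CA c = wdeg H a + wdeg H b + 2} (ext w [a])"
      using w by (simp add: homog_def add_ac)
  qed
  then show ?thesis by (simp add: homog_def)
qed

text \<open>The two \<open>twist\<close> terms combine to Delta(a b), the products (Delta b) a from
  \<open>Phi b a\<close> and from \<open>Psi a b\<close> cancel, and \<open>Psi a b\<close> supplies
  a (Delta b) instead.\<close>

lemma BV_identity: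
  assumes a: "a \<in> RC" and b: "b \<in> RC"
  shows "ext a [b] - ksign ((wdeg H a + 1) * (wdeg H b + 1)) \<cdot> ext b [a] =
    ksign (wdeg H a) \<cdot> (rot H bvec (a @ b) - rot H bvec a \<odot> bvec b - ksign (wdeg H a) \<cdot> (bvec a \<odot> rot H bvec b))
    + lin cd (BV_homotopy a b) + lin (\<lambda>x. BV_homotopy x b) (cd a) - ksign (wdeg H a) \<cdot> lin (BV_homotopy a) (cd b)"
proof -
  let ?k = "ksign ((wdeg H a + 1) * (wdeg H b + 1)) :: 'r"
  have ab: "a \<noteq> []" "b \<noteq> []" "a \<in> lists B" "b \<in> lists B" using a b RC_D by auto
  \<comment> \<open>The sign \<open>?k\<close> belongs to the degrees of \<open>a\<close> and
    \<open>b\<close>. Lowering the degree of one argument by one multiplies it by the sign of the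
    shifted degree of the other.\<close>
  have h1: "lin (\<lambda>x. BV_homotopy x b) (cd a) = lin (\<lambda>x. Phi x b
     - (?k * ksign (wdeg H b + 1)) \<cdot> Phi b x + (?k * ksign (wdeg H b + 1)) \<cdot> Psi x b) (cd a)"
  proof (rule lin_cong_supp[OF supp_cd_RC[OF a]])
    fix c assume "c \<in> {c \<in> RC. wdeg H c = wdeg H a - 1}"
    then have "c \<noteq> []" "wdeg H c = wdeg H a - 1" using RC_D(3) by auto
    then show "BV_homotopy c b = Phi c b
     - (?k * ksign (wdeg H b + 1)) \<cdot> Phi b c + (?k * ksign (wdeg H b + 1)) \<cdot> Psi c b"
      using ab by (simp add: BV_homotopy_def ksign_expand minus_scale)
  qed
  have h2: "lin (BV_homotopy a) (cd b) = lin (\<lambda>x. Phi a x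
     - (?k * ksign (wdeg H a + 1)) \<cdot> Phi x a + (?k * ksign (wdeg H a + 1)) \<cdot> Psi a x) (cd b)"
  proof (rule lin_cong_supp[OF supp_cd_RC[OF b]])
    fix c assume "c \<in> {c \<in> RC. wdeg H c = wdeg H b - 1}"
    then have "c \<noteq> []" "wdeg H c = wdeg H b - 1" using RC_D(3) by auto
    then show "BV_homotopy a c = Phi a c
     - (?k * ksign (wdeg H a + 1)) \<cdot> Phi c a + (?k * ksign (wdeg H a + 1)) \<cdot> Psi a c"
      using ab by (simp add: BV_homotopy_def ksign_expand minus_scale)
  qed
  have e1: "lin cd (Phi a b) = ext a [b] + ksign (wdeg H a) \<cdot> lin (Phi a) (cd b)
    - ksign (wdeg H a) \<cdot> twist a b + ksign (wdeg H a) \<cdot> (rot H bvec a \<odot> bvec b) - lin (\<lambda>w. Phi w b) (cd a)"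
    using cobar_diff_Phi[OF ab(3) b] by (simp add: eq_diff_eq)
  have e2: "lin cd (Phi b a) = ext b [a] + ksign (wdeg H b) \<cdot> lin (Phi b) (cd a)
    - ksign (wdeg H b) \<cdot> twist b a + ksign (wdeg H b) \<cdot> (rot H bvec b \<odot> bvec a) - lin (\<lambda>w. Phi w a) (cd b)"
    using cobar_diff_Phi[OF ab(4) a] by (simp add: eq_diff_eq)
  have e3: "lin cd (Psi a b) = ksign (wdeg H b) \<cdot> (rot H bvec b \<odot> bvec a) + ?k \<cdot> (bvec a \<odot> rot H bvec b)
     - lin (Psi a) (cd b) - ksign (wdeg H b + 1) \<cdot> lin (\<lambda>a. Psi a b) (cd a)"
    using cobar_diff_Psi[OF a ab(4)] by (simp add: eq_diff_eq add_ac)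
  have h: "BV_homotopy a b = Phi a b - ?k \<cdot> Phi b a + ?k \<cdot> Psi a b"
    using ab by (simp add: BV_homotopy_def)
  show ?thesis
    unfolding h1 h2 h lin_add lin_diff lin_scale e1 e2 e3 rot_bvec_append lin_fun_add lin_fun_diff lin_fun_scale
    by (simp add: ksign_expand scale_add scale_diff scale_minus)
qed

theorem homotopy_BV_algebra_cobar:
  "homotopy_BV_algebra (cobar (coalg_part H)) (kadeishvili H) (connes_moscovici H)"
proof -
  interpret K: brace CA ext by (rule kadeishvili_brace[OF red])
  let ?Del = "connes_moscovici H"
  note Del = connes_moscovici_eq_rot
  have LB: "w \<in> lists B" if "w \<in> lists (rbasis H)" for w using that by (auto simp: rbasis_def)
  have Del_lin: "lin ?Del p = lin (rot H bvec) p" if "supp (lists (rbasis H)) p" for p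
    using that by (rule lin_cong_supp) (rule Del)
  have supp_cd: "supp (lists (rbasis H)) (cd w)" if "w \<in> lists (rbasis H)" for w
    using dg_algebra_cobar that
    by (auto simp: dg_algebra_def dg_module_def homog_def)
  have D: "homog CA (deg CA a + 1) (?Del a) \<and> lin (diff CA) (?Del a) + lin ?Del (diff CA a) = 0
      \<and> lin ?Del (?Del a) = 0" if "a \<in> basis CA" for a
  proof -
    from that have a: "a \<in> lists (rbasis H)" by (simp add: rbasis_def)
    have "supp (lists (rbasis H)) (rot H bvec a)" using homog_rot[OF a] by (simp add: homog_cobar)
    then show ?thesis
      using homog_rot[OF a] rot_bvec_chain[OF LB[OF a]] rot_rot[OF a]
      by (simp add: Del[OF a] Del_lin supp_cd[OF a])
  qed
  have h: "homog CA (deg CA a + deg CA b + 2) (BV_homotopy a b) \<and> G_bracket CA ext a b =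
      ksign (deg CA a) \<cdot> (lin ?Del (mult CA a b) - lin (\<lambda>x. mult CA x b) (?Del a)
        - ksign (deg CA a) \<cdot> lin (mult CA a) (?Del b))
      + lin (diff CA) (BV_homotopy a b) + lin (\<lambda>x. BV_homotopy x b) (diff CA a)
      - ksign (deg CA a) \<cdot> lin (BV_homotopy a) (diff CA b)"
    if "a \<in> basis CA" "b \<in> basis CA" for a b
  proof -
    from that have a: "a \<in> lists (rbasis H)" and b: "b \<in> lists (rbasis H)" by (simp_all add: rbasis_def)
    have m: "lin (\<lambda>x. mult CA x b) (?Del a) = rot H bvec a \<odot> bvec b"
      "lin (mult CA a) (?Del b) = bvec a \<odot> rot H bvec b"
      by (simp_all add: Del a b conc_eq_lin)
    have rot_Nil: "rot H bvec [] = 0" by (simp add: rot_def)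
    have ab: "?Del (a @ b) = rot H bvec (a @ b)" by (rule Del) (use a b in simp)
    consider "a = []" | "b = []" | "a \<in> RC" "b \<in> RC"
      using a b by (auto simp: rbasis_cobar rbasis_def)
    then show ?thesis
    proof cases
      case 3
      have ne: "a \<noteq> []" "b \<noteq> []" using 3 RC_D(3) by auto
      have Phi_ba: "homog CA (wdeg H a + wdeg H b + 2) (Phi b a)"
        using homog_Phi[OF 3(2,1)] by (simp add: add.commute)
      note h = homog_Phi[OF 3] Phi_ba homog_Psi[OF 3]
      note h' = h[unfolded homog_cobar, THEN conjunct1] h[unfolded homog_cobar, THEN conjunct2]
      have eq: "BV_homotopy a b = Phi a b + (- ksign ((wdeg H a + 1) * (wdeg H b + 1))) \<cdot> Phi b a
          + ksign ((wdeg H a + 1) * (wdeg H b + 1)) \<cdot> Psi a b"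
        using ne by (simp add: BV_homotopy_def minus_scale)
      have "WH (wdeg H a + wdeg H b + 2) (BV_homotopy a b)"
        unfolding eq by (rule supp_add, rule supp_add, rule h', rule supp_scale, rule h', rule supp_scale, rule h')
      moreover have "supp (lists (rbasis H)) (BV_homotopy a b)"
        unfolding eq by (rule supp_add, rule supp_add, rule h', rule supp_scale, rule h', rule supp_scale, rule h')
      ultimately have "homog CA (deg CA a + deg CA b + 2) (BV_homotopy a b)" by (simp add: homog_cobar)
      then show ?thesis
        using ne BV_identity[OF 3] by (simp only: m G_bracket_def) (simp add: ab)
    next
      case 1
      have "lin (\<lambda>x. BV_homotopy x b) (cd a) = 0" "lin (BV_homotopy a) (cd b) = 0"
        by (simp_all add: 1 BV_homotopy_def[abs_def])
      then show ?thesis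
        by (simp only: m) (simp add: 1 Del[OF b] rot_Nil G_bracket_def homog_def BV_homotopy_def)
    next
      case 2
      have "lin (\<lambda>x. BV_homotopy x b) (cd a) = 0" "lin (BV_homotopy a) (cd b) = 0"
        by (simp_all add: 2 BV_homotopy_def[abs_def])
      then show ?thesis
        by (simp only: m) (simp add: 2 Del[OF a] rot_Nil G_bracket_def homog_def BV_homotopy_def)
    qed
  qed
  show ?thesis
    unfolding homotopy_BV_algebra_def
    using K.homotopy_G_algebra_brace D h by blast
qed

end

section \<open>The tensor Hopf algebra\<close>

context bialgebra
begin

text \<open>The convolution argument: S equals S convolved with id and T, which equals T by
  associativity. Off the basis both functions are 0. This is what identifies the antipode, defined
  by a definite description, with an explicit formula.\<close>

lemma antipode_unique:
  assumes S: "is_antipode H S" and T: "is_antipode H T"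
  shows "S = T"
proof
  fix x
  have SB: "supp B (S x)" if "x \<in> B" for x using S that by (auto simp: is_antipode_def homog_def)
  have TB: "supp B (T x)" if "x \<in> B" for x using T that by (auto simp: is_antipode_def homog_def)
  have Sl: "hsw x (\<lambda>a b. lin (\<lambda>s. mult H s b) (S a)) = (if x = one H then bvec (one H) else 0)" if "x \<in> B" for x
    using S that by (simp add: is_antipode_def sw_def)
  have Tr: "hsw x (\<lambda>a b. lin (mult H a) (T b)) = (if x = one H then bvec (one H) else 0)" if "x \<in> B" for x
    using T that by (simp add: is_antipode_def sw_def)
  let ?G = "\<lambda>a b c. lin (\<lambda>s. lin (mult H s) (lin (mult H b) (T c))) (S a)"
  show "S x = T x"
  proof (cases "x \<in> B")
    case x: True
    have 1: "hsw b (\<lambda>b1 b2. ?G a b1 b2) = (if b = one H then S a else 0)" if ab: "a \<in> B" "b \<in> B" for a b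
    proof -
      have "lmap (\<lambda>p. lin (\<lambda>s. lin (mult H s) p) (S a))" by (intro lmap_intros)
      note * = lmap_of_sw[OF this]
      have "hsw b (\<lambda>b1 b2. ?G a b1 b2) = lin (\<lambda>s. lin (mult H s) (if b = one H then bvec (one H) else 0)) (S a)"
        unfolding Tr[OF ab(2), symmetric] by (rule *[symmetric])
      also have "\<dots> = lin (\<lambda>s. if b = one H then bvec s else 0) (S a)"
        by (rule lin_cong_supp[OF SB[OF ab(1)]]) simp
      finally show ?thesis by (cases "b = one H") simp_all
    qed
    have 2: "hsw a (\<lambda>a1 a2. ?G a1 a2 c) = (if a = one H then T c else 0)" if ac: "a \<in> B" "c \<in> B" for a c
    proof -
      have "?G a1 a2 c = lin (\<lambda>t. lin (\<lambda>y. mult H y t) (lin (\<lambda>s. mult H s a2) (S a1))) (T c)"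
        if "a1 \<in> B" "a2 \<in> B" for a1 a2
      proof -
        have "?G a1 a2 c = lin (\<lambda>t. lin (\<lambda>s. lin (mult H s) (mult H a2 t)) (S a1)) (T c)"
          unfolding lin_lin by (rule lin_swap)
        also have "\<dots> = lin (\<lambda>t. lin (\<lambda>s. lin (\<lambda>y. mult H y t) (mult H s a2)) (S a1)) (T c)"
          by (rule lin_cong_supp[OF TB[OF ac(2)]], rule lin_cong_supp[OF SB[OF that(1)]])
            (rule mult_assoc[symmetric, OF _ that(2)])
        finally show ?thesis by (simp add: lin_lin)
      qed
      then have "hsw a (\<lambda>a1 a2. ?G a1 a2 c) =
          hsw a (\<lambda>a1 a2. lin (\<lambda>t. lin (\<lambda>y. mult H y t) (lin (\<lambda>s. mult H s a2) (S a1))) (T c))"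
        by (intro hsw_cong[OF ac(1)])
      also have "\<dots> = lin (\<lambda>t. lin (\<lambda>y. mult H y t) (if a = one H then bvec (one H) else 0)) (T c)"
      proof -
        have "lmap (\<lambda>p. lin (\<lambda>t. lin (\<lambda>y. mult H y t) p) (T c))" by (intro lmap_intros)
        note * = lmap_of_sw[OF this]
        show ?thesis unfolding Sl[OF ac(1), symmetric] by (rule *[symmetric])
      qed
      also have "\<dots> = lin (\<lambda>t. if a = one H then bvec t else 0) (T c)"
        by (rule lin_cong_supp[OF TB[OF ac(2)]]) simp
      finally show ?thesis by (cases "a = one H") simp_all
    qed
    have "S x = hsw x (\<lambda>a b. if b = one H then S a else 0)"
      by (subst hsw_counit_right[OF x]) simp_all
    also have "\<dots> = hsw x (\<lambda>a b. hsw b (\<lambda>b1 b2. ?G a b1 b2))"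
      by (rule hsw_cong[OF x]) (simp only: 1)
    also have "\<dots> = hsw x (\<lambda>a b. hsw a (\<lambda>a1 a2. ?G a1 a2 b))"
      by (rule hsw_coassoc[OF x, symmetric])
    also have "\<dots> = hsw x (\<lambda>a b. if a = one H then T b else 0)"
      by (rule hsw_cong[OF x]) (simp only: 2)
    also have "\<dots> = T x"
      by (subst hsw_counit_left[OF x]) simp_all
    finally show ?thesis .
  qed (use S T in \<open>simp add: is_antipode_def\<close>)
qed

lemma antipode_eqI: "is_antipode H T \<Longrightarrow> antipode H = T"
  unfolding antipode_def by (rule the_equality) (auto intro: antipode_unique)

end

lemma bialg_sel [simp]:
  "basis (bialg A nab) = basis A" "deg (bialg A nab) = deg A" "diff (bialg A nab) = diff A"
  "one (bialg A nab) = one A" "mult (bialg A nab) = mult A" "bcomult (bialg A nab) = nab"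
  by (simp_all add: bialg_def)

lemma alg_part_bialg [simp]: "alg_part (bialg A nab) = A"
  by (simp add: alg_part_def)

lemma case_prod_bvec [simp]: "(\<lambda>(a, b). bvec (a, b)) = bvec"
  by (simp add: fun_eq_iff)

text \<open>Primitivity is assumed twice: in \<open>C\<close>, where it removes the quadratic part
  of the cobar differential, and for the letters in the cobar construction, where it makes
  \<open>nab\<close> the unshuffle coproduct. The recursion for \<open>nab\<close> has the shape of
  that of \<open>baues_coproduct\<close>.\<close>

locale primitive_cobar = coalgebra C for C :: "('c, 'r::comm_ring_1) dgcoalg" +
  fixes nab :: "'c list \<Rightarrow> ('c list \<times> 'c list \<Rightarrow>\<^sub>0 'r)"
  assumes primitive: "c \<in> rbasis C \<Longrightarrow> reduced_comult C c = 0"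
    and nab_Nil: "nab [] = bvec ([], [])"
    and nab_Cons: "c \<in> rbasis C \<Longrightarrow>
      nab (c # w) = tensor_mult (cobar C) (bvec ([c], []) + bvec ([], [c])) (nab w)"
begin

abbreviation "W \<equiv> lists (rbasis C)"
abbreviation "H \<equiv> bialg (cobar C) nab"
abbreviation "N w F \<equiv> sw (coalg_part H) w F"

lemma N_def: "N w F = lin (\<lambda>(a, b). F a b) (nab w)"
  by (simp add: sw_def)

lemma N_Nil [simp]: "N [] F = F [] []"
  by (simp add: N_def nab_Nil)

lemma N_Cons: "c \<in> rbasis C \<Longrightarrow>
    N (c # w) F = N w (\<lambda>a b. F (c # a) b + ksign ((deg C c - 1) * wdeg C a) \<cdot> F a (c # b))"
  by (simp add: N_def nab_Cons tensor_mult_def lin2_def lin_add lin_lin lin_scale case_prod_unfold lin_fun_add)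

lemma supp_nab: "w \<in> W \<Longrightarrow> supp {(a, b). a \<in> W \<and> b \<in> W \<and> wdeg C a + wdeg C b = wdeg C w} (nab w)"
proof (induct w)
  case Nil
  show ?case unfolding nab_Nil by (rule supp_bvec) simp
next
  case (Cons c w)
  have "nab (c # w) = N (c # w) (\<lambda>a b. bvec (a, b))" by (simp add: N_def)
  also have "\<dots> = lin (\<lambda>(a, b). bvec (c # a, b) + ksign ((deg C c - 1) * wdeg C a) \<cdot> bvec (a, c # b)) (nab w)"
    using Cons by (subst N_Cons) (simp_all add: N_def)
  finally have eq: "nab (c # w) = lin (\<lambda>(a, b). bvec (c # a, b) + ksign ((deg C c - 1) * wdeg C a) \<cdot> bvec (a, c # b)) (nab w)" .
  have w: "w \<in> W" using Cons(2) by simp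
  show ?case unfolding eq
  proof (rule supp_lin[OF Cons(1)[OF w]])
    fix x assume x: "x \<in> {(a, b). a \<in> W \<and> b \<in> W \<and> wdeg C a + wdeg C b = wdeg C w}"
    show "supp {(a, b). a \<in> W \<and> b \<in> W \<and> wdeg C a + wdeg C b = wdeg C (c # w)}
      (case x of (a, b) \<Rightarrow> bvec (c # a, b) + ksign ((deg C c - 1) * wdeg C a) \<cdot> bvec (a, c # b))"
      unfolding case_prod_unfold
      by (rule supp_add, rule supp_bvec, use x Cons(2) in force, rule supp_scale, rule supp_bvec, use x Cons(2) in force)
  qed
qed

lemma N_cong:
  assumes "w \<in> W" "\<And>a b. a \<in> W \<Longrightarrow> b \<in> W \<Longrightarrow> wdeg C w = wdeg C a + wdeg C b \<Longrightarrow> F a b = G a b"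
  shows "N w F = N w G"
  unfolding N_def by (rule lin_cong_supp[OF supp_nab[OF assms(1)]]) (auto intro: assms(2))

lemma N_append: "u \<in> W \<Longrightarrow> N (u @ v) F = N u (\<lambda>a b. N v (\<lambda>a' b'. ksign (wdeg C b * wdeg C a') \<cdot> F (a @ a') (b @ b')))"
proof (induct u arbitrary: F)
  case (Cons c u)
  then show ?case
    by (simp add: N_Cons scale_sw sw_add[symmetric] del: sw_add)
      (rule N_cong, simp, simp add: scale_sw sw_add[symmetric] ksign_expand scale_add)
qed simp

lemma N_counit_left: "w \<in> W \<Longrightarrow> N w (\<lambda>a b. if a = [] then F b else 0) = F w"
proof (induct w arbitrary: F)
  case (Cons c w)
  have "N (c # w) (\<lambda>a b. if a = [] then F b else 0) = N w (\<lambda>a b. if a = [] then F (c # b) else 0)"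
    using Cons by (subst N_Cons, simp, intro N_cong) auto
  then show ?case using Cons by simp
qed simp

lemma N_counit_right: "w \<in> W \<Longrightarrow> N w (\<lambda>a b. if b = [] then F a else 0) = F w"
proof (induct w arbitrary: F)
  case (Cons c w)
  have "N (c # w) (\<lambda>a b. if b = [] then F a else 0) = N w (\<lambda>a b. if b = [] then F (c # a) else 0)"
    using Cons by (subst N_Cons, simp, intro N_cong) auto
  then show ?case using Cons by simp
qed simp

lemma N_coassoc: "w \<in> W \<Longrightarrow> N w (\<lambda>a b. N a (\<lambda>a1 a2. F a1 a2 b)) = N w (\<lambda>a b. N b (\<lambda>b1 b2. F a b1 b2))"
proof (induct w arbitrary: F)
  case (Cons c w)
  let ?s = "\<lambda>a. ksign ((deg C c - 1) * wdeg C a)"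
  let ?F = "\<lambda>x y z. F (c # x) y z + ?s x \<cdot> F x (c # y) z + (?s x * ?s y) \<cdot> F x y (c # z)"
  have c: "c \<in> rbasis C" and w: "w \<in> W" using Cons by auto
  have "N (c # w) (\<lambda>a b. N a (\<lambda>a1 a2. F a1 a2 b)) = N w (\<lambda>a b. N a (\<lambda>a1 a2. ?F a1 a2 b))"
    unfolding N_Cons[OF c] scale_sw sw_add[symmetric]
    by (intro N_cong w) (simp_all add: ksign_expand)
  also have "\<dots> = N w (\<lambda>a b. N b (\<lambda>b1 b2. ?F a b1 b2))"
    by (rule Cons(1)[OF w])
  also have "\<dots> = N (c # w) (\<lambda>a b. N b (\<lambda>b1 b2. F a b1 b2))"
    unfolding N_Cons[OF c] scale_sw sw_add[symmetric]
    by (intro N_cong w) (simp_all add: scale_add add.assoc)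
  finally show ?case .
qed simp

lemma N_cocomm: "w \<in> W \<Longrightarrow> N w F = N w (\<lambda>a b. ksign (wdeg C a * wdeg C b) \<cdot> F b a)"
proof (induct w arbitrary: F)
  case (Cons c w)
  have c: "c \<in> rbasis C" and w: "w \<in> W" using Cons by auto
  show ?case
    unfolding N_Cons[OF c]
    by (subst Cons(1)[OF w], rule N_cong[OF w]) (simp add: scale_add ksign_expand add.commute)
qed simp

lemma lin_cobar_diff_Cons: "c \<in> rbasis C \<Longrightarrow> lin G (cobar_diff C (c # w)) =
    - lin (\<lambda>c'. G (c' # w)) (diff C c) + ksign (deg C c - 1) \<cdot> lin (\<lambda>w'. G (c # w')) (cobar_diff C w)"
  by (simp add: cobar_diff_Cons cobar_gen_def primitive linear_simps letter_def conc_eq_lin)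

lemma N_diff: "w \<in> W \<Longrightarrow> lin (\<lambda>x. N x F) (cobar_diff C w) =
    N w (\<lambda>a b. lin (\<lambda>a'. F a' b) (cobar_diff C a) + ksign (wdeg C a) \<cdot> lin (F a) (cobar_diff C b))"
proof (induct w arbitrary: F)
  case (Cons c w)
  have c: "c \<in> rbasis C" and w: "w \<in> W" using Cons by auto
  let ?k = "deg C c - 1"
  have 1: "lin (\<lambda>c'. N (c' # w) F) (diff C c) =
      N w (\<lambda>a b. lin (\<lambda>c'. F (c' # a) b) (diff C c) + ksign ((?k - 1) * wdeg C a) \<cdot> lin (\<lambda>c'. F a (c' # b)) (diff C c))"
  proof -
    have "lin (\<lambda>c'. N (c' # w) F) (diff C c) =
       lin (\<lambda>c'. N w (\<lambda>a b. F (c' # a) b + ksign ((?k - 1) * wdeg C a) \<cdot> F a (c' # b))) (diff C c)"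
      by (rule lin_cong_supp[OF supp_diff_rbasis[OF c]]) (simp add: N_Cons)
    then show ?thesis by (simp only: sw_lin[symmetric] lin_fun_add lin_fun_scale)
  qed
  have 2: "lin (\<lambda>w'. N (c # w') F) (cobar_diff C w) = N w (\<lambda>a b.
      lin (\<lambda>a'. F (c # a') b) (cobar_diff C a) + ksign (?k * (wdeg C a - 1)) \<cdot> lin (\<lambda>a'. F a' (c # b)) (cobar_diff C a)
      + ksign (wdeg C a) \<cdot> (lin (F (c # a)) (cobar_diff C b) + ksign (?k * wdeg C a) \<cdot> lin (\<lambda>b'. F a (c # b')) (cobar_diff C b)))"
    unfolding N_Cons[OF c] Cons(1)[OF w]
  proof (rule N_cong[OF w], goal_cases)
    case (1 a b)
    have "lin (\<lambda>a'. ksign (?k * wdeg C a') \<cdot> F a' (c # b)) (cobar_diff C a) =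
       lin (\<lambda>a'. ksign (?k * (wdeg C a - 1)) \<cdot> F a' (c # b)) (cobar_diff C a)"
      by (rule lin_cong_supp[OF supp_cobar_diff[OF 1(1)]]) simp
    then show ?case by (simp only: lin_fun_add lin_fun_scale)
  qed
  show ?case
    unfolding lin_cobar_diff_Cons[OF c] 1 2 unfolding N_Cons[OF c] scale_sw sw_minus[symmetric] sw_add[symmetric]
    by (rule N_cong[OF w]) (simp add: lin_cobar_diff_Cons[OF c] ksign_expand scale_add scale_diff scale_minus)
qed simp

lemma dg_bialgebra_tensor: "dg_bialgebra H"
  unfolding dg_bialgebra_def
proof (intro conjI ballI)
  show "dg_algebra (alg_part H)" by (simp add: dg_algebra_cobar)
next
  have dgm: "dg_module (coalg_part H)"
    using dg_algebra_cobar by (simp add: dg_algebra_def dg_module_def homog_def)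
  have h: "homog2 (coalg_part H) (wdeg C w) (nab w)" if "w \<in> W" for w
    using supp_nab[OF that] by (simp add: homog2_def)
  have coassoc: "lin (\<lambda>(a, b). lin (\<lambda>(a1, a2). bvec (a1, a2, b)) (nab a)) (nab w) =
          lin (\<lambda>(a, b). lin (\<lambda>(b1, b2). bvec (a, b1, b2)) (nab b)) (nab w)" if "w \<in> W" for w
    using N_coassoc[OF that, of "\<lambda>a b c. bvec (a, b, c)"] by (simp add: N_def)
  have td: "tensor_diff (coalg_part H) = (\<lambda>(a, b). lin (\<lambda>a'. bvec (a', b)) (cobar_diff C a)
      + ksign (wdeg C a) \<cdot> lin (\<lambda>b'. bvec (a, b')) (cobar_diff C b))"
    by (simp add: tensor_diff_def tensor_eq_lin fun_eq_iff)
  have compat: "lin (tensor_diff (coalg_part H)) (nab w) = lin nab (cobar_diff C w)" if "w \<in> W" for w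
    using N_diff[OF that, of "\<lambda>a b. bvec (a, b)", symmetric] unfolding td by (simp add: N_def)
  have l: "lin (\<lambda>(a, b). if a = [] then bvec b else 0) (nab w) = bvec w" if "w \<in> W" for w
    using N_counit_left[OF that, of bvec] by (simp add: N_def)
  have r: "lin (\<lambda>(a, b). if b = [] then bvec a else 0) (nab w) = bvec w" if "w \<in> W" for w
    using N_counit_right[OF that, of bvec] by (simp add: N_def)
  show "dg_coalgebra (coalg_part H)"
    unfolding dg_coalgebra_def using dgm h coassoc compat l r by (simp add: nab_Nil)
next
  fix u v assume "u \<in> basis H" "v \<in> basis H"
  then have u: "u \<in> W" by simp
  show "lin (bcomult H) (mult H u v) = tensor_mult H (bcomult H u) (bcomult H v)"
    using N_append[OF u, of v "\<lambda>a b. bvec (a, b)"]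
    by (simp add: N_def tensor_mult_def lin2_def case_prod_unfold)
qed

sublocale T: bialgebra H
  by unfold_locales (rule dg_bialgebra_tensor)

text \<open>The sign of the antipode \<open>w \<mapsto> \<plusminus> rev w\<close>.\<close>

fun rsg :: "'c list \<Rightarrow> int" where
  "rsg [] = 0"
| "rsg (c # w) = rsg w + (deg C c - 1) * wdeg C w + 1"

lemma rev_in_W [simp]: "rev w \<in> W \<longleftrightarrow> w \<in> W"
  by (simp add: lists_eq_set)

lemma wdeg_rev: "wdeg C (rev w) = wdeg C w"
  by (induct w) simp_all

lemma rsg_append: "rsg (u @ v) = rsg u + rsg v + wdeg C u * wdeg C v"
  by (induct u) (simp_all add: algebra_simps)

lemma rsg_rev: "rsg (rev w) = rsg w"
  by (induct w) (simp_all add: rsg_append wdeg_rev algebra_simps)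

text \<open>The first letter c goes to the left or to the right factor, and in both cases it ends up
  between \<open>rev a\<close> and \<open>b\<close>. The two terms have opposite signs and
  cancel.\<close>

lemma rev_left: "w \<in> W \<Longrightarrow> N w (\<lambda>a b. ksign (rsg a) \<cdot> bvec (rev a @ b)) = (if w = [] then bvec [] else 0)"
proof (cases w)
  case (Cons c v)
  assume "w \<in> W"
  then have "N w (\<lambda>a b. ksign (rsg a) \<cdot> bvec (rev a @ b)) = N v (\<lambda>a b. 0 \<cdot> 0)"
    unfolding Cons by (subst N_Cons, simp, intro N_cong) (simp_all add: ksign_expand)
  then show ?thesis by (simp add: Cons scale_sw[symmetric])
qed simp

text \<open>Here the first letter lands at opposite ends of the word, so the terms do not cancel one
  by one. The induction hypothesis kills everything unless the rest is empty, where both ends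
  coincide.\<close>

lemma rev_right: "w \<in> W \<Longrightarrow> N w (\<lambda>a b. ksign (rsg b) \<cdot> bvec (a @ rev b)) = (if w = [] then bvec [] else 0)"
proof (induct w)
  case (Cons c w)
  let ?T = "N w (\<lambda>a b. ksign (rsg b) \<cdot> bvec (a @ rev b))"
  have "N (c # w) (\<lambda>a b. ksign (rsg b) \<cdot> bvec (a @ rev b)) =
      N w (\<lambda>a b. bvec [c] \<odot> (ksign (rsg b) \<cdot> bvec (a @ rev b))
        - ksign ((deg C c - 1) * wdeg C w) \<cdot> ((ksign (rsg b) \<cdot> bvec (a @ rev b)) \<odot> bvec [c]))"
    using Cons by (subst N_Cons, simp, intro N_cong) (simp_all add: ksign_expand scale_minus conc_scale_left conc_scale_right)
  also have "\<dots> = bvec [c] \<odot> ?T - ksign ((deg C c - 1) * wdeg C w) \<cdot> (?T \<odot> bvec [c])"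
    by (simp only: sw_diff scale_sw[symmetric] conc_sw_left conc_sw_right)
  also have "\<dots> = 0" using Cons by (cases "w = []") simp_all
  finally show ?case by simp
qed simp

lemma is_antipode_rev: "is_antipode H (\<lambda>w. if w \<in> W then ksign (rsg w) \<cdot> bvec (rev w) else 0)"
proof -
  let ?S = "\<lambda>w. if w \<in> W then ksign (rsg w) \<cdot> bvec (rev w) else 0"
  have "N w (\<lambda>a b. lin (\<lambda>x. bvec (x @ b)) (?S a)) = (if w = [] then bvec [] else 0)" if "w \<in> W" for w
    unfolding rev_left[OF that, symmetric] by (rule N_cong[OF that]) (simp add: lin_scale)
  moreover have "N w (\<lambda>a b. lin (\<lambda>y. bvec (a @ y)) (?S b)) = (if w = [] then bvec [] else 0)" if "w \<in> W" for w
    unfolding rev_right[OF that, symmetric] by (rule N_cong[OF that]) (simp add: lin_scale)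
  moreover have "supp {x \<in> W. wdeg C x = wdeg C w} (?S w)" if "w \<in> W" for w
    using that by (simp, intro supp_scale supp_bvec) (simp add: wdeg_rev)
  ultimately show ?thesis
    unfolding is_antipode_def by (intro conjI allI impI ballI) (simp_all add: N_def homog_def)
qed

lemma antipode_eq: "antipode H = (\<lambda>w. if w \<in> W then ksign (rsg w) \<cdot> bvec (rev w) else 0)"
  by (rule T.antipode_eqI[OF is_antipode_rev])

lemma dg_hopf_algebra_tensor: "dg_hopf_algebra H"
  unfolding dg_hopf_algebra_def using dg_bialgebra_tensor is_antipode_rev by blast

lemma involutive: "involutive_antipode H"
  unfolding involutive_antipode_def
proof
  fix w assume "w \<in> basis H"
  then have "w \<in> W" "rev w \<in> W" by simp_all
  then show "lin (antipode H) (antipode H w) = bvec w"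
    by (simp add: antipode_eq lin_scale rsg_rev)
qed

lemma N_rev: "w \<in> W \<Longrightarrow> ksign (rsg w) \<cdot> N (rev w) F = N w (\<lambda>a b. ksign (rsg a + rsg b) \<cdot> F (rev a) (rev b))"
proof (induct w arbitrary: F)
  case (Cons c w)
  have c: "c \<in> rbasis C" and w: "w \<in> W" using Cons by auto
  let ?F = "\<lambda>a b. ksign ((deg C c - 1) * wdeg C b) \<cdot> F (a @ [c]) b + F a (b @ [c])"
  have "N (rev (c # w)) F = N (rev w) ?F"
    using N_append[of "rev w" "[c]"] w by (simp add: N_Cons[OF c] mult.commute)
  then have "ksign (rsg (c # w)) \<cdot> N (rev (c # w)) F = ksign ((deg C c - 1) * wdeg C w + 1) \<cdot> (ksign (rsg w) \<cdot> N (rev w) ?F)"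
    by (simp add: ksign_expand)
  also have "\<dots> = N w (\<lambda>a b. ksign ((deg C c - 1) * wdeg C w + 1) \<cdot> (ksign (rsg a + rsg b) \<cdot> ?F (rev a) (rev b)))"
    by (subst Cons(1)[OF w]) (rule scale_sw)
  also have "\<dots> = N (c # w) (\<lambda>a b. ksign (rsg a + rsg b) \<cdot> F (rev a) (rev b))"
    unfolding N_Cons[OF c] by (rule N_cong[OF w]) (simp add: ksign_expand wdeg_rev scale_add scale_minus)
  finally show ?case .
qed simp

lemma rev_diff: "w \<in> W \<Longrightarrow> lin (\<lambda>x. ksign (rsg x) \<cdot> bvec (rev x)) (cobar_diff C w) = ksign (rsg w) \<cdot> cobar_diff C (rev w)"
proof (induct w)
  case (Cons c w)
  have c: "c \<in> rbasis C" and w: "w \<in> W" using Cons by auto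
  let ?k = "deg C c - 1"
  have 1: "lin (\<lambda>c'. ksign (rsg (c' # w)) \<cdot> bvec (rev (c' # w))) (diff C c) =
      ksign (rsg w + (?k - 1) * wdeg C w + 1) \<cdot> (bvec (rev w) \<odot> letter (diff C c))"
  proof -
    have "lin (\<lambda>c'. ksign (rsg (c' # w)) \<cdot> bvec (rev (c' # w))) (diff C c) =
       lin (\<lambda>c'. ksign (rsg w + (?k - 1) * wdeg C w + 1) \<cdot> bvec (rev w @ [c'])) (diff C c)"
      by (rule lin_cong_supp[OF supp_diff_rbasis[OF c]]) simp
    then show ?thesis by (simp add: lin_fun_scale letter_def conc_lin_right)
  qed
  have 2: "lin (\<lambda>w'. ksign (rsg (c # w')) \<cdot> bvec (rev (c # w'))) (cobar_diff C w) =
      ksign (?k * (wdeg C w - 1) + 1) \<cdot> (ksign (rsg w) \<cdot> cobar_diff C (rev w) \<odot> bvec [c])"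
  proof -
    have "lin (\<lambda>w'. ksign (rsg (c # w')) \<cdot> bvec (rev (c # w'))) (cobar_diff C w) =
       lin (\<lambda>w'. ksign (?k * (wdeg C w - 1) + 1) \<cdot> (ksign (rsg w') \<cdot> bvec (rev w') \<odot> bvec [c])) (cobar_diff C w)"
      by (rule lin_cong_supp[OF supp_cobar_diff[OF w]]) (auto simp: ksign_expand conc_scale_left)
    also have "\<dots> = ksign (?k * (wdeg C w - 1) + 1) \<cdot> (lin (\<lambda>w'. ksign (rsg w') \<cdot> bvec (rev w')) (cobar_diff C w) \<odot> bvec [c])"
      by (simp only: lin_fun_scale conc_lin_left)
    finally show ?thesis by (simp only: Cons(1)[OF w])
  qed
  have "cobar_diff C [c] = - letter (diff C c)"
    using lin_cobar_diff_Cons[OF c, of bvec "[]"] by (simp add: letter_def)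
  then show ?case
    unfolding lin_cobar_diff_Cons[OF c] 1 2
    by (simp add: cobar_diff_append wdeg_rev conc_minus_right conc_scale_left ksign_expand scale_add scale_diff scale_minus)
qed simp

lemma nab_single: "c \<in> rbasis C \<Longrightarrow> nab [c] = bvec ([c], []) + bvec ([], [c])"
  by (simp add: nab_Cons nab_Nil tensor_mult_def lin2_def lin_add)

lemma homotopy_G_coalgebra_primitive: "homotopy_G_coalgebra C nab"
  unfolding homotopy_G_coalgebra_def using dgc dg_bialgebra_tensor by (simp add: nab_single)

lemma cobar_component_primitive: "c \<in> rbasis C \<Longrightarrow> 1 \<le> k \<Longrightarrow> cobar_component nab k 1 c = 0"
  by (simp add: cobar_component_def nab_single lin_add)

text \<open>Letters of degree at least 3 have desuspended degree at least 2, so no word has degree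
  1. The remaining conditions are read off the reversal formula for the antipode.\<close>

lemma cocomm_hopf_tensor:
  assumes deg3: "\<And>c. c \<in> rbasis C \<Longrightarrow> 3 \<le> deg C c"
  shows "cocomm_hopf H"
proof unfold_locales
  have len: "wdeg C w \<ge> 2 * int (length w)" if "w \<in> W" for w
    using that by (induct w) (use deg3 in force)+
  then have "wdeg C w \<ge> 2" if "w \<in> W" "w \<noteq> []" for w
    using len[OF that(1)] that(2) by (cases w) auto
  then show "n_reduced 1 H" unfolding n_reduced_def by force
next
  fix x assume "x \<in> basis H"
  then have x: "x \<in> W" "rev x \<in> W" by simp_all
  show "bcomult H x = lin (\<lambda>(a, b). ksign (deg H a * deg H b) \<cdot> bvec (b, a)) (bcomult H x)"
    using N_cocomm[OF x(1), of "\<lambda>a b. bvec (a, b)"] by (simp add: N_def)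
  show "supp {s \<in> basis H. deg H s = deg H x} (antipode H x)"
    using x by (auto intro!: supp_scale supp_bvec simp: antipode_eq wdeg_rev)
  show "lin (bcomult H) (antipode H x) = lin (\<lambda>(a, b). tensor (antipode H a) (antipode H b)) (bcomult H x)"
  proof -
    have "lin (bcomult H) (antipode H x) = N x (\<lambda>a b. ksign (rsg a + rsg b) \<cdot> bvec (rev a, rev b))"
      using N_rev[OF x(1), of "\<lambda>a b. bvec (a, b)"] x by (simp add: N_def antipode_eq lin_scale)
    also have "\<dots> = N x (\<lambda>a b. tensor (antipode H a) (antipode H b))"
      by (rule N_cong[OF x(1)]) (simp add: antipode_eq tensor_eq_lin lin_scale ksign_mult)
    finally show ?thesis by (simp add: N_def)
  qed
  show "lin (antipode H) (diff H x) = lin (diff H) (antipode H x)"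
  proof -
    have "lin (antipode H) (diff H x) = lin (\<lambda>x. ksign (rsg x) \<cdot> bvec (rev x)) (cobar_diff C x)"
      unfolding bialg_sel cobar_sel
      by (rule lin_cong_supp[OF supp_cobar_diff[OF x(1)]]) (simp add: antipode_eq)
    then show ?thesis using x by (simp add: rev_diff antipode_eq lin_scale)
  qed
  show "lin (\<lambda>(a, b). lin (\<lambda>s. mult H s b) (antipode H a)) (bcomult H x) = (if x = one H then bvec (one H) else 0)"
  proof -
    have "N x (\<lambda>a b. lin (\<lambda>s. mult H s b) (antipode H a)) = N x (\<lambda>a b. ksign (rsg a) \<cdot> bvec (rev a @ b))"
      by (rule N_cong[OF x(1)]) (simp add: antipode_eq lin_scale)
    then show ?thesis using rev_left[OF x(1)] by (simp add: N_def)
  qed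
  fix y assume "y \<in> basis H"
  then have y: "y \<in> W" "rev y \<in> W" by simp_all
  show "lin (antipode H) (mult H x y) =
      ksign (deg H x * deg H y) \<cdot> lin (\<lambda>s. lin (mult H s) (antipode H x)) (antipode H y)"
    using x y by (simp add: antipode_eq lin_scale rsg_append) (simp add: ksign_expand)
qed

end

section \<open>Normalized chains\<close>

lemma chains_sel [simp]:
  "basis (normalized_chains Y) = {(n, x). x \<in> simp Y n \<and> \<not> degenerate Y n x}"
  "deg (normalized_chains Y) = (\<lambda>(n, x). int n)" "one (normalized_chains Y) = (0, vertex Y)"
  by (simp_all add: normalized_chains_def)

text \<open>Evaluated at degenerate simplices as well, in contrast to \<open>diff\<close>; its
  vanishing there is what makes it compatible with \<open>chain_class\<close>.\<close>

definition boundary :: "'a sset \<Rightarrow> nat \<Rightarrow> 'a \<Rightarrow> (nat \<times> 'a \<Rightarrow>\<^sub>0 'r::comm_ring_1)" where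
  "boundary Y n x = (\<Sum>i\<le>n. (-1) ^ i \<cdot> chain_class Y (n - 1) (face Y n i x))"

lemma chains_diff: "diff (normalized_chains Y) (n, x) = (if n = 0 then 0 else boundary Y n x)"
  by (simp add: normalized_chains_def boundary_def)

lemma chains_comult: "comult (normalized_chains Y) (n, x) =
    (\<Sum>i\<le>n. tensor (chain_class Y i (subsimplex Y n {0..i} x)) (chain_class Y (n - i) (subsimplex Y n {i..n} x)))"
  by (simp add: normalized_chains_def)

context
  fixes Y :: "'a sset"
  assumes Y: "simplicial_set Y"
begin

text \<open>The faces j and j + 1 of the degeneracy s_j y both equal y and cancel; all other faces
  are degenerate again.\<close>

lemma boundary_degenerate:
  assumes "degenerate Y n x"
  shows "boundary Y n x = 0"
proof -
  obtain m j y where y: "y \<in> simp Y m" and n: "n = Suc m" and j: "j \<le> m" and x: "x = degen Y m j y"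
    using assms by (auto simp: degenerate_def)
  have nz: "(-1) ^ i \<cdot> chain_class Y m (face Y (Suc m) i x) = 0" if i: "i \<le> Suc m" "i \<noteq> j" "i \<noteq> Suc j" for i
  proof -
    consider k where "m = Suc k" "i < j" | k where "m = Suc k" "Suc j < i"
      using i j by (cases m) force+
    then have "degenerate Y m (face Y (Suc m) i x)"
    proof cases
      case 1
      have "face Y (Suc m) i x = degen Y k (j - 1) (face Y m i y)"
        unfolding x using simplicial_setD(5)[OF Y y, of i j] 1 j by simp
      moreover have "face Y m i y \<in> simp Y k"
        unfolding 1 by (rule simplicial_setD(1)[OF Y]) (use y 1 j in auto)
      ultimately show ?thesis
        unfolding degenerate_def using 1 j by (intro exI[of _ k] exI[of _ "j - 1"] bexI[of _ "face Y m i y"]) auto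
    next
      case 2
      have "face Y (Suc m) i x = degen Y k j (face Y m (i - 1) y)"
        unfolding x using simplicial_setD(8)[OF Y y, of j i] 2 i by simp
      moreover have "face Y m (i - 1) y \<in> simp Y k"
        unfolding 2 by (rule simplicial_setD(1)[OF Y]) (use y 2 i in auto)
      ultimately show ?thesis
        unfolding degenerate_def using 2 i by (intro exI[of _ k] exI[of _ j] bexI[of _ "face Y m (i - 1) y"]) auto
    qed
    then show ?thesis by (simp add: chain_class_def)
  qed
  have "boundary Y n x = (\<Sum>i\<in>{j, Suc j}. (-1) ^ i \<cdot> chain_class Y m (face Y (Suc m) i x))"
    unfolding boundary_def n diff_Suc_1 by (rule sum.mono_neutral_right) (use j nz in auto)
  also have "\<dots> = 0"
    unfolding x by (simp add: simplicial_setD(6,7)[OF Y y j] minus_scale)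
  finally show ?thesis .
qed

lemma lin_diff_chain_class:
  "lin (diff (normalized_chains Y)) (chain_class Y (Suc n) x) = boundary Y (Suc n) x"
  by (simp add: chain_class_def boundary_degenerate chains_diff)

lemma boundary_boundary:
  assumes x: "x \<in> simp Y (Suc (Suc m))"
  shows "lin (diff (normalized_chains Y)) (boundary Y (Suc (Suc m)) x) = (0 :: nat \<times> 'a \<Rightarrow>\<^sub>0 'r::comm_ring_1)"
proof -
  let ?t = "\<lambda>(i, j). ((-1) ^ j * (-1) ^ i) \<cdot> chain_class Y m (face Y (Suc m) i (face Y (Suc (Suc m)) j x)) :: nat \<times> 'a \<Rightarrow>\<^sub>0 'r"
  let ?A = "{(i, j). i < j \<and> j \<le> Suc (Suc m)}" and ?B = "{(i, j). j \<le> i \<and> i \<le> Suc m}"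
  have fin: "finite ?A" "finite ?B"
    by (rule finite_subset[of _ "{..Suc (Suc m)} \<times> {..Suc (Suc m)}"]; force)+
  have "lin (diff (normalized_chains Y)) (boundary Y (Suc (Suc m)) x) = (\<Sum>j\<le>Suc (Suc m). \<Sum>i\<le>Suc m. ?t (i, j))"
    unfolding boundary_def lin_sum lin_scale diff_Suc_1 lin_diff_chain_class scale_sum by simp
  also have "\<dots> = (\<Sum>(j, i)\<in>{..Suc (Suc m)} \<times> {..Suc m}. ?t (i, j))"
    by (rule sum.cartesian_product)
  also have "\<dots> = sum ?t (?A \<union> ?B)"
    by (rule sum.reindex_bij_witness[of _ prod.swap prod.swap]) auto
  also have "\<dots> = sum ?t ?A + sum ?t ?B"
    by (rule sum.union_disjoint) (use fin in auto)
  \<comment> \<open>The simplicial identity for two faces pairs (i, j) with (j - 1, i), which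
    changes the sign.\<close>
  also have "sum ?t ?A = (\<Sum>p\<in>?B. - ?t p)"
  proof (rule sum.reindex_bij_witness[of _ "\<lambda>(i, j). (j, Suc i)" "\<lambda>(i, j). (j - 1, i)"])
    fix p assume "p \<in> ?A"
    then obtain i j where p: "p = (i, Suc j)" "i \<le> j" "j \<le> Suc m" by (cases p; cases "snd p") auto
    then show "- ?t (case p of (i, j) \<Rightarrow> (j - 1, i)) = ?t p"
      using simplicial_setD(3)[OF Y x, of i "Suc j"] by (simp add: minus_scale mult.commute)
  qed auto
  also have "(\<Sum>p\<in>?B. - ?t p) + sum ?t ?B = 0"
    by (simp add: sum_negf)
  finally show ?thesis .
qed

lemma supp_chain_class: "x \<in> simp Y n \<Longrightarrow> supp {c \<in> basis (normalized_chains Y). fst c = n} (chain_class Y n x)"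
  by (simp add: chain_class_def)

lemma supp_boundary:
  assumes "x \<in> simp Y (Suc n)"
  shows "supp {c \<in> basis (normalized_chains Y). fst c = n} (boundary Y (Suc n) x)"
  unfolding boundary_def diff_Suc_1
  by (rule supp_sum, rule supp_scale, rule supp_chain_class) (simp add: simplicial_setD(1)[OF Y assms])

end

lemma dg_coalgebra_primitive:
  assumes M: "dg_module C" and one: "comult C (one C) = bvec (one C, one C)"
    and prim: "\<And>c. c \<in> rbasis C \<Longrightarrow> comult C c = bvec (c, one C) + bvec (one C, c)"
  shows "dg_coalgebra C"
  unfolding dg_coalgebra_def
proof (intro conjI ballI M one)
  fix c assume c: "c \<in> basis C"
  note D = dg_moduleD[OF M]
  have cases: "c = one C \<or> (c \<in> rbasis C \<and> c \<noteq> one C)" using c by (auto simp: rbasis_def)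
  then show "homog2 C (deg C c) (comult C c)"
    unfolding homog2_def
    by (elim disjE conjE; simp only: one prim; (intro supp_add supp_bvec)?) (use c D(1,2) in simp_all)
  show "lin (\<lambda>(a, b). if a = one C then bvec b else 0) (comult C c) = bvec c"
    "lin (\<lambda>(a, b). if b = one C then bvec a else 0) (comult C c) = bvec c"
    "lin (\<lambda>(a, b). lin (\<lambda>(a1, a2). bvec (a1, a2, b)) (comult C a)) (comult C c) =
          lin (\<lambda>(a, b). lin (\<lambda>(b1, b2). bvec (a, b1, b2)) (comult C b)) (comult C c)"
    using cases by (auto simp: one prim lin_add)
  show "lin (tensor_diff C) (comult C c) = lin (comult C) (diff C c)"
  proof (cases "c = one C")
    case True
    then show ?thesis using D(2,3) by (simp add: one tensor_diff_def tensor_eq_lin)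
  next
    case False
    have "supp (rbasis C) (diff C c)"
      using M c by (auto simp: dg_module_def homog_def rbasis_def in_keys_iff)
    then have "lin (comult C) (diff C c) = lin (\<lambda>x. bvec (x, one C) + bvec (one C, x)) (diff C c)"
      by (rule lin_cong_supp) (rule prim)
    moreover have "c \<in> rbasis C" using False c by (simp add: rbasis_def)
    ultimately show ?thesis
      using D(2,3) by (simp add: prim lin_add lin_fun_add tensor_diff_def tensor_eq_lin)
  qed
qed

section \<open>Subsimplices of a double suspension\<close>

lemma delete_vertices_append: "delete_vertices Y n (a @ b) x = delete_vertices Y (n - length a) b (delete_vertices Y n a x)"
  by (induct a arbitrary: n x) simp_all

text \<open>Deleting from the top leaves the positions of lower vertices unchanged, so an invariant
  need only survive faces with index above \<open>l\<close>.\<close>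

lemma delete_vertices_invariant:
  assumes "\<And>n x j. P n x \<Longrightarrow> l < j \<Longrightarrow> j \<le> n \<Longrightarrow> P (n - 1) (face Y n j x)"
  shows "P n x \<Longrightarrow> sorted_wrt (>) js \<Longrightarrow> \<forall>j\<in>set js. l < j \<and> j \<le> n \<Longrightarrow>
    P (n - length js) (delete_vertices Y n js x)"
proof (induct js arbitrary: n x)
  case (Cons j js)
  have "P (n - 1 - length js) (delete_vertices Y (n - 1) js (face Y n j x))"
    by (rule Cons(1)) (use Cons assms in fastforce)+
  then show ?case by simp
qed simp

lemma rev_sorted_list_of_set: "sorted_wrt (>) (rev (sorted_list_of_set (A :: nat set)))"
  by (simp add: sorted_wrt_rev strict_sorted_list_of_set)

text \<open>As \<open>V\<close> contains every vertex below \<open>l\<close>, the vertex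
  \<open>l\<close> is the last to be deleted and still sits at position \<open>l\<close>. Everything
  before preserves the invariant, and the final face is \<open>p\<close>.\<close>

lemma subsimplex_collapse:
  assumes P: "\<And>n x j. P n x \<Longrightarrow> l < j \<Longrightarrow> j \<le> n \<Longrightarrow> P (n - 1) (face Y n j x)"
    and last: "\<And>n x. P n x \<Longrightarrow> l \<le> n \<Longrightarrow> face Y n l x = p"
    and x: "P n x" and l: "l \<le> n" "{0..<l} \<subseteq> V" "l \<notin> V"
  shows "subsimplex Y n V x = p"
proof -
  let ?A = "{0..n} - V"
  have "Min ?A = l" by (rule Min_eqI) (use l in \<open>auto simp: not_less[symmetric]\<close>)
  then have "sorted_list_of_set ?A = l # sorted_list_of_set (?A - {l})"
    using l by (subst sorted_list_of_set_nonempty) auto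
  then have eq: "subsimplex Y n V x = face Y (n - card (?A - {l})) l (delete_vertices Y n (rev (sorted_list_of_set (?A - {l}))) x)"
    by (simp add: subsimplex_def delete_vertices_append)
  have sub: "?A - {l} \<subseteq> {l<..n}"
    using l by (auto simp: subset_iff not_less[symmetric]) (metis atLeastLessThan_iff le0 nat_neq_iff)
  then have "card (?A - {l}) \<le> n - l"
    using card_mono[of "{l<..n}"] by fastforce
  then have "l \<le> n - card (?A - {l})" using l by linarith
  moreover have "P (n - card (?A - {l})) (delete_vertices Y n (rev (sorted_list_of_set (?A - {l}))) x)"
    using delete_vertices_invariant[of P l Y, OF P x rev_sorted_list_of_set, of "?A - {l}"] sub by fastforce
  ultimately show ?thesis unfolding eq by (rule last[rotated])
qed

lemma subsimplex_all: "subsimplex Y n {0..n} x = x"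
  by (simp add: subsimplex_def)

section \<open>Simplices of a single suspension\<close>

context
  fixes X :: "'a sset"
  assumes S: "simplicial_set X" and R: "reduced_sset X"
begin

lemma bpoint_susp: "bpoint (susp X) n = Pt"
proof (induct n)
  case 0
  have "simp (susp X) 0 = {Pt}" by (auto simp: susp_def)
  then show ?case using simp_0_eq[OF simplicial_set_susp[OF S R] reduced_sset_susp[OF S R]] by simp
qed (simp add: susp_operators[OF S R])

lemma degenerate_Pt: "0 < n \<Longrightarrow> degenerate (susp X) n Pt"
  unfolding degenerate_def
  by (intro exI[of _ "n - 1"] exI[of _ 0] bexI[of _ Pt])
    (simp_all add: susp_operators[OF S R] Pt_in_susp[OF S R])

lemma chain_class_Pt: "chain_class (susp X) n Pt = (if n = 0 then bvec (0, Pt) else 0)"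
  by (auto simp: chain_class_def degenerate_Pt) (simp add: degenerate_def)

text \<open>Faces of a nondegenerate simplex may be degenerate, so nondegeneracy is no invariant.
  Being the base point or some (1, x) is stable under all faces except d_0, and d_0 gives the base
  point.\<close>

definition base_cone :: "nat \<Rightarrow> 'a susp_simplex \<Rightarrow> bool" where
  "base_cone n y \<longleftrightarrow> y = Pt \<or> (\<exists>m. \<exists>x\<in>simp X m. n = Suc m \<and> y = cone X n 1 x)"

lemma base_cone_face_0: "base_cone n y \<Longrightarrow> face (susp X) n 0 y = Pt"
  unfolding base_cone_def susp_operators[OF S R]
  using susp_face_cone'(1)[OF S R, of 1 _ _ n 0] by auto

lemma base_cone_face:
  assumes "base_cone n y" "0 < j" "j \<le> n"
  shows "base_cone (n - 1) (face (susp X) n j y)"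
proof (cases "y = Pt")
  case False
  then obtain m x where x: "x \<in> simp X m" "n = Suc m" "y = cone X n 1 x"
    using assms(1) by (auto simp: base_cone_def)
  note f = susp_face_cone'(3,4)[OF S R le_refl x(1), of n j]
  show ?thesis
  proof (cases m)
    case 0
    then show ?thesis using f(1) assms x by (simp add: susp_operators[OF S R] base_cone_def)
  next
    case (Suc k)
    have "face X m (j - 1) x \<in> simp X k"
      unfolding Suc by (rule simplicial_setD(1)[OF S]) (use x Suc assms in auto)
    then show ?thesis using f(2) assms x Suc by (auto simp: susp_operators[OF S R] base_cone_def)
  qed
qed (simp add: susp_operators[OF S R] base_cone_def)

text \<open>A simplex (i, x) with i at least 2 is s_0(i - 1, x).\<close>

lemma nondegenerate_base_cone:
  assumes y: "y \<in> simp (susp X) n" "\<not> degenerate (susp X) n y"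
  shows "base_cone n y"
  using y(1)
proof (cases rule: susp_cases[OF S R, consumes 1])
  case (2 i x m)
  show ?thesis
  proof (cases "i = 1")
    case False
    then obtain k where i: "i = Suc k" "1 \<le> k" using 2 by (cases i) auto
    have n: "n = Suc (m + k)" using 2 i by simp
    have x: "x \<in> simp X (m + k - k)" using 2 by simp
    have "y = degen (susp X) (m + k) 0 (cone X (m + k) k x)"
      using susp_generators(4)[OF S R i(2) _ x] 2 i n by simp
    moreover have "cone X (m + k) k x \<in> simp (susp X) (m + k)"
      by (rule cone_in_susp[OF S R i(2) _ x]) simp
    ultimately have "degenerate (susp X) n y" unfolding degenerate_def n by blast
    then show ?thesis using y by simp
  qed (use 2 in \<open>auto simp: base_cone_def\<close>)
qed (simp add: base_cone_def)

end

section \<open>Simplices and chains of the double suspension\<close>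

context
  fixes X :: "'a sset"
  assumes S: "simplicial_set X" and R: "reduced_sset X"
begin

abbreviation (input) "YY \<equiv> susp (susp X)"

lemmas SZ = simplicial_set_susp[OF S R] and RZ = reduced_sset_susp[OF S R]
lemmas SY = simplicial_set_susp[OF SZ RZ] and RY = reduced_sset_susp[OF SZ RZ]

text \<open>The analogous invariant for the vertex 1: it survives the faces with index at least 2,
  and d_1 gives the base point.\<close>

definition double_cone :: "nat \<Rightarrow> 'a susp_simplex susp_simplex \<Rightarrow> bool" where
  "double_cone n y \<longleftrightarrow> y = Pt \<or> (\<exists>m x. base_cone X m x \<and> x \<in> simp (susp X) m \<and> n = Suc m \<and> y = cone (susp X) n 1 x)"

lemma vertex_YY: "vertex YY = Pt"
  using bpoint_susp[OF SZ RZ, of 0] by simp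

text \<open>d_1(1, x) = (1, d_0 x), where d_0 x is the base point for a base cone x, and the cone on
  a base point is the base point.\<close>

lemma double_cone_face_1:
  assumes "double_cone n y" "1 \<le> n"
  shows "face YY n 1 y = Pt"
proof (cases "y = Pt")
  case False
  then obtain m x where x: "base_cone X m x" "x \<in> simp (susp X) m" "n = Suc m" "y = cone (susp X) n 1 x"
    using assms(1) by (auto simp: double_cone_def)
  note f = susp_face_cone'(3,4)[OF SZ RZ le_refl x(2), of n 1]
  show ?thesis
    using f x base_cone_face_0[OF S R x(1)] bpoint_susp[OF S R]
    by (cases "m = 0") (simp_all add: susp_operators[OF SZ RZ] cone_def)
qed (simp add: susp_operators[OF SZ RZ])

lemma double_cone_face:
  assumes "double_cone n y" "1 < j" "j \<le> n"
  shows "double_cone (n - 1) (face YY n j y)"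
proof (cases "y = Pt")
  case False
  then obtain m x where x: "base_cone X m x" "x \<in> simp (susp X) m" "n = Suc m" "y = cone (susp X) n 1 x"
    using assms(1) by (auto simp: double_cone_def)
  note f = susp_face_cone'(4)[OF SZ RZ le_refl x(2), of n j]
  obtain k where k: "m = Suc k" using assms x by (cases m) auto
  have "face (susp X) m (j - 1) x \<in> simp (susp X) k"
    unfolding k by (rule simplicial_setD(1)[OF SZ]) (use x k assms in auto)
  moreover have "base_cone X k (face (susp X) m (j - 1) x)"
    using base_cone_face[OF S R x(1), of "j - 1"] assms x k by simp
  ultimately show ?thesis using f assms x k by (auto simp: susp_operators[OF SZ RZ] double_cone_def)
qed (simp add: susp_operators[OF SZ RZ] double_cone_def)

lemma rbasis_YY:
  assumes "(n, y) \<in> rbasis (normalized_chains YY)"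
  shows "y \<in> simp YY n" "\<not> degenerate YY n y" "base_cone (susp X) n y" "double_cone n y" "3 \<le> n"
proof -
  show y: "y \<in> simp YY n" "\<not> degenerate YY n y" using assms by (auto simp: rbasis_def)
  have "n \<noteq> 0"
  proof
    assume "n = 0"
    then have "y = Pt" using y simp_0_eq[OF SY RY] vertex_YY by simp
    then show False using assms \<open>n = 0\<close> vertex_YY by (simp add: rbasis_def)
  qed
  then have "y \<noteq> Pt" using y degenerate_Pt[OF SZ RZ] by auto
  show b: "base_cone (susp X) n y" by (rule nondegenerate_base_cone[OF SZ RZ y])
  then obtain m x where x: "x \<in> simp (susp X) m" "n = Suc m" "y = cone (susp X) n 1 x"
    using \<open>y \<noteq> Pt\<close> by (auto simp: base_cone_def[OF SZ RZ])
  have "x \<noteq> Pt" using \<open>y \<noteq> Pt\<close> x bpoint_susp[OF S R] by (auto simp: cone_def)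
  \<comment> \<open>The suspension of X has only the base point in dimensions 0 and 1, so
    \<open>x\<close> has dimension at least 2 and its cone at least 3.\<close>
  have "x \<notin> simp (susp X) 0"
    unfolding simp_0_eq[OF SZ RZ] using \<open>x \<noteq> Pt\<close> bpoint_susp[OF S R, of 0] by simp
  then have "m \<noteq> 0" using x(1) by (intro notI) simp
  have "x \<notin> simp (susp X) 1"
    unfolding susp_1_reduced[OF S R] using \<open>x \<noteq> Pt\<close> by simp
  then have "m \<noteq> 1" using x(1) by (intro notI) simp
  then show "3 \<le> n" using x(2) \<open>m \<noteq> 0\<close> by simp
  \<comment> \<open>A degeneracy s_i z in the base would give (1, s_i z) = s_{i+1}(1, z).\<close>
  have "\<not> degenerate (susp X) m x"
  proof
    assume "degenerate (susp X) m x"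
    then obtain k i z where z: "z \<in> simp (susp X) k" "m = Suc k" "i \<le> k" "x = degen (susp X) k i z"
      by (auto simp: degenerate_def)
    have "y = degen YY (Suc k) (i + 1) (cone (susp X) (Suc k) 1 z)"
      using susp_generators(5)[OF SZ RZ z(1,3)] x z by simp
    moreover have "cone (susp X) (Suc k) 1 z \<in> simp YY (Suc k)"
      by (rule cone_in_susp[OF SZ RZ]) (use z in simp_all)
    ultimately have "degenerate YY n y" unfolding degenerate_def x(2) z(2)
      using z(3) by (intro exI[of _ "Suc k"] exI[of _ "i + 1"] bexI) auto
    then show False using y by simp
  qed
  from nondegenerate_base_cone[OF S R x(1) this]
  show "double_cone n y" using x by (auto simp: double_cone_def)
qed

lemma subsimplex_without_0:
  assumes "base_cone (susp X) n y" "0 \<notin> V"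
  shows "subsimplex YY n V y = Pt"
proof (rule subsimplex_collapse[where P = "base_cone (susp X)" and l = 0 and n = n])
  fix m x assume x: "base_cone (susp X) m x"
  show "face YY m 0 x = Pt" by (rule base_cone_face_0[OF SZ RZ x])
  show "base_cone (susp X) (m - 1) (face YY m j x)" if "0 < j" "j \<le> m" for j
    by (rule base_cone_face[OF SZ RZ x that])
qed (use assms in simp_all)

lemma subsimplex_without_1:
  assumes "double_cone n y" "1 \<le> n" "0 \<in> V" "1 \<notin> V"
  shows "subsimplex YY n V y = Pt"
proof (rule subsimplex_collapse[where P = double_cone and l = 1 and n = n])
  fix m x assume x: "double_cone m x"
  show "face YY m 1 x = Pt" if "1 \<le> m" by (rule double_cone_face_1[OF x that])
  show "double_cone (m - 1) (face YY m j x)" if "1 < j" "j \<le> m" for j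
    by (rule double_cone_face[OF x that])
qed (use assms in simp_all)

lemma comult_YY:
  assumes c: "(n, y) \<in> rbasis (normalized_chains YY :: (_, 'r::comm_ring_1) dgcoalg)"
  shows "comult (normalized_chains YY :: (_, 'r) dgcoalg) (n, y) = bvec ((n, y), (0, Pt)) + bvec ((0, Pt), (n, y))"
proof -
  note y = rbasis_YY[OF c]
  let ?t = "\<lambda>i. tensor (chain_class YY i (subsimplex YY n {0..i} y)) (chain_class YY (n - i) (subsimplex YY n {i..n} y)) :: _ \<Rightarrow>\<^sub>0 'r"
  have cy: "chain_class YY n y = (bvec (n, y) :: _ \<Rightarrow>\<^sub>0 'r)" using y by (simp add: chain_class_def)
  have "subsimplex YY n {0} y = Pt"
    by (rule subsimplex_without_1) (use y in auto)
  then have t: "?t 0 = bvec ((0, Pt), (n, y))" "?t n = bvec ((n, y), (0, Pt))"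
    using subsimplex_without_0[OF y(3), of "{n..n}"] y(5)
    by (simp_all add: cy subsimplex_all chain_class_Pt[OF SZ RZ])
  \<comment> \<open>The back face misses the vertex 0 and has positive dimension, so it is a
    degenerate base point and vanishes in normalized chains.\<close>
  have "?t i = 0" if "i \<le> n" "i \<noteq> 0" "i \<noteq> n" for i
    using that by (simp add: subsimplex_without_0[OF y(3)] chain_class_Pt[OF SZ RZ] tensor_eq_lin)
  then have "(\<Sum>i\<le>n. ?t i) = (\<Sum>i\<in>{0, n}. ?t i)"
    by (intro sum.mono_neutral_right) auto
  then show ?thesis unfolding chains_comult using y(5) t by (simp add: add.commute)
qed

lemma one_in_chains: "(0, Pt) \<in> basis (normalized_chains YY)"
  by (simp add: Pt_in_susp[OF SZ RZ] degenerate_def)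

lemma dg_coalgebra_YY: "dg_coalgebra (normalized_chains YY :: (_, 'r::comm_ring_1) dgcoalg)"
proof (rule dg_coalgebra_primitive)
  let ?C = "normalized_chains YY :: (_, 'r) dgcoalg"
  have D: "homog ?C (deg ?C c - 1) (diff ?C c) \<and> lin (diff ?C) (diff ?C c) = 0 \<and> lk (diff ?C c) (one ?C) = 0"
    if c: "c \<in> basis ?C" for c
  proof (cases "c = (0, Pt)")
    case True
    then show ?thesis by (simp add: chains_diff homog_def)
  next
    case False
    obtain n y where ny: "c = (n, y)" by fastforce
    have "c \<in> rbasis ?C" using c False unfolding rbasis_def by (simp add: vertex_YY)
    note y = rbasis_YY[OF this[unfolded ny]]
    have "n = Suc (Suc (n - 2))" using y(5) by simp
    then obtain m where m: "n = Suc (Suc m)" ..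
    have d: "diff ?C c = boundary YY (Suc (Suc m)) y" by (simp add: ny m chains_diff)
    have supp: "supp {c \<in> basis ?C. fst c = Suc m} (diff ?C c)"
      unfolding d by (rule supp_boundary[OF SY y(1)[unfolded m]])
    have "homog ?C (deg ?C c - 1) (diff ?C c)"
      unfolding homog_def by (rule supp_mono[OF supp]) (auto simp: ny m)
    moreover have "lin (diff ?C) (diff ?C c) = 0"
      unfolding d by (rule boundary_boundary[OF SY y(1)[unfolded m]])
    moreover have "lk (diff ?C c) (one ?C) = 0"
      by (rule lookup_notin[OF supp]) simp
    ultimately show ?thesis by blast
  qed
  have one: "one ?C \<in> basis ?C" using one_in_chains by (simp add: vertex_YY)
  show "dg_module ?C"
    unfolding dg_module_def using D one by (simp add: chains_diff)
  show "comult ?C (one ?C) = bvec (one ?C, one ?C)"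
    by (simp add: chains_comult vertex_YY subsimplex_all subsimplex_all[of _ 0, simplified] chain_class_Pt[OF SZ RZ])
  fix c assume "c \<in> rbasis ?C"
  then show "comult ?C c = bvec (c, one ?C) + bvec (one ?C, c)"
    by (cases c) (simp add: comult_YY vertex_YY)
qed

section \<open>Baues' coproduct on the double suspension\<close>

lemma bracket_Pt: "(m, Pt) \<in> set ss \<Longrightarrow> 2 \<le> m \<Longrightarrow> bracket YY ss = 0"
  by (induct ss) (auto simp: bracket_def chain_class_Pt[OF SZ RZ] letter_def conc_eq_lin)

lemma bracket_1: "\<forall>p\<in>set ss. fst p < 2 \<Longrightarrow> bracket YY ss = bvec []"
proof -
  assume "\<forall>p\<in>set ss. fst p < 2"
  then have "filter (\<lambda>(m, x). 2 \<le> m) ss = []" by (auto simp: filter_empty_conv)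
  then show ?thesis unfolding bracket_def by simp
qed

lemma consecutive_list:
  assumes "ps ! 0 = 0" "\<And>i. i \<le> r \<Longrightarrow> ps ! Suc i = Suc (ps ! i)"
  shows "k \<le> Suc r \<Longrightarrow> ps ! k = k"
  by (induct k) (use assms in auto)

text \<open>If b is nonempty and misses 1, the right factor misses the vertex 1. If b contains 1 but
  is not full, some left factor of dimension at least 2 starts at a positive vertex and so misses 0.
  Either way the summand vanishes.\<close>

lemma baues_gen_YY:
  assumes c: "(n, y) \<in> rbasis (normalized_chains YY :: (_, 'r::comm_ring_1) dgcoalg)"
  shows "baues_gen YY (n, y) = (bvec ([(n, y)], []) + bvec ([], [(n, y)]) :: _ \<Rightarrow>\<^sub>0 'r)"
proof -
  note y = rbasis_YY[OF c]
  have cy: "chain_class YY n y = (bvec (n, y) :: _ \<Rightarrow>\<^sub>0 'r)" using y by (simp add: chain_class_def)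
  have bracket_y: "bracket YY [(n, y)] = (bvec [(n, y)] :: _ \<Rightarrow>\<^sub>0 'r)"
    using y(5) by (simp add: bracket_def cy letter_def)
  define ps where "ps = (\<lambda>b. 0 # sorted_list_of_set b @ [n])"
  define zeta where "zeta = (\<lambda>b. (\<Sum>i=1..card b. (int (card b) + 1 - int i) * (int (ps b ! i) - int (ps b ! (i - 1))))
      - int (card b * (card b + 1) div 2))"
  define L where "L = (\<lambda>b. map (\<lambda>i. (ps b ! Suc i - ps b ! i, subsimplex YY n {ps b ! i..ps b ! Suc i} y)) [0..<Suc (card b)])"
  define t where "t = (\<lambda>b. ksign (zeta b) \<cdot> tensor (bracket YY (L b))
      (bracket YY [(Suc (card b), subsimplex YY n (insert 0 (insert n b)) y)]) :: _ \<Rightarrow>\<^sub>0 'r)"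
  have gen: "baues_gen YY (n, y) = sum t (Pow {1..n - 1})"
    by (simp only: baues_gen_def Let_def prod.case t_def L_def zeta_def ps_def)
  let ?full = "{1..n - 1}"
  have zero: "t b = 0" if b: "b \<subseteq> ?full" "b \<noteq> {}" "b \<noteq> ?full" for b
  proof (cases "1 \<in> b")
    case False
    have fin: "finite b" using b finite_subset by blast
    \<comment> \<open>Since \<open>b\<close> is nonempty, this right-hand simplex has dimension at
      least 2; it is not an omitted one-dimensional entry but makes the bracket zero.\<close>
    have "subsimplex YY n (insert 0 (insert n b)) y = Pt"
      by (rule subsimplex_without_1) (use False y(4,5) in auto)
    moreover have "2 \<le> Suc (card b)" using b fin by (simp add: Suc_le_eq card_gt_0_iff)
    ultimately show ?thesis
      unfolding t_def by (subst (2) bracket_Pt[of "Suc (card b)"]) (simp_all add: tensor_eq_lin)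
  next
    case True
    have fin: "finite b" using b finite_subset by blast
    let ?r = "card b"
    have len: "length (ps b) = Suc (Suc ?r)" by (simp add: ps_def)
    have strict: "sorted_wrt (<) (ps b)"
    proof -
      have "0 < i \<and> i < n" if "i \<in> b" for i
        using subsetD[OF b(1) that] y(5) by simp linarith
      then show ?thesis
        using fin y(5) by (simp add: ps_def sorted_wrt_append strict_sorted_list_of_set)
    qed
    have ps0: "ps b ! 0 = 0" by (simp add: ps_def)
    have inc: "ps b ! i < ps b ! Suc i" if "i \<le> ?r" for i
      by (rule sorted_wrt_nth_less[OF strict]) (use that len in auto)
    have ps1: "ps b ! Suc 0 = 1"
    proof -
      have "1 \<in> set (ps b)" using True fin by (simp add: ps_def)
      then obtain k where k: "k < length (ps b)" "ps b ! k = 1" by (auto simp: in_set_conv_nth)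
      then have "k \<noteq> 0" using ps0 by (intro notI) simp
      then have "ps b ! Suc 0 \<le> 1"
        using k sorted_wrt_nth_less[OF strict, of "Suc 0" k] by (cases "k = Suc 0") auto
      then show ?thesis using inc[of 0] ps0 by simp
    qed
    \<comment> \<open>If all steps had length 1, the last entry n would equal card b + 1, and b
      would be the full set.\<close>
    have "\<exists>i\<le>?r. ps b ! Suc i \<noteq> Suc (ps b ! i)"
    proof (rule ccontr)
      assume "\<not> ?thesis"
      then have "ps b ! Suc ?r = Suc ?r" using consecutive_list[OF ps0, of ?r "Suc ?r"] by auto
      moreover have "ps b ! Suc ?r = n" by (simp add: ps_def nth_append)
      ultimately have "card b = card ?full" by simp
      then show False using b card_subset_eq[of ?full b] by simp
    qed
    then obtain i where i: "i \<le> ?r" "ps b ! Suc i \<noteq> Suc (ps b ! i)" by blast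
    \<comment> \<open>The first step goes from 0 to 1, so the long step starts at a positive
      vertex.\<close>
    then have "i \<noteq> 0" using ps0 ps1 by (intro notI) simp
    then have "ps b ! 0 < ps b ! i" by (intro sorted_wrt_nth_less[OF strict]) (use i len in auto)
    then have "subsimplex YY n {ps b ! i..ps b ! Suc i} y = Pt"
      by (intro subsimplex_without_0[OF y(3)]) simp
    then have "(ps b ! Suc i - ps b ! i, Pt) \<in> set (L b)"
      unfolding L_def using i by (auto intro!: image_eqI[of _ _ i])
    moreover have "2 \<le> ps b ! Suc i - ps b ! i" using inc[OF i(1)] i(2) by simp
    ultimately show ?thesis unfolding t_def by (subst bracket_Pt) (simp_all add: tensor_eq_lin)
  qed
  have "sum t (Pow ?full) = sum t {{}, ?full}"
    by (rule sum.mono_neutral_right) (use zero in blast)+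
  also have "\<dots> = t {} + t ?full"
    using y(5) by simp
  \<comment> \<open>For the empty subset the right-hand simplex is one-dimensional, hence omitted,
    and the right bracket is the unit.\<close>
  also have "t {} = bvec ([(n, y)], [])"
    by (simp add: t_def zeta_def L_def ps_def subsimplex_all bracket_y bracket_1)
  also have "t ?full = bvec ([], [(n, y)])"
  proof -
    have "sorted_list_of_set ?full = [1..<n]"
      using y(5) sorted_list_of_set_range[of 1 n] by (simp add: atLeastLessThanSuc_atLeastAtMost[symmetric])
    then have "ps ?full = [0..<Suc n]"
      using y(5) by (simp add: ps_def upt_conv_Cons[of 0])
    then have ps: "ps ?full ! i = i" if "i \<le> n" for i
      using that by (simp del: upt_Suc)
    have "bracket YY (L ?full) = (bvec [] :: _ \<Rightarrow>\<^sub>0 'r)"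
      by (rule bracket_1) (use y(5) ps in \<open>auto simp: L_def\<close>)
    moreover have "insert 0 (insert n ?full) = {0..n}" using y(5) by auto
    \<comment> \<open>With all steps of length 1 and r = n - 1, the weighted sum is r + (r - 1) +
      ... + 1, which is exactly the subtracted r(r + 1)/2.\<close>
    moreover have "zeta ?full = 0"
    proof -
      have "(\<Sum>i=1..n - 1. (int (n - 1) + 1 - int i) * (int (ps ?full ! i) - int (ps ?full ! (i - 1)))) =
          (\<Sum>i=1..n - 1. int (n - i))"
        by (rule sum.cong) (use ps in auto)
      also have "\<dots> = int (\<Sum>i=1..n - 1. n - i)" by simp
      also have "(\<Sum>i=1..n - 1. n - i) = (\<Sum>i=1..n - 1. i)"
        by (rule sum.reindex_bij_witness[of _ "\<lambda>i. n - i" "\<lambda>i. n - i"]) auto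
      also have "\<dots> = (n - 1) * (n - 1 + 1) div 2"
        using gauss_sum_from_Suc_0[of "n - 1", where 'a = nat] by simp
      finally show ?thesis by (simp add: zeta_def)
    qed
    ultimately show ?thesis
      using y(5) by (simp add: t_def subsimplex_all bracket_y)
  qed
  finally show ?thesis using gen by simp
qed

lemma primitive_cobar_YY: "primitive_cobar (normalized_chains YY) (baues_coproduct YY)"
proof (rule primitive_cobar.intro)
  show "coalgebra (normalized_chains YY :: (_, 'r::comm_ring_1) dgcoalg)"
    by unfold_locales (rule dg_coalgebra_YY)
  show "primitive_cobar_axioms (normalized_chains YY) (baues_coproduct YY :: _ \<Rightarrow> (_ \<Rightarrow>\<^sub>0 'r::comm_ring_1))"
  proof
    fix c assume c: "c \<in> rbasis (normalized_chains YY :: (_, 'r) dgcoalg)"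
    obtain n y where ny: "c = (n, y)" by fastforce
    show "reduced_comult (normalized_chains YY) c = (0 :: _ \<Rightarrow>\<^sub>0 'r)"
      unfolding reduced_comult_def ny comult_YY[OF c[unfolded ny]] by (simp add: vertex_YY)
    show "baues_coproduct YY (c # w) = tensor_mult (cobar (normalized_chains YY))
       (bvec ([c], []) + bvec ([], [c])) (baues_coproduct YY w :: _ \<Rightarrow>\<^sub>0 'r)" for w
      unfolding ny baues_coproduct.simps baues_gen_YY[OF c[unfolded ny]] by (rule refl)
  qed simp
qed

end

theorem theorem4p6:
  fixes X :: "'a sset"
    and Y :: "'a susp_simplex susp_simplex sset"
    and C :: "(nat \<times> 'a susp_simplex susp_simplex, 'r::comm_ring_1) dgcoalg"
    and H :: "((nat \<times> 'a susp_simplex susp_simplex) list, 'r) dgbialg"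
  assumes "simplicial_set X" and "reduced_sset X"
  defines "Y \<equiv> susp (susp X)"
  defines "C \<equiv> normalized_chains Y"
  defines "H \<equiv> cobar_chains_hopf Y"
  shows
    "(homotopy_G_coalgebra C (baues_coproduct Y) \<and>
      (\<forall>k\<ge>1. \<forall>c\<in>rbasis C.
         cobar_component (baues_coproduct Y) k 1 c =
           (0 :: (nat \<times> 'a susp_simplex susp_simplex) list \<times>
                 (nat \<times> 'a susp_simplex susp_simplex) list \<Rightarrow>\<^sub>0 'r))) \<and>
     (dg_hopf_algebra H \<and> n_reduced 1 H \<and> involutive_antipode H \<and>
      homotopy_BV_algebra (cobar (coalg_part H)) (kadeishvili H) (connes_moscovici H))"
proof -
  interpret P: primitive_cobar C "baues_coproduct Y"
    unfolding C_def Y_def by (rule primitive_cobar_YY[OF assms(1,2)])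
  have H: "H = bialg (cobar C) (baues_coproduct Y)"
    by (simp add: H_def C_def cobar_chains_hopf_def)
  have "3 \<le> deg C c" if "c \<in> rbasis C" for c
    using rbasis_YY(5)[OF assms(1,2), of "fst c" "snd c"] that
    by (simp add: C_def Y_def case_prod_unfold)
  then interpret Q: cocomm_hopf H
    unfolding H by (rule P.cocomm_hopf_tensor)
  have "dg_hopf_algebra H" "involutive_antipode H"
    unfolding H by (rule P.dg_hopf_algebra_tensor P.involutive)+
  then show ?thesis
    using P.homotopy_G_coalgebra_primitive P.cobar_component_primitive Q.red
      Q.homotopy_BV_algebra_cobar by blast
qed

end
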